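(* Let $\ell\ge-1/2$, let $q,\hat q\in L^1(0,1)$ be real-valued, let $a\in(0,1]$, and suppose $\hat q=q$ a.e. on $(a,1)$. Let $\beta_n\in\mathbb{R}\cup\{\infty\}$ and let $\lambda_n\in\sigma(\ell,q,\beta_n)\cap\sigma(\ell,\hat q,\beta_n)$, $n\in\mathbb{N}$, be distinct with $\lambda_n\nrightarrow-\infty$ (the sequence does not tend to $-\infty$). Put $\Lambda=\{\lambda_n\mid n\in\mathbb{N}\}$, let $S\subset\Lambda$, and suppose $\zeta(\lambda_n,\beta_n,q)=\zeta(\lambda_n,\beta_n,\hat q)$ for all $\lambda_n\in S$. Let $m(t)=2n_\Lambda(t^2)+2n_S(t^2)$. Let $k\in\mathbb{N}\cup\{0\}$ and $1\le p\le\infty$, and suppose that for some $\delta_0>0$: (i) if $1\le p<\infty$: $q-\hat q\in W^{k,p}((a-\delta_0,a])$ and $(q-\hat q)^{(i)}(a)=0$ for $i=0,1,\dots,k-1$; (ii) if $p=\infty$: $q-\hat q\in C^k((a-\delta_0,a])$ and $(q-\hat q)^{(i)}(a)=0$ for $i=0,1,\dots,k$. If there exists a sequence $R_i\to\infty$ such that $$\limsup_{i\to\infty}\left[\int_1^{R_i}\frac{m(t)}{t}\,dt-\frac{4aR_i}{\pi}+\left(k+2\ell+2+\frac1{p'}\right)\ln R_i\right]>-\infty,$$ then $q=\hat q$ a.e. on $(0,a)$.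
   Context: $\mathbb{N}=\{1,2,3,\dots\}$. For $\ell\ge-1/2$, a real-valued $q\in L^1(0,1)$ and $\beta\in\mathbb{R}\cup\{\infty\}$, consider on $(0,1)$ the equation $$-f''(x)+\frac{\ell(\ell+1)}{x^2}f(x)+q(x)f(x)=\lambda f(x)$$ with boundary conditions: $\lim_{x\to0}f(x)/x^{\ell+1}$ exists and is finite, and $f'(1)+\beta f(1)=0$, the latter meaning $f(1)=0$ if $\beta=\infty$. $\sigma(\ell,q,\beta)$ denotes the set of eigenvalues of this problem (real, simple, discrete). Let $\psi_\ell(\lambda,x,q)$ be the solution of the equation with $\psi_\ell(\lambda,1,q)=1$, $\psi_\ell'(\lambda,1,q)=-\beta$ if $\beta\in\mathbb{R}$, and $\psi_\ell(\lambda,1,q)=0$, $\psi_\ell'(\lambda,1,q)=-1$ if $\beta=\infty$. For $\lambda\in\sigma(\ell,q,\beta)$ the norming constant is $\zeta(\lambda,\beta,q)=\int_0^1|\psi_\ell(\lambda,x,q)|^2\,dx$. For a set $A$ of numbers, $n_A(t)$ is the number of $\lambda\in A$ with $|\lambda|\le t$. $p'$ is the conjugate exponent: $1/p+1/p'=1$ (so $1/p'=0$ for $p=1$), and $p'=1$ for $p=\infty$. Derivatives at $a$ are one-sided (from the left), $(a-\delta_0,a]\subset(0,a]$, and $W^{k,p}$ is the Sobolev space ($W^{0,p}=L^p$; the vanishing condition in (i) is empty for $k=0$). *)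

theory Defs
  imports "HOL-Analysis.Analysis"
begin

text \<open>
  Elements of \<open>L\<^sup>1\<close>, \<open>L\<^sup>p\<close> etc. are represented by functions on the whole line; only their values almost
  everywhere on the relevant interval matter. Measurability and null sets refer to Lebesgue measure.
\<close>

section \<open>The perturbed spherical Schroedinger equation\<close>

text \<open>
  \<open>sl_solution l q z f f'\<close>: \<open>f\<close> is a solution with derivative \<open>f'\<close> of
  \<open>- f'' + l (l + 1) / x\<^sup>2 f + q f = z f\<close> in the usual sense: \<open>f'\<close> is locally absolutely continuous
  with almost everywhere derivative \<open>f''\<close>, that is, \<open>f'\<close> is an indefinite Lebesgue integral of \<open>f''\<close>,
  and the equation holds almost everywhere. As \<open>q\<close> is integrable up to the end point \<open>1\<close>, \<open>f\<close> and
  \<open>f'\<close> extend continuously to \<open>1\<close>, where the derivative is one-sided; so the interval is \<open>(0,1]\<close>.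
\<close>
definition sl_solution ::
  "real \<Rightarrow> (real \<Rightarrow> real) \<Rightarrow> complex \<Rightarrow> (real \<Rightarrow> complex) \<Rightarrow> (real \<Rightarrow> complex) \<Rightarrow> bool" where
  "sl_solution l q z f f' \<longleftrightarrow>
     (\<forall>x\<in>{0<..1}. (f has_vector_derivative f' x) (at x within {0<..1})) \<and>
     (\<exists>f''. (\<forall>x\<in>{0<..1}. f'' absolutely_integrable_on {x..1} \<and>
                          f' 1 - f' x = integral {x..1} f'') \<and>
            (AE x in lebesgue. x \<in> {0<..<1} \<longrightarrow>
               - f'' x + of_real (l * (l + 1) / x\<^sup>2) * f x + of_real (q x) * f x = z * f x))"

text \<open>
  The parameter \<open>\<beta>\<close> ranges over the extended reals other than \<open>-\<infinity>\<close>; \<open>\<beta> = \<infinity>\<close> is the Dirichlet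
  condition.
\<close>
definition sl_spectrum :: "real \<Rightarrow> (real \<Rightarrow> real) \<Rightarrow> ereal \<Rightarrow> complex set" where
  "sl_spectrum l q \<beta> =
     {z. \<exists>f f'. sl_solution l q z f f' \<and> (\<exists>x\<in>{0<..1}. f x \<noteq> 0) \<and>
           (\<exists>c. ((\<lambda>x. f x / of_real (x powr (l + 1))) \<longlongrightarrow> c) (at_right 0)) \<and>
           (if \<beta> = \<infinity> then f 1 = 0 else f' 1 + of_real (real_of_ereal \<beta>) * f 1 = 0)}"

text \<open>
  The solution of the initial value problem at \<open>1\<close> is unique on \<open>(0,1]\<close>, but its values elsewhere are
  arbitrary; hence the choice operator.
\<close>
definition sl_psi :: "real \<Rightarrow> (real \<Rightarrow> real) \<Rightarrow> ereal \<Rightarrow> complex \<Rightarrow> real \<Rightarrow> complex" where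
  "sl_psi l q \<beta> z =
     (SOME f. \<exists>f'. sl_solution l q z f f' \<and>
        (if \<beta> = \<infinity> then f 1 = 0 \<and> f' 1 = -1
         else f 1 = 1 \<and> f' 1 = - of_real (real_of_ereal \<beta>)))"

definition norming_const :: "real \<Rightarrow> (real \<Rightarrow> real) \<Rightarrow> ereal \<Rightarrow> complex \<Rightarrow> real" where
  "norming_const l q \<beta> z = integral {0<..<1} (\<lambda>x. (norm (sl_psi l q \<beta> z x))\<^sup>2)"

section \<open>Counting functions\<close>

text \<open>
  Extended-valued: the points of \<open>A\<close> may accumulate at a finite point (the boundary parameters vary),
  and then the number is \<open>\<infinity>\<close>.
\<close>
definition ncount :: "real set \<Rightarrow> real \<Rightarrow> ennreal" where
  "ncount A t = emeasure (count_space UNIV) {x \<in> A. \<bar>x\<bar> \<le> t}"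

definition mcount :: "real set \<Rightarrow> real set \<Rightarrow> real \<Rightarrow> ennreal" where
  "mcount \<Lambda> S t = 2 * ncount \<Lambda> (t\<^sup>2) + 2 * ncount S (t\<^sup>2)"

section \<open>Sobolev and \<open>C\<^sup>k\<close> functions on an interval\<close>

definition Lp_on :: "real \<Rightarrow> real set \<Rightarrow> (real \<Rightarrow> real) \<Rightarrow> bool" where
  "Lp_on p I u \<longleftrightarrow> set_borel_measurable lebesgue I u \<and>
                  set_integrable lebesgue I (\<lambda>x. \<bar>u x\<bar> powr p)"

text \<open>
  \<open>v\<close> is the weak derivative of \<open>u\<close> on \<open>(s,t)\<close>. In one dimension it is customary to test against
  compactly supported \<open>C\<^sup>1\<close> functions \<open>\<phi>\<close>.
\<close>
definition weak_derivative_on ::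
  "real \<Rightarrow> real \<Rightarrow> (real \<Rightarrow> real) \<Rightarrow> (real \<Rightarrow> real) \<Rightarrow> bool" where
  "weak_derivative_on s t u v \<longleftrightarrow>
     (\<forall>c d. s < c \<longrightarrow> d < t \<longrightarrow>
        u absolutely_integrable_on {c..d} \<and> v absolutely_integrable_on {c..d}) \<and>
     (\<forall>\<phi> \<phi>'. (\<forall>x. (\<phi> has_real_derivative \<phi>' x) (at x)) \<longrightarrow> continuous_on UNIV \<phi>' \<longrightarrow>
        (\<exists>c d. s < c \<and> d < t \<and> (\<forall>x. x \<notin> {c..d} \<longrightarrow> \<phi> x = 0)) \<longrightarrow>
        integral {s<..<t} (\<lambda>x. u x * \<phi>' x) = - integral {s<..<t} (\<lambda>x. v x * \<phi> x))"

text \<open>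
  \<open>D 0\<close> lies in \<open>W\<^bsup>k,p\<^esup>\<close> on the interval with end points \<open>s\<close> and \<open>t\<close>, with weak derivatives
  \<open>D 1, \<dots>, D k\<close>.
\<close>
definition sobolev_derivs ::
  "nat \<Rightarrow> real \<Rightarrow> real \<Rightarrow> real \<Rightarrow> (nat \<Rightarrow> real \<Rightarrow> real) \<Rightarrow> bool" where
  "sobolev_derivs k p s t D \<longleftrightarrow>
     (\<forall>i\<le>k. Lp_on p {s<..<t} (D i)) \<and>
     (\<forall>i<k. weak_derivative_on s t (D i) (D (Suc i)))"

text \<open>
  The value at the right end point \<open>t\<close> of (the representative of \<open>u\<close> that is continuous on) \<open>(s,t]\<close>.
  If \<open>u\<close> is the \<open>i\<close>-th weak derivative of a function in \<open>W\<^bsup>k,p\<^esup>\<close> and \<open>i < k\<close>, this representative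
  exists, and its value at \<open>t\<close> is the one-sided \<open>i\<close>-th derivative there.
\<close>
definition has_end_value :: "real \<Rightarrow> real \<Rightarrow> (real \<Rightarrow> real) \<Rightarrow> real \<Rightarrow> bool" where
  "has_end_value s t u c \<longleftrightarrow>
     (\<exists>v. continuous_on {s<..t} v \<and> (AE x in lebesgue. x \<in> {s<..<t} \<longrightarrow> u x = v x) \<and> v t = c)"

text \<open>
  \<open>D 0\<close> is in \<open>C\<^sup>k\<close> on \<open>(s,t]\<close> with derivatives \<open>D 1, \<dots>, D k\<close>, one-sided at \<open>t\<close>.
\<close>
definition Ck_derivs :: "nat \<Rightarrow> real \<Rightarrow> real \<Rightarrow> (nat \<Rightarrow> real \<Rightarrow> real) \<Rightarrow> bool" where
  "Ck_derivs k s t D \<longleftrightarrow>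
     (\<forall>i\<le>k. continuous_on {s<..t} (D i)) \<and>
     (\<forall>i<k. \<forall>x\<in>{s<..t}. (D i has_real_derivative D (Suc i) x) (at x within {s<..t}))"

end

theory Submission
  imports Defs "HOL-Complex_Analysis.Complex_Analysis" "HOL-Real_Asymp.Real_Asymp"
begin

text \<open>
  Let \<open>\<phi>(z,x)\<close> and \<open>\<phi>\<^sub>h(z,x)\<close> be the solutions for \<open>q\<close> and \<open>qh\<close> that behave like \<open>x\<^bsup>l+1\<^esup>\<close> at \<open>0\<close>; they are entire
  in \<open>z\<close>. Everything rests on their Wronskian at \<open>1\<close>,
  \<open>F(z) = \<integral>\<^sub>0\<^sup>a (q - qh) \<phi>(z,\<cdot>) \<phi>\<^sub>h(z,\<cdot>)\<close>, where the integral stops at \<open>a\<close> because the potentials agree beyond it.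

  \<^emph>\<open>Zeros.\<close> At a common eigenvalue both \<open>\<phi>\<close> and \<open>\<phi>\<^sub>h\<close> satisfy the boundary condition at \<open>1\<close>, so \<open>F\<close> vanishes. If the
  norming constants are also equal, the zero is double, since \<open>F'\<close> is a multiple of their difference by Green's
  identity (\<open>wronskian_vanishes_to_order\<close>). So \<open>F\<close> has at least \<open>m(t)/2\<close> zeros, with
  multiplicities, in \<open>\<bar>z\<bar> \<le> t\<^sup>2\<close>.

  \<^emph>\<open>Growth.\<close> Gronwall's inequality gives \<open>\<bar>\<phi>(\<omega>\<^sup>2,x)\<bar> \<le> C \<bar>\<omega>\<bar>\<^bsup>-l-1\<^esup> exp (\<bar>Im \<omega>\<bar> x)\<close> (\<open>phi_bound\<close>), without any Bessel
  functions. Hence \<open>\<bar>F(\<omega>\<^sup>2)\<bar> \<le> C \<bar>\<omega>\<bar>\<^bsup>-2l-2\<^esup> exp (2 a \<tau>) J(\<tau>)\<close> with \<open>\<tau> = \<bar>Im \<omega>\<bar>\<close> and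
  \<open>J(\<tau>) = \<integral>\<^sub>0\<^sup>a \<bar>q - qh\<bar> exp (-2 \<tau> (a - x)) dx\<close> (\<open>wronskian_bound\<close>). The smoothness of \<open>q - qh\<close> and its vanishing at \<open>a\<close> to
  the order \<open>k\<close> make \<open>J(\<tau>) = o(\<tau>\<^bsup>-k-1/p'\<^esup>)\<close>: each primitive gains a factor \<open>1/\<tau>\<close>, and Hoelder's inequality the rest
  (\<open>decays_sobolev\<close>, \<open>decays_Ck\<close>).

  \<^emph>\<open>Counting.\<close> If \<open>F\<close> is not identically zero, Jensen's inequality on the circle \<open>\<bar>z\<bar> = R\<^sup>2\<close>, on which \<open>\<bar>Im \<omega>\<bar>\<close> has the mean
  \<open>2 R/\<pi>\<close>, yields \<open>\<integral>\<^sub>1\<^sup>R m(t)/t dt \<le> 4 a R/\<pi> - (2 l + 2 + k + 1/p') ln R + B\<close> for all large \<open>R\<close>. Because \<open>J\<close> decays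
  with a little \<open>o\<close>, this holds for \<^emph>\<open>every\<close> real \<open>B\<close> (\<open>zero_counting_bound\<close>), which contradicts the hypothesis on the
  limit superior. So \<open>F = 0\<close>.

  \<^emph>\<open>Uniqueness.\<close> \<open>F = 0\<close> says that the Weyl functions \<open>\<phi>'/\<phi>\<close> of the two potentials agree at \<open>a\<close> for all \<open>z\<close>, which
  determines the potential on \<open>(0,a)\<close>, by a theorem of Borg and Marchenko (\<open>borg_marchenko\<close>). In its proof the
  solutions that vanish at an interior point \<open>x\<close> are compared: their Wronskian at \<open>a\<close> is an entire function of
  \<open>z\<close> of order \<open>1/2\<close> which tends to \<open>0\<close> along the imaginary axis, because the diagonal of the Green function does
  (\<open>green_function_small\<close>), and so it vanishes by the principle of Phragmen and Lindelof and Liouville's theorem.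
\<close>

section \<open>Calculus of indefinite Lebesgue integrals\<close>

text \<open>
  Stands in for the theorem on vanishing derivatives: indefinite Lebesgue integrals are differentiable only
  almost everywhere, but their increments can be compared with those of a monotone function. Summed over a fine
  partition, the hypothesis bounds \<open>D d - D c\<close> by \<open>\<eta> (\<kappa> d - \<kappa> c)\<close> for every \<open>\<eta>\<close>.
\<close>
lemma constant_if_increments_small:
  fixes D :: "real \<Rightarrow> 'a::real_normed_vector" and \<kappa> :: "real \<Rightarrow> real"
  assumes "c \<le> d"
    and small: "\<And>\<eta>. \<eta> > 0 \<Longrightarrow> \<exists>\<delta>>0. \<forall>s t. c \<le> s \<longrightarrow> s \<le> t \<longrightarrow> t \<le> d \<longrightarrow> t - s < \<delta> \<longrightarrow>
                  norm (D t - D s) \<le> \<eta> * (\<kappa> t - \<kappa> s)"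
  shows "D d = D c"
proof -
  have "norm (D d - D c) \<le> \<eta> * (\<kappa> d - \<kappa> c)" if "\<eta> > 0" for \<eta>
  proof -
    obtain \<delta> where "\<delta> > 0" and \<delta>: "\<And>s t. c \<le> s \<Longrightarrow> s \<le> t \<Longrightarrow> t \<le> d \<Longrightarrow> t - s < \<delta> \<Longrightarrow>
                  norm (D t - D s) \<le> \<eta> * (\<kappa> t - \<kappa> s)"
      using small[OF \<open>\<eta> > 0\<close>] by blast
    obtain n :: nat where n: "(d - c) / \<delta> < real n" using reals_Archimedean2 by blast
    with \<open>c \<le> d\<close> \<open>\<delta> > 0\<close> have "n > 0"
      by (metis diff_ge_0_iff_ge divide_nonneg_pos gr0I leD of_nat_0)
    define P where "P j = c + (d - c) * real j / real n" for j
    have step: "P (Suc j) - P j = (d - c) / n" for j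
      unfolding P_def using \<open>n > 0\<close> by (simp add: field_simps)
    have "(d - c) / n < \<delta>" using n \<open>n > 0\<close> \<open>\<delta> > 0\<close> by (simp add: field_simps)
    have P: "c \<le> P j" "P j \<le> P (Suc j)" "P (Suc j) \<le> d" if "j < n" for j
    proof -
      show "c \<le> P j" unfolding P_def using \<open>c \<le> d\<close> by simp
      show "P j \<le> P (Suc j)" using step[of j] \<open>c \<le> d\<close> \<open>n > 0\<close>
        by (smt (verit) divide_nonneg_nonneg of_nat_0_le_iff)
      have "real (Suc j) / real n \<le> 1" using that by simp
      then have "(d - c) * (real (Suc j) / real n) \<le> (d - c) * 1"
        using \<open>c \<le> d\<close> by (intro mult_left_mono) auto
      then show "P (Suc j) \<le> d" unfolding P_def by simp
    qed
    have "D d - D c = (\<Sum>j<n. D (P (Suc j)) - D (P j))"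
      using \<open>n > 0\<close> by (subst sum_lessThan_telescope) (simp add: P_def)
    also have "norm \<dots> \<le> (\<Sum>j<n. \<eta> * (\<kappa> (P (Suc j)) - \<kappa> (P j)))"
    proof (rule order_trans[OF norm_sum], rule sum_mono)
      fix j assume "j \<in> {..<n}"
      then show "norm (D (P (Suc j)) - D (P j)) \<le> \<eta> * (\<kappa> (P (Suc j)) - \<kappa> (P j))"
        using P[of j] step[of j] \<open>(d - c) / n < \<delta>\<close> by (intro \<delta>) auto
    qed
    also have "\<dots> = \<eta> * (\<kappa> d - \<kappa> c)"
      unfolding sum_distrib_left[symmetric]
      using \<open>n > 0\<close> by (subst sum_lessThan_telescope) (simp add: P_def)
    finally show ?thesis .
  qed
  note * = this
  show ?thesis
  proof (rule ccontr)
    assume "D d \<noteq> D c"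
    then have pos: "norm (D d - D c) > 0" by simp
    then have "\<kappa> d - \<kappa> c > 0" using less_le_trans[OF pos *[OF zero_less_one]] by simp
    then have "norm (D d - D c) \<le> norm (D d - D c) / 2"
      using *[of "norm (D d - D c) / (2 * (\<kappa> d - \<kappa> c))"] pos
      by (simp only: times_divide_eq_left) (simp add: field_simps)
    with pos show False by simp
  qed
qed

lemma absolutely_integrable_mult_continuous:
  fixes f g :: "real \<Rightarrow> 'a::{euclidean_space, real_normed_algebra}"
  assumes "f absolutely_integrable_on {c..d}" "continuous_on {c..d} g"
  shows "(\<lambda>t. f t * g t) absolutely_integrable_on {c..d}"
proof (rule absolutely_integrable_bounded_measurable_product[where h = "\<lambda>x y. y * x"])
  show "bilinear (\<lambda>x y :: 'a. y * x)"
    unfolding bilinear_conv_bounded_bilinear by (rule bounded_bilinear.flip[OF bounded_bilinear_mult])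
  show "g \<in> borel_measurable (lebesgue_on {c..d})"
    using assms(2) by (rule continuous_imp_measurable_on_sets_lebesgue) auto
  show "bounded (g ` {c..d})"
    using assms(2) compact_Icc compact_continuous_image compact_imp_bounded by blast
qed (use assms in auto)

lemma absolutely_integrable_continuous_mult:
  fixes f g :: "real \<Rightarrow> 'a::{euclidean_space, real_normed_algebra}"
  assumes "f absolutely_integrable_on {c..d}" "continuous_on {c..d} g"
  shows "(\<lambda>t. g t * f t) absolutely_integrable_on {c..d}"
proof (rule absolutely_integrable_bounded_measurable_product[where h = "\<lambda>x y. x * y"])
  show "bilinear (\<lambda>x y :: 'a. x * y)" by (rule bilinear_times)
  show "g \<in> borel_measurable (lebesgue_on {c..d})"
    using assms(2) by (rule continuous_imp_measurable_on_sets_lebesgue) auto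
  show "bounded (g ` {c..d})"
    using assms(2) compact_Icc compact_continuous_image compact_imp_bounded by blast
qed (use assms in auto)

lemma norm_absolutely_integrable:
  fixes f :: "real \<Rightarrow> 'a::euclidean_space"
  assumes "f absolutely_integrable_on S" shows "(\<lambda>t. norm (f t)) absolutely_integrable_on S"
  using assms by (simp add: absolutely_integrable_norm[unfolded o_def])

lemma integral_diff_Icc:
  fixes f :: "real \<Rightarrow> 'a::banach"
  assumes "f integrable_on {c..d}" "c \<le> s" "s \<le> t" "t \<le> d"
  shows "integral {c..t} f - integral {c..s} f = integral {s..t} f"
proof -
  have "f integrable_on {c..t}" using assms integrable_subinterval_real by (metis atLeastatMost_subset_iff order.refl)
  then have "integral {c..s} f + integral {s..t} f = integral {c..t} f"
    using assms by (intro Henstock_Kurzweil_Integration.integral_combine) auto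
  then show ?thesis by (simp add: algebra_simps)
qed

lemma uniformly_continuous_Icc:
  fixes f :: "real \<Rightarrow> 'a::metric_space"
  assumes "continuous_on {c..d} f" "e > 0"
  shows "\<exists>\<delta>>0. \<forall>s t. c \<le> s \<longrightarrow> s \<le> t \<longrightarrow> t \<le> d \<longrightarrow> t - s < \<delta> \<longrightarrow> dist (f t) (f s) < e"
proof -
  have "uniformly_continuous_on {c..d} f"
    using assms(1) compact_uniformly_continuous by blast
  then obtain \<delta> where "\<delta> > 0" "\<And>s t. s \<in> {c..d} \<Longrightarrow> t \<in> {c..d} \<Longrightarrow> dist t s < \<delta> \<Longrightarrow> dist (f t) (f s) < e"
    unfolding uniformly_continuous_on_def using \<open>e > 0\<close> by metis
  then show ?thesis by (intro exI[of _ \<delta>]) (auto simp: dist_real_def)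
qed

text \<open>
  The defect of the product rule has increments that are small compared with
  those of the indefinite integral of \<open>\<bar>h\<bar> + \<bar>g\<bar>\<close>, so it is constant.
\<close>
lemma integral_by_parts_L1:
  fixes h g :: "real \<Rightarrow> 'a::{euclidean_space, real_normed_algebra}"
  assumes "c \<le> d"
    and h: "h absolutely_integrable_on {c..d}" and g: "g absolutely_integrable_on {c..d}"
    and H: "\<And>t. t \<in> {c..d} \<Longrightarrow> H t = H c + integral {c..t} h"
    and G: "\<And>t. t \<in> {c..d} \<Longrightarrow> G t = G c + integral {c..t} g"
  shows "H d * G d - H c * G c = integral {c..d} (\<lambda>t. h t * G t + H t * g t)"
    and "(\<lambda>t. h t * G t + H t * g t) absolutely_integrable_on {c..d}"
proof -
  have hi: "h integrable_on {c..d}" and gi: "g integrable_on {c..d}"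
    using h g set_lebesgue_integral_eq_integral(1) by blast+
  have cH: "continuous_on {c..d} H"
    by (subst continuous_on_cong[OF refl H, OF _ ])
       (auto intro!: continuous_intros indefinite_integral_continuous_1 hi)
  have cG: "continuous_on {c..d} G"
    by (subst continuous_on_cong[OF refl G, OF _ ])
       (auto intro!: continuous_intros indefinite_integral_continuous_1 gi)
  let ?f = "\<lambda>t. h t * G t + H t * g t"
  show f: "?f absolutely_integrable_on {c..d}"
    using absolutely_integrable_mult_continuous[OF h cG]
      absolutely_integrable_continuous_mult[OF g cH] by (rule set_integral_add)
  then have fi: "?f integrable_on {c..d}" using set_lebesgue_integral_eq_integral(1) by blast
  let ?k = "\<lambda>t. norm (h t) + norm (g t)"
  have k: "?k absolutely_integrable_on {c..d}"
    by (intro set_integral_add norm_absolutely_integrable h g)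
  then have ki: "?k integrable_on {c..d}" using set_lebesgue_integral_eq_integral(1) by blast
  define D where "D t = H t * G t - integral {c..t} ?f" for t
  have "D d = D c"
  proof (rule constant_if_increments_small[OF \<open>c \<le> d\<close>, where \<kappa> = "\<lambda>t. integral {c..t} ?k"])
    fix \<eta> :: real assume "\<eta> > 0"
    obtain \<delta>1 where \<delta>1: "\<delta>1 > 0" "\<And>s t. c \<le> s \<Longrightarrow> s \<le> t \<Longrightarrow> t \<le> d \<Longrightarrow> t - s < \<delta>1 \<Longrightarrow> dist (H t) (H s) < \<eta>"
      using uniformly_continuous_Icc[OF cH \<open>\<eta> > 0\<close>] by blast
    obtain \<delta>2 where \<delta>2: "\<delta>2 > 0" "\<And>s t. c \<le> s \<Longrightarrow> s \<le> t \<Longrightarrow> t \<le> d \<Longrightarrow> t - s < \<delta>2 \<Longrightarrow> dist (G t) (G s) < \<eta>"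
      using uniformly_continuous_Icc[OF cG \<open>\<eta> > 0\<close>] by blast
    show "\<exists>\<delta>>0. \<forall>s t. c \<le> s \<longrightarrow> s \<le> t \<longrightarrow> t \<le> d \<longrightarrow> t - s < \<delta> \<longrightarrow>
            norm (D t - D s) \<le> \<eta> * (integral {c..t} ?k - integral {c..s} ?k)"
    proof (intro exI conjI allI impI)
      show "min \<delta>1 \<delta>2 > 0" using \<delta>1 \<delta>2 by simp
      fix s t assume st: "c \<le> s" "s \<le> t" "t \<le> d" "t - s < min \<delta>1 \<delta>2"
      have sub: "{s..t} \<subseteq> {c..d}" using st by auto
      note si = integrable_subinterval_real[OF _ sub]
      have ai: "\<And>f::real \<Rightarrow> 'a. f absolutely_integrable_on {c..d} \<Longrightarrow> f absolutely_integrable_on {s..t}"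
        using absolutely_integrable_on_subinterval[OF _ sub] .
      have Hts: "H t - H s = integral {s..t} h" and Gts: "G t - G s = integral {s..t} g"
        using H[of t] H[of s] G[of t] G[of s] st integral_diff_Icc[OF hi, of s t] integral_diff_Icc[OF gi, of s t]
        by auto
      have hGt: "(\<lambda>\<tau>. h \<tau> * G t) integrable_on {s..t}" and hG: "(\<lambda>\<tau>. h \<tau> * G \<tau>) integrable_on {s..t}"
        and Hgt: "(\<lambda>\<tau>. H s * g \<tau>) integrable_on {s..t}" and Hg: "(\<lambda>\<tau>. H \<tau> * g \<tau>) integrable_on {s..t}"
        by (intro set_lebesgue_integral_eq_integral(1) ai absolutely_integrable_mult_continuous h g cG cH
            absolutely_integrable_continuous_mult continuous_intros)+
      have "H t * G t - H s * G s = (H t - H s) * G t + H s * (G t - G s)"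
        by (simp add: algebra_simps)
      also have "\<dots> = integral {s..t} (\<lambda>\<tau>. h \<tau> * G t) + integral {s..t} (\<lambda>\<tau>. H s * g \<tau>)"
        unfolding Hts Gts
        using integral_linear[OF si[OF hi] bounded_linear_mult_left[of "G t"]]
          integral_linear[OF si[OF gi] bounded_linear_mult_right[of "H s"]]
        by (simp add: o_def)
      finally have "D t - D s = integral {s..t} (\<lambda>\<tau>. h \<tau> * G t) + integral {s..t} (\<lambda>\<tau>. H s * g \<tau>)
                     - (integral {s..t} (\<lambda>\<tau>. h \<tau> * G \<tau>) + integral {s..t} (\<lambda>\<tau>. H \<tau> * g \<tau>))"
        using integral_diff_Icc[OF fi, of s t] st hG Hg
        by (simp add: D_def Henstock_Kurzweil_Integration.integral_add algebra_simps)
      also have "\<dots> = integral {s..t} (\<lambda>\<tau>. h \<tau> * G t + H s * g \<tau> - (h \<tau> * G \<tau> + H \<tau> * g \<tau>))"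
        using hG Hg hGt Hgt
        by (simp add: Henstock_Kurzweil_Integration.integral_add Henstock_Kurzweil_Integration.integral_diff integrable_add)
      also have "norm \<dots> \<le> integral {s..t} (\<lambda>\<tau>. \<eta> * ?k \<tau>)"
      proof (rule Henstock_Kurzweil_Integration.integral_norm_bound_integral)
        show "(\<lambda>\<tau>. h \<tau> * G t + H s * g \<tau> - (h \<tau> * G \<tau> + H \<tau> * g \<tau>)) integrable_on {s..t}"
          by (intro integrable_diff integrable_add hG Hg hGt Hgt)
        show "(\<lambda>\<tau>. \<eta> * ?k \<tau>) integrable_on {s..t}"
          using si[OF ki] by (intro integrable_on_mult_right) auto
        fix \<tau> assume \<tau>: "\<tau> \<in> {s..t}"
        have e1: "norm (G t - G \<tau>) \<le> \<eta>" using \<delta>2(2)[of \<tau> t] \<tau> st by (auto simp: dist_norm)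
        have e2: "norm (H s - H \<tau>) \<le> \<eta>" using \<delta>1(2)[of s \<tau>] \<tau> st by (auto simp: dist_norm norm_minus_commute)
        have "h \<tau> * G t + H s * g \<tau> - (h \<tau> * G \<tau> + H \<tau> * g \<tau>) = h \<tau> * (G t - G \<tau>) + (H s - H \<tau>) * g \<tau>"
          by (simp add: algebra_simps)
        also have "norm \<dots> \<le> norm (h \<tau>) * norm (G t - G \<tau>) + norm (H s - H \<tau>) * norm (g \<tau>)"
          by (intro norm_triangle_le add_mono norm_mult_ineq)
        also have "\<dots> \<le> norm (h \<tau>) * \<eta> + \<eta> * norm (g \<tau>)"
          by (intro add_mono mult_left_mono mult_right_mono e1 e2) auto
        finally show "norm (h \<tau> * G t + H s * g \<tau> - (h \<tau> * G \<tau> + H \<tau> * g \<tau>)) \<le> \<eta> * ?k \<tau>"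
          by (simp add: algebra_simps)
      qed
      also have "\<dots> = \<eta> * (integral {c..t} ?k - integral {c..s} ?k)"
        using integral_diff_Icc[OF ki, of s t] st by simp
      finally show "norm (D t - D s) \<le> \<eta> * (integral {c..t} ?k - integral {c..s} ?k)" .
    qed
  qed
  then show "H d * G d - H c * G c = integral {c..d} ?f"
    by (simp add: D_def algebra_simps)
qed

text \<open>
  Weighting by \<open>exp (2 \<kappa>)\<close>, where \<open>\<kappa>\<close> is the indefinite integral of \<open>k\<close>, turns a
  Volterra operator with kernel bounded by \<open>k\<close> into a contraction with factor \<open>1/2\<close>.
\<close>
lemma integral_exp_weight:
  fixes k :: "real \<Rightarrow> real"
  assumes "c \<le> d" and k: "k absolutely_integrable_on {c..d}" and k0: "\<And>t. t \<in> {c..d} \<Longrightarrow> 0 \<le> k t"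
  defines "\<kappa> \<equiv> \<lambda>t. integral {c..t} k"
  shows "integral {c..d} (\<lambda>t. k t * exp (2 * \<kappa> t)) \<le> exp (2 * \<kappa> d) / 2"
    and "(\<lambda>t. k t * exp (2 * \<kappa> t)) absolutely_integrable_on {c..d}"
    and "continuous_on {c..d} \<kappa>"
proof -
  have ki: "k integrable_on {c..d}"
    using k set_lebesgue_integral_eq_integral(1) by blast
  show c\<kappa>: "continuous_on {c..d} \<kappa>" unfolding \<kappa>_def by (intro indefinite_integral_continuous_1 ki)
  have mono: "\<kappa> s \<le> \<kappa> t" if "c \<le> s" "s \<le> t" "t \<le> d" for s t
  proof -
    have "\<kappa> t - \<kappa> s = integral {s..t} k" unfolding \<kappa>_def using integral_diff_Icc[OF ki that] .
    also have "\<dots> \<ge> 0" using that k0 by (intro Henstock_Kurzweil_Integration.integral_nonneg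
        integrable_subinterval_real[OF ki]) auto
    finally show ?thesis by simp
  qed
  let ?f = "\<lambda>t. k t * exp (2 * \<kappa> t)"
  show f: "?f absolutely_integrable_on {c..d}"
    by (intro absolutely_integrable_mult_continuous k continuous_intros c\<kappa>)
  then have fi: "?f integrable_on {c..d}" using set_lebesgue_integral_eq_integral(1) by blast
  define D where "D t = integral {c..t} ?f - exp (2 * \<kappa> t) / 2" for t
  have "D d = D c"
  proof (rule constant_if_increments_small[OF \<open>c \<le> d\<close>, where \<kappa> = \<kappa>])
    fix \<eta> :: real assume "\<eta> > 0"
    have "continuous_on {c..d} (\<lambda>t. exp (2 * \<kappa> t))" by (intro continuous_intros c\<kappa>)
    from uniformly_continuous_Icc[OF this \<open>\<eta> > 0\<close>]
    obtain \<delta> where \<delta>: "\<delta> > 0" "\<And>s t. c \<le> s \<Longrightarrow> s \<le> t \<Longrightarrow> t \<le> d \<Longrightarrow> t - s < \<delta> \<Longrightarrow>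
        dist (exp (2 * \<kappa> t)) (exp (2 * \<kappa> s)) < \<eta>" by blast
    show "\<exists>\<delta>>0. \<forall>s t. c \<le> s \<longrightarrow> s \<le> t \<longrightarrow> t \<le> d \<longrightarrow> t - s < \<delta> \<longrightarrow> norm (D t - D s) \<le> \<eta> * (\<kappa> t - \<kappa> s)"
    proof (intro exI[of _ \<delta>] conjI allI impI)
      fix s t assume st: "c \<le> s" "s \<le> t" "t \<le> d" "t - s < \<delta>"
      have sub: "{s..t} \<subseteq> {c..d}" using st by auto
      define A where "A = exp (2 * \<kappa> s)"
      define B where "B = exp (2 * \<kappa> t)"
      define m where "m = \<kappa> t - \<kappa> s"
      have m: "m \<ge> 0" "m = integral {s..t} k"
        using mono[of s t] st integral_diff_Icc[OF ki, of s t] by (auto simp: m_def \<kappa>_def)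
      have AB: "B - A < \<eta>" "A \<le> B" using \<delta>(2)[of s t] st mono[of s t] by (auto simp: A_def B_def dist_real_def)
      have i1: "integral {s..t} ?f \<le> integral {s..t} (\<lambda>\<tau>. k \<tau> * B)"
        using st sub k0 mono by (intro integral_le integrable_subinterval_real[OF fi sub] integrable_on_mult_left
            integrable_subinterval_real[OF ki sub] mult_left_mono) (auto simp: B_def)
      have i2: "integral {s..t} (\<lambda>\<tau>. k \<tau> * A) \<le> integral {s..t} ?f"
        using st sub k0 mono by (intro integral_le integrable_subinterval_real[OF fi sub] integrable_on_mult_left
            integrable_subinterval_real[OF ki sub] mult_left_mono) (auto simp: A_def)
      have up: "B - A \<le> 2 * (m * B)"
      proof -
        have "A = B * exp (- (2 * m))" by (simp add: A_def B_def m_def exp_add[symmetric] algebra_simps)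
        moreover have "1 - 2 * m \<le> exp (- (2 * m))" using exp_ge_add_one_self[of "- (2 * m)"] by simp
        ultimately have "B * (1 - 2 * m) \<le> A" by (simp add: B_def)
        then show ?thesis by (simp add: algebra_simps)
      qed
      have lo: "2 * (m * A) \<le> B - A"
      proof -
        have "B = A * exp (2 * m)" by (simp add: A_def B_def m_def exp_add[symmetric] algebra_simps)
        moreover have "1 + 2 * m \<le> exp (2 * m)" using exp_ge_add_one_self[of "2 * m"] by simp
        ultimately have "A * (1 + 2 * m) \<le> B" by (simp add: A_def)
        then show ?thesis by (simp add: algebra_simps)
      qed
      have "D t - D s = integral {s..t} ?f - (B - A) / 2"
        using integral_diff_Icc[OF fi, of s t] st by (simp add: D_def A_def B_def field_simps)
      moreover have "integral {s..t} ?f \<le> m * B" "m * A \<le> integral {s..t} ?f"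
        using i1 i2 m by simp_all
      ultimately have "\<bar>D t - D s\<bar> \<le> m * B - m * A" using up lo unfolding abs_le_iff by argo
      also have "\<dots> = m * (B - A)" by (simp add: algebra_simps)
      also have "\<dots> \<le> m * \<eta>" using AB m by (intro mult_left_mono) auto
      finally show "norm (D t - D s) \<le> \<eta> * (\<kappa> t - \<kappa> s)" by (simp add: m_def mult.commute)
    qed (use \<delta> in auto)
  qed
  then have "integral {c..d} ?f = exp (2 * \<kappa> d) / 2 - 1 / 2"
    by (simp add: D_def \<kappa>_def)
  then show "integral {c..d} ?f \<le> exp (2 * \<kappa> d) / 2" by simp
qed

text \<open>
  At a maximum of \<open>y exp (-2 \<kappa>)\<close>, where \<open>\<kappa>\<close> is the indefinite integral of \<open>k\<close>, the contraction property of the weighted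
  integral gives the bound at once. The exponent and the constant are not sharp, which does no harm below.
\<close>
lemma gronwall_L1:
  fixes k y :: "real \<Rightarrow> real"
  assumes "c \<le> d" and k: "k absolutely_integrable_on {c..d}" and k0: "\<And>t. t \<in> {c..d} \<Longrightarrow> 0 \<le> k t"
    and y: "continuous_on {c..d} y" and y0: "\<And>t. t \<in> {c..d} \<Longrightarrow> 0 \<le> y t" and "0 \<le> A"
    and le: "\<And>t. t \<in> {c..d} \<Longrightarrow> y t \<le> A + integral {c..t} (\<lambda>s. k s * y s)"
    and K: "integral {c..d} k \<le> K"
    and t: "t \<in> {c..d}"
  shows "y t \<le> 2 * A * exp (2 * K)"
proof -
  define \<kappa> where "\<kappa> t = integral {c..t} k" for t
  have ki: "k integrable_on {c..d}" using k set_lebesgue_integral_eq_integral(1) by blast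
  have c\<kappa>: "continuous_on {c..d} \<kappa>"
    using integral_exp_weight(3)[OF \<open>c \<le> d\<close> k k0] by (simp add: \<kappa>_def)
  have "continuous_on {c..d} (\<lambda>t. y t * exp (- (2 * \<kappa> t)))" by (intro continuous_intros y c\<kappa>)
  moreover have "{c..d} \<noteq> {}" using \<open>c \<le> d\<close> by simp
  ultimately obtain m where m: "m \<in> {c..d}"
    and max: "\<And>s. s \<in> {c..d} \<Longrightarrow> y s * exp (- (2 * \<kappa> s)) \<le> y m * exp (- (2 * \<kappa> m))"
    using continuous_attains_sup[of "{c..d}" "\<lambda>t. y t * exp (- (2 * \<kappa> t))"] by (auto simp: Ball_def)
  define M where "M = y m * exp (- (2 * \<kappa> m))"
  have M0: "M \<ge> 0" using y0[OF m] by (simp add: M_def)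
  have yM: "y s \<le> M * exp (2 * \<kappa> s)" if "s \<in> {c..d}" for s
    using max[OF that] by (simp add: M_def exp_minus field_simps)
  have \<kappa>0: "0 \<le> \<kappa> s" if "s \<in> {c..d}" for s
    unfolding \<kappa>_def using that k0 by (intro Henstock_Kurzweil_Integration.integral_nonneg
        integrable_subinterval_real[OF ki]) auto
  have sub: "{c..m} \<subseteq> {c..d}" using m by auto
  have km: "k absolutely_integrable_on {c..m}" by (rule absolutely_integrable_on_subinterval[OF k sub])
  have k0m: "\<And>t. t \<in> {c..m} \<Longrightarrow> 0 \<le> k t" using k0 sub by auto
  have w: "integral {c..m} (\<lambda>s. k s * exp (2 * \<kappa> s)) \<le> exp (2 * \<kappa> m) / 2"
     "(\<lambda>s. k s * exp (2 * \<kappa> s)) integrable_on {c..m}"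
    using integral_exp_weight(1,2)[OF _ km k0m] m set_lebesgue_integral_eq_integral(1)
    by (auto simp: \<kappa>_def)
  have "y m \<le> A + integral {c..m} (\<lambda>s. k s * y s)" by (rule le[OF m])
  also have "integral {c..m} (\<lambda>s. k s * y s) \<le> integral {c..m} (\<lambda>s. M * (k s * exp (2 * \<kappa> s)))"
  proof (rule integral_le)
    show "(\<lambda>s. k s * y s) integrable_on {c..m}"
      by (intro set_lebesgue_integral_eq_integral(1) absolutely_integrable_mult_continuous km
          continuous_on_subset[OF y sub])
    show "(\<lambda>s. M * (k s * exp (2 * \<kappa> s))) integrable_on {c..m}"
      by (intro integrable_on_mult_right w)
    show "k s * y s \<le> M * (k s * exp (2 * \<kappa> s))" if "s \<in> {c..m}" for s
      using mult_left_mono[OF yM k0m[OF that], of s] that sub by (auto simp: algebra_simps)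
  qed
  also have "\<dots> \<le> M * (exp (2 * \<kappa> m) / 2)" using mult_left_mono[OF w(1) M0] by simp
  finally have "y m \<le> A + M * exp (2 * \<kappa> m) / 2" by simp
  then have "M \<le> (A + M * exp (2 * \<kappa> m) / 2) * exp (- (2 * \<kappa> m))"
    unfolding M_def by (intro mult_right_mono) auto
  also have "\<dots> = A * exp (- (2 * \<kappa> m)) + M / 2"
    by (simp add: algebra_simps exp_add[symmetric])
  also have "A * exp (- (2 * \<kappa> m)) \<le> A * 1"
    using \<kappa>0[OF m] \<open>0 \<le> A\<close> by (intro mult_left_mono) auto
  finally have "M \<le> 2 * A" by simp
  have "\<kappa> t \<le> K"
  proof -
    have "\<kappa> d - \<kappa> t = integral {t..d} k" unfolding \<kappa>_def using t integral_diff_Icc[OF ki, of t d] by auto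
    also have "\<dots> \<ge> 0" using t k0 by (intro Henstock_Kurzweil_Integration.integral_nonneg
        integrable_subinterval_real[OF ki]) auto
    finally show ?thesis using K by (simp add: \<kappa>_def)
  qed
  have "y t \<le> M * exp (2 * \<kappa> t)" by (rule yM[OF t])
  also have "\<dots> \<le> 2 * A * exp (2 * K)"
    using \<open>M \<le> 2 * A\<close> \<open>\<kappa> t \<le> K\<close> M0 by (intro mult_mono) auto
  finally show ?thesis .
qed

text \<open>By Lebesgue's differentiation theorem.\<close>
lemma AE_zero_if_interval_integrals_zero:
  fixes f :: "real \<Rightarrow> 'a::euclidean_space"
  assumes int: "\<And>s t. c < s \<Longrightarrow> s \<le> t \<Longrightarrow> t < d \<Longrightarrow> f integrable_on {s..t} \<and> integral {s..t} f = 0"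
  shows "AE x in lebesgue. x \<in> {c<..<d} \<longrightarrow> f x = 0"
proof -
  have *: "AE x in lebesgue. x \<in> {s<..<t} \<longrightarrow> f x = 0" if st: "c < s" "t < d" for s t
  proof (cases "s < t")
    case True
    define g where "g x = (if x \<in> {s..t} then f x else 0)" for x
    have f: "f integrable_on {s..t}" using int[of s t] st True by auto
    have "g integrable_on cbox a b" for a b
    proof -
      have "g integrable_on UNIV" unfolding g_def using f integrable_restrict_UNIV[of "{s..t}" f] by simp
      then show ?thesis using integrable_on_subcbox by blast
    qed
    then obtain N where N: "negligible N" and lim: "\<And>x e. \<lbrakk>x \<notin> N; 0 < e\<rbrakk> \<Longrightarrow>
         \<exists>r>0. \<forall>h. 0 < h \<and> h < r \<longrightarrow> norm (integral (cbox x (x + h *\<^sub>R One)) g /\<^sub>R h ^ DIM(real) - g x) < e"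
      using integrable_ccontinuous_explicit[of g] by blast
    have "f x = 0" if x: "x \<in> {s<..<t}" "x \<notin> N" for x
    proof (rule ccontr)
      assume "f x \<noteq> 0"
      then obtain r where r: "r > 0" "\<And>h. 0 < h \<Longrightarrow> h < r \<Longrightarrow>
           norm (integral (cbox x (x + h *\<^sub>R One)) g /\<^sub>R h ^ DIM(real) - g x) < norm (f x)"
        using lim[OF x(2), of "norm (f x)"] by auto
      define h where "h = min r (t - x) / 2"
      have h: "0 < h" "h < r" "x + h < t" using r x by (auto simp: h_def min_def field_simps)
      have "integral {x..x + h} g = integral {x..x + h} f"
        using h x by (intro Henstock_Kurzweil_Integration.integral_cong) (auto simp: g_def)
      also have "\<dots> = 0" using int[of x "x + h"] h x st by auto
      finally have "norm (g x) < norm (f x)" using r(2)[OF h(1,2)] by simp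
      then show False using x by (simp add: g_def)
    qed
    then have "{x \<in> {s<..<t}. f x \<noteq> 0} \<subseteq> N" by auto
    moreover have "N \<in> null_sets lebesgue" using N negligible_iff_null_sets by blast
    ultimately show ?thesis by (intro AE_I') auto
  qed auto
  have "AE x in lebesgue. \<forall>n::nat. x \<in> {c + 1 / Suc n<..<d - 1 / Suc n} \<longrightarrow> f x = 0"
    unfolding AE_all_countable by (intro allI *) auto
  then show ?thesis
  proof eventually_elim
    case (elim x)
    show ?case
    proof
      assume x: "x \<in> {c<..<d}"
      then have "min (x - c) (d - x) > 0" by auto
      then obtain n where "inverse (real (Suc n)) < min (x - c) (d - x)" using reals_Archimedean by blast
      then have "x \<in> {c + 1 / Suc n<..<d - 1 / Suc n}" by (auto simp: inverse_eq_divide)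
      then show "f x = 0" using elim by blast
    qed
  qed
qed

section \<open>Solutions and Wronskians\<close>

text \<open>
  \<open>f'' = V f\<close> on \<open>[c,d]\<close>, written as a pair of integral equations, since \<open>f'\<close> is merely an indefinite integral when
  \<open>V\<close> is merely integrable.
\<close>
definition solves :: "(real \<Rightarrow> complex) \<Rightarrow> real \<Rightarrow> real \<Rightarrow> (real \<Rightarrow> complex) \<Rightarrow> (real \<Rightarrow> complex) \<Rightarrow> bool" where
  "solves V c d f f' \<longleftrightarrow>
     c \<le> d \<and> V absolutely_integrable_on {c..d} \<and> continuous_on {c..d} f' \<and>
     (\<forall>x\<in>{c..d}. f x = f c + integral {c..x} f') \<and>
     (\<forall>x\<in>{c..d}. f' x = f' c + integral {c..x} (\<lambda>t. V t * f t))"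

lemma solvesI:
  assumes "c \<le> d" "V absolutely_integrable_on {c..d}" "continuous_on {c..d} f'"
    and "\<And>x. x \<in> {c..d} \<Longrightarrow> f x = f c + integral {c..x} f'"
    and "\<And>x. x \<in> {c..d} \<Longrightarrow> f' x = f' c + integral {c..x} (\<lambda>t. V t * f t)"
  shows "solves V c d f f'"
  using assms unfolding solves_def by blast

lemma solvesD:
  assumes "solves V c d f f'"
  shows "c \<le> d" "V absolutely_integrable_on {c..d}" "continuous_on {c..d} f'"
    and "x \<in> {c..d} \<Longrightarrow> f x = f c + integral {c..x} f'"
    and "x \<in> {c..d} \<Longrightarrow> f' x = f' c + integral {c..x} (\<lambda>t. V t * f t)"
  using assms unfolding solves_def by blast+

lemma solves_continuous:
  assumes "solves V c d f f'"
  shows "continuous_on {c..d} f"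
proof -
  have "f' integrable_on {c..d}" by (intro integrable_continuous_real solvesD(3)[OF assms])
  then have "continuous_on {c..d} (\<lambda>x. f c + integral {c..x} f')"
    by (intro continuous_intros indefinite_integral_continuous_1)
  moreover have "continuous_on {c..d} f \<longleftrightarrow> continuous_on {c..d} (\<lambda>x. f c + integral {c..x} f')"
    by (rule continuous_on_cong[OF refl solvesD(4)[OF assms]])
  ultimately show ?thesis by blast
qed

lemma solves_integrable:
  assumes "solves V c d f f'"
  shows "(\<lambda>t. V t * f t) absolutely_integrable_on {c..d}"
  using absolutely_integrable_mult_continuous[OF solvesD(2)[OF assms] solves_continuous[OF assms]] .

lemma solves_has_vector_derivative:
  assumes "solves V c d f f'" "x \<in> {c..d}"
  shows "(f has_vector_derivative f' x) (at x within {c..d})"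
proof -
  have "((\<lambda>u. integral {c..u} f') has_vector_derivative f' x) (at x within {c..d})"
    by (rule integral_has_vector_derivative[OF solvesD(3)[OF assms(1)] assms(2)])
  then have "((\<lambda>u. f c + integral {c..u} f') has_vector_derivative f' x) (at x within {c..d})"
    by (auto intro!: derivative_eq_intros)
  then show ?thesis
    by (rule has_vector_derivative_transform[OF assms(2), rotated]) (rule solvesD(4)[OF assms(1)])
qed

lemma solves_subinterval:
  assumes "solves V c d f f'" "c \<le> s" "s \<le> t" "t \<le> d"
  shows "solves V s t f f'"
proof -
  have sub: "{s..t} \<subseteq> {c..d}" using assms by auto
  have i1: "f' integrable_on {c..d}" by (intro integrable_continuous_real solvesD(3)[OF assms(1)])
  have i2: "(\<lambda>t. V t * f t) integrable_on {c..d}"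
    using solves_integrable[OF assms(1)] set_lebesgue_integral_eq_integral(1) by blast
  have "f x = f s + integral {s..x} f'" if x: "x \<in> {s..t}" for x
  proof -
    have "f x - f s = integral {c..x} f' - integral {c..s} f'"
      using solvesD(4)[OF assms(1), of x] solvesD(4)[OF assms(1), of s] x assms(2-4) by simp
    also have "\<dots> = integral {s..x} f'" using integral_diff_Icc[OF i1, of s x] x assms(2-4) by simp
    finally show ?thesis by (simp add: algebra_simps)
  qed
  moreover have "f' x = f' s + integral {s..x} (\<lambda>t. V t * f t)" if x: "x \<in> {s..t}" for x
  proof -
    have "f' x - f' s = integral {c..x} (\<lambda>t. V t * f t) - integral {c..s} (\<lambda>t. V t * f t)"
      using solvesD(5)[OF assms(1), of x] solvesD(5)[OF assms(1), of s] x assms(2-4) by simp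
    also have "\<dots> = integral {s..x} (\<lambda>t. V t * f t)" using integral_diff_Icc[OF i2, of s x] x assms(2-4) by simp
    finally show ?thesis by (simp add: algebra_simps)
  qed
  ultimately show ?thesis
    using assms(3) absolutely_integrable_on_subinterval[OF solvesD(2)[OF assms(1)] sub]
      continuous_on_subset[OF solvesD(3)[OF assms(1)] sub]
    unfolding solves_def by blast
qed

text \<open>
  The main tool for the equation: with different choices of the second solution it gives variation
  of constants, Green's identities, and the uniqueness of solutions.
\<close>
lemma wronskian_increment:
  assumes f: "solves V c d f f'" and g: "solves U c d g g'"
  shows "(f' d * g d - f d * g' d) - (f' c * g c - f c * g' c)
           = integral {c..d} (\<lambda>t. (V t - U t) * (f t * g t))"
proof -
  note cd = solvesD(1)[OF f]
  note Vf = solves_integrable[OF f] and Ug = solves_integrable[OF g]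
  have f'i: "f' absolutely_integrable_on {c..d}" and g'i: "g' absolutely_integrable_on {c..d}"
    using solvesD(3)[OF f] solvesD(3)[OF g] by (auto intro: absolutely_integrable_continuous_real)
  have 1: "f' d * g d - f' c * g c = integral {c..d} (\<lambda>t. V t * f t * g t + f' t * g' t)"
    "(\<lambda>t. V t * f t * g t + f' t * g' t) absolutely_integrable_on {c..d}"
    by (rule integral_by_parts_L1[OF cd Vf g'i]; erule solvesD(5)[OF f] solvesD(4)[OF g])+
  have 2: "f d * g' d - f c * g' c = integral {c..d} (\<lambda>t. f' t * g' t + f t * (U t * g t))"
    "(\<lambda>t. f' t * g' t + f t * (U t * g t)) absolutely_integrable_on {c..d}"
    by (rule integral_by_parts_L1[OF cd f'i Ug]; erule solvesD(4)[OF f] solvesD(5)[OF g])+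
  have "(f' d * g d - f d * g' d) - (f' c * g c - f c * g' c)
        = (f' d * g d - f' c * g c) - (f d * g' d - f c * g' c)" by simp
  also have "\<dots> = integral {c..d} (\<lambda>t. V t * f t * g t + f' t * g' t - (f' t * g' t + f t * (U t * g t)))"
    unfolding 1(1) 2(1) using 1(2) 2(2) set_lebesgue_integral_eq_integral(1)
    by (intro Henstock_Kurzweil_Integration.integral_diff[symmetric]) blast+
  also have "\<dots> = integral {c..d} (\<lambda>t. (V t - U t) * (f t * g t))"
    by (intro Henstock_Kurzweil_Integration.integral_cong) (simp add: algebra_simps)
  finally show ?thesis .
qed

section \<open>The weighted Volterra equation with a spectral parameter\<close>

text \<open>
  The system \<open>u' = w\<close>, \<open>(x\<^sup>\<alpha> w)' = x\<^sup>\<alpha> (v - z) u\<close> with data at \<open>c\<close>. For \<open>\<alpha> = 0\<close> this is the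
  initial value problem for \<open>u'' = (v - z) u\<close> at a regular point; for \<open>\<alpha> = 2 l + 2\<close> and \<open>c = 0\<close> it
  is the equation for \<open>u = x\<^bsup>-l-1\<^esup> \<phi>\<close>, where \<open>\<phi>\<close> is the solution regular at \<open>0\<close>. The weight
  \<open>(y/x)\<^sup>\<alpha>\<close> never exceeds \<open>1\<close>, so both cases obey the same estimates.
\<close>

locale weighted_volterra =
  fixes \<alpha> c d :: real and v :: "real \<Rightarrow> complex"
  assumes \<alpha>: "0 \<le> \<alpha>" and c0: "0 \<le> c" and c\<alpha>: "0 < c \<or> 0 < \<alpha>" and cd: "c \<le> d" and dc: "d \<le> c + 1"
    and v: "v absolutely_integrable_on {c..d}"
begin

definition volterra :: "(real \<Rightarrow> complex) \<Rightarrow> (real \<Rightarrow> complex) \<Rightarrow> real \<Rightarrow> complex" where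
  "volterra p f x = integral {c..x} (\<lambda>y. of_real ((y / x) powr \<alpha>) * (p y * f y))"

lemma weight_le_1: "0 \<le> y \<Longrightarrow> y \<le> x \<Longrightarrow> (y / x) powr \<alpha> \<le> 1"
  using \<alpha> by (intro powr_le1) (auto simp: divide_le_eq_1)

lemma volterra_integrable:
  fixes p f :: "real \<Rightarrow> complex"
  assumes "p absolutely_integrable_on {c..d}" "continuous_on {c..d} f" "x \<in> {c..d}"
  shows "(\<lambda>y. of_real ((y / x) powr \<alpha>) * (p y * f y)) absolutely_integrable_on {c..x}"
proof -
  have sub: "{c..x} \<subseteq> {c..d}" using assms by auto
  have pf: "(\<lambda>y. p y * f y) absolutely_integrable_on {c..x}"
    using absolutely_integrable_on_subinterval[OF absolutely_integrable_mult_continuous[OF assms(1,2)] sub] .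
  show ?thesis
  proof (cases "x = c")
    case True
    have "negligible {c..x}" using True by simp
    then show ?thesis using absolutely_integrable_negligible by blast
  next
    case False
    then have x: "x > 0" using assms c0 by auto
    have "continuous_on {c..x} (\<lambda>y. complex_of_real ((y / x) powr \<alpha>))"
      using x c0 c\<alpha> \<alpha> by (intro continuous_intros continuous_on_powr') auto
    then show ?thesis by (intro absolutely_integrable_continuous_mult pf)
  qed
qed

lemma volterra_bound:
  assumes p: "p absolutely_integrable_on {c..d}" and f: "continuous_on {c..d} f" and x: "x \<in> {c..d}"
    and k: "k absolutely_integrable_on {c..d}" "\<And>y. y \<in> {c..x} \<Longrightarrow> norm (p y) * norm (f y) \<le> k y"
  shows "norm (volterra p f x) \<le> integral {c..x} k"
  unfolding volterra_def
proof (rule Henstock_Kurzweil_Integration.integral_norm_bound_integral)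
  show "(\<lambda>y. of_real ((y / x) powr \<alpha>) * (p y * f y)) integrable_on {c..x}"
    using volterra_integrable[OF p f x] set_lebesgue_integral_eq_integral(1) by blast
  show "k integrable_on {c..x}"
    using k(1) x by (intro set_lebesgue_integral_eq_integral(1) absolutely_integrable_on_subinterval[OF k(1)]) auto
  fix y assume y: "y \<in> {c..x}"
  have "norm (of_real ((y / x) powr \<alpha>) * (p y * f y)) \<le> 1 * (norm (p y) * norm (f y))"
    unfolding norm_mult norm_of_real using y c0 weight_le_1[of y x]
    by (intro mult_right_mono) auto
  also have "\<dots> \<le> k y" using k(2)[OF y] by simp
  finally show "norm (of_real ((y / x) powr \<alpha>) * (p y * f y)) \<le> k y" .
qed

lemma volterra_add:
  assumes "p absolutely_integrable_on {c..d}" "continuous_on {c..d} f" "continuous_on {c..d} g" "x \<in> {c..d}"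
  shows "volterra p (\<lambda>y. f y + g y) x = volterra p f x + volterra p g x"
  unfolding volterra_def
  by (subst Henstock_Kurzweil_Integration.integral_add[symmetric])
     (use volterra_integrable[OF assms(1,2,4)] volterra_integrable[OF assms(1,3,4)] set_lebesgue_integral_eq_integral(1)
      in \<open>auto simp: algebra_simps\<close>)

lemma volterra_cmult: "volterra p (\<lambda>y. a * f y) x = a * volterra p f x"
  unfolding volterra_def by (subst Henstock_Kurzweil_Integration.integral_mult_right[symmetric]) (simp add: algebra_simps)

lemma volterra_minus: "volterra p (\<lambda>y. - f y) x = - volterra p f x"
  using volterra_cmult[of p "-1" f x] by simp

lemma volterra_diff:
  assumes "p absolutely_integrable_on {c..d}" "continuous_on {c..d} f" "continuous_on {c..d} g" "x \<in> {c..d}"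
  shows "volterra p (\<lambda>y. f y - g y) x = volterra p f x - volterra p g x"
  using volterra_add[OF assms(1,2) continuous_on_minus[OF assms(3)] assms(4)] volterra_cmult[of p "-1" g x] by simp

lemma volterra_continuous:
  assumes p: "p absolutely_integrable_on {c..d}" and f: "continuous_on {c..d} f"
  shows "continuous_on {c..d} (volterra p f)"
  unfolding continuous_on_eq_continuous_within
proof
  fix x0 assume x0: "x0 \<in> {c..d}"
  have pf: "(\<lambda>y. p y * f y) absolutely_integrable_on {c..d}"
    by (rule absolutely_integrable_mult_continuous[OF p f])
  show "continuous (at x0 within {c..d}) (volterra p f)"
  proof (cases "x0 > 0")
    case True
    define g where "g x = of_real (x powr (- \<alpha>)) * integral {c..x} (\<lambda>y. of_real (y powr \<alpha>) * (p y * f y))" for x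
    have cw: "continuous_on {c..d} (\<lambda>y. complex_of_real (y powr \<alpha>))"
      using c0 c\<alpha> \<alpha> by (intro continuous_intros continuous_on_powr') auto
    have "continuous_on {c..d} (\<lambda>x. integral {c..x} (\<lambda>y. of_real (y powr \<alpha>) * (p y * f y)))"
      by (intro indefinite_integral_continuous_1 set_lebesgue_integral_eq_integral(1)
          absolutely_integrable_continuous_mult pf cw)
    then have "continuous (at x0 within {c..d}) g"
      unfolding g_def using x0 True by (intro continuous_intros) (auto simp: continuous_on_eq_continuous_within)
    moreover have "eventually (\<lambda>x. g x = volterra p f x) (at x0 within {c..d})"
      unfolding eventually_at
    proof (intro exI conjI ballI impI)
      fix x assume x: "x \<in> {c..d}" "x \<noteq> x0 \<and> dist x x0 < x0"
      then have "x > 0" by (auto simp: dist_real_def)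
      then show "g x = volterra p f x" unfolding g_def volterra_def
        using c0 by (subst Henstock_Kurzweil_Integration.integral_mult_right[symmetric])
          (auto intro!: Henstock_Kurzweil_Integration.integral_cong simp: powr_divide powr_minus_divide)
    qed (use True in auto)
    moreover have "g x0 = volterra p f x0" unfolding g_def volterra_def
        using c0 True by (subst Henstock_Kurzweil_Integration.integral_mult_right[symmetric])
          (auto intro!: Henstock_Kurzweil_Integration.integral_cong simp: powr_divide powr_minus_divide)
    ultimately show ?thesis
      unfolding continuous_within using Lim_transform_eventually by fastforce
  next
    case False
    then have zero: "x0 = 0" "c = 0" using x0 c0 by auto
    have n: "(\<lambda>y. norm (p y * f y)) absolutely_integrable_on {c..d}" by (rule norm_absolutely_integrable[OF pf])
    have "continuous_on {c..d} (\<lambda>x. integral {c..x} (\<lambda>y. norm (p y * f y)))"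
      by (intro indefinite_integral_continuous_1 set_lebesgue_integral_eq_integral(1) n)
    then have lim: "((\<lambda>x. integral {c..x} (\<lambda>y. norm (p y * f y))) \<longlongrightarrow> 0) (at 0 within {c..d})"
      using x0 zero unfolding continuous_on_def by force
    have "(volterra p f \<longlongrightarrow> 0) (at 0 within {c..d})"
    proof (rule Lim_null_comparison[OF _ lim])
      show "\<forall>\<^sub>F x in at 0 within {c..d}. norm (volterra p f x) \<le> integral {c..x} (\<lambda>y. norm (p y * f y))"
        unfolding eventually_at by (rule exI[of _ 1]) (use volterra_bound[OF p f _ n] in \<open>simp add: norm_mult\<close>)
    qed
    moreover have "volterra p f x0 = 0" unfolding volterra_def by (simp add: zero)
    ultimately show ?thesis unfolding continuous_within by (simp only: zero(1))
  qed
qed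

text \<open>
  Families in \<open>z\<close> that are polynomial in \<open>z\<close> with continuous coefficients. The Picard iterates are
  of this kind, which makes their holomorphy in \<open>z\<close> a triviality.
\<close>
inductive polyfam :: "(complex \<Rightarrow> real \<Rightarrow> complex) \<Rightarrow> bool" where
  const: "continuous_on {c..d} a \<Longrightarrow> polyfam (\<lambda>z. a)"
| add: "polyfam f \<Longrightarrow> polyfam g \<Longrightarrow> polyfam (\<lambda>z x. f z x + g z x)"
| mult: "polyfam f \<Longrightarrow> polyfam (\<lambda>z x. z * f z x)"
| agree: "polyfam f \<Longrightarrow> (\<And>z x. x \<in> {c..d} \<Longrightarrow> f z x = g z x) \<Longrightarrow> polyfam g"

lemma polyfam_continuous: "polyfam f \<Longrightarrow> continuous_on {c..d} (f z)"
proof (induction rule: polyfam.induct)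
  case (agree f g)
  then show ?case by (metis (mono_tags, lifting) continuous_on_cong)
qed (auto intro!: continuous_intros)

lemma polyfam_holomorphic: "polyfam f \<Longrightarrow> x \<in> {c..d} \<Longrightarrow> (\<lambda>z. f z x) holomorphic_on S"
proof (induction rule: polyfam.induct)
  case (agree f g)
  then show ?case by simp
qed (auto intro!: holomorphic_intros)

lemma polyfam_volterra:
  assumes p: "p absolutely_integrable_on {c..d}"
  shows "polyfam f \<Longrightarrow> polyfam (\<lambda>z. volterra p (f z))"
proof (induction rule: polyfam.induct)
  case (const a)
  then show ?case by (intro polyfam.const volterra_continuous p)
next
  case (add f g)
  show ?case
    by (rule polyfam.agree[OF polyfam.add[OF add.IH]])
       (auto simp: volterra_add[OF p] polyfam_continuous add.hyps)
next
  case (mult f)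
  show ?case by (rule polyfam.agree[OF polyfam.mult[OF mult.IH]]) (simp add: volterra_cmult)
next
  case (agree f g)
  show ?case
  proof (rule polyfam.agree[OF agree.IH])
    fix z x assume "x \<in> {c..d}"
    then show "volterra p (f z) x = volterra p (g z) x" unfolding volterra_def
      using agree.hyps by (intro Henstock_Kurzweil_Integration.integral_cong) auto
  qed
qed

lemma polyfam_integral: "polyfam f \<Longrightarrow> polyfam (\<lambda>z x. integral {c..x} (f z))"
proof (induction rule: polyfam.induct)
  case (const a)
  then show ?case by (intro polyfam.const indefinite_integral_continuous_1 integrable_continuous_real)
next
  case (add f g)
  have i: "f z integrable_on {c..x}" "g z integrable_on {c..x}" if "x \<in> {c..d}" for x z
    using that add.hyps by (auto intro!: integrable_continuous_real continuous_on_subset[OF polyfam_continuous])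
  show ?case
    by (rule polyfam.agree[OF polyfam.add[OF add.IH]]) (simp add: Henstock_Kurzweil_Integration.integral_add i)
next
  case (mult f)
  show ?case by (rule polyfam.agree[OF polyfam.mult[OF mult.IH]]) simp
next
  case (agree f g)
  show ?case
  proof (rule polyfam.agree[OF agree.IH])
    fix z x assume "x \<in> {c..d}"
    then show "integral {c..x} (f z) = integral {c..x} (g z)"
      using agree.hyps by (intro Henstock_Kurzweil_Integration.integral_cong) auto
  qed
qed

lemma one_integrable: "(\<lambda>x. 1 :: complex) absolutely_integrable_on {c..d}"
  by (intro absolutely_integrable_continuous_real continuous_intros)

lemma shifted_integrable: "(\<lambda>y. v y - z) absolutely_integrable_on {c..d}"
  by (intro set_integral_diff v absolutely_integrable_continuous_real continuous_intros)

lemma volterra_shifted: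
  assumes "continuous_on {c..d} f" "x \<in> {c..d}"
  shows "volterra (\<lambda>y. v y - z) f x = volterra v f x - z * volterra (\<lambda>_. 1) f x"
proof -
  have "volterra v f x - z * volterra (\<lambda>_. 1) f x = integral {c..x} (\<lambda>y. of_real ((y / x) powr \<alpha>) * (v y * f y))
         - integral {c..x} (\<lambda>y. z * (of_real ((y / x) powr \<alpha>) * (1 * f y)))"
    unfolding volterra_def by simp
  also have "\<dots> = integral {c..x} (\<lambda>y. of_real ((y / x) powr \<alpha>) * (v y * f y)
         - z * (of_real ((y / x) powr \<alpha>) * (1 * f y)))"
    using volterra_integrable[OF v assms] volterra_integrable[OF one_integrable assms] set_lebesgue_integral_eq_integral(1)
    by (intro Henstock_Kurzweil_Integration.integral_diff[symmetric] integrable_on_mult_right) blast+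
  also have "\<dots> = volterra (\<lambda>y. v y - z) f x"
    unfolding volterra_def by (intro Henstock_Kurzweil_Integration.integral_cong) (simp add: algebra_simps)
  finally show ?thesis by simp
qed

context
  fixes A B :: complex
begin

definition deriv_step :: "complex \<Rightarrow> (real \<Rightarrow> complex) \<Rightarrow> real \<Rightarrow> complex" where
  "deriv_step z f x = B + volterra (\<lambda>y. v y - z) f x"

definition step :: "complex \<Rightarrow> (real \<Rightarrow> complex) \<Rightarrow> real \<Rightarrow> complex" where
  "step z f x = A + integral {c..x} (deriv_step z f)"

primrec iterate :: "nat \<Rightarrow> complex \<Rightarrow> real \<Rightarrow> complex" where
  "iterate 0 z = (\<lambda>x. 0)"
| "iterate (Suc n) z = step z (iterate n z)"

lemma polyfam_deriv_step: "polyfam f \<Longrightarrow> polyfam (\<lambda>z. deriv_step z (f z))"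
proof -
  assume f: "polyfam f"
  have "polyfam (\<lambda>z x. (\<lambda>_. B) x + (volterra v (f z) x + (\<lambda>z x. z * (\<lambda>z x. volterra (\<lambda>_. 1) (\<lambda>x. (-1) * f z x) x) z x) z x))"
  proof (intro polyfam.intros(2) polyfam.mult)
    show "polyfam (\<lambda>z x. B)" by (intro polyfam.const continuous_intros)
    show "polyfam (\<lambda>z. volterra v (f z))" by (intro polyfam_volterra v f)
    have "polyfam (\<lambda>z x. (-1) * volterra (\<lambda>_. 1) (f z) x)"
    proof -
      have "polyfam (\<lambda>z. volterra (\<lambda>_. -1) (f z))"
        by (intro polyfam_volterra f absolutely_integrable_continuous_real continuous_intros)
      then show ?thesis
        by (rule polyfam.agree) (simp add: volterra_def)
    qed
    then show "polyfam (\<lambda>z. volterra (\<lambda>_. 1) (\<lambda>x. (-1) * f z x))" by (rule polyfam.agree) (simp add: volterra_minus)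
  qed
  then show ?thesis
    by (rule polyfam.agree) (simp add: deriv_step_def volterra_shifted polyfam_continuous f volterra_minus)
qed

lemma polyfam_iterate: "polyfam (iterate n)"
proof (induction n)
  case 0
  have "polyfam (\<lambda>z x. 0)" by (intro polyfam.const continuous_intros)
  then show ?case by (rule polyfam.agree) simp
next
  case (Suc n)
  have "polyfam (\<lambda>z x. A + integral {c..x} (deriv_step z (iterate n z)))"
    by (intro polyfam.add polyfam.const polyfam_integral polyfam_deriv_step Suc continuous_intros)
  then show ?case by (rule polyfam.agree) (simp add: step_def)
qed

lemma deriv_step_diff_bound:
  assumes "continuous_on {c..d} f" "continuous_on {c..d} g" "x \<in> {c..d}" "norm z \<le> L"
    and k: "k absolutely_integrable_on {c..d}"
    and le: "\<And>y. y \<in> {c..x} \<Longrightarrow> (norm (v y) + L) * norm (f y - g y) \<le> k y"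
  shows "norm (deriv_step z f x - deriv_step z g x) \<le> integral {c..x} k"
proof -
  have "deriv_step z f x - deriv_step z g x = volterra (\<lambda>y. v y - z) (\<lambda>y. f y - g y) x"
    unfolding deriv_step_def using assms volterra_diff[OF shifted_integrable] by simp
  also have "norm \<dots> \<le> integral {c..x} k"
  proof (rule volterra_bound[OF shifted_integrable _ \<open>x \<in> {c..d}\<close> k])
    show "continuous_on {c..d} (\<lambda>y. f y - g y)" by (intro continuous_intros assms)
    fix y assume y: "y \<in> {c..x}"
    have "norm (v y - z) \<le> norm (v y) + L" using assms norm_triangle_ineq4[of "v y" z] by linarith
    then have "norm (v y - z) * norm (f y - g y) \<le> (norm (v y) + L) * norm (f y - g y)"
      by (intro mult_right_mono) auto
    then show "norm (v y - z) * norm (f y - g y) \<le> k y" using le[OF y] by simp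
  qed
  finally show ?thesis .
qed

lemma k_integrable: "(\<lambda>y. norm (v y) + L) absolutely_integrable_on {c..d}"
  by (intro set_integral_add norm_absolutely_integrable v absolutely_integrable_continuous_real continuous_intros)

text \<open>
  In the norm weighted by \<open>exp (-2 \<kappa>)\<close> each Picard step is a contraction with factor \<open>1/2\<close>, uniformly in \<open>\<bar>z\<bar> \<le> L\<close>.
\<close>
lemma iterate_diff_bound:
  assumes "norm z \<le> L" "x \<in> {c..d}"
  shows "norm (iterate (Suc n) z x - iterate n z x)
           \<le> (norm A + norm B) * (1/2) ^ n * exp (2 * integral {c..x} (\<lambda>y. norm (v y) + L))"
  using assms(2)
proof (induction n arbitrary: x)
  case 0
  let ?\<kappa> = "integral {c..x} (\<lambda>y. norm (v y) + L)"
  have L: "L \<ge> 0" using assms norm_ge_zero order_trans by blast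
  have "iterate (Suc 0) z x = A + integral {c..x} (\<lambda>_. B)"
    by (simp add: step_def deriv_step_def[abs_def] volterra_def)
  also have "integral {c..x} (\<lambda>_. B) = (x - c) *\<^sub>R B" using 0 by simp
  finally have "norm (iterate (Suc 0) z x - iterate 0 z x) = norm (A + (x - c) *\<^sub>R B)" by simp
  also have "\<dots> \<le> norm A + norm ((x - c) *\<^sub>R B)" by (rule norm_triangle_ineq)
  also have "norm ((x - c) *\<^sub>R B) \<le> 1 * norm B"
    unfolding norm_scaleR using 0 dc by (intro mult_right_mono) auto
  finally have "norm (iterate (Suc 0) z x - iterate 0 z x) \<le> (norm A + norm B) * 1" by simp
  also have "\<dots> \<le> (norm A + norm B) * exp (2 * ?\<kappa>)"
  proof (intro mult_left_mono)
    have "?\<kappa> \<ge> 0" using L 0 by (intro Henstock_Kurzweil_Integration.integral_nonneg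
        set_lebesgue_integral_eq_integral(1) absolutely_integrable_on_subinterval[OF k_integrable]) auto
    then show "1 \<le> exp (2 * ?\<kappa>)" by simp
  qed auto
  finally show ?case by simp
next
  case (Suc n)
  have L: "L \<ge> 0" using assms norm_ge_zero order_trans by blast
  let ?k = "\<lambda>y. norm (v y) + L"
  let ?M = "(norm A + norm B) * (1/2) ^ n"
  define \<kappa> where "\<kappa> t = integral {c..t} ?k" for t
  have cont: "continuous_on {c..d} (iterate n z)" for n by (rule polyfam_continuous[OF polyfam_iterate])
  have \<kappa>mono: "\<kappa> s \<le> \<kappa> t" if "c \<le> s" "s \<le> t" "t \<le> d" for s t
  proof -
    have ki: "?k integrable_on {c..d}" using k_integrable set_lebesgue_integral_eq_integral(1) by blast
    have "\<kappa> t - \<kappa> s = integral {s..t} ?k" unfolding \<kappa>_def using integral_diff_Icc[OF ki that] .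
    also have "\<dots> \<ge> 0" using that L by (intro Henstock_Kurzweil_Integration.integral_nonneg
        integrable_subinterval_real[OF ki]) auto
    finally show ?thesis by simp
  qed
  have D: "norm (deriv_step z (iterate (Suc n) z) t - deriv_step z (iterate n z) t)
        \<le> ?M * (1/2) * exp (2 * \<kappa> x)" if t: "t \<in> {c..x}" for t
  proof -
    have td: "t \<in> {c..d}" using t Suc.prems by auto
    have kt: "?k absolutely_integrable_on {c..t}"
      by (rule absolutely_integrable_on_subinterval[OF k_integrable]) (use td in auto)
    have kd: "(\<lambda>y. ?k y * exp (2 * \<kappa> y)) absolutely_integrable_on {c..d}"
      using integral_exp_weight(2)[OF cd k_integrable] L by (simp add: \<kappa>_def)
    have "norm (deriv_step z (iterate (Suc n) z) t - deriv_step z (iterate n z) t)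
        \<le> integral {c..t} (\<lambda>y. ?M * (?k y * exp (2 * \<kappa> y)))"
    proof (rule deriv_step_diff_bound[OF cont cont td assms(1)])
      show "(\<lambda>y. ?M * (?k y * exp (2 * \<kappa> y))) absolutely_integrable_on {c..d}"
        using kd by (rule set_integrable_mult_right)
      fix y assume "y \<in> {c..t}"
      then have "norm (iterate (Suc n) z y - iterate n z y) \<le> ?M * exp (2 * \<kappa> y)"
        using Suc.IH[of y] td by (auto simp: \<kappa>_def)
      then show "?k y * norm (iterate (Suc n) z y - iterate n z y) \<le> ?M * (?k y * exp (2 * \<kappa> y))"
        using mult_left_mono[of _ _ "?k y"] L by (fastforce simp: algebra_simps)
    qed
    also have "\<dots> = ?M * integral {c..t} (\<lambda>y. ?k y * exp (2 * \<kappa> y))" by simp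
    also have "\<dots> \<le> ?M * (exp (2 * \<kappa> t) / 2)"
      using integral_exp_weight(1)[OF _ kt] td L by (intro mult_left_mono) (auto simp: \<kappa>_def)
    also have "\<dots> \<le> ?M * (exp (2 * \<kappa> x) / 2)"
      using \<kappa>mono[of t x] t Suc.prems by (intro mult_left_mono divide_right_mono) auto
    finally show ?thesis by simp
  qed
  have ci: "deriv_step z (iterate n z) integrable_on {c..x}" for n
    using Suc.prems by (intro integrable_continuous_real continuous_on_subset[OF polyfam_continuous[OF
          polyfam_deriv_step[OF polyfam_iterate]]]) auto
  have "iterate (Suc (Suc n)) z x - iterate (Suc n) z x
     = integral {c..x} (\<lambda>t. deriv_step z (iterate (Suc n) z) t - deriv_step z (iterate n z) t)"
    using ci[of n] ci[of "Suc n"] by (simp add: step_def[of _ "step _ _"] step_def[of _ "iterate _ _"]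
        Henstock_Kurzweil_Integration.integral_diff)
  also have "norm \<dots> \<le> (?M * (1/2) * exp (2 * \<kappa> x)) * (x - c)"
  proof -
    have "norm (integral {c..x} (\<lambda>t. deriv_step z (iterate (Suc n) z) t - deriv_step z (iterate n z) t))
       \<le> integral {c..x} (\<lambda>_. ?M * (1/2) * exp (2 * \<kappa> x))"
      by (intro Henstock_Kurzweil_Integration.integral_norm_bound_integral integrable_diff ci D) auto
    also have "\<dots> = (?M * (1/2) * exp (2 * \<kappa> x)) * (x - c)" using Suc.prems by simp
    finally show ?thesis .
  qed
  also have "\<dots> \<le> (?M * (1/2) * exp (2 * \<kappa> x)) * 1"
    using Suc.prems dc by (intro mult_left_mono) auto
  finally show ?case by (simp add: \<kappa>_def)
qed

text \<open>
  The iterates converge uniformly on compact sets of \<open>z\<close>, so the limit is entire in \<open>z\<close> along with them.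
\<close>
lemma solution_exists:
  obtains u w where
    "\<And>z. continuous_on {c..d} (u z)" "\<And>z. continuous_on {c..d} (w z)"
    "\<And>z x. x \<in> {c..d} \<Longrightarrow> u z x = A + integral {c..x} (w z)"
    "\<And>z x. x \<in> {c..d} \<Longrightarrow> w z x = B + volterra (\<lambda>y. v y - z) (u z) x"
    "\<And>x. x \<in> {c..d} \<Longrightarrow> (\<lambda>z. u z x) holomorphic_on UNIV"
    "\<And>x. x \<in> {c..d} \<Longrightarrow> (\<lambda>z. w z x) holomorphic_on UNIV"
proof -
  define u where "u z x = (\<Sum>n. iterate (Suc n) z x - iterate n z x)" for z x
  define w where "w z = deriv_step z (u z)" for z
  have unif: "uniform_limit (cball 0 L \<times> {c..d}) (\<lambda>n p. iterate n (fst p) (snd p)) (\<lambda>p. u (fst p) (snd p)) sequentially"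
    if "L \<ge> 0" for L
  proof -
    define K where "K = integral {c..d} (\<lambda>y. norm (v y) + L)"
    have "uniform_limit (cball 0 L \<times> {c..d})
       (\<lambda>n p. \<Sum>i<n. iterate (Suc i) (fst p) (snd p) - iterate i (fst p) (snd p))
       (\<lambda>p. suminf (\<lambda>i. iterate (Suc i) (fst p) (snd p) - iterate i (fst p) (snd p))) sequentially"
    proof (rule Weierstrass_m_test)
      show "summable (\<lambda>n. (norm A + norm B) * (1/2) ^ n * exp (2 * K))"
        by (intro summable_mult2 summable_mult summable_geometric) auto
      fix n and p :: "complex \<times> real" assume p: "p \<in> cball 0 L \<times> {c..d}"
      then have x: "snd p \<in> {c..d}" and z: "norm (fst p) \<le> L" by auto
      have "integral {c..snd p} (\<lambda>y. norm (v y) + L) \<le> K"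
      proof -
        have ki: "(\<lambda>y. norm (v y) + L) integrable_on {c..d}"
          using k_integrable set_lebesgue_integral_eq_integral(1) by blast
        have "K - integral {c..snd p} (\<lambda>y. norm (v y) + L) = integral {snd p..d} (\<lambda>y. norm (v y) + L)"
          unfolding K_def using x integral_diff_Icc[OF ki, of "snd p" d] by auto
        also have "\<dots> \<ge> 0" using x that by (intro Henstock_Kurzweil_Integration.integral_nonneg
            integrable_subinterval_real[OF ki]) auto
        finally show ?thesis by simp
      qed
      then have "(norm A + norm B) * (1/2) ^ n * exp (2 * integral {c..snd p} (\<lambda>y. norm (v y) + L))
              \<le> (norm A + norm B) * (1/2) ^ n * exp (2 * K)" by (intro mult_left_mono) auto
      then show "norm (iterate (Suc n) (fst p) (snd p) - iterate n (fst p) (snd p))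
            \<le> (norm A + norm B) * (1/2) ^ n * exp (2 * K)"
        using iterate_diff_bound[OF z x, of n] by linarith
    qed
    then show ?thesis
      unfolding u_def using sum_lessThan_telescope[of "\<lambda>i. iterate i z x" n for z x n]
      by (simp only: iterate.simps(1) diff_zero)
  qed
  have conv: "\<forall>\<^sub>F n in sequentially. \<forall>z x. norm z \<le> L \<longrightarrow> x \<in> {c..d} \<longrightarrow> norm (iterate n z x - u z x) < e"
    if "L \<ge> 0" "e > 0" for L e
    using uniform_limitD[OF unif[OF that(1)] that(2)]
    by (auto simp: dist_norm elim!: eventually_mono)
  have itc: "continuous_on {c..d} (iterate n z)" for n z by (rule polyfam_continuous[OF polyfam_iterate])
  have ulim: "uniform_limit {c..d} (\<lambda>n. iterate n z) (u z) sequentially" for z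
    unfolding uniform_limit_iff dist_norm
    by (intro allI impI eventually_mono[OF conv[of "norm z"]]) auto
  have uc: "continuous_on {c..d} (u z)" for z
    by (rule uniform_limit_theorem[OF _ ulim]) (simp_all only: itc eventually_True trivial_limit_sequentially simp_thms)
  have wc: "continuous_on {c..d} (w z)" for z
    unfolding w_def deriv_step_def[abs_def] by (intro continuous_intros volterra_continuous shifted_integrable uc)
  have wconv: "\<forall>\<^sub>F n in sequentially. \<forall>z x. norm z \<le> L \<longrightarrow> x \<in> {c..d} \<longrightarrow>
        norm (deriv_step z (iterate n z) x - w z x) < e" if L: "L \<ge> 0" and e: "e > 0" for L e
  proof -
    define K where "K = integral {c..d} (\<lambda>y. norm (v y) + L)"
    have ki: "(\<lambda>y. norm (v y) + L) integrable_on {c..d}"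
      using k_integrable set_lebesgue_integral_eq_integral(1) by blast
    have "K \<ge> 0" unfolding K_def using L
      by (intro Henstock_Kurzweil_Integration.integral_nonneg ki) auto
    define r where "r = (e / 2) / (K + 1)"
    have "r > 0" using e \<open>K \<ge> 0\<close> by (simp add: r_def)
    moreover have "r * K \<le> r * (K + 1)" using \<open>r > 0\<close> by simp
    moreover have "r * (K + 1) = e / 2" using \<open>K \<ge> 0\<close> unfolding r_def by (intro nonzero_eq_divide_eq[THEN iffD1]) auto
    ultimately have r: "r > 0" "r * K < e" using e by auto
    show ?thesis using conv[OF L r(1)]
    proof eventually_elim
      case (elim n)
      show ?case
      proof (intro allI impI)
        fix z :: complex and x assume z: "norm z \<le> L" and x: "x \<in> {c..d}"
        have "norm (deriv_step z (iterate n z) x - w z x) \<le> integral {c..x} (\<lambda>y. (norm (v y) + L) * r)"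
          unfolding w_def
        proof (rule deriv_step_diff_bound[OF itc uc x z])
          show "(\<lambda>y. (norm (v y) + L) * r) absolutely_integrable_on {c..d}"
            using k_integrable by (rule set_integrable_mult_left)
          fix y assume "y \<in> {c..x}"
          then have "norm (iterate n z y - u z y) \<le> r" using elim z x by (auto intro: less_imp_le)
          then show "(norm (v y) + L) * norm (iterate n z y - u z y) \<le> (norm (v y) + L) * r"
            using L by (intro mult_left_mono) auto
        qed
        also have "\<dots> = integral {c..x} (\<lambda>y. norm (v y) + L) * r" by simp
        also have "\<dots> \<le> K * r"
        proof (rule mult_right_mono)
          have "K - integral {c..x} (\<lambda>y. norm (v y) + L) = integral {x..d} (\<lambda>y. norm (v y) + L)"
            unfolding K_def using x integral_diff_Icc[OF ki, of x d] by auto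
          also have "\<dots> \<ge> 0" using x L by (intro Henstock_Kurzweil_Integration.integral_nonneg
              integrable_subinterval_real[OF ki]) auto
          finally show "integral {c..x} (\<lambda>y. norm (v y) + L) \<le> K" by simp
        qed (use r in auto)
        finally show "norm (deriv_step z (iterate n z) x - w z x) < e" using r by (simp add: mult.commute)
      qed
    qed
  qed
  have wlim: "uniform_limit {c..d} (\<lambda>n. deriv_step z (iterate n z)) (w z) sequentially" for z
    unfolding uniform_limit_iff dist_norm
    by (intro allI impI eventually_mono[OF wconv[of "norm z"]]) auto
  have dc: "continuous_on {c..d} (deriv_step z (iterate n z))" for z n
    by (rule polyfam_continuous[OF polyfam_deriv_step[OF polyfam_iterate]])
  have ueq: "u z x = A + integral {c..x} (w z)" if x: "x \<in> {c..d}" for z x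
  proof (rule LIMSEQ_unique)
    show "(\<lambda>n. iterate (Suc n) z x) \<longlonglongrightarrow> u z x"
      using tendsto_uniform_limitI[OF ulim x] by (rule LIMSEQ_Suc)
    have sub: "{c..x} \<subseteq> {c..d}" using x by auto
    have "(\<lambda>n. integral {c..x} (deriv_step z (iterate n z))) \<longlonglongrightarrow> integral {c..x} (w z)"
    proof -
      have "continuous_on {c..x} (deriv_step z (iterate n z))" for n
        by (rule continuous_on_subset[OF dc sub])
      then obtain I J where I: "\<And>n. (deriv_step z (iterate n z) has_integral I n) {c..x}"
          and J: "(w z has_integral J) {c..x}" and IJ: "I \<longlonglongrightarrow> J"
        using uniform_limit_integral[OF uniform_limit_on_subset[OF wlim sub], of z] by (metis trivial_limit_sequentially)
      then show ?thesis using integral_unique[OF I] integral_unique[OF J] by simp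
    qed
    then show "(\<lambda>n. iterate (Suc n) z x) \<longlonglongrightarrow> A + integral {c..x} (w z)"
      by (simp add: step_def tendsto_intros)
  qed
  have weq: "w z x = B + volterra (\<lambda>y. v y - z) (u z) x" for z x
    by (simp add: w_def deriv_step_def)
  have uh: "(\<lambda>z. u z x) holomorphic_on UNIV" if x: "x \<in> {c..d}" for x
  proof (rule holomorphic_uniform_sequence[where f = "\<lambda>n z. iterate n z x"])
    show "(\<lambda>z. iterate n z x) holomorphic_on UNIV" for n
      by (rule polyfam_holomorphic[OF polyfam_iterate x])
    fix z0 :: complex
    show "\<exists>e>0. cball z0 e \<subseteq> UNIV \<and> uniform_limit (cball z0 e) (\<lambda>n z. iterate n z x) (\<lambda>z. u z x) sequentially"
    proof (intro exI[of _ 1] conjI)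
      have "norm z \<le> norm z0 + 1" if "z \<in> cball z0 1" for z
        using that norm_triangle_ineq2[of z z0] by (auto simp: dist_norm norm_minus_commute)
      then show "uniform_limit (cball z0 1) (\<lambda>n z. iterate n z x) (\<lambda>z. u z x) sequentially"
        unfolding uniform_limit_iff dist_norm using x
        by (intro allI impI eventually_mono[OF conv[of "norm z0 + 1"]]) auto
    qed auto
  qed auto
  have wh: "(\<lambda>z. w z x) holomorphic_on UNIV" if x: "x \<in> {c..d}" for x
  proof (rule holomorphic_uniform_sequence[where f = "\<lambda>n z. deriv_step z (iterate n z) x"])
    show "(\<lambda>z. deriv_step z (iterate n z) x) holomorphic_on UNIV" for n
      by (rule polyfam_holomorphic[OF polyfam_deriv_step[OF polyfam_iterate] x])
    fix z0 :: complex
    show "\<exists>e>0. cball z0 e \<subseteq> UNIV \<and> uniform_limit (cball z0 e) (\<lambda>n z. deriv_step z (iterate n z) x) (\<lambda>z. w z x) sequentially"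
    proof (intro exI[of _ 1] conjI)
      have "norm z \<le> norm z0 + 1" if "z \<in> cball z0 1" for z
        using that norm_triangle_ineq2[of z z0] by (auto simp: dist_norm norm_minus_commute)
      then show "uniform_limit (cball z0 1) (\<lambda>n z. deriv_step z (iterate n z) x) (\<lambda>z. w z x) sequentially"
        unfolding uniform_limit_iff dist_norm using x
        by (intro allI impI eventually_mono[OF wconv[of "norm z0 + 1"]]) auto
    qed auto
  qed auto
  show thesis by (rule that[OF uc wc ueq weq uh wh])
qed

end

end

section \<open>Solutions on intervals away from the singular end point\<close>

lemma norm_sin_cos_le:
  fixes w :: complex and r :: real
  assumes "0 \<le> r"
  shows "norm (sin (w * r)) \<le> exp (\<bar>Im w\<bar> * r)" "norm (cos (w * r)) \<le> exp (\<bar>Im w\<bar> * r)"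
proof -
  have 1: "norm (exp (\<i> * (w * r))) \<le> exp (\<bar>Im w\<bar> * r)"
    using mult_right_mono[OF abs_ge_minus_self[of "Im w"] assms] by (simp add: norm_exp_eq_Re)
  have 2: "norm (exp (- (\<i> * (w * r)))) \<le> exp (\<bar>Im w\<bar> * r)"
    using mult_right_mono[OF abs_ge_self[of "Im w"] assms] by (simp add: norm_exp_eq_Re)
  have "norm (exp (\<i> * (w * r)) - exp (- (\<i> * (w * r)))) \<le> 2 * exp (\<bar>Im w\<bar> * r)"
    using norm_triangle_ineq4[of "exp (\<i> * (w * r))" "exp (- (\<i> * (w * r)))"] 1 2 by linarith
  then show "norm (sin (w * r)) \<le> exp (\<bar>Im w\<bar> * r)"
    unfolding sin_exp_eq by (simp add: norm_divide norm_mult)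
  have "norm (exp (\<i> * (w * r)) + exp (- (\<i> * (w * r)))) \<le> 2 * exp (\<bar>Im w\<bar> * r)"
    using norm_triangle_ineq[of "exp (\<i> * (w * r))" "exp (- (\<i> * (w * r)))"] 1 2 by linarith
  then show "norm (cos (w * r)) \<le> exp (\<bar>Im w\<bar> * r)"
    unfolding cos_exp_eq by (simp add: norm_divide)
qed

lemma solvesI_smooth:
  assumes "c \<le> d" "continuous_on {c..d} V" "continuous_on {c..d} f" "continuous_on {c..d} f'"
    and f: "\<And>x. x \<in> {c..d} \<Longrightarrow> (f has_vector_derivative f' x) (at x within {c..d})"
    and f': "\<And>x. x \<in> {c..d} \<Longrightarrow> (f' has_vector_derivative V x * f x) (at x within {c..d})"
  shows "solves V c d f f'"
proof -
  have "f x = f c + integral {c..x} f'" if x: "x \<in> {c..d}" for x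
  proof -
    have "(f' has_integral (f x - f c)) {c..x}"
      using x by (intro fundamental_theorem_of_calculus)
        (auto intro!: has_vector_derivative_within_subset[OF f])
    then show ?thesis by (simp add: integral_unique)
  qed
  moreover have "f' x = f' c + integral {c..x} (\<lambda>t. V t * f t)" if x: "x \<in> {c..d}" for x
  proof -
    have "((\<lambda>t. V t * f t) has_integral (f' x - f' c)) {c..x}"
      using x by (intro fundamental_theorem_of_calculus)
        (auto intro!: has_vector_derivative_within_subset[OF f'])
    then show ?thesis by (simp add: integral_unique)
  qed
  ultimately show ?thesis
    using assms absolutely_integrable_continuous_real unfolding solves_def by blast
qed

text \<open>
  The Wronskian of \<open>f\<close> with \<open>t \<mapsto> sin (w (y - t)) / w\<close>, which solves the equation without \<open>Q\<close>.
\<close>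
lemma variation_of_constants:
  assumes f: "solves (\<lambda>t. Q t - w\<^sup>2) c d f f'" and w: "w \<noteq> 0" and y: "y \<in> {c..d}"
  shows "f y = f c * cos (w * of_real (y - c)) + f' c * (sin (w * of_real (y - c)) / w)
               + integral {c..y} (\<lambda>t. Q t * (f t * (sin (w * of_real (y - t)) / w)))"
proof -
  define g where "g t = sin (w * of_real (y - t)) / w" for t
  define g' where "g' t = - cos (w * of_real (y - t))" for t
  have g: "solves (\<lambda>_. - (w\<^sup>2)) c y g g'"
  proof (rule solvesI_smooth)
    fix x
    show "(g has_vector_derivative g' x) (at x within {c..y})"
      unfolding g_def g'_def using w
      by (auto intro!: derivative_eq_intros has_vector_derivative_real_field simp: field_simps)
    show "(g' has_vector_derivative - (w\<^sup>2) * g x) (at x within {c..y})"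
      unfolding g_def g'_def using w
      by (auto intro!: derivative_eq_intros has_vector_derivative_real_field simp: field_simps power2_eq_square)
  qed (use y w in \<open>auto simp: g_def g'_def intro!: continuous_intros\<close>)
  have "solves (\<lambda>t. Q t - w\<^sup>2) c y f f'" using y by (intro solves_subinterval[OF f]) auto
  from wronskian_increment[OF this g]
  have "(f' y * g y - f y * g' y) - (f' c * g c - f c * g' c) = integral {c..y} (\<lambda>t. Q t * (f t * g t))"
    by simp
  moreover have "g y = 0" "g' y = -1" by (simp_all add: g_def g'_def)
  ultimately show ?thesis by (simp add: g_def g'_def algebra_simps)
qed

text \<open>
  Gronwall's inequality for \<open>f(y) exp (- \<bar>Im w\<bar> (y - c))\<close>, applied to the formula of variation of constants.
\<close>
lemma solution_bound:
  assumes f: "solves (\<lambda>t. Q t - w\<^sup>2) c d f f'" and w: "w \<noteq> 0" and y: "y \<in> {c..d}"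
    and K: "integral {c..d} (\<lambda>t. norm (Q t)) / norm w \<le> K"
  shows "norm (f y) \<le> 2 * (norm (f c) + norm (f' c) / norm w) * exp (2 * K) * exp (\<bar>Im w\<bar> * (y - c))"
proof -
  define r where "r = \<bar>Im w\<bar>"
  have r: "r \<ge> 0" by (simp add: r_def)
  note cd = solvesD(1)[OF f]
  have Q: "Q absolutely_integrable_on {c..d}"
  proof -
    have "(\<lambda>t. (Q t - w\<^sup>2) + w\<^sup>2) absolutely_integrable_on {c..d}"
      by (intro set_integral_add solvesD(2)[OF f] absolutely_integrable_continuous_real continuous_intros)
    then show ?thesis by simp
  qed
  have fc: "continuous_on {c..d} f" by (rule solves_continuous[OF f])
  define k where "k t = norm (Q t) / norm w" for t
  define Y where "Y t = norm (f t) * exp (- r * (t - c))" for t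
  define A where "A = norm (f c) + norm (f' c) / norm w"
  have "k = (\<lambda>t. norm (Q t) * (1 / norm w))" by (auto simp: k_def)
  then have k: "k absolutely_integrable_on {c..d}"
    using norm_absolutely_integrable[OF Q] by (auto intro: set_integrable_mult_left)
  have "Y y \<le> 2 * A * exp (2 * K)"
  proof (rule gronwall_L1[OF cd k, where y = Y and t = y])
    show "continuous_on {c..d} Y" unfolding Y_def[abs_def]  by (intro continuous_intros fc)
    show "integral {c..d} k \<le> K" using K by (simp add: k_def[abs_def])
    fix t assume t: "t \<in> {c..d}"
    have E: "norm (cos (w * of_real (t - s))) \<le> exp (r * (t - s))"
            "norm (sin (w * of_real (t - s)) / w) \<le> exp (r * (t - s)) / norm w" if "s \<le> t" for s
      using norm_sin_cos_le[of "t - s" w] that unfolding norm_divide by (auto intro!: divide_right_mono simp: r_def)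
    have sub: "{c..t} \<subseteq> {c..d}" using t by auto
    have int: "norm (integral {c..t} (\<lambda>s. Q s * (f s * (sin (w * of_real (t - s)) / w))))
        \<le> integral {c..t} (\<lambda>s. exp (r * (t - c)) * (k s * Y s))"
    proof (rule Henstock_Kurzweil_Integration.integral_norm_bound_integral)
      show "(\<lambda>s. Q s * (f s * (sin (w * of_real (t - s)) / w))) integrable_on {c..t}"
        using w by (intro set_lebesgue_integral_eq_integral(1) absolutely_integrable_mult_continuous
            absolutely_integrable_on_subinterval[OF Q sub] continuous_intros continuous_on_subset[OF fc sub]) auto
      show "(\<lambda>s. exp (r * (t - c)) * (k s * Y s)) integrable_on {c..t}"
        unfolding Y_def by (intro integrable_on_mult_right set_lebesgue_integral_eq_integral(1) absolutely_integrable_mult_continuous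
            absolutely_integrable_on_subinterval[OF k sub] continuous_intros continuous_on_subset[OF fc sub])
      fix s assume s: "s \<in> {c..t}"
      have "norm (Q s * (f s * (sin (w * of_real (t - s)) / w))) \<le> norm (Q s) * (norm (f s) * (exp (r * (t - s)) / norm w))"
        unfolding norm_mult using E(2)[of s] s by (intro mult_left_mono) auto
      also have "\<dots> = exp (r * (t - c)) * (k s * Y s)"
        by (simp add: k_def Y_def exp_diff exp_minus algebra_simps field_simps)
      finally show "norm (Q s * (f s * (sin (w * of_real (t - s)) / w))) \<le> exp (r * (t - c)) * (k s * Y s)" .
    qed
    have "norm (f t) \<le> norm (f c * cos (w * of_real (t - c)) + f' c * (sin (w * of_real (t - c)) / w))
            + norm (integral {c..t} (\<lambda>s. Q s * (f s * (sin (w * of_real (t - s)) / w))))"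
      by (subst variation_of_constants[OF f w t]) (rule norm_triangle_ineq)
    also have "\<dots> \<le> norm (f c) * exp (r * (t - c)) + norm (f' c) * (exp (r * (t - c)) / norm w)
            + integral {c..t} (\<lambda>s. exp (r * (t - c)) * (k s * Y s))"
    proof (intro add_mono int norm_triangle_le)
      show "norm (f c * cos (w * of_real (t - c))) \<le> norm (f c) * exp (r * (t - c))"
        unfolding norm_mult using t E(1)[of c] by (intro mult_left_mono) auto
      show "norm (f' c * (sin (w * of_real (t - c)) / w)) \<le> norm (f' c) * (exp (r * (t - c)) / norm w)"
        unfolding norm_mult[of "f' c"] using t E(2)[of c] by (intro mult_left_mono) auto
    qed
    also have "\<dots> = exp (r * (t - c)) * (A + integral {c..t} (\<lambda>s. k s * Y s))"
      unfolding Henstock_Kurzweil_Integration.integral_mult_right A_def by (simp add: algebra_simps)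
    finally have "norm (f t) \<le> exp (r * (t - c)) * (A + integral {c..t} (\<lambda>s. k s * Y s))" .
    then have "Y t \<le> exp (r * (t - c)) * (A + integral {c..t} (\<lambda>s. k s * Y s)) * exp (- r * (t - c))"
      unfolding Y_def by (intro mult_right_mono) auto
    also have "\<dots> = A + integral {c..t} (\<lambda>s. k s * Y s)"
      by (simp add: exp_minus)
    finally show "Y t \<le> A + integral {c..t} (\<lambda>s. k s * Y s)" .
  qed (use y in \<open>auto simp: k_def Y_def A_def\<close>)
  then have "Y y * exp (r * (y - c)) \<le> 2 * A * exp (2 * K) * exp (r * (y - c))"
    by (intro mult_right_mono) auto
  moreover have "Y y * exp (r * (y - c)) = norm (f y)" by (simp add: Y_def exp_minus)
  ultimately show ?thesis by (simp only: A_def r_def)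
qed

text \<open>Gronwall's inequality for \<open>\<bar>f\<bar> + \<bar>f'\<bar>\<close>.\<close>
lemma solves_zero_data:
  assumes f: "solves V c d f f'" and "f c = 0" "f' c = 0" and x: "x \<in> {c..d}"
  shows "f x = 0" "f' x = 0"
proof -
  note cd = solvesD(1)[OF f]
  have fc: "continuous_on {c..d} f" by (rule solves_continuous[OF f])
  have k: "(\<lambda>t. norm (V t) + 1) absolutely_integrable_on {c..d}"
    by (intro set_integral_add norm_absolutely_integrable solvesD(2)[OF f]
        absolutely_integrable_continuous_real continuous_intros)
  have "norm (f x) + norm (f' x) \<le> 2 * 0 * exp (2 * integral {c..d} (\<lambda>t. norm (V t) + 1))"
  proof (rule gronwall_L1[OF cd k, where y = "\<lambda>x. norm (f x) + norm (f' x)" and t = x])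
    show yc: "continuous_on {c..d} (\<lambda>x. norm (f x) + norm (f' x))"
      by (intro continuous_intros fc solvesD(3)[OF f])
    fix t assume t: "t \<in> {c..d}"
    have sub: "{c..t} \<subseteq> {c..d}" using t by auto
    have i1: "f' integrable_on {c..t}" and i1': "(\<lambda>s. norm (f' s)) integrable_on {c..t}"
      by (intro integrable_continuous_real continuous_intros continuous_on_subset[OF solvesD(3)[OF f] sub])+
    have i2: "(\<lambda>s. V s * f s) absolutely_integrable_on {c..t}"
      by (rule absolutely_integrable_on_subinterval[OF solves_integrable[OF f] sub])
    note i2' = norm_absolutely_integrable[OF i2]
    have "norm (f t) = norm (integral {c..t} f')" using solvesD(4)[OF f t] assms by simp
    also have "\<dots> \<le> integral {c..t} (\<lambda>s. norm (f' s))"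
      by (intro Henstock_Kurzweil_Integration.integral_norm_bound_integral i1 i1') auto
    finally have 1: "norm (f t) \<le> integral {c..t} (\<lambda>s. norm (f' s))" .
    have "norm (f' t) = norm (integral {c..t} (\<lambda>s. V s * f s))" using solvesD(5)[OF f t] assms by simp
    also have "\<dots> \<le> integral {c..t} (\<lambda>s. norm (V s * f s))"
      by (intro Henstock_Kurzweil_Integration.integral_norm_bound_integral
          set_lebesgue_integral_eq_integral(1)[OF i2] set_lebesgue_integral_eq_integral(1)[OF i2']) auto
    finally have "norm (f t) + norm (f' t) \<le> integral {c..t} (\<lambda>s. norm (f' s) + norm (V s * f s))"
      using 1 i1' set_lebesgue_integral_eq_integral(1)[OF i2']
      by (subst Henstock_Kurzweil_Integration.integral_add) auto
    also have "\<dots> \<le> integral {c..t} (\<lambda>s. (norm (V s) + 1) * (norm (f s) + norm (f' s)))"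
    proof (rule integral_le)
      show "(\<lambda>s. norm (f' s) + norm (V s * f s)) integrable_on {c..t}"
        by (intro integrable_add i1' set_lebesgue_integral_eq_integral(1) i2')
      show "(\<lambda>s. (norm (V s) + 1) * (norm (f s) + norm (f' s))) integrable_on {c..t}"
        by (intro set_lebesgue_integral_eq_integral(1) absolutely_integrable_mult_continuous
            absolutely_integrable_on_subinterval[OF k sub] continuous_on_subset[OF yc sub])
    qed (auto simp: norm_mult algebra_simps)
    finally show "norm (f t) + norm (f' t)
       \<le> 0 + integral {c..t} (\<lambda>s. (norm (V s) + 1) * (norm (f s) + norm (f' s)))" by simp
  qed (use x in auto)
  then have "norm (f x) + norm (f' x) \<le> 0" by simp
  then show "f x = 0" "f' x = 0" by (smt (verit) norm_ge_zero norm_le_zero_iff)+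
qed

lemma solves_diff_scaled:
  assumes f: "solves V c d f f'" and g: "solves V c d g g'"
  shows "solves V c d (\<lambda>x. f x - \<kappa> * g x) (\<lambda>x. f' x - \<kappa> * g' x)"
proof -
  have "f x - \<kappa> * g x = f c - \<kappa> * g c + integral {c..x} (\<lambda>x. f' x - \<kappa> * g' x)" if x: "x \<in> {c..d}" for x
  proof -
    have sub: "{c..x} \<subseteq> {c..d}" using x by auto
    have "integral {c..x} (\<lambda>x. f' x - \<kappa> * g' x) = integral {c..x} f' - \<kappa> * integral {c..x} g'"
      by (subst Henstock_Kurzweil_Integration.integral_diff)
        (auto intro!: integrable_continuous_real continuous_intros continuous_on_subset[OF solvesD(3)[OF f] sub]
            continuous_on_subset[OF solvesD(3)[OF g] sub])
    moreover note solvesD(4)[OF f x] solvesD(4)[OF g x]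
    ultimately show ?thesis by (simp add: algebra_simps)
  qed
  moreover have "f' x - \<kappa> * g' x = f' c - \<kappa> * g' c + integral {c..x} (\<lambda>t. V t * (f t - \<kappa> * g t))" if x: "x \<in> {c..d}" for x
  proof -
    have sub: "{c..x} \<subseteq> {c..d}" using x by auto
    have "integral {c..x} (\<lambda>t. V t * (f t - \<kappa> * g t)) = integral {c..x} (\<lambda>t. V t * f t - \<kappa> * (V t * g t))"
      by (intro Henstock_Kurzweil_Integration.integral_cong) (simp add: algebra_simps)
    also have "\<dots> = integral {c..x} (\<lambda>t. V t * f t) - \<kappa> * integral {c..x} (\<lambda>t. V t * g t)"
      using absolutely_integrable_on_subinterval[OF solves_integrable[OF f] sub]
        absolutely_integrable_on_subinterval[OF solves_integrable[OF g] sub] set_lebesgue_integral_eq_integral(1)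
      by (subst Henstock_Kurzweil_Integration.integral_diff) (auto intro!: integrable_on_mult_right)
    moreover note solvesD(5)[OF f x] solvesD(5)[OF g x]
    ultimately show ?thesis by (simp add: algebra_simps)
  qed
  moreover have "continuous_on {c..d} (\<lambda>x. f' x - \<kappa> * g' x)"
    by (intro continuous_intros solvesD(3)[OF f] solvesD(3)[OF g])
  ultimately show ?thesis by (intro solvesI solvesD(1,2)[OF f])
qed

lemma integral_cnj:
  assumes "f integrable_on S"
  shows "integral S (\<lambda>x. cnj (f x)) = cnj (integral S f)"
  using integral_linear[OF assms bounded_linear_cnj] by (simp add: o_def)

lemma solves_cnj:
  assumes f: "solves V c d f f'"
  shows "solves (\<lambda>x. cnj (V x)) c d (\<lambda>x. cnj (f x)) (\<lambda>x. cnj (f' x))"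
proof -
  have "cnj (f x) = cnj (f c) + integral {c..x} (\<lambda>x. cnj (f' x))" if x: "x \<in> {c..d}" for x
  proof -
    have "f' integrable_on {c..x}" using x
      by (intro integrable_continuous_real continuous_on_subset[OF solvesD(3)[OF f]]) auto
    then show ?thesis using integral_cnj[of f'] solvesD(4)[OF f x] by simp
  qed
  moreover have "cnj (f' x) = cnj (f' c) + integral {c..x} (\<lambda>t. cnj (V t) * cnj (f t))" if x: "x \<in> {c..d}" for x
  proof -
    have "(\<lambda>t. V t * f t) integrable_on {c..x}" using x
      by (intro set_lebesgue_integral_eq_integral(1) absolutely_integrable_on_subinterval[OF solves_integrable[OF f]]) auto
    then show ?thesis using integral_cnj[of "\<lambda>t. V t * f t"] solvesD(5)[OF f x] by simp
  qed
  moreover have "(\<lambda>x. cnj (V x)) absolutely_integrable_on {c..d}"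
    using absolutely_integrable_linear[OF solvesD(2)[OF f] bounded_linear_cnj] by (simp add: o_def)
  moreover have "continuous_on {c..d} (\<lambda>x. cnj (f' x))"
    by (intro continuous_intros solvesD(3)[OF f])
  ultimately show ?thesis by (intro solvesI solvesD(1)[OF f])
qed

lemma initial_value_problem:
  assumes "0 < c" "c \<le> d" "d \<le> c + 1" "v absolutely_integrable_on {c..d}"
  obtains f f' :: "complex \<Rightarrow> real \<Rightarrow> complex" where
    "\<And>z. solves (\<lambda>t. v t - z) c d (f z) (f' z)" "\<And>z. f z c = A" "\<And>z. f' z c = B"
    "\<And>x. x \<in> {c..d} \<Longrightarrow> (\<lambda>z. f z x) holomorphic_on UNIV"
    "\<And>x. x \<in> {c..d} \<Longrightarrow> (\<lambda>z. f' z x) holomorphic_on UNIV"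
proof -
  interpret weighted_volterra 0 c d v
    by unfold_locales (use assms in auto)
  obtain u w where uw:
    "\<And>z. continuous_on {c..d} (u z)" "\<And>z. continuous_on {c..d} (w z)"
    "\<And>z x. x \<in> {c..d} \<Longrightarrow> u z x = A + integral {c..x} (w z)"
    "\<And>z x. x \<in> {c..d} \<Longrightarrow> w z x = B + volterra (\<lambda>y. v y - z) (u z) x"
    "\<And>x. x \<in> {c..d} \<Longrightarrow> (\<lambda>z. u z x) holomorphic_on UNIV"
    "\<And>x. x \<in> {c..d} \<Longrightarrow> (\<lambda>z. w z x) holomorphic_on UNIV"
    using solution_exists[of A B] by metis
  have volterra: "volterra (\<lambda>y. v y - z) (u z) x = integral {c..x} (\<lambda>y. (v y - z) * u z y)" if "x \<in> {c..d}" for z x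
    unfolding volterra_def using that assms
    by (intro Henstock_Kurzweil_Integration.integral_cong) auto
  show thesis
  proof (rule that[OF _ _ _ uw(5,6)])
    show c1: "u z c = A" for z using uw(3)[of c z] assms by simp
    show c2: "w z c = B" for z using uw(4)[of c z] volterra[of c z] assms by simp
    show "solves (\<lambda>t. v t - z) c d (u z) (w z)" for z
      using uw(2) uw(3) uw(4) volterra by (intro solvesI shifted_integrable cd) (simp_all only: c1 c2)
  qed
qed

section \<open>The regular solution\<close>

text \<open>
  The shape near \<open>0\<close> of the regular solutions and of their derivatives. It is just enough to make Wronskians of
  regular solutions vanish at \<open>0\<close>, also for \<open>l < 0\<close>, where the derivatives may be unbounded.
\<close>
definition regular_at_0 :: "real \<Rightarrow> (real \<Rightarrow> complex) \<Rightarrow> (real \<Rightarrow> complex) \<Rightarrow> bool" where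
  "regular_at_0 l f f' \<longleftrightarrow> (\<exists>u w. continuous_on {0..1} u \<and> continuous_on {0..1} w \<and>
     (\<forall>x\<in>{0..1}. f x = of_real (x powr (l + 1)) * u x \<and>
        f' x = of_real ((l + 1) * x powr l) * u x + of_real (x powr (l + 1)) * w x))"

lemma regular_at_0_cnj:
  assumes "regular_at_0 l f f'"
  shows "regular_at_0 l (\<lambda>x. cnj (f x)) (\<lambda>x. cnj (f' x))"
proof -
  obtain u w where uw: "continuous_on {0..1} u" "continuous_on {0..1} w"
     "\<And>x. x \<in> {0..1} \<Longrightarrow> f x = of_real (x powr (l + 1)) * u x"
     "\<And>x. x \<in> {0..1} \<Longrightarrow> f' x = of_real ((l + 1) * x powr l) * u x + of_real (x powr (l + 1)) * w x"
    using assms unfolding regular_at_0_def by blast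
  have "continuous_on {0..1} (\<lambda>x. cnj (u x))" "continuous_on {0..1} (\<lambda>x. cnj (w x))"
    by (intro continuous_intros uw)+
  then show ?thesis
    unfolding regular_at_0_def using uw(3,4)
    by (intro exI[of _ "\<lambda>x. cnj (u x)"] exI[of _ "\<lambda>x. cnj (w x)"]) simp
qed

lemma regular_at_0_continuous:
  assumes "regular_at_0 l f f'" "l \<ge> -1/2"
  shows "continuous_on {0..1} f"
proof -
  obtain u w where uw: "continuous_on {0..1} u"
     "\<And>x. x \<in> {0..1} \<Longrightarrow> f x = of_real (x powr (l + 1)) * u x"
    using assms unfolding regular_at_0_def by blast
  have "continuous_on {0..1} (\<lambda>x. of_real (x powr (l + 1)) * u x)"
    using assms(2) by (intro continuous_intros uw(1) continuous_on_powr') auto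
  then show ?thesis by (rule continuous_on_eq) (simp add: uw(2))
qed

text \<open>
  The singular terms with the factor \<open>(l + 1) x\<^bsup>2l+1\<^esup>\<close> cancel in the Wronskian.
\<close>
lemma regular_wronskian_tendsto_0:
  assumes f: "regular_at_0 l f f'" and g: "regular_at_0 l g g'" and l: "l \<ge> -1/2"
  shows "((\<lambda>x. f' x * g x - f x * g' x) \<longlongrightarrow> 0) (at_right 0)"
proof -
  obtain u w where uw: "continuous_on {0..1} u" "continuous_on {0..1} w"
     "\<And>x. x \<in> {0..1} \<Longrightarrow> f x = of_real (x powr (l + 1)) * u x"
     "\<And>x. x \<in> {0..1} \<Longrightarrow> f' x = of_real ((l + 1) * x powr l) * u x + of_real (x powr (l + 1)) * w x"
    using f unfolding regular_at_0_def by blast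
  obtain v y where vy: "continuous_on {0..1} v" "continuous_on {0..1} y"
     "\<And>x. x \<in> {0..1} \<Longrightarrow> g x = of_real (x powr (l + 1)) * v x"
     "\<And>x. x \<in> {0..1} \<Longrightarrow> g' x = of_real ((l + 1) * x powr l) * v x + of_real (x powr (l + 1)) * y x"
    using g unfolding regular_at_0_def by blast
  define W where "W x = complex_of_real (x powr (l + 1)) * (of_real (x powr (l + 1)) * (w x * v x - u x * y x))" for x
  have "continuous_on {0..1} W"
    unfolding W_def[abs_def] using l by (intro continuous_intros uw vy continuous_on_powr') auto
  then have "(W \<longlongrightarrow> W 0) (at 0 within {0..1})" unfolding continuous_on_def by simp
  then have "(W \<longlongrightarrow> W 0) (at_right 0)"
    by (simp add: at_within_Icc_at_right)
  then have W0: "(W \<longlongrightarrow> 0) (at_right 0)" by (simp add: W_def)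
  have W1: "\<forall>\<^sub>F x in at_right 0. W x = f' x * g x - f x * g' x"
    unfolding eventually_at_right_field
  proof (intro exI[of _ 1] conjI allI impI)
    fix x :: real assume "0 < x" "x < 1"
    then have "x \<in> {0..1}" by simp
    from uw(3,4)[OF this] vy(3,4)[OF this] show "W x = f' x * g x - f x * g' x"
      by (simp add: W_def algebra_simps)
  qed simp
  show ?thesis by (rule Lim_transform_eventually[OF W0 W1])
qed

text \<open>
  The increment of the Wronskian from \<open>c\<close> to \<open>x\<close>, as \<open>c \<rightarrow> 0\<close>. The integrand is written with \<open>h\<close> because \<open>V\<close> and \<open>U\<close> are singular
  at \<open>0\<close> and only their difference is integrable there.
\<close>
lemma wronskian_from_0:
  assumes f: "regular_at_0 l f f'" and g: "regular_at_0 l g g'" and l: "l \<ge> -1/2" and x: "0 < x" "x \<le> 1"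
    and fV: "\<And>c. 0 < c \<Longrightarrow> c \<le> x \<Longrightarrow> solves V c x f f'"
    and gU: "\<And>c. 0 < c \<Longrightarrow> c \<le> x \<Longrightarrow> solves U c x g g'"
    and h: "h absolutely_integrable_on {0..x}" and hVU: "\<And>t. t \<in> {0<..x} \<Longrightarrow> h t = V t - U t"
  shows "f' x * g x - f x * g' x = integral {0..x} (\<lambda>t. h t * (f t * g t))"
proof -
  have sub: "{0..x} \<subseteq> {0..1}" using x by auto
  have "(\<lambda>t. h t * (f t * g t)) absolutely_integrable_on {0..x}"
    using regular_at_0_continuous[OF f l] regular_at_0_continuous[OF g l] sub
    by (intro absolutely_integrable_mult_continuous h continuous_intros) (auto intro: continuous_on_subset)
  then have "(\<lambda>t. h t * (f t * g t)) integrable_on {0..x}" using set_lebesgue_integral_eq_integral(1) by blast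
  then have "continuous_on {0..x} (\<lambda>c. integral {c..x} (\<lambda>t. h t * (f t * g t)))"
    by (rule indefinite_integral_continuous_1')
  then have 1: "((\<lambda>c. integral {c..x} (\<lambda>t. h t * (f t * g t))) \<longlongrightarrow> integral {0..x} (\<lambda>t. h t * (f t * g t))) (at_right 0)"
    using x unfolding continuous_on_def by (force simp: at_within_Icc_at_right)
  have 2: "((\<lambda>c. (f' x * g x - f x * g' x) - (f' c * g c - f c * g' c)) \<longlongrightarrow> (f' x * g x - f x * g' x) - 0) (at_right 0)"
    by (intro tendsto_intros regular_wronskian_tendsto_0[OF f g l])
  have 3: "\<forall>\<^sub>F c in at_right 0. (f' x * g x - f x * g' x) - (f' c * g c - f c * g' c) = integral {c..x} (\<lambda>t. h t * (f t * g t))"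
    unfolding eventually_at_right_field
  proof (intro exI[of _ x] conjI allI impI)
    fix c assume c: "0 < c" "c < x"
    have "(f' x * g x - f x * g' x) - (f' c * g c - f c * g' c) = integral {c..x} (\<lambda>t. (V t - U t) * (f t * g t))"
      using c by (intro wronskian_increment fV gU) auto
    also have "\<dots> = integral {c..x} (\<lambda>t. h t * (f t * g t))"
      using c hVU by (intro Henstock_Kurzweil_Integration.integral_cong) auto
    finally show "(f' x * g x - f x * g' x) - (f' c * g c - f c * g' c) = integral {c..x} (\<lambda>t. h t * (f t * g t))" .
  qed (use x in simp)
  have "((\<lambda>c. integral {c..x} (\<lambda>t. h t * (f t * g t))) \<longlongrightarrow> (f' x * g x - f x * g' x) - 0) (at_right 0)"
    by (rule Lim_transform_eventually[OF 2 3])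
  from tendsto_unique[OF _ this 1] show ?thesis by simp
qed

lemma powr_indefinite_integral:
  assumes "0 < c" "c \<le> t"
  shows "complex_of_real (t powr s) = of_real (c powr s) + integral {c..t} (\<lambda>x. of_real (s * x powr (s - 1)))"
proof -
  have "((\<lambda>x. complex_of_real (s * x powr (s - 1))) has_integral (of_real (t powr s) - of_real (c powr s))) {c..t}"
  proof (rule fundamental_theorem_of_calculus[OF assms(2)])
    fix x assume "x \<in> {c..t}"
    then have "x > 0" using assms by auto
    then have "((\<lambda>x. x powr s) has_real_derivative s * x powr (s - 1)) (at x within {c..t})"
      by (auto intro!: derivative_eq_intros)
    then show "((\<lambda>x. complex_of_real (x powr s)) has_vector_derivative complex_of_real (s * x powr (s - 1))) (at x within {c..t})"
      by (rule has_vector_derivative_of_real)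
  qed
  from integral_unique[OF this] show ?thesis by (metis add.commute diff_add_cancel)
qed

locale radial_potential =
  fixes l :: real and q :: "real \<Rightarrow> real"
  assumes l: "l \<ge> -1/2" and q: "q absolutely_integrable_on {0..1}"
begin

definition pot :: "real \<Rightarrow> complex" where "pot x = of_real (l * (l + 1) / x\<^sup>2 + q x)"

abbreviation qc :: "real \<Rightarrow> complex" where "qc \<equiv> \<lambda>x. of_real (q x)"

lemma qc: "qc absolutely_integrable_on {0..1}"
  using absolutely_integrable_linear[OF q bounded_linear_of_real] by (simp add: o_def)

lemma q_sub: "0 \<le> c \<Longrightarrow> d \<le> 1 \<Longrightarrow> q absolutely_integrable_on {c..d}"
  by (rule absolutely_integrable_on_subinterval[OF q]) auto

lemma qc_sub: "0 \<le> c \<Longrightarrow> d \<le> 1 \<Longrightarrow> qc absolutely_integrable_on {c..d}"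
  by (rule absolutely_integrable_on_subinterval[OF qc]) auto

lemma pot: "0 < c \<Longrightarrow> d \<le> 1 \<Longrightarrow> pot absolutely_integrable_on {c..d}"
  unfolding pot_def[abs_def] of_real_add
  by (intro set_integral_add qc_sub absolutely_integrable_continuous_real continuous_intros) auto

sublocale W: weighted_volterra "2 * l + 2" 0 1 qc
  by unfold_locales (use l qc in auto)

text \<open>
  \<open>u = x\<^bsup>-l-1\<^esup> \<phi>\<close> and its derivative \<open>w\<close>, for all \<open>z\<close> at once, as produced by the Volterra equation with data \<open>(1,0)\<close> at \<open>0\<close>.
\<close>
definition regular_pair :: "(complex \<Rightarrow> real \<Rightarrow> complex) \<times> (complex \<Rightarrow> real \<Rightarrow> complex) \<Rightarrow> bool" where
  "regular_pair p \<longleftrightarrow> (case p of (u, w) \<Rightarrow>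
    (\<forall>z. continuous_on {0..1} (u z)) \<and> (\<forall>z. continuous_on {0..1} (w z)) \<and>
    (\<forall>z. \<forall>x\<in>{0..1}. u z x = 1 + integral {0..x} (w z)) \<and>
    (\<forall>z. \<forall>x\<in>{0..1}. w z x = W.volterra (\<lambda>y. qc y - z) (u z) x) \<and>
    (\<forall>x\<in>{0..1}. (\<lambda>z. u z x) holomorphic_on UNIV) \<and> (\<forall>x\<in>{0..1}. (\<lambda>z. w z x) holomorphic_on UNIV))"

lemma regular_pair_exists: "\<exists>p. regular_pair p"
proof -
  obtain u w where "\<And>z. continuous_on {0..1} (u z)" "\<And>z. continuous_on {0..1} (w z)"
    "\<And>z x. x \<in> {0..1} \<Longrightarrow> u z x = 1 + integral {0..x} (w z)"
    "\<And>z x. x \<in> {0..1} \<Longrightarrow> w z x = 0 + W.volterra (\<lambda>y. qc y - z) (u z) x"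
    "\<And>x. x \<in> {0..1} \<Longrightarrow> (\<lambda>z. u z x) holomorphic_on UNIV"
    "\<And>x. x \<in> {0..1} \<Longrightarrow> (\<lambda>z. w z x) holomorphic_on UNIV"
    using W.solution_exists[of 1 0] by metis
  then have "regular_pair (u, w)" unfolding regular_pair_def prod.case by (metis add_0)
  then show ?thesis ..
qed

definition u where "u = fst (SOME p. regular_pair p)"
definition w where "w = snd (SOME p. regular_pair p)"

lemma regular_pair_u_w:
  shows u_cont: "continuous_on {0..1} (u z)" and w_cont: "continuous_on {0..1} (w z)"
    and u_eq: "x \<in> {0..1} \<Longrightarrow> u z x = 1 + integral {0..x} (w z)"
    and w_eq: "x \<in> {0..1} \<Longrightarrow> w z x = W.volterra (\<lambda>y. qc y - z) (u z) x"
    and u_hol: "x \<in> {0..1} \<Longrightarrow> (\<lambda>z. u z x) holomorphic_on UNIV"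
    and w_hol: "x \<in> {0..1} \<Longrightarrow> (\<lambda>z. w z x) holomorphic_on UNIV"
proof -
  have "regular_pair (u, w)"
    using someI_ex[OF regular_pair_exists] unfolding u_def w_def by simp
  then show "continuous_on {0..1} (u z)" "continuous_on {0..1} (w z)"
    "x \<in> {0..1} \<Longrightarrow> u z x = 1 + integral {0..x} (w z)"
    "x \<in> {0..1} \<Longrightarrow> w z x = W.volterra (\<lambda>y. qc y - z) (u z) x"
    "x \<in> {0..1} \<Longrightarrow> (\<lambda>z. u z x) holomorphic_on UNIV"
    "x \<in> {0..1} \<Longrightarrow> (\<lambda>z. w z x) holomorphic_on UNIV"
    unfolding regular_pair_def prod.case by blast+
qed

definition phi :: "complex \<Rightarrow> real \<Rightarrow> complex" where
  "phi z x = of_real (x powr (l + 1)) * u z x"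

definition phi' :: "complex \<Rightarrow> real \<Rightarrow> complex" where
  "phi' z x = of_real ((l + 1) * x powr l) * u z x + of_real (x powr (l + 1)) * w z x"

lemma phi_regular: "regular_at_0 l (phi z) (phi' z)"
  unfolding regular_at_0_def using u_cont w_cont phi_def phi'_def by blast

lemma phi_cont: "continuous_on {0..1} (phi z)"
  by (rule regular_at_0_continuous[OF phi_regular l])

lemma phi_hol: "x \<in> {0..1} \<Longrightarrow> (\<lambda>z. phi z x) holomorphic_on UNIV"
  unfolding phi_def by (intro holomorphic_intros u_hol)

lemma phi'_hol: "x \<in> {0..1} \<Longrightarrow> (\<lambda>z. phi' z x) holomorphic_on UNIV"
  unfolding phi'_def by (intro holomorphic_intros u_hol w_hol)

lemma u_0: "u z 0 = 1"
  using u_eq[of 0 z] by simp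

text \<open>
  The equation for \<open>u\<close> says that \<open>Y = x\<^bsup>2l+2\<^esup> w\<close> is an indefinite integral. The product rule for indefinite integrals,
  applied to \<open>\<phi> = x\<^bsup>l+1\<^esup> u\<close> and \<open>\<phi>' = (l + 1) x\<^sup>l u + x\<^bsup>-l-1\<^esup> Y\<close>, turns it into the original equation.
\<close>
lemma phi_solves:
  assumes c: "0 < c" "c \<le> d" "d \<le> 1"
  shows "solves (\<lambda>t. pot t - z) c d (phi z) (phi' z)"
proof -
  define Y where "Y x = integral {0..x} (\<lambda>y. of_real (y powr (2 * l + 2)) * ((qc y - z) * u z y))" for x
  have Yi: "(\<lambda>y. of_real (y powr (2 * l + 2)) * ((qc y - z) * u z y)) absolutely_integrable_on {0..1}"
    using l by (intro absolutely_integrable_continuous_mult absolutely_integrable_mult_continuous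
        W.shifted_integrable u_cont continuous_intros continuous_on_powr') auto
  have wY: "w z x = of_real (x powr - (2 * l + 2)) * Y x" if "x \<in> {c..d}" for x
  proof -
    have "w z x = W.volterra (\<lambda>y. qc y - z) (u z) x" using w_eq[of x z] that c by simp
    also have "\<dots> = of_real (x powr - (2 * l + 2)) * Y x"
      unfolding W.volterra_def Y_def Henstock_Kurzweil_Integration.integral_mult_right[symmetric] using that c
      by (auto intro!: Henstock_Kurzweil_Integration.integral_cong simp: powr_divide powr_minus_divide
          simp del: minus_add_distrib Henstock_Kurzweil_Integration.integral_mult_right)
    finally show ?thesis .
  qed
  have sub: "{c..d} \<subseteq> {0..1}" using c by auto
  have uc: "continuous_on {c..d} (u z)" and wc: "continuous_on {c..d} (w z)"
    using continuous_on_subset[OF u_cont sub] continuous_on_subset[OF w_cont sub] by blast+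
  have phi'_Y: "phi' z x = of_real (l + 1) * (of_real (x powr l) * u z x) + of_real (x powr - (l + 1)) * Y x" if "x \<in> {c..d}" for x
  proof -
    have "complex_of_real (x powr (l + 1)) * of_real (x powr - (2 * l + 2)) = of_real (x powr - (l + 1))"
      unfolding of_real_mult[symmetric] powr_add[symmetric] by (simp add: algebra_simps)
    then show ?thesis unfolding phi'_def wY[OF that] by (simp add: algebra_simps)
  qed
  have upart: "u z t = u z c + integral {c..t} (w z)" if t: "t \<in> {c..d}" for t
  proof -
    have "w z integrable_on {0..1}" using w_cont by (rule integrable_continuous_real)
    from integral_diff_Icc[OF this, of c t] show ?thesis
      using u_eq[of t z] u_eq[of c z] t c by (simp add: algebra_simps)
  qed
  have Ypart: "Y t = Y c + integral {c..t} (\<lambda>y. of_real (y powr (2 * l + 2)) * ((qc y - z) * u z y))" if t: "t \<in> {c..d}" for t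
    using integral_diff_Icc[OF set_lebesgue_integral_eq_integral(1)[OF Yi], of c t] t c
    by (simp add: Y_def algebra_simps)
  have pc: "continuous_on {c..t} (\<lambda>x. complex_of_real (s * x powr r))" if "t \<in> {c..d}" for t s r
    using c by (intro continuous_intros) auto
  have wi: "w z absolutely_integrable_on {c..t}" if "t \<in> {c..d}" for t
    using that by (intro absolutely_integrable_continuous_real continuous_on_subset[OF wc]) auto
  have pw: "x powr a * x powr b = x powr (a + b)" for x a b :: real by (simp add: powr_add)
  show ?thesis
  proof (rule solvesI)
    show "(\<lambda>t. pot t - z) absolutely_integrable_on {c..d}"
      by (intro set_integral_diff(1)[OF pot[OF c(1,3)]] absolutely_integrable_continuous_real continuous_intros)
    show "continuous_on {c..d} (phi' z)"
      unfolding phi'_def[abs_def] using c by (intro continuous_intros uc wc) auto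
    fix x assume x: "x \<in> {c..d}"
    have cx: "c \<le> x" using x by simp
    have "phi z x - phi z c = integral {c..x} (\<lambda>t. of_real ((l + 1) * t powr (l + 1 - 1)) * u z t + of_real (t powr (l + 1)) * w z t)"
      unfolding phi_def
      by (rule integral_by_parts_L1(1)[OF cx absolutely_integrable_continuous_real[OF pc[OF x]] wi[OF x]
            powr_indefinite_integral[OF c(1)] upart]) (use x in auto)
    also have "\<dots> = integral {c..x} (phi' z)"
      by (intro Henstock_Kurzweil_Integration.integral_cong) (simp add: phi'_def)
    finally show "phi z x = phi z c + integral {c..x} (phi' z)" by (simp add: algebra_simps)
    have I1: "of_real (x powr l) * u z x - of_real (c powr l) * u z c
          = integral {c..x} (\<lambda>t. of_real (l * t powr (l - 1)) * u z t + of_real (t powr l) * w z t)"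
       "(\<lambda>t. of_real (l * t powr (l - 1)) * u z t + of_real (t powr l) * w z t) absolutely_integrable_on {c..x}"
      by (rule integral_by_parts_L1[OF cx absolutely_integrable_continuous_real[OF pc[OF x]] wi[OF x]
            powr_indefinite_integral[OF c(1)] upart]; use x in auto)+
    have Yix: "(\<lambda>y. of_real (y powr (2 * l + 2)) * ((qc y - z) * u z y)) absolutely_integrable_on {c..x}"
      using x c by (intro absolutely_integrable_on_subinterval[OF Yi]) auto
    have I2: "of_real (x powr - (l + 1)) * Y x - of_real (c powr - (l + 1)) * Y c
          = integral {c..x} (\<lambda>t. of_real (- (l + 1) * t powr (- (l + 1) - 1)) * Y t
               + of_real (t powr - (l + 1)) * (of_real (t powr (2 * l + 2)) * ((qc t - z) * u z t)))"
       "(\<lambda>t. of_real (- (l + 1) * t powr (- (l + 1) - 1)) * Y t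
               + of_real (t powr - (l + 1)) * (of_real (t powr (2 * l + 2)) * ((qc t - z) * u z t))) absolutely_integrable_on {c..x}"
      by (rule integral_by_parts_L1[OF cx absolutely_integrable_continuous_real[OF pc[OF x]] Yix
            powr_indefinite_integral[OF c(1)] Ypart]; use x in auto)+
    have "phi' z x - phi' z c
       = of_real (l + 1) * (of_real (x powr l) * u z x - of_real (c powr l) * u z c)
           + (of_real (x powr - (l + 1)) * Y x - of_real (c powr - (l + 1)) * Y c)"
      using phi'_Y[OF x] phi'_Y[of c] x by (simp add: algebra_simps)
    also have "\<dots> = integral {c..x} (\<lambda>t. of_real (l + 1) * (of_real (l * t powr (l - 1)) * u z t + of_real (t powr l) * w z t)
          + (of_real (- (l + 1) * t powr (- (l + 1) - 1)) * Y t
               + of_real (t powr - (l + 1)) * (of_real (t powr (2 * l + 2)) * ((qc t - z) * u z t))))"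
      unfolding I1(1) I2(1)
      by (subst Henstock_Kurzweil_Integration.integral_add)
        (intro integrable_on_mult_right set_lebesgue_integral_eq_integral(1)[OF I1(2)] set_lebesgue_integral_eq_integral(1)[OF I2(2)],
         intro set_lebesgue_integral_eq_integral(1)[OF I2(2)], simp only: Henstock_Kurzweil_Integration.integral_mult_right)
    also have "\<dots> = integral {c..x} (\<lambda>t. (pot t - z) * phi z t)"
    proof (rule Henstock_Kurzweil_Integration.integral_cong)
      fix t assume t: "t \<in> {c..x}"
      then have td: "t \<in> {c..d}" and t0: "t > 0" using x c by auto
      have e1: "t powr (- (l + 1) - 1) = t powr l * t powr - (2 * l + 2)"
        unfolding pw by (simp add: algebra_simps)
      have e2: "complex_of_real (t powr - (l + 1)) * of_real (t powr (2 * l + 2)) = of_real (t powr (l + 1))"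
        unfolding of_real_mult[symmetric] pw by (simp add: algebra_simps)
      have e3: "t powr (l - 1) = t powr (l + 1) / t\<^sup>2"
        using t0 by (simp add: powr_diff powr_add power2_eq_square)
      have "of_real (- (l + 1) * t powr (- (l + 1) - 1)) * Y t = - of_real (l + 1) * (of_real (t powr l) * w z t)"
        unfolding wY[OF td] e1 by simp
      moreover have "complex_of_real (t powr - (l + 1)) * (of_real (t powr (2 * l + 2)) * ((qc t - z) * u z t))
          = of_real (t powr (l + 1)) * ((qc t - z) * u z t)"
        unfolding mult.assoc[symmetric] e2 ..
      moreover have "of_real (l + 1) * (of_real (l * t powr (l - 1)) * u z t) = of_real (l * (l + 1) / t\<^sup>2) * phi z t"
        unfolding e3 phi_def by simp
      ultimately show "of_real (l + 1) * (of_real (l * t powr (l - 1)) * u z t + of_real (t powr l) * w z t)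
          + (of_real (- (l + 1) * t powr (- (l + 1) - 1)) * Y t
               + of_real (t powr - (l + 1)) * (of_real (t powr (2 * l + 2)) * ((qc t - z) * u z t)))
          = (pot t - z) * phi z t"
        unfolding distrib_left pot_def of_real_add[of "l * (l + 1) / t\<^sup>2"] by (simp add: phi_def algebra_simps)
    qed
    finally show "phi' z x = phi' z c + integral {c..x} (\<lambda>t. (pot t - z) * phi z t)" by (simp add: algebra_simps)
  qed (use c in auto)
qed

lemma phi_normalized: "((\<lambda>x. phi z x / of_real (x powr (l + 1))) \<longlongrightarrow> 1) (at_right 0)"
proof -
  have "(u z \<longlongrightarrow> u z 0) (at 0 within {0..1})" using u_cont[of z] unfolding continuous_on_def by simp
  then have "(u z \<longlongrightarrow> 1) (at_right 0)" by (simp add: at_within_Icc_at_right u_0)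
  moreover have "\<forall>\<^sub>F x in at_right 0. u z x = phi z x / of_real (x powr (l + 1))"
    unfolding eventually_at_right_field by (rule exI[of _ 1]) (simp add: phi_def)
  ultimately show ?thesis by (rule Lim_transform_eventually)
qed

lemma abs_q_plus_integrable: "(\<lambda>y. \<bar>q y\<bar> + m) absolutely_integrable_on {0..1}"
  using set_integral_add(1)[OF norm_absolutely_integrable[OF q]
      absolutely_integrable_continuous_real[OF continuous_on_const]] by simp

lemma w_bound:
  assumes z: "norm z \<le> m" and t: "t \<in> {0..1}"
  shows "norm (w z t) \<le> integral {0..t} (\<lambda>y. (\<bar>q y\<bar> + m) * norm (u z y))"
  unfolding w_eq[OF t]
proof (rule W.volterra_bound[OF W.shifted_integrable u_cont t])
  show "(\<lambda>y. (\<bar>q y\<bar> + m) * norm (u z y)) absolutely_integrable_on {0..1}"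
    by (intro absolutely_integrable_mult_continuous abs_q_plus_integrable continuous_intros u_cont)
  fix y
  have "norm (qc y - z) \<le> norm (qc y) + norm z" by (rule norm_triangle_ineq4)
  then show "norm (qc y - z) * norm (u z y) \<le> (\<bar>q y\<bar> + m) * norm (u z y)"
    using z by (intro mult_right_mono) auto
qed

text \<open>
  Gronwall's inequality on \<open>[0,x\<^sub>0]\<close>. The two integrations in the equation for \<open>u\<close> give the factor \<open>x\<^sub>0\<close>, which
  compensates a large spectral parameter when \<open>x\<^sub>0\<close> is small.
\<close>
lemma u_bound:
  assumes z: "norm z \<le> m" and x0: "0 < x0" "x0 \<le> 1"
    and K: "x0 * integral {0..x0} (\<lambda>y. \<bar>q y\<bar> + m) \<le> K" and t: "t \<in> {0..x0}"
  shows "norm (u z t) \<le> 2 * exp (2 * K)"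
proof -
  define k where "k y = \<bar>q y\<bar> + m" for y
  have m: "m \<ge> 0" using z norm_ge_zero order_trans by blast
  have k0: "k y \<ge> 0" for y using m by (simp add: k_def)
  have sub0: "{0..x0} \<subseteq> {0..1}" using x0 by auto
  have nuc: "continuous_on {0..1} (\<lambda>y. norm (u z y))" by (intro continuous_intros u_cont)
  have kui: "(\<lambda>y. k y * norm (u z y)) integrable_on {0..t}" if "t \<le> 1" for t
    unfolding k_def using that
    by (intro set_lebesgue_integral_eq_integral(1) absolutely_integrable_mult_continuous
        absolutely_integrable_on_subinterval[OF abs_q_plus_integrable] continuous_on_subset[OF nuc]) auto
  have kx0: "(\<lambda>y. x0 * k y) absolutely_integrable_on {0..x0}"
    unfolding k_def by (intro set_integrable_mult_right absolutely_integrable_on_subinterval[OF abs_q_plus_integrable sub0])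
  have "norm (u z t) \<le> 2 * 1 * exp (2 * K)"
  proof (rule gronwall_L1[OF _ kx0, where y = "\<lambda>t. norm (u z t)" and t = t])
    show "continuous_on {0..x0} (\<lambda>t. norm (u z t))" by (rule continuous_on_subset[OF nuc sub0])
    show "integral {0..x0} (\<lambda>y. x0 * k y) \<le> K" using K by (simp add: k_def)
    fix t assume t: "t \<in> {0..x0}"
    then have t1: "t \<in> {0..1}" using sub0 by blast
    have "norm (u z t) \<le> norm (1::complex) + norm (integral {0..t} (w z))"
      unfolding u_eq[OF t1] by (rule norm_triangle_ineq)
    also have "norm (integral {0..t} (w z)) \<le> integral {0..t} (\<lambda>_. integral {0..t} (\<lambda>y. k y * norm (u z y)))"
    proof (rule Henstock_Kurzweil_Integration.integral_norm_bound_integral)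
      show "w z integrable_on {0..t}"
        using t1 by (intro integrable_continuous_real continuous_on_subset[OF w_cont]) auto
      fix s assume s: "s \<in> {0..t}"
      then have "norm (w z s) \<le> integral {0..s} (\<lambda>y. k y * norm (u z y))"
        using t1 unfolding k_def by (intro w_bound z) auto
      also have "\<dots> \<le> integral {0..t} (\<lambda>y. k y * norm (u z y))"
        using s t1 k0 by (intro integral_subset_le kui) auto
      finally show "norm (w z s) \<le> integral {0..t} (\<lambda>y. k y * norm (u z y))" .
    qed auto
    also have "\<dots> = t * integral {0..t} (\<lambda>y. k y * norm (u z y))" using t by simp
    also have "\<dots> \<le> x0 * integral {0..t} (\<lambda>y. k y * norm (u z y))"
      using t t1 k0 by (intro mult_right_mono Henstock_Kurzweil_Integration.integral_nonneg kui) auto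
    also have "\<dots> = integral {0..t} (\<lambda>s. x0 * k s * norm (u z s))"
      unfolding mult.assoc by simp
    finally show "norm (u z t) \<le> 1 + integral {0..t} (\<lambda>s. x0 * k s * norm (u z s))" by simp
  qed (use x0 k0 t in auto)
  then show ?thesis by simp
qed

lemma phi_locally_bounded: "\<exists>C. \<forall>z x. norm z \<le> m \<longrightarrow> x \<in> {0..1} \<longrightarrow> norm (phi z x) \<le> C"
proof (intro exI allI impI)
  fix z :: complex and x :: real assume z: "norm z \<le> m" and x: "x \<in> {0..1}"
  have "norm (phi z x) = x powr (l + 1) * norm (u z x)" by (simp add: phi_def norm_mult)
  also have "\<dots> \<le> 1 * (2 * exp (2 * integral {0..1} (\<lambda>y. \<bar>q y\<bar> + m)))"
    using x l by (intro mult_mono u_bound[OF z zero_less_one order_refl] powr_le1) auto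
  finally show "norm (phi z x) \<le> 1 * (2 * exp (2 * integral {0..1} (\<lambda>y. \<bar>q y\<bar> + m)))" .
qed

text \<open>
  Up to \<open>x = 1 / \<bar>\<omega>\<bar>\<close> the spectral parameter is a bounded perturbation of \<open>u'' + (2 l + 2) u' / x = q u\<close>;
  beyond that point \<open>l (l + 1) / x\<^sup>2\<close> is a perturbation of \<open>- f'' = \<omega>\<^sup>2 f\<close> whose integral is at most a
  multiple of \<open>\<bar>\<omega>\<bar>\<close>, so that Gronwall's inequality costs only a constant factor on either side.
\<close>
lemma phi_bound:
  obtains C where "C > 0"
    "\<And>\<omega> x. norm \<omega> \<ge> 1 \<Longrightarrow> 0 < x \<Longrightarrow> x \<le> 1 \<Longrightarrow>
        norm (phi (\<omega>\<^sup>2) x) \<le> C * norm \<omega> powr - (l + 1) * exp (\<bar>Im \<omega>\<bar> * x)"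
proof -
  define N where "N = integral {0..1} (\<lambda>x. \<bar>q x\<bar>)"
  have absq: "(\<lambda>x. \<bar>q x\<bar>) absolutely_integrable_on {0..1}"
    using norm_absolutely_integrable[OF q] by simp
  have absqi: "(\<lambda>x. \<bar>q x\<bar>) integrable_on {c..d}" if "0 \<le> c" "d \<le> 1" for c d
    using set_lebesgue_integral_eq_integral(1) absolutely_integrable_on_subinterval[OF absq, of c d] that by auto
  have N: "integral {c..d} (\<lambda>x. \<bar>q x\<bar>) \<le> N" if "0 \<le> c" "d \<le> 1" for c d
    unfolding N_def using that by (intro integral_subset_le absqi) auto
  have N0: "N \<ge> 0" unfolding N_def by (intro Henstock_Kurzweil_Integration.integral_nonneg absqi) auto
  define C1 where "C1 = 2 * exp (2 * (N + 1))"
  have C1: "C1 > 0" by (simp add: C1_def)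
  define K where "K = \<bar>l * (l + 1)\<bar> + N"
  define C where "C = 2 * (C1 * (l + 3 + N)) * exp (2 * K)"
  have CC1: "C1 \<le> C" "C > 0"
  proof -
    have "1 * 1 \<le> (2 * (l + 3 + N)) * exp (2 * K)" using l N0 by (intro mult_mono) (auto simp: K_def)
    then have "C1 * 1 \<le> C1 * ((2 * (l + 3 + N)) * exp (2 * K))" using C1 by (intro mult_left_mono) auto
    then show "C1 \<le> C" by (simp add: C_def algebra_simps)
    then show "C > 0" using C1 by simp
  qed
  have main: "norm (phi (\<omega>\<^sup>2) x) \<le> C * norm \<omega> powr - (l + 1) * exp (\<bar>Im \<omega>\<bar> * x)"
    if \<omega>: "norm \<omega> \<ge> 1" and x: "0 < x" "x \<le> 1" for \<omega> x
  proof -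
    define m where "m = norm \<omega>"
    \<comment> \<open>the scale at which \<open>\<omega>\<^sup>2\<close> and \<open>1 / x\<^sup>2\<close> are of the same size\<close>
    define x0 where "x0 = 1 / m"
    have m: "m \<ge> 1" "m > 0" using \<omega> by (auto simp: m_def)
    have x0: "0 < x0" "x0 \<le> 1" "x0 * m = 1" using m by (auto simp: x0_def)
    define k where "k y = \<bar>q y\<bar> + m\<^sup>2" for y
    have z: "norm (\<omega>\<^sup>2) \<le> m\<^sup>2" by (simp add: m_def norm_power)
    have k0: "k y \<ge> 0" for y by (simp add: k_def)
    have kui': "(\<lambda>y. k y * norm (u (\<omega>\<^sup>2) y)) integrable_on {0..t}" if "t \<le> 1" for t
      unfolding k_def using that
      by (intro set_lebesgue_integral_eq_integral(1) absolutely_integrable_mult_continuous continuous_intros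
          absolutely_integrable_on_subinterval[OF abs_q_plus_integrable] continuous_on_subset[OF u_cont]) auto
    have k: "k absolutely_integrable_on {0..x0}"
      unfolding k_def[abs_def] using x0 by (intro absolutely_integrable_on_subinterval[OF abs_q_plus_integrable]) auto
    have int_k: "integral {0..x0} k \<le> N + m"
    proof -
      have "integral {0..x0} k = integral {0..x0} (\<lambda>y. \<bar>q y\<bar>) + integral {0..x0} (\<lambda>y. m\<^sup>2)"
        unfolding k_def[abs_def] using x0
        by (intro Henstock_Kurzweil_Integration.integral_add absqi) auto
      also have "integral {0..x0} (\<lambda>y. m\<^sup>2) = m" using x0 m by (simp add: x0_def power2_eq_square)
      finally show ?thesis using N[of 0 x0] x0 by simp
    qed
    have u_le: "norm (u (\<omega>\<^sup>2) t) \<le> C1" if t: "t \<in> {0..x0}" for t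
      unfolding C1_def
    proof (rule u_bound[OF z x0(1,2) _ t])
      have "x0 * integral {0..x0} k \<le> x0 * (N + m)" using int_k x0 by (intro mult_left_mono) auto
      also have "\<dots> = x0 * N + 1" using x0 by (simp add: distrib_left)
      also have "x0 * N \<le> 1 * N" using x0 N0 by (intro mult_right_mono) auto
      finally show "x0 * integral {0..x0} (\<lambda>y. \<bar>q y\<bar> + m\<^sup>2) \<le> N + 1" by (simp add: k_def[abs_def])
    qed
    have x0p: "x0 powr (l + 1) = m powr - (l + 1)"
      using m unfolding x0_def powr_minus_divide by (simp add: powr_divide)
    have r: "1 \<le> exp (\<bar>Im \<omega>\<bar> * x)" using x by simp
    show ?thesis
    proof (cases "x \<le> x0")
      case True
      have "norm (phi (\<omega>\<^sup>2) x) = x powr (l + 1) * norm (u (\<omega>\<^sup>2) x)" by (simp add: phi_def norm_mult)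
      also have "\<dots> \<le> x0 powr (l + 1) * C1"
        using True x l by (intro mult_mono u_le powr_mono2) auto
      also have "\<dots> \<le> x0 powr (l + 1) * C" using CC1 by (intro mult_left_mono) auto
      also have "\<dots> \<le> x0 powr (l + 1) * C * exp (\<bar>Im \<omega>\<bar> * x)"
        using r CC1 mult_left_mono[OF r, of "x0 powr (l + 1) * C"] by simp
      finally show ?thesis using x0p by (simp add: m_def mult.commute)
    next
      case False
      have w0: "\<omega> \<noteq> 0" using m by (auto simp: m_def)
      have sol: "solves (\<lambda>t. pot t - \<omega>\<^sup>2) x0 1 (phi (\<omega>\<^sup>2)) (phi' (\<omega>\<^sup>2))"
        using x0 by (intro phi_solves) auto
      have intP: "integral {x0..1} (\<lambda>t. norm (pot t)) / norm \<omega> \<le> K"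
      proof -
        have hi: "((\<lambda>t. \<bar>l * (l + 1)\<bar> * (1 / t\<^sup>2)) has_integral \<bar>l * (l + 1)\<bar> * ((- (1 / 1)) - (- (1 / x0)))) {x0..1}"
        proof (intro has_integral_mult_right fundamental_theorem_of_calculus)
          fix t assume "t \<in> {x0..1}"
          then have "t > 0" using x0 by auto
          then show "((\<lambda>t. - (1 / t)) has_vector_derivative 1 / t\<^sup>2) (at t within {x0..1})"
            unfolding has_real_derivative_iff_has_vector_derivative[symmetric]
            by (auto intro!: derivative_eq_intros simp: power2_eq_square)
        qed (use x0 in auto)
        have "integral {x0..1} (\<lambda>t. norm (pot t)) \<le> integral {x0..1} (\<lambda>t. \<bar>l * (l + 1)\<bar> * (1 / t\<^sup>2) + \<bar>q t\<bar>)"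
        proof (rule integral_le)
          show "(\<lambda>t. norm (pot t)) integrable_on {x0..1}"
            by (intro set_lebesgue_integral_eq_integral(1) norm_absolutely_integrable pot x0) auto
          show "(\<lambda>t. \<bar>l * (l + 1)\<bar> * (1 / t\<^sup>2) + \<bar>q t\<bar>) integrable_on {x0..1}"
            using hi x0 by (intro integrable_add absqi) (auto intro: has_integral_integrable)
          fix t assume "t \<in> {x0..1}"
          have "norm (pot t) \<le> \<bar>l * (l + 1) / t\<^sup>2\<bar> + \<bar>q t\<bar>" unfolding pot_def norm_of_real by (rule abs_triangle_ineq)
          then show "norm (pot t) \<le> \<bar>l * (l + 1)\<bar> * (1 / t\<^sup>2) + \<bar>q t\<bar>" by (simp add: abs_divide)
        qed
        also have "\<dots> = integral {x0..1} (\<lambda>t. \<bar>l * (l + 1)\<bar> * (1 / t\<^sup>2)) + integral {x0..1} (\<lambda>t. \<bar>q t\<bar>)"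
          using hi x0 by (intro Henstock_Kurzweil_Integration.integral_add absqi) (auto intro: has_integral_integrable)
        also have "\<dots> \<le> \<bar>l * (l + 1)\<bar> * (1 / x0) + N"
          using integral_unique[OF hi] N[of x0 1] x0 by (simp add: algebra_simps)
        also have "\<dots> \<le> \<bar>l * (l + 1)\<bar> * m + N * m"
          using m N0 mult_left_mono[of 1 m N] by (simp add: x0_def)
        finally show ?thesis using m by (simp add: m_def[symmetric] K_def field_simps)
      qed
      have "norm (phi (\<omega>\<^sup>2) x0) = x0 powr (l + 1) * norm (u (\<omega>\<^sup>2) x0)" by (simp add: phi_def norm_mult)
      also have "\<dots> \<le> x0 powr (l + 1) * C1" using x0 by (intro mult_left_mono u_le) auto
      finally have d0: "norm (phi (\<omega>\<^sup>2) x0) \<le> x0 powr (l + 1) * C1" .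
      have x0l: "x0 powr l = x0 powr (l + 1) * m" using x0 m by (simp add: powr_add x0_def)
      have "norm (phi' (\<omega>\<^sup>2) x0) \<le> (l + 1) * x0 powr l * norm (u (\<omega>\<^sup>2) x0) + x0 powr (l + 1) * norm (w (\<omega>\<^sup>2) x0)"
        unfolding phi'_def using l by (intro norm_triangle_le) (simp add: norm_mult)
      also have "\<dots> \<le> (l + 1) * x0 powr l * C1 + x0 powr (l + 1) * (C1 * ((N + 1) * m))"
      proof (intro add_mono mult_left_mono u_le)
        have "norm (w (\<omega>\<^sup>2) x0) \<le> integral {0..x0} (\<lambda>y. k y * norm (u (\<omega>\<^sup>2) y))" using x0 w_bound[OF z, of x0] by (simp add: k_def)
        also have "\<dots> \<le> integral {0..x0} (\<lambda>y. k y * C1)"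
          using x0 k0 set_lebesgue_integral_eq_integral(1)[OF k]
          by (intro integral_le kui' mult_left_mono u_le integrable_on_mult_left) auto
        also have "\<dots> = C1 * integral {0..x0} k" by simp
        also have "\<dots> \<le> C1 * (N + m)" using C1 int_k by (intro mult_left_mono) auto
        also have "\<dots> \<le> C1 * ((N + 1) * m)"
          using C1 m N0 mult_left_mono[of 1 m N] by (intro mult_left_mono) (auto simp: algebra_simps)
        finally show "norm (w (\<omega>\<^sup>2) x0) \<le> C1 * ((N + 1) * m)" .
      qed (use x0 l in auto)
      also have "\<dots> = x0 powr (l + 1) * C1 * (l + 2 + N) * m" unfolding x0l by (simp add: algebra_simps)
      finally have "norm (phi' (\<omega>\<^sup>2) x0) / norm \<omega> \<le> x0 powr (l + 1) * C1 * (l + 2 + N)"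
        using m by (simp add: m_def[symmetric] field_simps)
      with d0 have "norm (phi (\<omega>\<^sup>2) x0) + norm (phi' (\<omega>\<^sup>2) x0) / norm \<omega> \<le> x0 powr (l + 1) * (C1 * (l + 3 + N))"
        by (simp add: algebra_simps)
      then have A: "2 * (norm (phi (\<omega>\<^sup>2) x0) + norm (phi' (\<omega>\<^sup>2) x0) / norm \<omega>) * exp (2 * K)
            \<le> 2 * (x0 powr (l + 1) * (C1 * (l + 3 + N))) * exp (2 * K)"
        by (intro mult_right_mono mult_left_mono) auto
      have "norm (phi (\<omega>\<^sup>2) x) \<le> 2 * (norm (phi (\<omega>\<^sup>2) x0) + norm (phi' (\<omega>\<^sup>2) x0) / norm \<omega>) * exp (2 * K) * exp (\<bar>Im \<omega>\<bar> * (x - x0))"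
        using False x by (intro solution_bound[OF sol w0 _ intP]) auto
      also have "\<dots> \<le> 2 * (x0 powr (l + 1) * (C1 * (l + 3 + N))) * exp (2 * K) * exp (\<bar>Im \<omega>\<bar> * x)"
        using l N0 C1 x0 by (intro mult_mono A) (auto intro!: mult_left_mono)
      also have "\<dots> = C * x0 powr (l + 1) * exp (\<bar>Im \<omega>\<bar> * x)" by (simp add: C_def)
      finally show ?thesis using x0p by (simp add: m_def)
    qed
  qed
  show thesis by (rule that[OF CC1(2) main])
qed

end

context radial_potential
begin

text \<open>
  \<open>1/\<phi>\<^sup>2 = x\<^bsup>-2l-2\<^esup> u\<^bsup>-2\<^esup>\<close> with \<open>u \<rightarrow> 1\<close> and \<open>2 l + 2 \<ge> 1\<close>.
\<close>
lemma phi_nonzero_near_0: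
  obtains b where "0 < b" "b < 1"
    "\<And>x. 0 < x \<Longrightarrow> x \<le> b \<Longrightarrow> phi z x \<noteq> 0"
    "\<And>x. 0 < x \<Longrightarrow> x \<le> b \<Longrightarrow> Re (1 / (phi z x)\<^sup>2) \<ge> 1 / (2 * x)"
proof -
  have "(u z \<longlongrightarrow> u z 0) (at 0 within {0..1})" using u_cont[of z] unfolding continuous_on_def by simp
  then have u1: "(u z \<longlongrightarrow> 1) (at_right 0)" by (simp add: at_within_Icc_at_right u_0)
  then have "((\<lambda>x. Re (1 / (u z x)\<^sup>2)) \<longlongrightarrow> Re (1 / 1\<^sup>2)) (at_right 0)"
    by (intro tendsto_intros) auto
  then have "\<forall>\<^sub>F x in at_right 0. Re (1 / (u z x)\<^sup>2) > 1 / 2"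
    by (rule order_tendstoD) simp
  then obtain b0 where b0: "b0 > 0" "\<And>x. 0 < x \<Longrightarrow> x < b0 \<Longrightarrow> Re (1 / (u z x)\<^sup>2) > 1 / 2"
    unfolding eventually_at_right_field by blast
  define b where "b = min b0 1 / 2"
  have b: "0 < b" "b < 1" "b < b0" using b0 by (auto simp: b_def min_def)
  have ub: "Re (1 / (u z x)\<^sup>2) > 1 / 2" if "0 < x" "x \<le> b" for x using b0(2) that b by auto
  show thesis
  proof (rule that[OF b(1,2)])
    fix x assume x: "0 < x" "x \<le> b"
    have "u z x \<noteq> 0" using ub[OF x] by auto
    then show "phi z x \<noteq> 0" using x by (simp add: phi_def)
    have p: "x powr (l + 1) * x powr (l + 1) = x powr (2 * l + 2)"
      unfolding powr_add[symmetric] by (simp add: algebra_simps)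
    have "1 / (phi z x)\<^sup>2 = of_real (1 / x powr (2 * l + 2)) * (1 / (u z x)\<^sup>2)"
      unfolding phi_def p[symmetric] by (simp add: power2_eq_square)
    then have "Re (1 / (phi z x)\<^sup>2) = (1 / x powr (2 * l + 2)) * Re (1 / (u z x)\<^sup>2)"
      by (metis scaleR_complex.simps(1) scaleR_conv_of_real)
    also have "\<dots> \<ge> (1 / x) * (1 / 2)"
    proof (intro mult_mono)
      have "x powr (2 * l + 2) \<le> x powr 1" using x b l by (intro powr_mono') auto
      then show "1 / x \<le> 1 / x powr (2 * l + 2)" using x by (simp add: frac_le)
    qed (use x ub[OF x] in auto)
    finally show "Re (1 / (phi z x)\<^sup>2) \<ge> 1 / (2 * x)" by simp
  qed
qed

text \<open>
  Two solutions with nonzero Wronskian \<open>W\<close> satisfy \<open>(f/\<phi>)' = W/\<phi>\<^sup>2\<close>, which is not integrable at \<open>0\<close>.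
  So a solution \<open>f\<close> for which \<open>f/\<phi>\<close> has a finite limit is a multiple of \<open>\<phi>\<close>.
\<close>
lemma regular_unique:
  assumes f: "\<And>c. 0 < c \<Longrightarrow> c \<le> 1 \<Longrightarrow> solves (\<lambda>t. pot t - z) c 1 f f'"
    and lim: "((\<lambda>x. f x / of_real (x powr (l + 1))) \<longlongrightarrow> \<kappa>) (at_right 0)"
    and x: "0 < x" "x \<le> 1"
  shows "f x = \<kappa> * phi z x" "f' x = \<kappa> * phi' z x"
proof -
  obtain b where b: "0 < b" "b < 1" and nz: "\<And>x. 0 < x \<Longrightarrow> x \<le> b \<Longrightarrow> phi z x \<noteq> 0"
    and Re: "\<And>x. 0 < x \<Longrightarrow> x \<le> b \<Longrightarrow> Re (1 / (phi z x)\<^sup>2) \<ge> 1 / (2 * x)"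
    using phi_nonzero_near_0[of z] by blast
  define W where "W = f' 1 * phi z 1 - f 1 * phi' z 1"
  have W: "f' x * phi z x - f x * phi' z x = W" if "0 < x" "x \<le> 1" for x
    using wronskian_increment[OF f[OF that] phi_solves[OF that order_refl, of z]] by (simp add: W_def)
  define h where "h x = f x / phi z x" for x
  have dh: "(h has_vector_derivative W / (phi z x)\<^sup>2) (at x)" if x: "0 < x" "x \<le> b" for x
  proof -
    have xi: "x \<in> {x/2..1}" and at: "at x within {x/2..1} = at x" using x b by (auto simp: at_within_Icc_at)
    have "(f has_vector_derivative f' x) (at x)"
      using solves_has_vector_derivative[OF f xi] x b unfolding at by simp
    then have df: "(f has_derivative (\<lambda>t. t *\<^sub>R f' x)) (at x)" unfolding has_vector_derivative_def .
    have "(phi z has_vector_derivative phi' z x) (at x)"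
      using solves_has_vector_derivative[OF phi_solves xi, of z] x b unfolding at by simp
    then have dp: "(phi z has_derivative (\<lambda>t. t *\<^sub>R phi' z x)) (at x)" unfolding has_vector_derivative_def .
    have eq: "t *\<^sub>R (W / (phi z x)\<^sup>2) = (t *\<^sub>R f' x * phi z x - f x * (t *\<^sub>R phi' z x)) / (phi z x * phi z x)" for t
      using W[of x] x b by (simp add: power2_eq_square scaleR_conv_of_real algebra_simps flip: W)
    show ?thesis unfolding has_vector_derivative_def h_def eq
      by (rule has_derivative_divide'[OF df dp nz[OF x]])
  qed
  have hlim: "(h \<longlongrightarrow> \<kappa>) (at_right 0)"
  proof (rule Lim_transform_eventually)
    show "((\<lambda>x. (f x / of_real (x powr (l + 1))) / (phi z x / of_real (x powr (l + 1)))) \<longlongrightarrow> \<kappa>) (at_right 0)"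
      using tendsto_divide[OF lim phi_normalized[of z]] by simp
    show "\<forall>\<^sub>F x in at_right 0. (f x / of_real (x powr (l + 1))) / (phi z x / of_real (x powr (l + 1))) = h x"
      unfolding eventually_at_right_field by (rule exI[of _ 1]) (simp add: h_def)
  qed
  have "W = 0"
  proof (rule ccontr)
    assume W0: "W \<noteq> 0"
    define g where "g x = Re (h x / W) - ln x / 2" for x
    have "\<exists>y. (g has_real_derivative y) (at x) \<and> y \<ge> 0" if x: "0 < x" "x \<le> b" for x
    proof -
      have "((\<lambda>x. Re (h x / W)) has_vector_derivative Re (W / (phi z x)\<^sup>2 / W)) (at x)"
        by (intro derivative_intros dh[OF x] bounded_linear.has_vector_derivative[OF bounded_linear_Re]
            bounded_linear.has_vector_derivative[OF bounded_linear_divide])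
      moreover have "W / (phi z x)\<^sup>2 / W = 1 / (phi z x)\<^sup>2" using W0 by simp
      ultimately have "((\<lambda>x. Re (h x / W)) has_real_derivative Re (1 / (phi z x)\<^sup>2)) (at x)"
        by (simp add: has_real_derivative_iff_has_vector_derivative)
      moreover have "((\<lambda>x. ln x / 2) has_real_derivative 1 / x / 2) (at x)"
        using x by (auto intro!: derivative_eq_intros)
      ultimately have "(g has_real_derivative Re (1 / (phi z x)\<^sup>2) - 1 / x / 2) (at x)"
        unfolding g_def[abs_def] by (rule DERIV_diff)
      then show ?thesis using Re[OF x] by (intro exI conjI) auto
    qed
    then have mono: "g x \<le> g b" if "0 < x" "x \<le> b" for x
      using that by (intro DERIV_nonneg_imp_nondecreasing[of x b g]) auto
    have "((\<lambda>x. Re (h x / W)) \<longlongrightarrow> Re (\<kappa> / W)) (at_right 0)" by (intro tendsto_intros hlim W0)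
    then have "\<forall>\<^sub>F x in at_right 0. Re (h x / W) > Re (\<kappa> / W) - 1" by (rule order_tendstoD) simp
    moreover have "\<forall>\<^sub>F x in at_right 0. ln x < 2 * (Re (\<kappa> / W) - 1 - g b)"
      using ln_at_0 by (simp add: filterlim_at_bot_dense)
    moreover have "\<forall>\<^sub>F x in at_right 0. 0 < x \<and> x < b"
      using b unfolding eventually_at_right_field by blast
    ultimately have "\<forall>\<^sub>F x::real in at_right 0. False"
    proof eventually_elim
      case (elim x)
      then show ?case using mono[of x] by (simp add: g_def)
    qed
    then show False by simp
  qed
  have hb: "h x = \<kappa>" if x: "0 < x" "x \<le> b" for x
  proof -
    have const: "h y = h b" if y: "0 < y" "y \<le> b" for y
    proof -
      have "(h has_vector_derivative 0) (at t within {y..b})" if "t \<in> {y..b}" for t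
        using dh[of t] that y \<open>W = 0\<close> by (auto intro: has_vector_derivative_at_within)
      then obtain r where "\<And>t. t \<in> {y..b} \<Longrightarrow> h t = r"
        using has_vector_derivative_zero_constant[of "{y..b}" h] convex_closed_interval by blast
      then show ?thesis using y by force
    qed
    have ev: "\<forall>\<^sub>F x in at_right 0. h x = h b"
      unfolding eventually_at_right_field
      by (intro exI[of _ b] conjI allI impI const b(1)) auto
    have "((\<lambda>_. h b) \<longlongrightarrow> \<kappa>) (at_right (0::real))"
      by (rule Lim_transform_eventually[OF hlim ev])
    then have "h b = \<kappa>" by (simp add: tendsto_const_iff)
    then show ?thesis using const[OF x] by simp
  qed
  have small: "f x = \<kappa> * phi z x" "f' x = \<kappa> * phi' z x" if x: "0 < x" "x \<le> b" for x
  proof -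
    show 1: "f x = \<kappa> * phi z x" using hb[OF x] nz[OF x] by (simp add: h_def field_simps)
    have "f' x * phi z x = \<kappa> * phi' z x * phi z x" using W[of x] x b 1 \<open>W = 0\<close> by (simp add: algebra_simps)
    then show "f' x = \<kappa> * phi' z x" using nz[OF x] by simp
  qed
  show "f x = \<kappa> * phi z x" "f' x = \<kappa> * phi' z x"
  proof -
    have "f x = \<kappa> * phi z x \<and> f' x = \<kappa> * phi' z x"
    proof (cases "x \<le> b")
      case True
      then show ?thesis using small x by blast
    next
      case False
      have s: "solves (\<lambda>t. pot t - z) b 1 (\<lambda>x. f x - \<kappa> * phi z x) (\<lambda>x. f' x - \<kappa> * phi' z x)"
        using b by (intro solves_diff_scaled f phi_solves) auto
      from solves_zero_data[OF s, of x] small[of b] False x b show ?thesis by simp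
    qed
    then show "f x = \<kappa> * phi z x" "f' x = \<kappa> * phi' z x" by blast+
  qed
qed

lemma phi_real:
  assumes "z \<in> \<real>" "0 < x" "x \<le> 1"
  shows "cnj (phi z x) = phi z x" "cnj (phi' z x) = phi' z x"
proof -
  have pot: "cnj (pot t - z) = pot t - z" for t using assms(1) by (simp add: pot_def complex_is_Real_iff complex_eq_iff)
  have s: "solves (\<lambda>t. pot t - z) c 1 (\<lambda>x. cnj (phi z x)) (\<lambda>x. cnj (phi' z x))" if "0 < c" "c \<le> 1" for c
    using solves_cnj[OF phi_solves[OF that order_refl, of z]] unfolding pot .
  have "((\<lambda>x. cnj (phi z x / of_real (x powr (l + 1)))) \<longlongrightarrow> cnj 1) (at_right 0)"
    by (intro tendsto_intros phi_normalized)
  then have "((\<lambda>x. cnj (phi z x) / of_real (x powr (l + 1))) \<longlongrightarrow> 1) (at_right 0)" by simp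
  from regular_unique[OF s this assms(2,3)]
  show "cnj (phi z x) = phi z x" "cnj (phi' z x) = phi' z x" by simp_all
qed

text \<open>
  Testing against the solution that starts at \<open>c\<close> with data \<open>(0,1)\<close>: zero data at the right end point
  propagate to the left.
\<close>
lemma solves_zero_end_data:
  assumes f: "solves (\<lambda>t. pot t - z) c d f f'" and cd: "0 < c" "c \<le> d" "d \<le> 1" and "f d = 0" "f' d = 0"
  shows "f c = 0"
proof -
  have "d \<le> c + 1" using cd by simp
  from initial_value_problem[OF cd(1,2) this pot[OF cd(1,3)], of 0 1]
  obtain s s' where s: "\<And>z. solves (\<lambda>t. pot t - z) c d (s z) (s' z)" "\<And>z. s z c = 0" "\<And>z. s' z c = 1"
    by metis
  from wronskian_increment[OF f s(1)[of z]] show ?thesis using s assms by simp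
qed

lemma phi_end_data_nonzero:
  assumes "0 < d" "d \<le> 1"
  shows "phi z d \<noteq> 0 \<or> phi' z d \<noteq> 0"
proof (rule ccontr)
  assume "\<not> (phi z d \<noteq> 0 \<or> phi' z d \<noteq> 0)"
  then have z: "phi z d = 0" "phi' z d = 0" by auto
  obtain b where b: "0 < b" "b < 1" "\<And>x. 0 < x \<Longrightarrow> x \<le> b \<Longrightarrow> phi z x \<noteq> 0"
    using phi_nonzero_near_0[of z] by metis
  define c where "c = min b d"
  have c: "0 < c" "c \<le> b" "c \<le> d" using assms b by (auto simp: c_def)
  have "phi z c = 0" by (rule solves_zero_end_data[OF phi_solves c(1,3) assms(2) z]) (use c assms in auto)
  with b(3)[OF c(1,2)] show False by simp
qed

section \<open>Eigenvalues and norming constants\<close>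

lemma sl_solution_solves:
  assumes f: "sl_solution l q z f f'" and c: "0 < c" "c \<le> 1"
  shows "solves (\<lambda>t. pot t - z) c 1 f f'"
proof -
  obtain f'' where d: "\<And>x. x \<in> {0<..1} \<Longrightarrow> (f has_vector_derivative f' x) (at x within {0<..1})"
    and f''i: "\<And>x. x \<in> {0<..1} \<Longrightarrow> f'' absolutely_integrable_on {x..1}"
    and f'': "\<And>x. x \<in> {0<..1} \<Longrightarrow> f' 1 - f' x = integral {x..1} f''"
    and ae: "AE x in lebesgue. x \<in> {0<..<1} \<longrightarrow>
               - f'' x + of_real (l * (l + 1) / x\<^sup>2) * f x + of_real (q x) * f x = z * f x"
    using f unfolding sl_solution_def by blast
  have c1: "c \<in> {0<..1}" using c by simp
  have i: "f'' integrable_on {c..1}" using f''i[OF c1] set_lebesgue_integral_eq_integral(1) by blast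
  have f'eq: "f' x = f' 1 - integral {x..1} f''" if "x \<in> {c..1}" for x
    using f''[of x] that c by (simp add: algebra_simps)
  have f'c: "continuous_on {c..1} f'"
  proof (rule continuous_on_eq)
    show "continuous_on {c..1} (\<lambda>x. f' 1 - integral {x..1} f'')"
      by (intro continuous_intros indefinite_integral_continuous_1' i)
  qed (rule f'eq[symmetric])
  obtain N where N: "negligible N" "{x. \<not> (x \<in> {0<..<1} \<longrightarrow>
               - f'' x + of_real (l * (l + 1) / x\<^sup>2) * f x + of_real (q x) * f x = z * f x)} \<subseteq> N"
    using ae unfolding eventually_ae_filter negligible_iff_null_sets by auto
  have eq: "f'' x = (pot x - z) * f x" if "x \<in> {0<..<1}" "x \<notin> N" for x
  proof -
    have "- f'' x + of_real (l * (l + 1) / x\<^sup>2) * f x + of_real (q x) * f x = z * f x"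
      using N(2) that by blast
    then show ?thesis unfolding pot_def of_real_add by (simp add: algebra_simps)
  qed
  show ?thesis
  proof (rule solvesI[OF c(2) _ f'c])
    show "(\<lambda>t. pot t - z) absolutely_integrable_on {c..1}"
      by (intro set_integral_diff(1)[OF pot[OF c(1) order_refl]] absolutely_integrable_continuous_real continuous_intros)
    fix x assume x: "x \<in> {c..1}"
    have "(f' has_integral (f x - f c)) {c..x}"
      using x c by (intro fundamental_theorem_of_calculus)
        (auto intro!: has_vector_derivative_within_subset[OF d])
    from integral_unique[OF this] show "f x = f c + integral {c..x} f'" by simp
    have "f' x - f' c = integral {c..1} f'' - integral {x..1} f''" using f'eq[OF x] f'eq[of c] c by simp
    also have "\<dots> = integral {c..x} f''"
      using Henstock_Kurzweil_Integration.integral_combine[of c x 1 f''] x i by (simp add: algebra_simps)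
    also have "\<dots> = integral {c..x} (\<lambda>t. (pot t - z) * f t)"
    proof (rule integral_spike)
      show "negligible (N \<union> {1})" using N by simp
    qed (use eq x c in auto)
    finally show "f' x = f' c + integral {c..x} (\<lambda>t. (pot t - z) * f t)" by (simp add: algebra_simps)
  qed
qed

lemma sl_solution_scale:
  assumes "sl_solution l q z f f'"
  shows "sl_solution l q z (\<lambda>x. k * f x) (\<lambda>x. k * f' x)"
proof -
  obtain f'' where d: "\<And>x. x \<in> {0<..1} \<Longrightarrow> (f has_vector_derivative f' x) (at x within {0<..1})"
    and f''i: "\<And>x. x \<in> {0<..1} \<Longrightarrow> f'' absolutely_integrable_on {x..1}"
    and f'': "\<And>x. x \<in> {0<..1} \<Longrightarrow> f' 1 - f' x = integral {x..1} f''"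
    and ae: "AE x in lebesgue. x \<in> {0<..<1} \<longrightarrow>
               - f'' x + of_real (l * (l + 1) / x\<^sup>2) * f x + of_real (q x) * f x = z * f x"
    using assms unfolding sl_solution_def by blast
  have "\<forall>x\<in>{0<..1}. ((\<lambda>x. k * f x) has_vector_derivative k * f' x) (at x within {0<..1})"
    using d by (auto intro: has_vector_derivative_mult_right)
  moreover have "\<forall>x\<in>{0<..1}. (\<lambda>x. k * f'' x) absolutely_integrable_on {x..1} \<and>
      k * f' 1 - k * f' x = integral {x..1} (\<lambda>x. k * f'' x)"
    using f''i f'' by (auto simp flip: right_diff_distrib intro: set_integrable_mult_right)
  moreover have "AE x in lebesgue. x \<in> {0<..<1} \<longrightarrow>
               - (k * f'' x) + of_real (l * (l + 1) / x\<^sup>2) * (k * f x) + of_real (q x) * (k * f x) = z * (k * f x)"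
    using ae
  proof eventually_elim
    case (elim x)
    show ?case
    proof
      assume "x \<in> {0<..<1}"
      then have "k * (- f'' x + of_real (l * (l + 1) / x\<^sup>2) * f x + of_real (q x) * f x) = k * (z * f x)"
        using elim by simp
      then show "- (k * f'' x) + of_real (l * (l + 1) / x\<^sup>2) * (k * f x) + of_real (q x) * (k * f x) = z * (k * f x)"
        by (simp add: algebra_simps)
    qed
  qed
  ultimately show ?thesis unfolding sl_solution_def by blast
qed

text \<open>
  \<open>(bc0, bc1)\<close> are the values at \<open>1\<close> of \<open>\<psi>\<close> and \<open>\<psi>'\<close>. They treat the Dirichlet condition along with the others.
\<close>
definition bc0 :: "ereal \<Rightarrow> complex" where "bc0 \<beta> = (if \<beta> = \<infinity> then 0 else 1)"
definition bc1 :: "ereal \<Rightarrow> complex" where "bc1 \<beta> = (if \<beta> = \<infinity> then - 1 else - of_real (real_of_ereal \<beta>))"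

text \<open>
  Eigenfunctions are multiples of \<open>\<phi>\<close> by \<open>regular_unique\<close>. So \<open>\<phi>\<close> satisfies the boundary condition, and it is a
  multiple of \<open>\<psi>\<close> because both solve the same problem at \<open>1\<close>; the factor \<open>k\<close> enters the norming constant.
\<close>
lemma eigenvalue_phi:
  assumes "z \<in> sl_spectrum l q \<beta>"
  obtains k where "k \<noteq> 0" "phi z 1 = k * bc0 \<beta>" "phi' z 1 = k * bc1 \<beta>"
    "integral {0..1} (\<lambda>x. (norm (phi z x))\<^sup>2) = (norm k)\<^sup>2 * norming_const l q \<beta> z"
proof -
  obtain f f' c x0 where f: "sl_solution l q z f f'" and x0: "x0 \<in> {0<..1}" "f x0 \<noteq> 0"
    and lim: "((\<lambda>x. f x / of_real (x powr (l + 1))) \<longlongrightarrow> c) (at_right 0)"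
    and bc: "if \<beta> = \<infinity> then f 1 = 0 else f' 1 + of_real (real_of_ereal \<beta>) * f 1 = 0"
    using assms unfolding sl_spectrum_def by blast
  note fs = sl_solution_solves[OF f]
  have f_eq: "f x = c * phi z x" "f' x = c * phi' z x" if "0 < x" "x \<le> 1" for x
    using regular_unique[OF fs lim that] by auto
  have "c \<noteq> 0" using x0 f_eq(1)[of x0] by auto
  define k where "k = (if \<beta> = \<infinity> then - phi' z 1 else phi z 1)"
  have bcphi: "phi z 1 = k * bc0 \<beta>" "phi' z 1 = k * bc1 \<beta>"
  proof -
    have *: "if \<beta> = \<infinity> then c * phi z 1 = 0 else c * (phi' z 1 + of_real (real_of_ereal \<beta>) * phi z 1) = 0"
      using bc f_eq[of 1] by (simp add: algebra_simps split: if_splits)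
    then show "phi z 1 = k * bc0 \<beta>" using \<open>c \<noteq> 0\<close> by (auto simp: k_def bc0_def)
    show "phi' z 1 = k * bc1 \<beta>"
    proof (cases "\<beta> = \<infinity>")
      case False
      then have "phi' z 1 + of_real (real_of_ereal \<beta>) * phi z 1 = 0" using * \<open>c \<noteq> 0\<close> by simp
      then show ?thesis using False by (simp add: k_def bc1_def eq_neg_iff_add_eq_0 mult.commute)
    qed (simp add: k_def bc1_def)
  qed
  have k0: "k \<noteq> 0" using phi_end_data_nonzero[of 1 z] bcphi by auto
  have "\<exists>f. \<exists>f'. sl_solution l q z f f' \<and> (if \<beta> = \<infinity> then f 1 = 0 \<and> f' 1 = -1
         else f 1 = 1 \<and> f' 1 = - of_real (real_of_ereal \<beta>))"
  proof (intro exI conjI)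
    show "sl_solution l q z (\<lambda>x. (1 / (c * k)) * f x) (\<lambda>x. (1 / (c * k)) * f' x)"
      by (rule sl_solution_scale[OF f])
    show "if \<beta> = \<infinity> then 1 / (c * k) * f 1 = 0 \<and> 1 / (c * k) * f' 1 = -1
         else 1 / (c * k) * f 1 = 1 \<and> 1 / (c * k) * f' 1 = - of_real (real_of_ereal \<beta>)"
      using f_eq[of 1] bcphi k0 \<open>c \<noteq> 0\<close> by (simp add: bc0_def bc1_def)
  qed
  \<comment> \<open>only the property that defines the chosen \<open>\<psi>\<close> is known, so its values on \<open>(0,1]\<close> are compared with those of \<open>\<phi>\<close>\<close>
  from someI_ex[OF this] obtain \<psi>' where \<psi>: "sl_solution l q z (sl_psi l q \<beta> z) \<psi>'"
    and \<psi>1: "if \<beta> = \<infinity> then sl_psi l q \<beta> z 1 = 0 \<and> \<psi>' 1 = -1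
         else sl_psi l q \<beta> z 1 = 1 \<and> \<psi>' 1 = - of_real (real_of_ereal \<beta>)"
    unfolding sl_psi_def by blast
  have eq: "phi z x = k * sl_psi l q \<beta> z x" if x: "0 < x" "x \<le> 1" for x
  proof -
    have "phi z x - k * sl_psi l q \<beta> z x = 0"
    proof (rule solves_zero_end_data[OF solves_diff_scaled[OF phi_solves sl_solution_solves[OF \<psi>]] x order_refl])
      show "phi z 1 - k * sl_psi l q \<beta> z 1 = 0" "phi' z 1 - k * \<psi>' 1 = 0"
        using \<psi>1 bcphi by (auto simp: bc0_def bc1_def split: if_splits)
    qed (use x in auto)
    then show ?thesis by simp
  qed
  have "integral {0..1} (\<lambda>x. (norm (phi z x))\<^sup>2) = integral {0<..<1} (\<lambda>x. (norm (phi z x))\<^sup>2)"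
    by (rule integral_open_interval_real)
  also have "\<dots> = integral {0<..<1} (\<lambda>x. (norm k)\<^sup>2 * (norm (sl_psi l q \<beta> z x))\<^sup>2)"
    by (intro Henstock_Kurzweil_Integration.integral_cong) (simp add: eq norm_mult power_mult_distrib)
  also have "\<dots> = (norm k)\<^sup>2 * norming_const l q \<beta> z" by (simp add: norming_const_def)
  finally show thesis by (intro that[OF k0 bcphi])
qed

lemma phi_green:
  "phi' z 1 * phi \<mu> 1 - phi z 1 * phi' \<mu> 1 = (\<mu> - z) * integral {0..1} (\<lambda>t. phi z t * phi \<mu> t)"
proof -
  have "phi' z 1 * phi \<mu> 1 - phi z 1 * phi' \<mu> 1 = integral {0..1} (\<lambda>t. (\<mu> - z) * (phi z t * phi \<mu> t))"
    by (rule wronskian_from_0[OF phi_regular phi_regular l, where V = "\<lambda>t. pot t - z" and U = "\<lambda>t. pot t - \<mu>"])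
      (auto intro!: phi_solves absolutely_integrable_continuous_real continuous_intros)
  then show ?thesis by simp
qed

lemma phi_product_integral_continuous:
  "((\<lambda>\<mu>. integral {0..1} (\<lambda>t. phi z t * phi \<mu> t)) \<longlongrightarrow> integral {0..1} (\<lambda>t. phi z t * phi z t)) (at z)"
  unfolding tendsto_at_iff_sequentially
proof (intro allI impI, unfold o_def)
  fix X :: "nat \<Rightarrow> complex" assume "X \<longlonglongrightarrow> z"
  then have "Bseq X" by (intro convergent_imp_Bseq convergentI)
  then obtain m where m: "\<And>n. norm (X n) \<le> m" unfolding Bseq_def by blast
  obtain C where C: "\<And>z x. norm z \<le> m \<Longrightarrow> x \<in> {0..1} \<Longrightarrow> norm (phi z x) \<le> C"
    using phi_locally_bounded by blast
  obtain D where D: "\<And>x. x \<in> {0..1} \<Longrightarrow> norm (phi z x) \<le> D"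
    using phi_locally_bounded[of "norm z"] by blast
  show "(\<lambda>n. integral {0..1} (\<lambda>t. phi z t * phi (X n) t)) \<longlonglongrightarrow> integral {0..1} (\<lambda>t. phi z t * phi z t)"
  proof (rule dominated_convergence(2))
    show "(\<lambda>t. phi z t * phi (X n) t) integrable_on {0..1}" for n
      by (intro integrable_continuous_real continuous_intros phi_cont)
    show "(\<lambda>_. D * C) integrable_on {0..1::real}" by auto
    show "norm (phi z x * phi (X n) x) \<le> D * C" if x: "x \<in> {0..1}" for n x
    proof -
      have "D \<ge> 0" using D[OF x] norm_ge_zero order_trans by blast
      then show ?thesis unfolding norm_mult by (intro mult_mono D C m x) auto
    qed
    fix x :: real assume x: "x \<in> {0..1}"
    have "continuous_on UNIV (\<lambda>z. phi z x)" by (rule holomorphic_on_imp_continuous_on[OF phi_hol[OF x]])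
    then have "(\<lambda>n. phi (X n) x) \<longlonglongrightarrow> phi z x"
      using \<open>X \<longlonglongrightarrow> z\<close> continuous_on_tendsto_compose[of UNIV "\<lambda>z. phi z x" X z sequentially] by simp
    then show "(\<lambda>n. phi z x * phi (X n) x) \<longlonglongrightarrow> phi z x * phi z x" by (intro tendsto_intros)
  qed
qed

end

section \<open>Zeros and growth of entire functions\<close>

text \<open>
  The sum has the period \<open>\<pi>/N\<close> in \<open>\<alpha>\<close>. For \<open>0 \<le> \<alpha> \<le> \<pi>/N\<close> all sines are nonnegative, and the sum telescopes after
  multiplication by \<open>2 sin (\<pi>/(2N))\<close>.
\<close>
lemma sum_abs_sin_le:
  assumes N: "N > 0" and "0 \<le> \<alpha>"
  shows "(\<Sum>j<N. \<bar>sin (\<alpha> + pi * real j / real N)\<bar>) \<le> 1 / sin (pi / (2 * real N))"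
proof -
  define S where "S \<alpha> = (\<Sum>j<N. \<bar>sin (\<alpha> + pi * real j / real N)\<bar>)" for \<alpha>
  have shift: "S (\<alpha> + pi / N) = S \<alpha>" for \<alpha>
  proof -
    define f where "f j = \<bar>sin (\<alpha> + pi * real j / real N)\<bar>" for j
    have fN: "f N = f 0" using N by (simp add: f_def)
    have "S (\<alpha> + pi / N) = (\<Sum>j<N. f (Suc j))"
      unfolding S_def f_def using N by (intro sum.cong) (auto simp: field_simps)
    also have "f 0 + \<dots> = (\<Sum>j<N. f j) + f N" by (metis sum.lessThan_Suc sum.lessThan_Suc_shift)
    finally show ?thesis using fN by (simp add: S_def f_def)
  qed
  have shifts: "S (\<alpha> + pi * real m / N) = S \<alpha>" for \<alpha> m
  proof (induction m)
    case (Suc m)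
    have "\<alpha> + pi * real (Suc m) / N = (\<alpha> + pi * real m / N) + pi / N"
      by (simp add: distrib_left add_divide_distrib)
    then show ?case using shift[of "\<alpha> + pi * real m / N"] Suc by metis
  qed simp
  have base: "S \<alpha> \<le> 1 / sin (pi / (2 * real N))" if \<alpha>: "0 \<le> \<alpha>" "\<alpha> \<le> pi / N" for \<alpha>
  proof -
    define h where "h = pi / (2 * real N)"
    have "h > 0" using N by (simp add: h_def)
    moreover have "h < pi" using N pi_gt_zero mult_left_mono[of 1 "real N" pi] by (simp add: h_def divide_less_eq)
    ultimately have sh: "sin h > 0" by (rule sin_gt_zero)
    define g where "g j = cos (\<alpha> + pi * real j / N - h)" for j
    have "S \<alpha> * (2 * sin h) = (\<Sum>j<N. g j - g (Suc j))"
      unfolding S_def sum_distrib_right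
    proof (rule sum.cong)
      fix j assume j: "j \<in> {..<N}"
      define x where "x = \<alpha> + pi * real j / N"
      have "pi * real j + pi \<le> pi * N" using j mult_left_mono[of "real j + 1" "real N" pi]
        by (simp add: distrib_left)
      then have "pi * real j / N + pi / N \<le> pi" using N by (simp add: field_simps)
      then have "0 \<le> x" "x \<le> pi" using \<alpha> by (auto simp: x_def)
      then have "\<bar>sin x\<bar> = sin x" using sin_ge_zero by simp
      moreover have "\<alpha> + pi * real (Suc j) / N - h = x + h" using N by (simp add: x_def h_def field_simps)
      ultimately show "\<bar>sin (\<alpha> + pi * real j / real N)\<bar> * (2 * sin h) = g j - g (Suc j)"
        unfolding g_def x_def[symmetric] by (simp only: cos_diff cos_add)
    qed simp
    also have "\<dots> = g 0 - g N" using sum_lessThan_telescope'[of g N] .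
    also have "\<dots> \<le> 1 - (-1)" unfolding g_def by (intro diff_mono) auto
    finally have "S \<alpha> \<le> 1 / sin h" using sh by (simp add: field_simps)
    then show ?thesis by (simp only: h_def)
  qed
  define m where "m = nat \<lfloor>\<alpha> * N / pi\<rfloor>"
  have "real m \<le> \<alpha> * N / pi" "\<alpha> * N / pi \<le> real m + 1"
    using assms by (auto simp: m_def)
  then have "pi * m \<le> \<alpha> * N" "\<alpha> * N \<le> pi * m + pi"
    by (simp_all add: pos_le_divide_eq pos_divide_le_eq algebra_simps)
  then have "pi * m / N \<le> \<alpha>" "\<alpha> \<le> (pi * m + pi) / N"
    using N by (simp_all add: pos_le_divide_eq pos_divide_le_eq)
  then have "0 \<le> \<alpha> - pi * m / N" "\<alpha> - pi * m / N \<le> pi / N"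
    by (simp_all add: add_divide_distrib)
  from base[OF this] shifts[of "\<alpha> - pi * m / N" m] show ?thesis by (simp add: S_def)
qed

text \<open>
  The function \<open>\<bar>sin (\<theta>/2)\<bar>\<close> has mean \<open>2/\<pi>\<close>. Instead of the mean value inequality for \<open>log \<bar>g\<bar>\<close>, the maximum
  principle is applied to the product of \<open>N\<close> rotated copies of \<open>g\<close>; the average over the rotations becomes the mean
  as \<open>N \<rightarrow> \<infinity>\<close>, and zeros of \<open>g\<close> do no harm.
\<close>
lemma maximum_modulus_averaged:
  assumes g: "g holomorphic_on ball 0 \<rho>'" and \<rho>: "0 < \<rho>" "\<rho> < \<rho>'" and "c \<ge> 0"
    and bound: "\<And>\<theta>. norm (g (of_real \<rho> * cis \<theta>)) \<le> exp (B + c * \<bar>sin (\<theta> / 2)\<bar>)"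
  shows "norm (g 0) \<le> exp (B + 2 * c / pi)"
proof -
  have N_bound: "norm (g 0) \<le> exp (B + c * (1 / (real N * sin (pi / (2 * real N)))))" if N: "N > 0" for N :: nat
  proof -
    define H where "H z = (\<Prod>j<N. g (z * cis (2 * pi * real j / N)))" for z
    have "(\<lambda>z. g (z * cis t)) holomorphic_on ball 0 \<rho>'" for t
    proof -
      have "(g \<circ> (\<lambda>z. z * cis t)) holomorphic_on ball 0 \<rho>'"
        by (rule holomorphic_on_compose_gen[OF _ g]) (auto intro!: holomorphic_intros simp: norm_mult)
      then show ?thesis by (simp add: o_def)
    qed
    then have H: "H holomorphic_on ball 0 \<rho>'" unfolding H_def by (intro holomorphic_intros)
    have "norm (H 0) \<le> exp (real N * B + c * (1 / sin (pi / (2 * real N))))"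
    proof (rule maximum_modulus_frontier[where f = H and \<xi> = 0 and S = "cball 0 \<rho>"])
      have sub: "cball 0 \<rho> \<subseteq> ball 0 \<rho>'" using \<rho> by auto
      show "H holomorphic_on interior (cball 0 \<rho>)"
        by (rule holomorphic_on_subset[OF H order_trans[OF interior_subset sub]])
      show "continuous_on (closure (cball 0 \<rho>)) H"
        using holomorphic_on_imp_continuous_on[OF holomorphic_on_subset[OF H sub]] by simp
      fix z assume "z \<in> frontier (cball (0::complex) \<rho>)"
      then have "norm z = \<rho>" using \<rho> by (simp add: frontier_cball)
      define \<theta> where "\<theta> = Arg2pi z"
      have z: "z = of_real \<rho> * cis \<theta>" and \<theta>: "\<theta> \<ge> 0"
        using complex_norm_eq_1_exp[of 1] Arg2pi[of z] \<open>norm z = \<rho>\<close>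
        by (auto simp: \<theta>_def cis_conv_exp mult.commute is_Arg_def)
      have "norm (H z) = (\<Prod>j<N. norm (g (of_real \<rho> * cis (\<theta> + 2 * pi * real j / N))))"
        unfolding H_def z prod_norm[symmetric] by (simp add: mult.assoc cis_mult)
      also have "\<dots> \<le> (\<Prod>j<N. exp (B + c * \<bar>sin (\<theta> / 2 + pi * real j / N)\<bar>))"
      proof (intro prod_mono conjI)
        fix j
        have "(\<theta> + 2 * pi * real j / N) / 2 = \<theta> / 2 + pi * real j / N" by (simp add: field_simps)
        then show "norm (g (of_real \<rho> * cis (\<theta> + 2 * pi * real j / N))) \<le> exp (B + c * \<bar>sin (\<theta> / 2 + pi * real j / N)\<bar>)"
          using bound[of "\<theta> + 2 * pi * real j / N"] by (simp only:)
      qed auto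
      also have "\<dots> = exp (real N * B + c * (\<Sum>j<N. \<bar>sin (\<theta> / 2 + pi * real j / N)\<bar>))"
        by (simp add: exp_sum[symmetric] sum.distrib sum_distrib_left)
      also have "\<dots> \<le> exp (real N * B + c * (1 / sin (pi / (2 * real N))))"
        using sum_abs_sin_le[OF N, of "\<theta> / 2"] \<theta> \<open>c \<ge> 0\<close> by (simp add: mult_left_mono del: times_divide_eq_right)
      finally show "norm (H z) \<le> exp (real N * B + c * (1 / sin (pi / (2 * real N))))" .
    qed (use \<rho> in auto)
    moreover have "norm (H 0) = norm (g 0) ^ N" by (simp add: H_def norm_power)
    moreover have "exp (real N * B + c * (1 / sin (pi / (2 * real N))))
         = exp (B + c * (1 / (real N * sin (pi / (2 * real N))))) ^ N"
      unfolding exp_of_nat_mult[symmetric] using N by (simp add: distrib_left)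
    ultimately have "norm (g 0) ^ N \<le> exp (B + c * (1 / (real N * sin (pi / (2 * real N))))) ^ N" by simp
    then show ?thesis using N by (simp add: power_mono_iff)
  qed
  have "(\<lambda>N. 1 / (real N * sin (pi / (2 * real N)))) \<longlonglongrightarrow> 2 / pi" by real_asymp
  then have "(\<lambda>N. exp (B + c * (1 / (real N * sin (pi / (2 * real N)))))) \<longlonglongrightarrow> exp (B + c * (2 / pi))"
    by (intro tendsto_exp tendsto_add tendsto_mult tendsto_const)
  then have "norm (g 0) \<le> exp (B + c * (2 / pi))"
    by (rule LIMSEQ_le_const) (use N_bound in \<open>auto intro!: exI[of _ 1]\<close>)
  then show ?thesis by (simp add: mult.commute)
qed

text \<open>
  As in the proof of Jensen's formula, each factor \<open>z - w\<close> is replaced by \<open>(\<rho>\<^sup>2 - cnj w z)/\<rho>\<close>, which has the same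
  modulus on the circle and the value \<open>\<rho>\<close> at \<open>0\<close>.
\<close>
lemma jensen_inequality:
  assumes g: "g holomorphic_on ball 0 \<rho>'" and \<rho>: "0 < \<rho>" "\<rho> < \<rho>'" and "c \<ge> 0"
    and bound: "\<And>\<theta>. norm (g (of_real \<rho> * cis \<theta>) * (\<Prod>w\<in>A. (of_real \<rho> * cis \<theta> - w) ^ m w))
                    \<le> exp (B + c * \<bar>sin (\<theta> / 2)\<bar>)"
  shows "norm (g 0) * (\<Prod>w\<in>A. \<rho> ^ m w) \<le> exp (B + 2 * c / pi)"
proof -
  define G where "G z = g z * (\<Prod>w\<in>A. ((of_real (\<rho>\<^sup>2) - cnj w * z) / of_real \<rho>) ^ m w)" for z
  have "G holomorphic_on ball 0 \<rho>'"
    unfolding G_def using \<rho> by (intro holomorphic_intros g) auto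
  moreover have "norm (G (of_real \<rho> * cis \<theta>)) \<le> exp (B + c * \<bar>sin (\<theta> / 2)\<bar>)" for \<theta>
  proof -
    define z where "z = of_real \<rho> * cis \<theta>"
    have nz: "norm z = \<rho>" using \<rho> by (simp add: z_def norm_mult)
    have "norm ((of_real (\<rho>\<^sup>2) - cnj w * z) / of_real \<rho>) = norm (z - w)" for w
    proof -
      have "of_real (\<rho>\<^sup>2) - cnj w * z = z * cnj (z - w)"
        using complex_norm_square[of z] by (simp add: nz algebra_simps)
      then have "norm (of_real (\<rho>\<^sup>2) - cnj w * z) = \<rho> * norm (z - w)"
        using nz by (simp add: norm_mult flip: complex_cnj_diff)
      then show ?thesis using \<rho> by (simp add: norm_divide)
    qed
    then have "norm (G z) = norm (g z * (\<Prod>w\<in>A. (z - w) ^ m w))"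
      by (simp add: G_def norm_mult norm_power flip: prod_norm)
    then show ?thesis using bound[of \<theta>] by (simp add: z_def)
  qed
  ultimately have "norm (G 0) \<le> exp (B + 2 * c / pi)"
    by (rule maximum_modulus_averaged[OF _ \<rho> \<open>c \<ge> 0\<close>])
  moreover have "norm (G 0) = norm (g 0) * (\<Prod>w\<in>A. \<rho> ^ m w)"
    using \<rho> by (simp add: G_def norm_mult norm_power norm_divide power2_eq_square flip: prod_norm)
  ultimately show ?thesis by simp
qed

text \<open>The order of the zero is at least \<open>m\<close>.\<close>
definition vanishes_to_order :: "(complex \<Rightarrow> complex) \<Rightarrow> complex \<Rightarrow> nat \<Rightarrow> bool" where
  "vanishes_to_order f w m \<longleftrightarrow> (\<exists>g. g holomorphic_on UNIV \<and> (\<forall>z. f z = (z - w) ^ m * g z))"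

lemma vanishes_to_order_1:
  assumes "f holomorphic_on UNIV" "f w = 0"
  obtains g where "g holomorphic_on UNIV" "\<And>z. f z = (z - w) * g z"
proof (rule that)
  show "(\<lambda>z. if z = w then deriv f w else (f z - f w) / (z - w)) holomorphic_on UNIV"
    by (rule pole_lemma_open[OF assms(1) open_UNIV])
  show "f z = (z - w) * (if z = w then deriv f w else (f z - f w) / (z - w))" for z
    using assms(2) by simp
qed

lemma vanishes_to_order_2:
  assumes f: "f holomorphic_on UNIV" "f w = 0" "deriv f w = 0"
  shows "vanishes_to_order f w 2"
proof -
  obtain g where g: "g holomorphic_on UNIV" "\<And>z. f z = (z - w) * g z"
    using vanishes_to_order_1[OF f(1,2)] by blast
  have "(g has_field_derivative deriv g w) (at w)"
    using g(1) holomorphic_derivI by blast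
  then have "((\<lambda>z. (z - w) * g z) has_field_derivative g w) (at w)"
    by (auto intro!: derivative_eq_intros)
  moreover have "f = (\<lambda>z. (z - w) * g z)" by (rule ext) (rule g(2))
  ultimately have "(f has_field_derivative g w) (at w)" by simp
  then have "g w = 0" using f(3) DERIV_imp_deriv by force
  then obtain h where "h holomorphic_on UNIV" "\<And>z. g z = (z - w) * h z"
    using vanishes_to_order_1[OF g(1)] by blast
  then show ?thesis unfolding vanishes_to_order_def using g(2) by (auto simp: power2_eq_square)
qed

lemma vanishes_to_order_cofactor:
  assumes h: "h holomorphic_on UNIV" and f: "\<And>z. f z = (z - w') ^ n * h z" and "w \<noteq> w'"
    and zero: "vanishes_to_order f w m"
  shows "vanishes_to_order h w m"
proof -
  obtain g where g: "g holomorphic_on UNIV" "\<And>z. f z = (z - w) ^ m * g z"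
    using zero unfolding vanishes_to_order_def by blast
  have "j \<le> m \<Longrightarrow> vanishes_to_order h w j" for j
  proof (induction j)
    case 0
    then show ?case unfolding vanishes_to_order_def using h by auto
  next
    case (Suc j)
    then obtain r where r: "r holomorphic_on UNIV" "\<And>z. h z = (z - w) ^ j * r z"
      unfolding vanishes_to_order_def by auto
    define k where "k z = (z - w') ^ n * r z - (z - w) ^ (m - j) * g z" for z
    have "k holomorphic_on UNIV" unfolding k_def by (intro holomorphic_intros r g)
    then have "isCont k w" using holomorphic_on_imp_continuous_on continuous_on_eq_continuous_at by blast
    then have lim: "(k \<longlongrightarrow> k w) (at w)" by (simp add: isCont_def)
    have k0: "k z = 0" if "z \<noteq> w" for z
    proof -
      have "(z - w) ^ j * k z = (z - w') ^ n * h z - (z - w) ^ (j + (m - j)) * g z"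
        by (simp add: k_def r power_add algebra_simps)
      also have "\<dots> = 0" using f[of z] g(2)[of z] Suc.prems by simp
      finally show ?thesis using that by simp
    qed
    have "((\<lambda>_. 0) \<longlongrightarrow> k w) (at w)"
      by (rule Lim_transform_eventually[OF lim]) (auto simp: eventually_at_filter k0)
    then have "k w = 0" by (simp add: tendsto_const_iff)
    then have "r w = 0" using Suc.prems \<open>w \<noteq> w'\<close> by (simp add: k_def power_0_left)
    then obtain s where "s holomorphic_on UNIV" "\<And>z. r z = (z - w) * s z"
      using vanishes_to_order_1[OF r(1)] by blast
    then show ?case unfolding vanishes_to_order_def using r(2) by (auto intro!: exI[of _ s])
  qed
  then show ?thesis by blast
qed

lemma factor_out_zeros:
  assumes "finite A"
  shows "f holomorphic_on UNIV \<Longrightarrow> (\<And>w. w \<in> A \<Longrightarrow> vanishes_to_order f w (m w)) \<Longrightarrow>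
    \<exists>g. g holomorphic_on UNIV \<and> (\<forall>z. f z = g z * (\<Prod>w\<in>A. (z - w) ^ m w))"
  using assms
proof (induction A arbitrary: f rule: finite_induct)
  case empty
  then show ?case by auto
next
  case (insert w A)
  obtain h where h: "h holomorphic_on UNIV" "\<And>z. f z = (z - w) ^ m w * h z"
    using insert.prems(2)[of w] unfolding vanishes_to_order_def by auto
  have "vanishes_to_order h w' (m w')" if "w' \<in> A" for w'
    by (rule vanishes_to_order_cofactor[OF h]) (use that insert in auto)
  then obtain g where "g holomorphic_on UNIV" "\<And>z. h z = g z * (\<Prod>w\<in>A. (z - w) ^ m w)"
    using insert.IH[OF h(1)] by blast
  then show ?case using h(2) insert.hyps by (auto intro!: exI[of _ g] simp: algebra_simps)
qed

lemma order_at_0: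
  assumes f: "f holomorphic_on UNIV" and "f z0 \<noteq> 0"
  obtains n g where "g holomorphic_on UNIV" "g 0 \<noteq> (0::complex)" "\<And>z. f z = z ^ n * g z"
proof (cases "f 0 = 0")
  case False
  then show thesis using that[of f 0] f by simp
next
  case True
  obtain g r n where g: "0 < n" "0 < r" "g holomorphic_on ball 0 r"
      "\<And>w. w \<in> ball 0 r \<Longrightarrow> f w = (w - 0) ^ n * g w" "\<And>w. w \<in> ball 0 r \<Longrightarrow> g w \<noteq> 0"
  proof (rule holomorphic_factor_zero_nonconstant[OF f open_UNIV connected_UNIV _ True])
    show "\<not> f constant_on UNIV"
    proof
      assume "f constant_on UNIV"
      then obtain y where "\<And>x. f x = y" unfolding constant_on_def by blast
      then show False using True assms(2) by simp
    qed
  qed auto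
  define G where "G z = (if z = 0 then g 0 else f z / z ^ n)" for z
  have "G holomorphic_on ball 0 r"
    by (rule holomorphic_transform[OF g(3)]) (use g(4) in \<open>auto simp: G_def\<close>)
  moreover have "G holomorphic_on - {0}"
    by (rule holomorphic_transform[of "\<lambda>z. f z / z ^ n"])
      (auto simp: G_def intro!: holomorphic_intros holomorphic_on_subset[OF f])
  ultimately have "G holomorphic_on (ball 0 r \<union> - {0})"
    by (intro holomorphic_on_Un) auto
  moreover have "ball 0 r \<union> - {0::complex} = UNIV" using g(2) by auto
  ultimately have "G holomorphic_on UNIV" by simp
  moreover have "G 0 \<noteq> 0" using g(2,5) by (simp add: G_def)
  moreover have "f z = z ^ n * G z" for z using True g(1) by (simp add: G_def)
  ultimately show thesis by (rule that)
qed

text \<open>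
  The principle of Phragmen and Lindelof for functions of order \<open>1/2\<close>, proved as usual with the factor
  \<open>exp (- \<epsilon> (z + 1)\<^bsup>3/4\<^esup>)\<close>; any exponent between \<open>1/2\<close> and \<open>1\<close> makes it decay faster than the function grows while its
  modulus stays at most \<open>1\<close> in the half-plane.
\<close>
lemma half_plane_bound:
  assumes E: "E holomorphic_on UNIV" and growth: "\<And>z. norm (E z) \<le> C * exp (c * sqrt (norm z))"
    and axis: "\<And>y::real. norm (E (\<i> * y)) \<le> B" and "B > 0" and z0: "Re z0 \<ge> 0"
  shows "norm (E z0) \<le> B"
proof -
  define \<kappa> where "\<kappa> = cos (3/4 * (pi/2))"
  have \<kappa>: "\<kappa> > 0" unfolding \<kappa>_def by (intro cos_gt_zero) auto
  define \<psi> where "\<psi> z = (z + 1) powr (3/4 :: complex)" for z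
  have Re\<psi>: "Re (\<psi> z) \<ge> \<kappa> * norm z powr (3/4)" "Re (\<psi> z) \<ge> 0" if z: "Re z \<ge> 0" for z
  proof -
    have z1: "z + 1 \<noteq> 0" "Re (z + 1) > 0" using z by (auto simp: complex_eq_iff)
    have a: "\<bar>Im (Ln (z + 1))\<bar> < pi / 2" using Re_Ln_pos_lt[OF z1(1)] z1(2) by simp
    have ps: "\<psi> z = exp (of_real (3/4) * Ln (z + 1))" using z1 by (simp add: \<psi>_def powr_def)
    have "Re (\<psi> z) = exp (3/4 * ln (norm (z + 1))) * cos (3/4 * Im (Ln (z + 1)))"
      unfolding ps Re_exp using z1(1) by simp
    also have "exp (3/4 * ln (norm (z + 1))) = norm (z + 1) powr (3/4)" using z1(1) by (simp add: powr_def)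
    finally have R: "Re (\<psi> z) = norm (z + 1) powr (3/4) * cos (3/4 * Im (Ln (z + 1)))" .
    have "cos (3/4 * (pi/2)) \<le> cos \<bar>3/4 * Im (Ln (z + 1))\<bar>"
      using a by (intro cos_monotone_0_pi_le) auto
    then have cs: "\<kappa> \<le> cos (3/4 * Im (Ln (z + 1)))" by (simp only: cos_abs_real \<kappa>_def)
    have nz: "norm z \<le> norm (z + 1)" using z by (simp add: cmod_def power2_eq_square algebra_simps)
    have "\<kappa> * norm z powr (3/4) \<le> cos (3/4 * Im (Ln (z + 1))) * norm (z + 1) powr (3/4)"
      using \<kappa> cs nz by (intro mult_mono powr_mono2) auto
    then show "Re (\<psi> z) \<ge> \<kappa> * norm z powr (3/4)" using R by (simp add: mult.commute)
    then show "Re (\<psi> z) \<ge> 0" using \<kappa> by (smt (verit) mult_nonneg_nonneg powr_ge_zero)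
  qed
  have \<psi>hol: "\<psi> holomorphic_on {z. Re z > -1}"
    unfolding \<psi>_def by (intro holomorphic_intros) (auto simp: complex_nonpos_Reals_iff)
  have eps: "norm (E z0) * exp (- (\<epsilon> * Re (\<psi> z0))) \<le> B" if \<epsilon>: "\<epsilon> > 0" for \<epsilon>
  proof -
    define g where "g z = E z * exp (- (of_real \<epsilon> * \<psi> z))" for z
    have ng: "norm (g z) = norm (E z) * exp (- (\<epsilon> * Re (\<psi> z)))" for z
      by (simp add: g_def norm_mult)
    have ghol: "g holomorphic_on {z. Re z > -1}"
      unfolding g_def by (intro holomorphic_intros \<psi>hol holomorphic_on_subset[OF E]) auto
    have "((\<lambda>\<rho>. C * exp (c * sqrt \<rho> - (\<epsilon> * \<kappa>) * \<rho> powr (3/4))) \<longlongrightarrow> 0) at_top"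
    proof -
      have "((\<lambda>\<rho>. C * exp (c * sqrt \<rho> - e * \<rho> powr (3/4))) \<longlongrightarrow> 0) at_top" if "e > 0" for e :: real
        using that by real_asymp
      then show ?thesis using \<epsilon> \<kappa> by simp
    qed
    then have "\<forall>\<^sub>F \<rho> in at_top. C * exp (c * sqrt \<rho> - (\<epsilon> * \<kappa>) * \<rho> powr (3/4)) < B"
      using \<open>B > 0\<close> by (rule order_tendstoD)
    moreover have "\<forall>\<^sub>F \<rho> in at_top. \<rho> > norm z0 + 1" by (rule eventually_gt_at_top)
    ultimately have "\<forall>\<^sub>F \<rho> in at_top. C * exp (c * sqrt \<rho> - (\<epsilon> * \<kappa>) * \<rho> powr (3/4)) < B \<and> \<rho> > norm z0 + 1"
      by (rule eventually_conj)
    from eventually_happens'[OF trivial_limit_at_top_linorder this]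
    obtain \<rho> where \<rho>: "C * exp (c * sqrt \<rho> - (\<epsilon> * \<kappa>) * \<rho> powr (3/4)) < B" "\<rho> > norm z0 + 1"
      by blast
    have "\<rho> > 0" using \<rho>(2) norm_ge_zero[of z0] by linarith
    define S where "S = cball 0 \<rho> \<inter> {z. Re z \<ge> 0}"
    have Scl: "closed S" unfolding S_def by (intro closed_Int closed_cball closed_halfspace_Re_ge)
    have Ssub: "S \<subseteq> {z. Re z > -1}" unfolding S_def by auto
    have "norm (g z0) \<le> B"
    proof (rule maximum_modulus_frontier[where f = g and \<xi> = z0 and S = S])
      show "g holomorphic_on interior S"
        using holomorphic_on_subset[OF ghol] Ssub interior_subset by blast
      show "continuous_on (closure S) g"
        using holomorphic_on_imp_continuous_on[OF holomorphic_on_subset[OF ghol Ssub]] Scl by simp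
      show "bounded S" unfolding S_def by (intro bounded_Int) auto
      show "z0 \<in> S" using z0 \<rho> by (simp add: S_def)
      fix z assume z: "z \<in> frontier S"
      have "ball 0 \<rho> \<inter> {z. Re z > 0} \<subseteq> interior S"
        by (rule interior_maximal) (auto simp: S_def intro!: open_Int open_halfspace_Re_gt)
      then have zz: "z \<in> S" "z \<notin> ball 0 \<rho> \<inter> {z. Re z > 0}" using z Scl by (auto simp: frontier_def)
      then have Rez: "Re z \<ge> 0" by (simp add: S_def)
      show "norm (g z) \<le> B"
      proof (cases "Re z = 0")
        case True
        then have "z = \<i> * of_real (Im z)" by (simp add: complex_eq_iff)
        then have "norm (E z) \<le> B" using axis[of "Im z"] by metis
        moreover have "exp (- (\<epsilon> * Re (\<psi> z))) \<le> 1" using Re\<psi>(2)[OF Rez] \<epsilon> by simp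
        ultimately have "norm (E z) * exp (- (\<epsilon> * Re (\<psi> z))) \<le> B * 1" using \<open>B > 0\<close> by (intro mult_mono) auto
        then show ?thesis by (simp add: ng)
      next
        case False
        then have nz: "norm z = \<rho>" using zz by (auto simp: S_def)
        have "norm (g z) \<le> (C * exp (c * sqrt \<rho>)) * exp (- ((\<epsilon> * \<kappa>) * \<rho> powr (3/4)))"
          unfolding ng using growth[of z] Re\<psi>(1)[OF Rez] \<epsilon> unfolding nz
          by (intro mult_mono) (auto intro: order_trans[OF norm_ge_zero] simp: mult.assoc)
        also have "\<dots> < B" using \<rho>(1) by (simp add: exp_diff exp_minus field_simps)
        finally show ?thesis by simp
      qed
    qed
    then show ?thesis by (simp add: ng)
  qed
  have "((\<lambda>\<epsilon>. norm (E z0) * exp (- (\<epsilon> * Re (\<psi> z0)))) \<longlongrightarrow> norm (E z0) * exp (- (0 * Re (\<psi> z0)))) (at_right 0)"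
    by (intro tendsto_intros)
  then have lim: "((\<lambda>\<epsilon>. norm (E z0) * exp (- (\<epsilon> * Re (\<psi> z0)))) \<longlongrightarrow> norm (E z0)) (at_right 0)" by simp
  show ?thesis
    by (rule tendsto_upperbound[OF lim]) (auto simp: eventually_at_right_field intro!: exI[of _ 1] eps)
qed

text \<open>
  Both half-planes together make \<open>E\<close> bounded, hence constant, and the constant is the limit along the axis.
\<close>
lemma entire_order_half_vanishing_on_axis:
  assumes E: "E holomorphic_on UNIV" and growth: "\<And>z. norm (E z) \<le> C * exp (c * sqrt (norm z))"
    and lim: "\<And>s. s \<in> {1, -1} \<Longrightarrow> ((\<lambda>y::real. E (\<i> * of_real (s * y))) \<longlongrightarrow> 0) at_top"
  shows "E z = 0"
proof -
  have "\<exists>Y. \<forall>y\<ge>Y. norm (E (\<i> * of_real (s * y))) \<le> 1" if "s \<in> {1, -1}" for s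
  proof -
    have "\<forall>\<^sub>F y in at_top. norm (E (\<i> * of_real (s * y))) < 1"
      using tendsto_norm_zero[OF lim[OF that]] by (rule order_tendstoD) simp
    then show ?thesis unfolding eventually_at_top_linorder by (meson less_imp_le)
  qed
  then obtain Y1 Y2 where Y: "\<And>y. y \<ge> Y1 \<Longrightarrow> norm (E (\<i> * of_real (1 * y))) \<le> 1"
    "\<And>y. y \<ge> Y2 \<Longrightarrow> norm (E (\<i> * of_real (-1 * y))) \<le> 1"
    by (metis insertCI)
  define B where "B = max 1 (C * exp (\<bar>c\<bar> * sqrt (max \<bar>Y1\<bar> \<bar>Y2\<bar>)))"
  have "norm (E 0) \<le> C * exp (c * sqrt (norm (0::complex)))" by (rule growth)
  then have "norm (E 0) \<le> C" by simp
  then have C0: "C \<ge> 0" using norm_ge_zero[of "E 0"] by linarith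
  have axis: "norm (E (\<i> * of_real y)) \<le> B" for y
  proof (cases "\<bar>y\<bar> \<le> max \<bar>Y1\<bar> \<bar>Y2\<bar>")
    case True
    have "norm (E (\<i> * of_real y)) \<le> C * exp (c * sqrt \<bar>y\<bar>)" using growth[of "\<i> * of_real y"] by (simp add: norm_mult)
    also have "c * sqrt \<bar>y\<bar> \<le> \<bar>c\<bar> * sqrt (max \<bar>Y1\<bar> \<bar>Y2\<bar>)" using True by (intro mult_mono) auto
    finally show ?thesis using C0 by (auto simp: B_def mult_left_mono le_max_iff_disj)
  next
    case False
    then have "y \<ge> Y1 \<or> - y \<ge> Y2" by (auto simp: abs_if max_def split: if_splits)
    then have "norm (E (\<i> * of_real y)) \<le> 1" using Y(1)[of y] Y(2)[of "- y"] by auto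
    then show ?thesis by (simp add: B_def)
  qed
  have B: "B > 0" by (simp add: B_def)
  have "norm (E z) \<le> B" for z
  proof (cases "Re z \<ge> 0")
    case True
    show ?thesis by (rule half_plane_bound[OF E growth axis B True])
  next
    case False
    have "norm ((\<lambda>z. E (- z)) (- z)) \<le> B"
    proof (rule half_plane_bound[where E = "\<lambda>z. E (- z)" and C = C and c = c])
      have "(E \<circ> uminus) holomorphic_on UNIV" by (intro holomorphic_on_compose_gen[OF _ E] holomorphic_intros) auto
      then show "(\<lambda>z. E (- z)) holomorphic_on UNIV" by (simp add: o_def)
      show "norm (E (- z)) \<le> C * exp (c * sqrt (norm z))" for z using growth[of "- z"] by simp
      show "norm (E (- (\<i> * of_real y))) \<le> B" for y using axis[of "- y"] by simp
    qed (use False B in auto)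
    then show ?thesis by simp
  qed
  then have "bounded (range E)" unfolding bounded_iff by auto
  with E have "E constant_on UNIV" using Liouville_theorem constant_on_def by (metis UNIV_I)
  then obtain k where k: "\<And>z. E z = k" unfolding constant_on_def by blast
  have "((\<lambda>y::real. k) \<longlongrightarrow> 0) at_top" using lim[of 1] by (simp add: k)
  then have "k = 0" by (simp add: tendsto_const_iff)
  then show ?thesis by (simp add: k)
qed

section \<open>Decay of exponentially weighted integrals\<close>

text \<open>
  This is what remains of \<open>\<integral> v \<phi> \<phi>\<^sub>h\<close> after the growth \<open>exp (2 \<tau> a)\<close> of the two solutions at \<open>a\<close> has been split off. The
  lower end point is a parameter because only a neighbourhood of \<open>a\<close> matters for the decay in \<open>\<tau>\<close>.
\<close>
definition exp_weighted :: "real \<Rightarrow> real \<Rightarrow> (real \<Rightarrow> real) \<Rightarrow> real \<Rightarrow> real" where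
  "exp_weighted b a v \<tau> = integral {b..a} (\<lambda>x. \<bar>v x\<bar> * exp (- (2 * \<tau> * (a - x))))"

lemma exp_weighted_integrable:
  fixes v :: "real \<Rightarrow> real"
  assumes "v absolutely_integrable_on {b..a}"
  shows "(\<lambda>x. \<bar>v x\<bar> * exp (- (2 * \<tau> * (a - x)))) absolutely_integrable_on {b..a}"
  using norm_absolutely_integrable[OF assms]
  by (intro absolutely_integrable_mult_continuous continuous_intros) simp

lemma exp_integral_le:
  assumes "b \<le> a" "\<tau> > (0::real)"
  shows "integral {b..a} (\<lambda>x. exp (- (\<tau> * (a - x)))) \<le> 1 / \<tau>"
proof -
  have "((\<lambda>x. exp (- (\<tau> * (a - x)))) has_integral (exp (- (\<tau> * (a - a))) / \<tau> - exp (- (\<tau> * (a - b))) / \<tau>)) {b..a}"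
    using assms by (intro fundamental_theorem_of_calculus)
      (auto intro!: derivative_eq_intros simp flip: has_real_derivative_iff_has_vector_derivative)
  then have "integral {b..a} (\<lambda>x. exp (- (\<tau> * (a - x)))) = 1 / \<tau> - exp (- (\<tau> * (a - b))) / \<tau>"
    by (simp add: integral_unique)
  also have "\<dots> \<le> 1 / \<tau>" using assms by simp
  finally show ?thesis .
qed

text \<open>
  \<open>\<bar>u\<bar>\<close> is at most the integral of \<open>\<bar>v\<bar>\<close> from \<open>x\<close> to \<open>a\<close>, and the weight divided by \<open>2 \<tau>\<close> is a primitive of the weight. When
  these two are integrated by parts, one boundary term vanishes and the other is negative.
\<close>
lemma exp_weighted_primitive:
  assumes "b \<le> a" and v: "v absolutely_integrable_on {b..a}" and \<tau>: "\<tau> > 0"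
    and u: "AE x in lebesgue. x \<in> {b<..<a} \<longrightarrow> u x = - integral {x..a} v"
  shows "exp_weighted b a u \<tau> \<le> exp_weighted b a v \<tau> / (2 * \<tau>)"
proof -
  define H where "H x = integral {x..a} (\<lambda>t. \<bar>v t\<bar>)" for x
  have av: "(\<lambda>t. \<bar>v t\<bar>) absolutely_integrable_on {b..a}" using norm_absolutely_integrable[OF v] by simp
  then have avi: "(\<lambda>t. \<bar>v t\<bar>) integrable_on {b..a}" using set_lebesgue_integral_eq_integral(1) by blast
  have vi: "v integrable_on {b..a}" using v set_lebesgue_integral_eq_integral(1) by blast
  have Hc: "continuous_on {b..a} H" unfolding H_def by (rule indefinite_integral_continuous_1'[OF avi])
  have Hrep: "H t = H b + integral {b..t} (\<lambda>t. - \<bar>v t\<bar>)" if "t \<in> {b..a}" for t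
    using Henstock_Kurzweil_Integration.integral_combine[of b t a "\<lambda>t. \<bar>v t\<bar>"] avi that by (simp add: H_def)
  define E where "E x = exp (- (2 * \<tau> * (a - x))) / (2 * \<tau>)" for x
  have Erep: "E t = E b + integral {b..t} (\<lambda>x. exp (- (2 * \<tau> * (a - x))))" if "t \<in> {b..a}" for t
  proof -
    have "((\<lambda>x. exp (- (2 * \<tau> * (a - x)))) has_integral (E t - E b)) {b..t}"
      unfolding E_def using that \<tau> by (intro fundamental_theorem_of_calculus)
        (auto intro!: derivative_eq_intros simp flip: has_real_derivative_iff_has_vector_derivative)
    from integral_unique[OF this] show ?thesis by simp
  qed
  have mav: "(\<lambda>t. - \<bar>v t\<bar>) absolutely_integrable_on {b..a}"
    using set_integrable_mult_right[OF av, of "-1"] by simp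
  have ei: "(\<lambda>x. exp (- (2 * \<tau> * (a - x)))) absolutely_integrable_on {b..a}"
    by (intro absolutely_integrable_continuous_real continuous_intros)
  have parts: "H a * E a - H b * E b = integral {b..a} (\<lambda>t. - \<bar>v t\<bar> * E t + H t * exp (- (2 * \<tau> * (a - t))))"
    by (rule integral_by_parts_L1(1)[OF \<open>b \<le> a\<close> mav ei Hrep Erep])
  have i1: "(\<lambda>t. - \<bar>v t\<bar> * E t) integrable_on {b..a}"
    unfolding E_def by (intro set_lebesgue_integral_eq_integral(1) absolutely_integrable_mult_continuous mav continuous_intros)
      (use \<tau> in auto)
  have i2: "(\<lambda>t. H t * exp (- (2 * \<tau> * (a - t)))) integrable_on {b..a}"
    by (intro integrable_continuous_real continuous_intros Hc)
  have Hb: "H b \<ge> 0" unfolding H_def by (intro Henstock_Kurzweil_Integration.integral_nonneg avi) auto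
  have "H a = 0" by (simp add: H_def)
  with parts have "integral {b..a} (\<lambda>t. H t * exp (- (2 * \<tau> * (a - t))))
       = - (H b * E b) - integral {b..a} (\<lambda>t. - \<bar>v t\<bar> * E t)"
    using Henstock_Kurzweil_Integration.integral_add[OF i1 i2] by simp
  also have "\<dots> \<le> - integral {b..a} (\<lambda>t. - \<bar>v t\<bar> * E t)" using Hb \<tau> by (simp add: E_def)
  also have "\<dots> = exp_weighted b a v \<tau> / (2 * \<tau>)"
    unfolding exp_weighted_def E_def by (simp flip: integral_neg integral_divide)
  finally have 1: "integral {b..a} (\<lambda>t. H t * exp (- (2 * \<tau> * (a - t)))) \<le> exp_weighted b a v \<tau> / (2 * \<tau>)" .
  obtain N where N: "negligible N" "{x. \<not> (x \<in> {b<..<a} \<longrightarrow> u x = - integral {x..a} v)} \<subseteq> N"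
    using u unfolding eventually_ae_filter negligible_iff_null_sets by auto
  have "exp_weighted b a u \<tau> = integral {b..a} (\<lambda>x. \<bar>integral {x..a} v\<bar> * exp (- (2 * \<tau> * (a - x))))"
    unfolding exp_weighted_def
  proof (rule integral_spike)
    show "negligible (N \<union> {a, b})" using N by simp
    fix x assume "x \<in> {b..a} - (N \<union> {a, b})"
    then have "x \<in> {b<..<a}" "x \<notin> N" by auto
    then have "u x = - integral {x..a} v" using N(2) by blast
    then show "\<bar>integral {x..a} v\<bar> * exp (- (2 * \<tau> * (a - x))) = \<bar>u x\<bar> * exp (- (2 * \<tau> * (a - x)))" by simp
  qed
  also have "\<dots> \<le> integral {b..a} (\<lambda>t. H t * exp (- (2 * \<tau> * (a - t))))"
  proof (rule integral_le)
    show "(\<lambda>x. \<bar>integral {x..a} v\<bar> * exp (- (2 * \<tau> * (a - x)))) integrable_on {b..a}"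
      by (intro integrable_continuous_real continuous_intros indefinite_integral_continuous_1' vi)
    fix x assume x: "x \<in> {b..a}"
    have "\<bar>integral {x..a} v\<bar> \<le> H x" unfolding H_def
      using Henstock_Kurzweil_Integration.integral_norm_bound_integral[of v "{x..a}" "\<lambda>t. \<bar>v t\<bar>"] x
        integrable_subinterval_real[OF vi, of x a] integrable_subinterval_real[OF avi, of x a] by auto
    then show "\<bar>integral {x..a} v\<bar> * exp (- (2 * \<tau> * (a - x))) \<le> H x * exp (- (2 * \<tau> * (a - x)))"
      by (intro mult_right_mono) auto
  qed (rule i2)
  finally show ?thesis using 1 by simp
qed

text \<open>
  For nonnegative \<open>J\<close> this is \<open>J(\<tau>) = o(\<tau>\<^bsup>-\<sigma>\<^esup>)\<close> as \<open>\<tau> \<rightarrow> \<infinity>\<close>.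
\<close>
definition decays :: "real \<Rightarrow> (real \<Rightarrow> real) \<Rightarrow> bool" where
  "decays \<sigma> J \<longleftrightarrow> (\<forall>\<epsilon>>0. \<forall>\<^sub>F \<tau> in at_top. J \<tau> \<le> \<epsilon> * \<tau> powr - \<sigma>)"

lemma decays_primitive:
  assumes "b \<le> a" and v: "v absolutely_integrable_on {b..a}"
    and u: "AE x in lebesgue. x \<in> {b<..<a} \<longrightarrow> u x = - integral {x..a} v"
    and dec: "decays \<sigma> (exp_weighted b a v)"
  shows "decays (\<sigma> + 1) (exp_weighted b a u)"
  unfolding decays_def
proof (intro allI impI)
  fix \<epsilon> :: real assume "\<epsilon> > 0"
  then have "\<forall>\<^sub>F \<tau> in at_top. exp_weighted b a v \<tau> \<le> \<epsilon> * \<tau> powr - \<sigma>" using dec unfolding decays_def by blast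
  moreover have "\<forall>\<^sub>F \<tau>::real in at_top. \<tau> > 0" by (rule eventually_gt_at_top)
  ultimately show "\<forall>\<^sub>F \<tau> in at_top. exp_weighted b a u \<tau> \<le> \<epsilon> * \<tau> powr - (\<sigma> + 1)"
  proof eventually_elim
    case (elim \<tau>)
    have "exp_weighted b a u \<tau> \<le> exp_weighted b a v \<tau> / (2 * \<tau>)" by (rule exp_weighted_primitive[OF assms(1) v elim(2) u])
    also have "\<dots> \<le> (\<epsilon> * \<tau> powr - \<sigma>) / (2 * \<tau>)" using elim by (intro divide_right_mono) auto
    also have "\<dots> = \<epsilon> * \<tau> powr - (\<sigma> + 1) / 2"
      using elim by (simp add: powr_diff powr_minus_divide field_simps)
    also have "\<dots> \<le> \<epsilon> * \<tau> powr - (\<sigma> + 1)" using \<open>\<epsilon> > 0\<close> by simp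
    finally show ?case .
  qed
qed

lemma exp_weighted_sub_le:
  assumes v: "v absolutely_integrable_on {b..a}" and b: "b \<le> b'" "b' \<le> a" and "\<tau> \<ge> 0"
  shows "exp_weighted b a v \<tau> \<le> exp (- (2 * \<tau> * (a - b'))) * integral {b..a} (\<lambda>x. \<bar>v x\<bar>) + exp_weighted b' a v \<tau>"
proof -
  let ?g = "\<lambda>x. \<bar>v x\<bar> * exp (- (2 * \<tau> * (a - x)))"
  have g: "?g integrable_on {b..a}" using exp_weighted_integrable[OF v] set_lebesgue_integral_eq_integral(1) by blast
  have av: "(\<lambda>t. \<bar>v t\<bar>) integrable_on {b..a}"
    using norm_absolutely_integrable[OF v] set_lebesgue_integral_eq_integral(1) by fastforce
  have sub: "(\<lambda>t. \<bar>v t\<bar>) integrable_on {b..b'}" using integrable_subinterval_real[OF av] b by auto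
  have "exp_weighted b a v \<tau> = integral {b..b'} ?g + exp_weighted b' a v \<tau>"
    using Henstock_Kurzweil_Integration.integral_combine[OF b g] by (simp add: exp_weighted_def)
  also have "integral {b..b'} ?g \<le> integral {b..b'} (\<lambda>x. \<bar>v x\<bar> * exp (- (2 * \<tau> * (a - b'))))"
  proof (rule integral_le)
    show "?g integrable_on {b..b'}" using integrable_subinterval_real[OF g] b by auto
    show "(\<lambda>x. \<bar>v x\<bar> * exp (- (2 * \<tau> * (a - b')))) integrable_on {b..b'}" by (intro integrable_on_mult_left sub)
    fix x assume "x \<in> {b..b'}"
    then have "2 * \<tau> * (a - b') \<le> 2 * \<tau> * (a - x)" using \<open>\<tau> \<ge> 0\<close> by (intro mult_left_mono) auto
    then show "?g x \<le> \<bar>v x\<bar> * exp (- (2 * \<tau> * (a - b')))" by (intro mult_left_mono) auto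
  qed
  also have "\<dots> = exp (- (2 * \<tau> * (a - b'))) * integral {b..b'} (\<lambda>x. \<bar>v x\<bar>)" by simp
  also have "integral {b..b'} (\<lambda>x. \<bar>v x\<bar>) \<le> integral {b..a} (\<lambda>x. \<bar>v x\<bar>)"
    using b by (intro integral_subset_le sub av) auto
  finally show ?thesis by (simp add: mult_left_mono)
qed

text \<open>The part of the integral away from \<open>a\<close> is exponentially small.\<close>
lemma decays_localize:
  assumes v: "v absolutely_integrable_on {b..a}" and b: "b \<le> b'" "b' < a" and dec: "decays \<sigma> (exp_weighted b' a v)"
  shows "decays \<sigma> (exp_weighted b a v)"
  unfolding decays_def
proof (intro allI impI)
  fix \<epsilon> :: real assume "\<epsilon> > 0"
  define I where "I = integral {b..a} (\<lambda>x. \<bar>v x\<bar>)"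
  define d where "d = a - b'"
  have d: "d > 0" using b by (simp add: d_def)
  have "\<forall>\<^sub>F \<tau> in at_top. exp_weighted b' a v \<tau> \<le> (\<epsilon> / 2) * \<tau> powr - \<sigma>" 
    using dec[unfolded decays_def, rule_format, of "\<epsilon> / 2"] \<open>\<epsilon> > 0\<close> by simp
  moreover have "((\<lambda>\<tau>. exp (- (2 * \<tau> * d)) * I * \<tau> powr \<sigma>) \<longlongrightarrow> 0) at_top" using d by real_asymp
  then have "\<forall>\<^sub>F \<tau> in at_top. exp (- (2 * \<tau> * d)) * I * \<tau> powr \<sigma> < \<epsilon> / 2"
    by (rule order_tendstoD) (use \<open>\<epsilon> > 0\<close> in simp)
  moreover have "\<forall>\<^sub>F \<tau>::real in at_top. \<tau> > 0" by (rule eventually_gt_at_top)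
  ultimately show "\<forall>\<^sub>F \<tau> in at_top. exp_weighted b a v \<tau> \<le> \<epsilon> * \<tau> powr - \<sigma>"
  proof eventually_elim
    case (elim \<tau>)
    have "exp (- (2 * \<tau> * d)) * I = exp (- (2 * \<tau> * d)) * I * \<tau> powr \<sigma> * \<tau> powr - \<sigma>"
      using elim(3) by (simp add: powr_minus_divide)
    also have "\<dots> \<le> (\<epsilon> / 2) * \<tau> powr - \<sigma>" using elim(2) by (intro mult_right_mono) auto
    finally have "exp (- (2 * \<tau> * d)) * I \<le> (\<epsilon> / 2) * \<tau> powr - \<sigma>" .
    with exp_weighted_sub_le[OF v b(1) less_imp_le[OF b(2)], of \<tau>] elim show ?case by (simp add: I_def d_def)
  qed
qed

text \<open>
  If the part of \<open>v\<close> over \<open>[b',a]\<close> contributes arbitrarily little on the scale of \<open>\<tau>\<^bsup>-\<sigma>\<^esup>\<close> when \<open>b'\<close> is close to \<open>a\<close>, then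
  the decay is faster than \<open>\<tau>\<^bsup>-\<sigma>\<^esup>\<close>, since the rest is exponentially small.
\<close>
lemma decays_if_small_near_end:
  assumes v: "v absolutely_integrable_on {b..a}"
    and small: "\<And>\<epsilon>. \<epsilon> > 0 \<Longrightarrow> \<exists>b'. b \<le> b' \<and> b' < a \<and> (\<forall>\<tau>>0. exp_weighted b' a v \<tau> \<le> \<epsilon> * \<tau> powr - \<sigma>)"
  shows "decays \<sigma> (exp_weighted b a v)"
  unfolding decays_def
proof (intro allI impI)
  fix \<epsilon> :: real assume \<epsilon>: "\<epsilon> > 0"
  then obtain b' where b': "b \<le> b'" "b' < a" "\<And>\<tau>. \<tau> > 0 \<Longrightarrow> exp_weighted b' a v \<tau> \<le> (\<epsilon> / 2) * \<tau> powr - \<sigma>"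
    using small[of "\<epsilon> / 2"] by auto
  define I where "I = integral {b..a} (\<lambda>x. \<bar>v x\<bar>)"
  define d where "d = a - b'"
  have d: "d > 0" using b' by (simp add: d_def)
  have "((\<lambda>\<tau>. exp (- (2 * \<tau> * d)) * I * \<tau> powr \<sigma>) \<longlongrightarrow> 0) at_top" using d by real_asymp
  then have "\<forall>\<^sub>F \<tau> in at_top. exp (- (2 * \<tau> * d)) * I * \<tau> powr \<sigma> < \<epsilon> / 2"
    by (rule order_tendstoD) (use \<epsilon> in simp)
  moreover have "\<forall>\<^sub>F \<tau>::real in at_top. \<tau> > 0" by (rule eventually_gt_at_top)
  ultimately show "\<forall>\<^sub>F \<tau> in at_top. exp_weighted b a v \<tau> \<le> \<epsilon> * \<tau> powr - \<sigma>"
  proof eventually_elim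
    case (elim \<tau>)
    have "exp (- (2 * \<tau> * d)) * I = exp (- (2 * \<tau> * d)) * I * \<tau> powr \<sigma> * \<tau> powr - \<sigma>"
      using elim(2) by (simp add: powr_minus_divide)
    also have "\<dots> \<le> (\<epsilon> / 2) * \<tau> powr - \<sigma>" using elim(1) by (intro mult_right_mono) auto
    finally have "exp (- (2 * \<tau> * d)) * I \<le> (\<epsilon> / 2) * \<tau> powr - \<sigma>" .
    with exp_weighted_sub_le[OF v b'(1) less_imp_le[OF b'(2)], of \<tau>] elim b'(3)[of \<tau>] show ?case by (simp add: I_def d_def)
  qed
qed

lemma integral_near_end_small:
  fixes g :: "real \<Rightarrow> real"
  assumes g: "g integrable_on {b..a}" and "b < a" "\<epsilon> > 0"
  obtains b' where "b \<le> b'" "b' < a" "integral {b'..a} g \<le> \<epsilon>"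
proof -
  have "continuous_on {b..a} (\<lambda>x. integral {x..a} g)" by (rule indefinite_integral_continuous_1'[OF g])
  from this[unfolded continuous_on_def, rule_format, of a]
  have "((\<lambda>x. integral {x..a} g) \<longlongrightarrow> integral {a..a} g) (at a within {b..a})"
    using \<open>b < a\<close> by simp
  then have "((\<lambda>x. integral {x..a} g) \<longlongrightarrow> 0) (at_left a)"
    using \<open>b < a\<close> by (simp add: at_within_Icc_at_left)
  then have "\<forall>\<^sub>F x in at_left a. integral {x..a} g < \<epsilon>" using \<open>\<epsilon> > 0\<close> by (rule order_tendstoD)
  then obtain c where c: "c < a" "\<And>x. c < x \<Longrightarrow> x < a \<Longrightarrow> integral {x..a} g < \<epsilon>"
    unfolding eventually_at_left_field by blast
  define b' where "b' = (max b c + a) / 2"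
  have "b \<le> b'" "c < b'" "b' < a" using c \<open>b < a\<close> by (auto simp: b'_def max_def)
  with c(2)[of b'] that[of b'] show thesis by (simp add: less_imp_le)
qed

text \<open>The case \<open>p = 1\<close>, by the absolute continuity of the integral.\<close>
lemma decays_L1:
  assumes v: "v absolutely_integrable_on {b..a}" and "b < a"
  shows "decays 0 (exp_weighted b a v)"
proof (rule decays_if_small_near_end[OF v])
  fix \<epsilon> :: real assume "\<epsilon> > 0"
  have av: "(\<lambda>t. \<bar>v t\<bar>) integrable_on {b..a}"
    using norm_absolutely_integrable[OF v] set_lebesgue_integral_eq_integral(1) by fastforce
  obtain b' where b': "b \<le> b'" "b' < a" "integral {b'..a} (\<lambda>t. \<bar>v t\<bar>) \<le> \<epsilon>"
    using integral_near_end_small[OF av assms(2) \<open>\<epsilon> > 0\<close>] by blast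
  have "exp_weighted b' a v \<tau> \<le> \<epsilon> * \<tau> powr - 0" if \<tau>: "\<tau> > 0" for \<tau>
  proof -
    have v': "v absolutely_integrable_on {b'..a}"
      by (rule absolutely_integrable_on_subinterval[OF v]) (use b' in auto)
    have "exp_weighted b' a v \<tau> \<le> integral {b'..a} (\<lambda>t. \<bar>v t\<bar>)"
      unfolding exp_weighted_def
    proof (rule integral_le)
      show "(\<lambda>x. \<bar>v x\<bar> * exp (- (2 * \<tau> * (a - x)))) integrable_on {b'..a}"
        using exp_weighted_integrable[OF v'] set_lebesgue_integral_eq_integral(1) by blast
      show "(\<lambda>t. \<bar>v t\<bar>) integrable_on {b'..a}" using integrable_subinterval_real[OF av] b' by auto
      fix x assume "x \<in> {b'..a}"
      then have "exp (- (2 * \<tau> * (a - x))) \<le> 1" using \<tau> by simp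
      from mult_left_mono[OF this, of "\<bar>v x\<bar>"] show "\<bar>v x\<bar> * exp (- (2 * \<tau> * (a - x))) \<le> \<bar>v x\<bar>" by simp
    qed
    with b' show ?thesis using \<tau> by simp
  qed
  then show "\<exists>b'. b \<le> b' \<and> b' < a \<and> (\<forall>\<tau>>0. exp_weighted b' a v \<tau> \<le> \<epsilon> * \<tau> powr - 0)" using b' by blast
qed

text \<open>
  Young's inequality with weights \<open>\<mu> \<tau>\<^bsup>-1/(pr)\<^esup>\<close> and its inverse, where \<open>r\<close> is the conjugate exponent, takes the
  place of Hoelder's inequality: first \<open>\<mu>\<close> is chosen large, then the interval short.
\<close>
lemma decays_Lp:
  assumes v: "v absolutely_integrable_on {b..a}" and "b < a" and p: "p > 1" and r: "1 / p + 1 / r = 1"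
    and vp: "(\<lambda>x. \<bar>v x\<bar> powr p) integrable_on {b..a}"
  shows "decays (1 / r) (exp_weighted b a v)"
proof (rule decays_if_small_near_end[OF v])
  fix \<epsilon> :: real assume \<epsilon>: "\<epsilon> > 0"
  have r1: "r > 1"
  proof -
    have "1 / r = 1 - 1 / p" "1 - 1 / p > 0" "1 - 1 / p < 1" using r p by (auto simp: field_simps)
    then have "r > 0" "1 / r < 1" by (metis zero_less_divide_1_iff, metis)
    then show ?thesis by (simp add: field_simps)
  qed
  \<comment> \<open>makes the second term of Young's inequality, with the integral of the exponential, at most \<open>(\<epsilon>/2) \<tau>\<^bsup>-1/r\<^esup>\<close>\<close>
  define \<mu> where "\<mu> = (\<epsilon> / 2) powr (- (1 / r))"
  have \<mu>: "\<mu> > 0" using \<epsilon> by (simp add: \<mu>_def)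
  have \<mu>r: "\<mu> powr - r = \<epsilon> / 2" using \<epsilon> r1 by (simp add: \<mu>_def powr_powr)
  define \<eta> where "\<eta> = (\<epsilon> / 2) / \<mu> powr p"
  have \<eta>: "\<eta> > 0" using \<epsilon> \<mu> by (simp add: \<eta>_def)
  obtain b' where b': "b \<le> b'" "b' < a" "integral {b'..a} (\<lambda>x. \<bar>v x\<bar> powr p) \<le> \<eta>"
    using integral_near_end_small[OF vp assms(2) \<eta>] by blast
  have "exp_weighted b' a v \<tau> \<le> \<epsilon> * \<tau> powr - (1 / r)" if \<tau>: "\<tau> > 0" for \<tau>
  proof -
    define A where "A = \<mu> * \<tau> powr - (1 / (p * r))"
    have A: "A > 0" using \<mu> \<tau> by (simp add: A_def)
    have Ap: "A powr p = \<mu> powr p * \<tau> powr - (1 / r)"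
      using \<mu> \<tau> p by (simp add: A_def powr_mult powr_powr)
    have Ar: "A powr - r = \<mu> powr - r * \<tau> powr (1 / p)"
      using \<mu> \<tau> r1 by (simp add: A_def powr_mult powr_powr)
    have sub: "{b'..a} \<subseteq> {b..a}" using b' by auto
    have v': "v absolutely_integrable_on {b'..a}" by (rule absolutely_integrable_on_subinterval[OF v sub])
    have vp': "(\<lambda>x. \<bar>v x\<bar> powr p) integrable_on {b'..a}" by (rule integrable_subinterval_real[OF vp sub])
    have ei: "(\<lambda>x. exp (- (\<tau> * (a - x)))) integrable_on {b'..a}"
      by (intro integrable_continuous_real continuous_intros)
    have "exp_weighted b' a v \<tau> \<le> integral {b'..a} (\<lambda>x. A powr p * \<bar>v x\<bar> powr p + A powr - r * exp (- (\<tau> * (a - x))))"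
      unfolding exp_weighted_def
    proof (rule integral_le)
      show "(\<lambda>x. \<bar>v x\<bar> * exp (- (2 * \<tau> * (a - x)))) integrable_on {b'..a}"
        using exp_weighted_integrable[OF v'] set_lebesgue_integral_eq_integral(1) by blast
      show "(\<lambda>x. A powr p * \<bar>v x\<bar> powr p + A powr - r * exp (- (\<tau> * (a - x)))) integrable_on {b'..a}"
        by (intro integrable_add integrable_on_mult_right vp' ei)
      fix x assume x: "x \<in> {b'..a}"
      define e where "e = exp (- (2 * \<tau> * (a - x)))"
      have "(A * \<bar>v x\<bar>) * (e / A) \<le> (A * \<bar>v x\<bar>) powr p / p + (e / A) powr r / r"
        using A p r1 r by (intro Youngs_inequality) (auto simp: e_def)
      also have "(A * \<bar>v x\<bar>) powr p / p \<le> (A * \<bar>v x\<bar>) powr p"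
        using p by (simp add: divide_le_eq mult_le_cancel_left1)
      also have "(A * \<bar>v x\<bar>) powr p = A powr p * \<bar>v x\<bar> powr p" using A by (simp add: powr_mult)
      also have "(e / A) powr r / r \<le> (e / A) powr r"
        using r1 by (simp add: divide_le_eq mult_le_cancel_left1)
      also have "(e / A) powr r = A powr - r * e powr r"
        using A by (simp add: powr_divide e_def powr_minus_divide)
      also have "e powr r \<le> exp (- (\<tau> * (a - x)))"
      proof -
        have "(\<tau> * (a - x)) * 1 \<le> (\<tau> * (a - x)) * (2 * r)" using r1 \<tau> x by (intro mult_left_mono) auto
        then show ?thesis by (simp add: e_def powr_def algebra_simps)
      qed
      also have "(A * \<bar>v x\<bar>) * (e / A) = \<bar>v x\<bar> * e" using A by simp
      finally show "\<bar>v x\<bar> * exp (- (2 * \<tau> * (a - x))) \<le> A powr p * \<bar>v x\<bar> powr p + A powr - r * exp (- (\<tau> * (a - x)))"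
        by (simp add: e_def mult_left_mono)
    qed
    also have "\<dots> = A powr p * integral {b'..a} (\<lambda>x. \<bar>v x\<bar> powr p) + A powr - r * integral {b'..a} (\<lambda>x. exp (- (\<tau> * (a - x))))"
      by (subst Henstock_Kurzweil_Integration.integral_add) (intro integrable_on_mult_right vp' ei, intro integrable_on_mult_right vp' ei, simp)
    also have "\<dots> \<le> A powr p * \<eta> + A powr - r * (1 / \<tau>)"
      using b' \<tau> by (intro add_mono mult_left_mono exp_integral_le) auto
    also have "A powr p * \<eta> = (\<epsilon> / 2) * \<tau> powr - (1 / r)" using \<mu> by (simp add: Ap \<eta>_def)
    also have "A powr - r * (1 / \<tau>) = (\<epsilon> / 2) * \<tau> powr - (1 / r)"
    proof -
      have "1 / p = 1 + - (1 / r)" using r by simp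
      then have "\<tau> powr (1 / p) = \<tau> * \<tau> powr - (1 / r)" using \<tau> powr_add[of \<tau> 1 "- (1 / r)"] by simp
      then show ?thesis using \<tau> by (simp add: Ar \<mu>r)
    qed
    finally show ?thesis by simp
  qed
  then show "\<exists>b'. b \<le> b' \<and> b' < a \<and> (\<forall>\<tau>>0. exp_weighted b' a v \<tau> \<le> \<epsilon> * \<tau> powr - (1 / r))" using b' by blast
qed

text \<open>
  Near \<open>a\<close> the function is at most \<open>\<epsilon>\<close>, and the integral of the weight is at most \<open>1/(2 \<tau>)\<close>.
\<close>
lemma decays_continuous_vanishing:
  assumes v: "continuous_on {b..a} v" and "b < a" and "v a = 0"
  shows "decays 1 (exp_weighted b a v)"
proof (rule decays_if_small_near_end)
  show vi: "v absolutely_integrable_on {b..a}" by (rule absolutely_integrable_continuous_real[OF v])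
  fix \<epsilon> :: real assume \<epsilon>: "\<epsilon> > 0"
  have "(v \<longlongrightarrow> v a) (at a within {b..a})" using v \<open>b < a\<close> unfolding continuous_on_def by simp
  then have "(v \<longlongrightarrow> 0) (at_left a)" using \<open>b < a\<close> assms(3) by (simp add: at_within_Icc_at_left)
  then have "\<forall>\<^sub>F x in at_left a. \<bar>v x\<bar> < \<epsilon>" using \<epsilon> tendsto_rabs_zero order_tendstoD(2) by blast
  then obtain c where c: "c < a" "\<And>x. c < x \<Longrightarrow> x < a \<Longrightarrow> \<bar>v x\<bar> < \<epsilon>"
    unfolding eventually_at_left_field by blast
  define b' where "b' = (max b c + a) / 2"
  have b': "b \<le> b'" "c < b'" "b' < a" using c \<open>b < a\<close> by (auto simp: b'_def max_def)
  have "exp_weighted b' a v \<tau> \<le> \<epsilon> * \<tau> powr - 1" if \<tau>: "\<tau> > 0" for \<tau>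
  proof -
    have v': "v absolutely_integrable_on {b'..a}"
      by (rule absolutely_integrable_on_subinterval[OF vi]) (use b' in auto)
    have "exp_weighted b' a v \<tau> \<le> integral {b'..a} (\<lambda>x. \<epsilon> * exp (- ((2 * \<tau>) * (a - x))))"
      unfolding exp_weighted_def
    proof (rule integral_le)
      show "(\<lambda>x. \<bar>v x\<bar> * exp (- (2 * \<tau> * (a - x)))) integrable_on {b'..a}"
        using exp_weighted_integrable[OF v'] set_lebesgue_integral_eq_integral(1) by blast
      show "(\<lambda>x. \<epsilon> * exp (- ((2 * \<tau>) * (a - x)))) integrable_on {b'..a}"
        by (intro integrable_continuous_real continuous_intros)
      fix x assume "x \<in> {b'..a}"
      then have "\<bar>v x\<bar> \<le> \<epsilon>" using c(2)[of x] b' \<epsilon> assms(3) by (cases "x = a") auto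
      then show "\<bar>v x\<bar> * exp (- (2 * \<tau> * (a - x))) \<le> \<epsilon> * exp (- ((2 * \<tau>) * (a - x)))"
        by (intro mult_right_mono) auto
    qed
    also have "\<dots> = \<epsilon> * integral {b'..a} (\<lambda>x. exp (- ((2 * \<tau>) * (a - x))))" by simp
    also have "\<dots> \<le> \<epsilon> * (1 / (2 * \<tau>))" using b' \<tau> \<epsilon> by (intro mult_left_mono exp_integral_le) auto
    also have "\<dots> \<le> \<epsilon> * \<tau> powr - 1" using \<tau> \<epsilon> by (simp add: powr_minus_divide field_simps)
    finally show ?thesis .
  qed
  then show "\<exists>b'. b \<le> b' \<and> b' < a \<and> (\<forall>\<tau>>0. exp_weighted b' a v \<tau> \<le> \<epsilon> * \<tau> powr - 1)" using b' by blast
qed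

section \<open>A vanishing Wronskian determines the potential\<close>

text \<open>
  The bound on \<open>f\<close>, inserted into the formula of variation of constants, makes the integral one order smaller.
\<close>
lemma solution_asymptotics:
  assumes f: "solves (\<lambda>t. Q t - \<omega>\<^sup>2) c d f f'" and \<omega>: "norm \<omega> \<ge> 1"
    and Q: "Q absolutely_integrable_on {c..d}" and K: "K = integral {c..d} (\<lambda>t. norm (Q t))"
  shows "norm (f d - (f c * cos (\<omega> * of_real (d - c)) + f' c * (sin (\<omega> * of_real (d - c)) / \<omega>)))
     \<le> 2 * K * exp (2 * K) / norm \<omega> * (norm (f c) + norm (f' c) / norm \<omega>) * exp (\<bar>Im \<omega>\<bar> * (d - c))"
proof -
  define r where "r = \<bar>Im \<omega>\<bar>"
  note cd = solvesD(1)[OF f]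
  have \<omega>0: "\<omega> \<noteq> 0" using \<omega> by auto
  have nQ: "(\<lambda>t. norm (Q t)) integrable_on {c..d}"
    using norm_absolutely_integrable[OF Q] set_lebesgue_integral_eq_integral(1) by blast
  have K0: "K \<ge> 0" unfolding K by (intro Henstock_Kurzweil_Integration.integral_nonneg nQ) auto
  have KK: "integral {c..d} (\<lambda>t. norm (Q t)) / norm \<omega> \<le> K"
    using K0 \<omega> unfolding K[symmetric] by (simp add: divide_le_eq mult_le_cancel_left1)
  define M where "M = 2 * (norm (f c) + norm (f' c) / norm \<omega>) * exp (2 * K)"
  have fb: "norm (f y) \<le> M * exp (r * (y - c))" if "y \<in> {c..d}" for y
    using solution_bound[OF f \<omega>0 that KK] by (simp add: M_def r_def)
  have "f d - (f c * cos (\<omega> * of_real (d - c)) + f' c * (sin (\<omega> * of_real (d - c)) / \<omega>))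
      = integral {c..d} (\<lambda>t. Q t * (f t * (sin (\<omega> * of_real (d - t)) / \<omega>)))"
    by (subst variation_of_constants[OF f \<omega>0, of d]) (use cd in auto)
  also have "norm \<dots> \<le> integral {c..d} (\<lambda>t. norm (Q t) * (M * exp (r * (d - c)) / norm \<omega>))"
  proof (rule Henstock_Kurzweil_Integration.integral_norm_bound_integral)
    show "(\<lambda>t. Q t * (f t * (sin (\<omega> * of_real (d - t)) / \<omega>))) integrable_on {c..d}"
      using \<omega>0 by (intro set_lebesgue_integral_eq_integral(1) absolutely_integrable_mult_continuous Q
          continuous_intros solves_continuous[OF f]) auto
    show "(\<lambda>t. norm (Q t) * (M * exp (r * (d - c)) / norm \<omega>)) integrable_on {c..d}"
      by (intro integrable_on_mult_left nQ)
    fix t assume t: "t \<in> {c..d}"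
    have "norm (f t * (sin (\<omega> * of_real (d - t)) / \<omega>)) \<le> (M * exp (r * (t - c))) * (exp (r * (d - t)) / norm \<omega>)"
      unfolding norm_mult norm_divide using norm_sin_cos_le(1)[of "d - t" \<omega>] t fb[OF t]
      by (intro mult_mono divide_right_mono) (auto simp: r_def intro: order_trans[OF norm_ge_zero])
    also have "\<dots> = M * exp (r * (d - c)) / norm \<omega>" by (simp add: exp_add[symmetric] algebra_simps)
    finally show "norm (Q t * (f t * (sin (\<omega> * of_real (d - t)) / \<omega>))) \<le> norm (Q t) * (M * exp (r * (d - c)) / norm \<omega>)"
      unfolding norm_mult[of "Q t"] by (intro mult_left_mono) auto
  qed
  also have "\<dots> = K * (M * exp (r * (d - c)) / norm \<omega>)" unfolding K by simp
  also have "\<dots> = 2 * K * exp (2 * K) / norm \<omega> * (norm (f c) + norm (f' c) / norm \<omega>) * exp (\<bar>Im \<omega>\<bar> * (d - c))"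
    by (simp add: M_def r_def)
  finally show ?thesis .
qed

text \<open>
  On the rays \<open>\<omega> = \<tau> (\<plusminus>1 + \<i>)\<close>, on which \<open>\<omega>\<^sup>2\<close> is purely imaginary, \<open>sin (\<omega> L)\<close> and \<open>cos (\<omega> L)\<close> are exponentially large with
  \<open>sin/cos\<close> close to \<open>\<i>\<close>. The numbers \<open>s\<close> and \<open>c\<close> stand for the solutions with data \<open>(0,1)\<close> and \<open>(1,0)\<close>, which inherit this.
\<close>
lemma sine_cosine_comparison:
  assumes L: "L > 0" and K: "K \<ge> 0"
  shows "\<forall>\<^sub>F \<tau> in at_top. \<forall>\<omega> s c :: complex. Im \<omega> = \<tau> \<longrightarrow> norm \<omega> = sqrt 2 * \<tau> \<longrightarrow>
     norm (s - sin (\<omega> * of_real L) / \<omega>) \<le> K * exp (\<tau> * L) / (norm \<omega>)\<^sup>2 \<longrightarrow>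
     norm (c - cos (\<omega> * of_real L)) \<le> K * exp (\<tau> * L) / norm \<omega> \<longrightarrow>
       exp (\<tau> * L) / 4 \<le> norm \<omega> * norm s \<and> norm \<omega> * norm s \<le> (1 + K) * exp (\<tau> * L) \<and>
       norm (c / s + \<i> * \<omega>) \<le> 1 + 8 * K"
proof -
  have "((\<lambda>\<tau>. exp (- (2 * \<tau> * L))) \<longlongrightarrow> 0) at_top" using L by real_asymp
  then have 1: "\<forall>\<^sub>F \<tau> in at_top. exp (- (2 * \<tau> * L)) < 1/4" by (rule order_tendstoD) simp
  have "((\<lambda>\<tau>. 4 * (sqrt 2 * \<tau>) * exp (- (2 * \<tau> * L))) \<longlongrightarrow> 0) at_top" using L by real_asymp
  then have 2: "\<forall>\<^sub>F \<tau> in at_top. 4 * (sqrt 2 * \<tau>) * exp (- (2 * \<tau> * L)) < 1" by (rule order_tendstoD) simp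
  have 3: "\<forall>\<^sub>F \<tau> in at_top. \<tau> \<ge> 8 * K + 1" by (rule eventually_ge_at_top)
  show ?thesis using 1 2 3
  proof eventually_elim
    case (elim \<tau>)
    show ?case
    proof (intro allI impI)
      fix \<omega> s c :: complex
      assume Im: "Im \<omega> = \<tau>" and n\<omega>: "norm \<omega> = sqrt 2 * \<tau>"
        and s: "norm (s - sin (\<omega> * of_real L) / \<omega>) \<le> K * exp (\<tau> * L) / (norm \<omega>)\<^sup>2"
        and c: "norm (c - cos (\<omega> * of_real L)) \<le> K * exp (\<tau> * L) / norm \<omega>"
      define D where "D = exp (\<tau> * L)"
      define N where "N = norm \<omega>"
      have \<tau>: "\<tau> > 0" "\<tau> \<ge> 1" using elim K by auto
      have "1 * \<tau> \<le> sqrt 2 * \<tau>" using \<tau> by (intro mult_right_mono) auto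
      then have N: "N \<ge> \<tau>" "N > 0" "\<omega> \<noteq> 0" using n\<omega> \<tau> by (auto simp: N_def)
      have D: "D > 0" by (simp add: D_def)
      have e2: "exp (- (2 * \<tau> * L)) = 1 / (D * D)" unfolding D_def exp_add[symmetric] by (simp add: exp_minus divide_inverse)
      have em: "norm (exp (- (\<i> * (\<omega> * of_real L)))) = D" "norm (exp (\<i> * (\<omega> * of_real L))) = 1 / D"
        unfolding norm_exp_eq_Re by (simp_all add: Im D_def exp_minus divide_inverse)
      have sin_lo: "norm (sin (\<omega> * of_real L)) \<ge> (D - 1 / D) / 2"
      proof -
        have "norm (exp (\<i> * (\<omega> * of_real L)) - exp (- (\<i> * (\<omega> * of_real L)))) \<ge> D - 1 / D"
          using norm_triangle_ineq2[of "exp (- (\<i> * (\<omega> * of_real L)))" "exp (\<i> * (\<omega> * of_real L))"] em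
          by (simp add: norm_minus_commute)
        then show ?thesis unfolding sin_exp_eq by (simp add: norm_divide norm_mult)
      qed
      have sin_up: "norm (sin (\<omega> * of_real L)) \<le> D"
        using norm_sin_cos_le(1)[of L \<omega>] L Im \<tau> by (simp add: D_def)
      have s': "norm (\<omega> * s - sin (\<omega> * of_real L)) \<le> K * D / N"
      proof -
        have "\<omega> * s - sin (\<omega> * of_real L) = \<omega> * (s - sin (\<omega> * of_real L) / \<omega>)" using N by (simp add: algebra_simps)
        also have "norm \<dots> \<le> N * (K * D / N\<^sup>2)" unfolding norm_mult N_def[symmetric]
          using s N by (intro mult_left_mono) (auto simp: D_def N_def)
        finally show ?thesis using N by (simp add: power2_eq_square)
      qed
      have KN: "K * D / N \<le> D / 8"
      proof -
        have "K \<le> N / 8" using elim N by simp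
        then have "K * D \<le> N / 8 * D" using D by (intro mult_right_mono) auto
        then show ?thesis using N by (simp add: field_simps)
      qed
      have DD: "1 / D \<le> D / 4"
      proof -
        have "1 / (D * D) * D \<le> 1 / 4 * D" using elim(1) D unfolding e2 by (intro mult_right_mono) auto
        then show ?thesis using D by simp
      qed
      have n_s: "norm (\<omega> * s) = N * norm s" by (simp add: norm_mult N_def)
      have lo: "D / 4 \<le> N * norm s"
      proof -
        have "norm (sin (\<omega> * of_real L)) - K * D / N \<le> N * norm s"
          using norm_triangle_ineq2[of "sin (\<omega> * of_real L)" "\<omega> * s"] s' n_s by (simp add: norm_minus_commute)
        then show ?thesis using sin_lo KN DD by argo
      qed
      have up: "N * norm s \<le> (1 + K) * D"
      proof -
        have "N * norm s \<le> norm (sin (\<omega> * of_real L)) + K * D / N"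
          using norm_triangle_ineq2[of "\<omega> * s" "sin (\<omega> * of_real L)"] s' n_s by simp
        moreover have "K * D / N \<le> K * D / 1" using K D N \<tau> by (intro divide_left_mono) auto
        ultimately show ?thesis using sin_up by (simp add: algebra_simps)
      qed
      have s0: "s \<noteq> 0" using lo D by auto
      have "norm (c + \<i> * \<omega> * s) \<le> 1 / D + 2 * (K * D / N)"
      proof -
        have "cos (\<omega> * of_real L) + \<i> * sin (\<omega> * of_real L) = exp (\<i> * (\<omega> * of_real L))"
          by (simp add: exp_Euler)
        then have "c + \<i> * \<omega> * s = exp (\<i> * (\<omega> * of_real L)) + ((c - cos (\<omega> * of_real L)) + \<i> * (\<omega> * s - sin (\<omega> * of_real L)))"
          by (simp add: algebra_simps)
        also have "norm \<dots> \<le> 1 / D + (K * D / N + K * D / N)"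
        proof (intro norm_triangle_le add_mono)
          show "norm (c - cos (\<omega> * of_real L)) \<le> K * D / N" using c by (simp add: D_def N_def)
          show "norm (\<i> * (\<omega> * s - sin (\<omega> * of_real L))) \<le> K * D / N" using s' by (simp add: norm_mult)
          show "norm (exp (\<i> * (\<omega> * of_real L))) \<le> 1 / D" by (simp only: em order_refl)
        qed
        finally show ?thesis by (simp only: mult_2)
      qed
      then have "norm (c + \<i> * \<omega> * s) / norm s \<le> (1 / D + 2 * (K * D / N)) / norm s"
        by (intro divide_right_mono) auto
      also have "\<dots> \<le> (1 / D + 2 * (K * D / N)) / (D / (4 * N))"
      proof (intro divide_left_mono)
        show "D / (4 * N) \<le> norm s" using lo N by (simp add: field_simps)
      qed (use D K N s0 in auto)
      also have "\<dots> = 4 * N * (1 / (D * D)) + 8 * K" using D N by (simp add: field_simps)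
      also have "\<dots> \<le> 1 + 8 * K" using elim(2) unfolding e2 n\<omega>[folded N_def, symmetric] by simp
      finally have "norm (c + \<i> * \<omega> * s) / norm s \<le> 1 + 8 * K" .
      moreover have "c / s + \<i> * \<omega> = (c + \<i> * \<omega> * s) / s" using s0 by (simp add: field_simps)
      ultimately have "norm (c / s + \<i> * \<omega>) \<le> 1 + 8 * K" by (simp add: norm_divide)
      then show "exp (\<tau> * L) / 4 \<le> norm \<omega> * norm s \<and> norm \<omega> * norm s \<le> (1 + K) * exp (\<tau> * L) \<and>
         norm (c / s + \<i> * \<omega>) \<le> 1 + 8 * K" using lo up by (simp add: D_def N_def)
    qed
  qed
qed

context radial_potential
begin

text \<open>
  Green's identity for \<open>\<phi>\<close> and its conjugate: \<open>Im (\<phi>' cnj \<phi>) = - Im z \<integral>\<^sub>0\<^sup>x \<bar>\<phi>\<bar>\<^sup>2\<close>, and the integral is positive. So \<open>\<phi>'/\<phi>\<close> is,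
  up to sign, a Herglotz function.
\<close>
lemma phi_nonreal:
  assumes "Im z \<noteq> 0" and x: "0 < x" "x \<le> 1"
  shows "phi z x \<noteq> 0" "Im z * Im (phi' z x / phi z x) \<le> 0"
proof -
  define I where "I = integral {0..x} (\<lambda>t. (norm (phi z t))\<^sup>2)"
  have s: "solves (\<lambda>t. cnj (pot t - z)) c x (\<lambda>x. cnj (phi z x)) (\<lambda>x. cnj (phi' z x))" if "0 < c" "c \<le> x" for c
    by (intro solves_cnj phi_solves that x)
  have cP: "cnj (pot t) = pot t" for t by (simp add: pot_def)
  have "phi' z x * cnj (phi z x) - phi z x * cnj (phi' z x) = integral {0..x} (\<lambda>t. (cnj z - z) * (phi z t * cnj (phi z t)))"
    by (rule wronskian_from_0[OF phi_regular regular_at_0_cnj[OF phi_regular] l x phi_solves[OF _ _ x(2)] s])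
      (auto intro!: absolutely_integrable_continuous_real continuous_intros simp: cP)
  also have "\<dots> = (cnj z - z) * integral {0..x} (\<lambda>t. of_real ((norm (phi z t))\<^sup>2))"
  proof -
    have "w * cnj w = of_real ((norm w)\<^sup>2)" for w by (rule complex_norm_square[symmetric])
    then show ?thesis by (simp only: Henstock_Kurzweil_Integration.integral_mult_right)
  qed
  also have "integral {0..x} (\<lambda>t. complex_of_real ((norm (phi z t))\<^sup>2)) = of_real I"
  proof -
    have "(\<lambda>t. (norm (phi z t))\<^sup>2) integrable_on {0..x}"
      using x by (intro integrable_continuous_real continuous_intros continuous_on_subset[OF phi_cont]) auto
    from integral_linear[OF this bounded_linear_of_real[where 'a = complex]] show ?thesis
      by (simp add: I_def o_def)
  qed
  finally have eq: "phi' z x * cnj (phi z x) - phi z x * cnj (phi' z x) = (cnj z - z) * of_real I" .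
  have im: "Im (phi' z x * cnj (phi z x)) = - Im z * I"
    using arg_cong[OF eq, of Im] by (simp add: algebra_simps)
  have "I > 0"
  proof -
    obtain b where b: "0 < b" "b < 1" "\<And>y. 0 < y \<Longrightarrow> y \<le> b \<Longrightarrow> phi z y \<noteq> 0"
      using phi_nonzero_near_0[of z] by metis
    define c where "c = min b x"
    have c: "0 < c" "c \<le> b" "c \<le> x" using b x by (auto simp: c_def)
    have ci: "(\<lambda>t. (norm (phi z t))\<^sup>2) integrable_on {s..t}" if "0 \<le> s" "t \<le> 1" for s t
      using that by (intro integrable_continuous_real continuous_intros continuous_on_subset[OF phi_cont]) auto
    have "continuous_on {c/2..c} (\<lambda>t. (norm (phi z t))\<^sup>2)"
      using c x by (intro continuous_intros continuous_on_subset[OF phi_cont]) auto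
    moreover have "{c/2..c} \<noteq> {}" using c by simp
    ultimately obtain m where m: "m \<in> {c/2..c}" "\<And>t. t \<in> {c/2..c} \<Longrightarrow> (norm (phi z m))\<^sup>2 \<le> (norm (phi z t))\<^sup>2"
      using continuous_attains_inf[of "{c/2..c}" "\<lambda>t. (norm (phi z t))\<^sup>2"] by auto
    have "0 < (norm (phi z m))\<^sup>2 * (c - c/2)" using b(3)[of m] m(1) c by simp
    also have "\<dots> = integral {c/2..c} (\<lambda>_. (norm (phi z m))\<^sup>2)" using c by simp
    also have "\<dots> \<le> integral {c/2..c} (\<lambda>t. (norm (phi z t))\<^sup>2)"
      using m c x by (intro integral_le ci) auto
    also have "\<dots> \<le> I" unfolding I_def using c x by (intro integral_subset_le ci) auto
    finally show ?thesis .
  qed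
  then show nz: "phi z x \<noteq> 0" using im assms(1) by auto
  have "phi' z x / phi z x = phi' z x * cnj (phi z x) / of_real ((norm (phi z x))\<^sup>2)"
  proof -
    have "complex_of_real ((norm (phi z x))\<^sup>2) = phi z x * cnj (phi z x)" by (rule complex_norm_square)
    then show ?thesis using nz by simp
  qed
  then have "Im (phi' z x / phi z x) = - Im z * I / (norm (phi z x))\<^sup>2"
    using im by (simp only: Im_divide_of_real)
  then have "Im z * Im (phi' z x / phi z x) = - ((Im z)\<^sup>2 * I / (norm (phi z x))\<^sup>2)"
    by (simp add: power2_eq_square)
  also have "\<dots> \<le> 0" using \<open>I > 0\<close> by simp
  finally show "Im z * Im (phi' z x / phi z x) \<le> 0" .
qed

text \<open>
  \<open>\<phi>(x) s(a) / \<phi>(a)\<close> is the diagonal of the Green function of the problem on \<open>(0,a)\<close> with a Dirichlet condition at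
  \<open>a\<close>. Its reciprocal is \<open>c(a)/s(a) + \<phi>'(x)/\<phi>(x)\<close>. On the rays in question the first summand is close to
  \<open>- \<i> \<omega>\<close>, and the imaginary part of the second has the same sign by \<open>phi_nonreal\<close>. In this way the size of \<open>\<phi>\<close> from
  below, which would need its asymptotics, does not enter.
\<close>
lemma green_function_small:
  assumes z: "z = \<omega>\<^sup>2" and \<omega>: "Re \<omega> = \<sigma> * \<tau>" "Im \<omega> = \<tau>" "\<sigma> \<in> {1, -1}" "\<tau> > K"
    and K: "norm (c a / s a + \<i> * \<omega>) \<le> K" and x: "0 < x" "x \<le> a" "a \<le> 1" and K0: "K \<ge> 0"
    and s: "solves (\<lambda>t. pot t - z) x a s s'" "s x = 0" "s' x = 1" "s a \<noteq> 0"
    and c: "solves (\<lambda>t. pot t - z) x a c c'" "c x = 1" "c' x = 0"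
  shows "norm (phi z x * s a / phi z a) \<le> 1 / (\<tau> - K)"
proof -
  have Imz: "Im z = 2 * \<sigma> * \<tau>\<^sup>2" unfolding z Im_power2 using \<omega> by (simp add: power2_eq_square)
  then have Imz0: "Im z \<noteq> 0" using \<omega> K0 by auto
  have nz: "phi z x \<noteq> 0" "phi z a \<noteq> 0" using phi_nonreal(1)[OF Imz0] x by auto
  note \<phi> = phi_solves[OF x(1,2,3), of z]
  have W1: "phi' z a * s a - phi z a * s' a = - phi z x"
      by (rule eq_neg_iff_add_eq_0[THEN iffD2])
        (use wronskian_increment[OF \<phi> s(1)] s in simp)
  have W2: "phi' z a * c a - phi z a * c' a = phi' z x" using wronskian_increment[OF \<phi> c(1)] c by simp
  have W3: "c' a * s a - c a * s' a = - 1"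
      by (rule eq_neg_iff_add_eq_0[THEN iffD2])
        (use wronskian_increment[OF c(1) s(1)] s c in simp)
  have "phi z x * c a + phi' z x * s a = - (phi' z a * s a - phi z a * s' a) * c a + (phi' z a * c a - phi z a * c' a) * s a"
    unfolding W1 W2 by simp
  also have "\<dots> = - phi z a * (c' a * s a - c a * s' a)" by (simp add: algebra_simps)
  finally have "phi z x * c a + phi' z x * s a = phi z a" unfolding W3 by simp
  then have inv: "phi z a / (phi z x * s a) = c a / s a + phi' z x / phi z x"
    using nz s(4) by (simp add: field_simps)
  define N where "N = c a / s a + phi' z x / phi z x"
  have "\<bar>Im (c a / s a + \<i> * \<omega>)\<bar> \<le> K" using K abs_Im_le_cmod order_trans by blast
  then have k: "\<bar>Im (c a / s a) + \<sigma> * \<tau>\<bar> \<le> K" using \<omega> by simp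
  have "\<tau> > 0" using \<omega> K0 by simp
  have "2 * \<tau>\<^sup>2 * (\<sigma> * Im (phi' z x / phi z x)) \<le> 0"
    using phi_nonreal(2)[OF Imz0 x(1)] x unfolding Imz by (simp add: algebra_simps)
  then have m: "\<sigma> * Im (phi' z x / phi z x) \<le> 0" using \<open>\<tau> > 0\<close> by (simp add: mult_le_0_iff)
  have "\<tau> - K \<le> - \<sigma> * Im N"
    using k m \<omega>(3) by (auto simp: N_def)
  also have "\<dots> \<le> \<bar>Im N\<bar>" using \<omega>(3) by auto
  also have "\<dots> \<le> norm N" by (rule abs_Im_le_cmod)
  finally have "\<tau> - K \<le> norm N" .
  then have "1 / norm N \<le> 1 / (\<tau> - K)" using \<omega>(4) by (intro divide_left_mono mult_pos_pos) auto
  moreover have "phi z x * s a / phi z a = 1 / N" unfolding N_def inv[symmetric] by simp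
  ultimately show ?thesis by (simp add: norm_divide)
qed

end

locale radial_pair = A: radial_potential l q + B: radial_potential l qh for l q qh
begin

definition h :: "real \<Rightarrow> complex" where "h t = of_real (q t - qh t)"

lemma h_abs_integrable: "h absolutely_integrable_on {0..1}"
  unfolding h_def[abs_def] of_real_diff by (intro set_integral_diff(1) A.qc B.qc)

lemma pot_diff: "(A.pot t - z) - (B.pot t - z) = h t"
  by (simp add: A.pot_def B.pot_def h_def)

definition wronskian :: "complex \<Rightarrow> real \<Rightarrow> complex" where
  "wronskian z x = A.phi' z x * B.phi z x - A.phi z x * B.phi' z x"

lemma wronskian_eq_integral:
  assumes "0 < x" "x \<le> 1"
  shows "wronskian z x = integral {0..x} (\<lambda>t. h t * (A.phi z t * B.phi z t))"
  unfolding wronskian_def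
  by (rule wronskian_from_0[OF A.phi_regular B.phi_regular A.l assms A.phi_solves[OF _ _ assms(2)] B.phi_solves[OF _ _ assms(2)]])
    (use assms pot_diff in \<open>auto intro!: absolutely_integrable_on_subinterval[OF h_abs_integrable]\<close>)

lemma wronskian_hol: "0 < x \<Longrightarrow> x \<le> 1 \<Longrightarrow> (\<lambda>z. wronskian z x) holomorphic_on UNIV"
  unfolding wronskian_def by (intro holomorphic_intros A.phi_hol A.phi'_hol B.phi_hol B.phi'_hol) auto

lemma hphi_integrable: "(\<lambda>t. h t * (A.phi z t * B.phi z t)) absolutely_integrable_on {0..1}"
  by (intro absolutely_integrable_mult_continuous h_abs_integrable continuous_intros A.phi_cont B.phi_cont)

text \<open>
  If the logarithmic derivatives of the two regular solutions agree at \<open>a\<close>, then so do those of the solutions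
  that start at \<open>x\<close> with data \<open>(0,1)\<close>: their Wronskian \<open>E\<close> at \<open>a\<close> is entire of order \<open>1/2\<close>. It is the difference of the
  diagonals of the two Green functions, each multiplied by a bounded quotient, and so it tends to \<open>0\<close> along the
  imaginary axis.
\<close>
lemma dirichlet_wronskian_zero:
  assumes x: "0 < x" "x < a" "a \<le> 1" and wr0: "\<And>z. wronskian z a = 0"
    and sA: "\<And>z. solves (\<lambda>t. A.pot t - z) x a (sA z) (sA' z)" "\<And>z. sA z x = 0" "\<And>z. sA' z x = 1"
      "(\<lambda>z. sA z a) holomorphic_on UNIV" "(\<lambda>z. sA' z a) holomorphic_on UNIV"
    and sB: "\<And>z. solves (\<lambda>t. B.pot t - z) x a (sB z) (sB' z)" "\<And>z. sB z x = 0" "\<And>z. sB' z x = 1"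
      "(\<lambda>z. sB z a) holomorphic_on UNIV" "(\<lambda>z. sB' z a) holomorphic_on UNIV"
  shows "sA' z a * sB z a - sA z a * sB' z a = 0"
proof -
  define E where "E z = sA' z a * sB z a - sA z a * sB' z a" for z
  define L where "L = a - x"
  have L: "L > 0" "L \<le> 1" using x by (auto simp: L_def)
  have Ehol: "E holomorphic_on UNIV" unfolding E_def by (intro holomorphic_intros sA sB)
  define KA where "KA = integral {x..a} (\<lambda>t. norm (A.pot t))"
  define KB where "KB = integral {x..a} (\<lambda>t. norm (B.pot t))"
  have PA: "A.pot absolutely_integrable_on {x..a}" and PB: "B.pot absolutely_integrable_on {x..a}"
    using A.pot B.pot x by auto
  have nPA: "(\<lambda>t. norm (A.pot t)) integrable_on {x..a}" and nPB: "(\<lambda>t. norm (B.pot t)) integrable_on {x..a}"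
    using norm_absolutely_integrable[OF PA] norm_absolutely_integrable[OF PB] set_lebesgue_integral_eq_integral(1) by blast+
  have KA0: "KA \<ge> 0" and KB0: "KB \<ge> 0"
    unfolding KA_def KB_def by (intro Henstock_Kurzweil_Integration.integral_nonneg nPA nPB; simp)+
  define J where "J = integral {x..a} (\<lambda>t. norm (h t))"
  have hx: "h absolutely_integrable_on {x..a}"
    by (rule absolutely_integrable_on_subinterval[OF h_abs_integrable]) (use x in auto)
  have nh: "(\<lambda>t. norm (h t)) integrable_on {x..a}"
    using norm_absolutely_integrable[OF hx] set_lebesgue_integral_eq_integral(1) by blast
  have Eint: "E z = integral {x..a} (\<lambda>t. h t * (sA z t * sB z t))" for z
    using wronskian_increment[OF sA(1)[of z] sB(1)[of z]] sA(2,3) sB(2,3) by (simp add: E_def pot_diff)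
  define M where "M = J * ((2 * exp (2 * KA)) * (2 * exp (2 * KB)))"
  have growth1: "norm (E z) \<le> M * exp (2 * sqrt (norm z))" if z: "norm z \<ge> 1" for z
  proof -
    define \<omega> where "\<omega> = csqrt z"
    have \<omega>: "\<omega>\<^sup>2 = z" "norm \<omega> = sqrt (norm z)" by (auto simp: \<omega>_def)
    have \<omega>1: "norm \<omega> \<ge> 1" "\<omega> \<noteq> 0" using z \<omega>(2) by auto
    define e where "e = exp (sqrt (norm z))"
    have ee: "exp (\<bar>Im \<omega>\<bar> * (t - x)) \<le> e" if "t \<in> {x..a}" for t
    proof -
      have "\<bar>Im \<omega>\<bar> * (t - x) \<le> norm \<omega> * 1" using that x abs_Im_le_cmod[of \<omega>] by (intro mult_mono) auto
      then show ?thesis by (simp add: e_def \<omega>)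
    qed
    have bA: "norm (sA z t) \<le> 2 * exp (2 * KA) * e" if t: "t \<in> {x..a}" for t
    proof -
      have s: "solves (\<lambda>t. A.pot t - \<omega>\<^sup>2) x a (sA z) (sA' z)" using sA(1)[of z] by (simp add: \<omega>)
      have "KA / norm \<omega> \<le> KA" using KA0 \<omega>1 by (simp add: divide_le_eq mult_le_cancel_left1)
      then have "norm (sA z t) \<le> 2 * (norm (sA z x) + norm (sA' z x) / norm \<omega>) * exp (2 * KA) * exp (\<bar>Im \<omega>\<bar> * (t - x))"
        by (intro solution_bound[OF s \<omega>1(2) t]) (simp add: KA_def)
      also have "\<dots> \<le> 2 * 1 * exp (2 * KA) * e"
        using \<omega>1 ee[OF t] by (intro mult_mono) (auto simp: sA(2,3))
      finally show ?thesis by simp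
    qed
    have bB: "norm (sB z t) \<le> 2 * exp (2 * KB) * e" if t: "t \<in> {x..a}" for t
    proof -
      have s: "solves (\<lambda>t. B.pot t - \<omega>\<^sup>2) x a (sB z) (sB' z)" using sB(1)[of z] by (simp add: \<omega>)
      have "KB / norm \<omega> \<le> KB" using KB0 \<omega>1 by (simp add: divide_le_eq mult_le_cancel_left1)
      then have "norm (sB z t) \<le> 2 * (norm (sB z x) + norm (sB' z x) / norm \<omega>) * exp (2 * KB) * exp (\<bar>Im \<omega>\<bar> * (t - x))"
        by (intro solution_bound[OF s \<omega>1(2) t]) (simp add: KB_def)
      also have "\<dots> \<le> 2 * 1 * exp (2 * KB) * e"
        using \<omega>1 ee[OF t] by (intro mult_mono) (auto simp: sB(2,3))
      finally show ?thesis by simp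
    qed
    have "norm (E z) \<le> integral {x..a} (\<lambda>t. norm (h t) * ((2 * exp (2 * KA) * e) * (2 * exp (2 * KB) * e)))"
      unfolding Eint
    proof (rule Henstock_Kurzweil_Integration.integral_norm_bound_integral)
      show "(\<lambda>t. h t * (sA z t * sB z t)) integrable_on {x..a}"
        by (intro set_lebesgue_integral_eq_integral(1) absolutely_integrable_mult_continuous hx continuous_intros
            solves_continuous[OF sA(1)] solves_continuous[OF sB(1)])
      show "(\<lambda>t. norm (h t) * ((2 * exp (2 * KA) * e) * (2 * exp (2 * KB) * e))) integrable_on {x..a}"
        by (intro integrable_on_mult_left nh)
      show "norm (h t * (sA z t * sB z t)) \<le> norm (h t) * ((2 * exp (2 * KA) * e) * (2 * exp (2 * KB) * e))"
        if t: "t \<in> {x..a}" for t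
        unfolding norm_mult by (intro mult_left_mono mult_mono bA bB t) (auto simp: e_def)
    qed
    also have "\<dots> = M * (e * e)" by (simp add: M_def J_def)
    also have "e * e = exp (2 * sqrt (norm z))" by (simp add: e_def exp_add[symmetric])
    finally show ?thesis .
  qed
  obtain M1 where M1: "\<And>z. norm z \<le> 1 \<Longrightarrow> norm (E z) \<le> M1"
  proof -
    have "continuous_on (cball 0 1) E" by (rule holomorphic_on_imp_continuous_on[OF holomorphic_on_subset[OF Ehol]]) auto
    then have "bounded (E ` cball 0 1)" using compact_continuous_image compact_imp_bounded compact_cball by blast
    then obtain M1 where "\<forall>y\<in>E ` cball 0 1. norm y \<le> M1" unfolding bounded_iff by blast
    then show thesis by (intro that[of M1]) simp
  qed
  have growth: "norm (E z) \<le> max M M1 * exp (2 * sqrt (norm z))" for z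
  proof (cases "norm z \<ge> 1")
    case True
    have "M * exp (2 * sqrt (norm z)) \<le> max M M1 * exp (2 * sqrt (norm z))" by (intro mult_right_mono) auto
    with growth1[OF True] show ?thesis by linarith
  next
    case False
    have "M1 \<ge> 0" using M1[of 0] norm_ge_zero order_trans by (metis norm_zero zero_le_one)
    have "norm (E z) \<le> M1 * 1" using M1[of z] False by simp
    also have "\<dots> \<le> max M M1 * exp (2 * sqrt (norm z))" using \<open>M1 \<ge> 0\<close> by (intro mult_mono) auto
    finally show ?thesis .
  qed
  obtain cA cA' where cA: "\<And>z. solves (\<lambda>t. A.pot t - z) x a (cA z) (cA' z)" "\<And>z. cA z x = 1" "\<And>z. cA' z x = 0"
  proof -
    have "a \<le> x + 1" using x by simp
    from initial_value_problem[OF x(1) less_imp_le[OF x(2)] this PA, of 1 0] that show thesis by metis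
  qed
  obtain cB cB' where cB: "\<And>z. solves (\<lambda>t. B.pot t - z) x a (cB z) (cB' z)" "\<And>z. cB z x = 1" "\<And>z. cB' z x = 0"
  proof -
    have "a \<le> x + 1" using x by simp
    from initial_value_problem[OF x(1) less_imp_le[OF x(2)] this PB, of 1 0] that show thesis by metis
  qed
  define K where "K = 2 * KA * exp (2 * KA) + 2 * KB * exp (2 * KB)"
  have K0: "K \<ge> 0" and KKA: "2 * KA * exp (2 * KA) \<le> K" and KKB: "2 * KB * exp (2 * KB) \<le> K"
    using KA0 KB0 by (auto simp: K_def)
  define K2 where "K2 = 1 + 8 * K"
  have lim: "((\<lambda>y::real. E (\<i> * of_real (\<sigma> * y))) \<longlongrightarrow> 0) at_top" if \<sigma>: "\<sigma> \<in> {1, -1}" for \<sigma> :: real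
  proof (rule Lim_null_comparison)
    have "filterlim (\<lambda>y::real. sqrt (y / 2)) at_top at_top" by real_asymp
    from eventually_compose_filterlim[OF sine_cosine_comparison[OF L(1) K0] this]
    have ev: "\<forall>\<^sub>F y in at_top. \<forall>\<omega> s c :: complex. Im \<omega> = sqrt (y / 2) \<longrightarrow> norm \<omega> = sqrt 2 * sqrt (y / 2) \<longrightarrow>
     norm (s - sin (\<omega> * of_real L) / \<omega>) \<le> K * exp (sqrt (y / 2) * L) / (norm \<omega>)\<^sup>2 \<longrightarrow>
     norm (c - cos (\<omega> * of_real L)) \<le> K * exp (sqrt (y / 2) * L) / norm \<omega> \<longrightarrow>
       exp (sqrt (y / 2) * L) / 4 \<le> norm \<omega> * norm s \<and> norm \<omega> * norm s \<le> (1 + K) * exp (sqrt (y / 2) * L) \<and>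
       norm (c / s + \<i> * \<omega>) \<le> 1 + 8 * K" .
    have ev2: "\<forall>\<^sub>F y::real in at_top. sqrt (y / 2) > K2" by real_asymp
    have ev3: "\<forall>\<^sub>F y::real in at_top. y > 2" by (rule eventually_gt_at_top)
    show "\<forall>\<^sub>F y in at_top. norm (E (\<i> * of_real (\<sigma> * y))) \<le> 8 * (1 + K) / (sqrt (y / 2) - K2)"
      using ev ev2 ev3
    proof eventually_elim
      case (elim y)
      define \<tau> where "\<tau> = sqrt (y / 2)"
      define \<omega> where "\<omega> = Complex (\<sigma> * \<tau>) \<tau>"
      define z where "z = \<i> * of_real (\<sigma> * y)"
      have \<tau>2: "\<tau>\<^sup>2 = y / 2" using elim(3) by (simp add: \<tau>_def)
      have \<tau>: "\<tau> \<ge> 1" using elim(3) by (simp add: \<tau>_def)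
      have \<sigma>2: "\<sigma> * \<sigma> = 1" using \<sigma> by auto
      have z: "z = \<omega>\<^sup>2"
        using \<tau>2 \<sigma>2 by (simp add: z_def \<omega>_def complex_eq_iff power2_eq_square algebra_simps)
      have n\<omega>: "norm \<omega> = sqrt 2 * \<tau>"
      proof -
        have "norm \<omega> = sqrt ((\<sigma> * \<tau>)\<^sup>2 + \<tau>\<^sup>2)" by (simp add: \<omega>_def cmod_def)
        also have "(\<sigma> * \<tau>)\<^sup>2 + \<tau>\<^sup>2 = 2 * \<tau>\<^sup>2" using \<sigma>2 by (simp add: power2_eq_square)
        finally show ?thesis using \<tau> by (simp add: real_sqrt_mult)
      qed
      have "1 * 1 \<le> sqrt 2 * \<tau>" using \<tau> by (intro mult_mono) auto
      then have \<omega>1: "norm \<omega> \<ge> 1" by (simp add: n\<omega>)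
      have Im\<omega>: "Im \<omega> = \<tau>" "\<bar>Im \<omega>\<bar> = \<tau>" "Re \<omega> = \<sigma> * \<tau>" using \<tau> by (auto simp: \<omega>_def)
      have e0: "exp (\<tau> * L) > 0" by simp
      have asy: "norm (s - sin (\<omega> * of_real L) / \<omega>) \<le> K * exp (\<tau> * L) / (norm \<omega>)\<^sup>2"
        if s: "solves (\<lambda>t. Q t - z) x a sf sf'" "sf x = 0" "sf' x = 1" "sf a = s"
          and Q: "Q absolutely_integrable_on {x..a}" and KQ: "2 * k * exp (2 * k) \<le> K" "k = integral {x..a} (\<lambda>t. norm (Q t))"
        for sf sf' s Q k
      proof -
        have "norm (s - sin (\<omega> * of_real L) / \<omega>) \<le> 2 * k * exp (2 * k) / norm \<omega> * (1 / norm \<omega>) * exp (\<tau> * L)"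
          using solution_asymptotics[OF s(1)[unfolded z] \<omega>1 Q KQ(2)] s Im\<omega> by (simp add: L_def)
        also have "\<dots> = 2 * k * exp (2 * k) * (exp (\<tau> * L) / (norm \<omega>)\<^sup>2)" by (simp add: power2_eq_square)
        also have "\<dots> \<le> K * (exp (\<tau> * L) / (norm \<omega>)\<^sup>2)" by (intro mult_right_mono KQ) auto
        finally show ?thesis by simp
      qed
      have asyc: "norm (c - cos (\<omega> * of_real L)) \<le> K * exp (\<tau> * L) / norm \<omega>"
        if s: "solves (\<lambda>t. Q t - z) x a sf sf'" "sf x = 1" "sf' x = 0" "sf a = c"
          and Q: "Q absolutely_integrable_on {x..a}" and KQ: "2 * k * exp (2 * k) \<le> K" "k = integral {x..a} (\<lambda>t. norm (Q t))"
        for sf sf' c Q k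
      proof -
        have "norm (c - cos (\<omega> * of_real L)) \<le> 2 * k * exp (2 * k) / norm \<omega> * exp (\<tau> * L)"
          using solution_asymptotics[OF s(1)[unfolded z] \<omega>1 Q KQ(2)] s Im\<omega> by (simp add: L_def)
        also have "\<dots> = 2 * k * exp (2 * k) * (exp (\<tau> * L) / norm \<omega>)" by simp
        also have "\<dots> \<le> K * (exp (\<tau> * L) / norm \<omega>)" by (intro mult_right_mono KQ) auto
        finally show ?thesis by simp
      qed
      have compA: "exp (\<tau> * L) / 4 \<le> norm \<omega> * norm (sA z a) \<and> norm \<omega> * norm (sA z a) \<le> (1 + K) * exp (\<tau> * L) \<and>
         norm (cA z a / sA z a + \<i> * \<omega>) \<le> K2"
        using elim(1)[folded \<tau>_def, rule_format, OF Im\<omega>(1) n\<omega>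
            asy[OF sA(1-3)[of z] refl PA KKA KA_def] asyc[OF cA(1-3)[of z] refl PA KKA KA_def]] by (simp add: K2_def)
      have compB: "exp (\<tau> * L) / 4 \<le> norm \<omega> * norm (sB z a) \<and> norm \<omega> * norm (sB z a) \<le> (1 + K) * exp (\<tau> * L) \<and>
         norm (cB z a / sB z a + \<i> * \<omega>) \<le> K2"
        using elim(1)[folded \<tau>_def, rule_format, OF Im\<omega>(1) n\<omega>
            asy[OF sB(1-3)[of z] refl PB KKB KB_def] asyc[OF cB(1-3)[of z] refl PB KKB KB_def]] by (simp add: K2_def)
      have sA0: "sA z a \<noteq> 0" and sB0: "sB z a \<noteq> 0" using compA compB e0 by auto
      have ratio: "norm (s / t) \<le> 4 * (1 + K)" if "exp (\<tau> * L) / 4 \<le> norm \<omega> * norm t" "norm \<omega> * norm s \<le> (1 + K) * exp (\<tau> * L)"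
        for s t :: complex
      proof -
        have t: "norm t > 0" using that(1) e0 \<omega>1 by (smt (verit) divide_pos_pos mult_eq_0_iff norm_ge_zero)
        have "norm \<omega> * norm s \<le> (1 + K) * (4 * (norm \<omega> * norm t))"
          using that(1) K0 by (intro order_trans[OF that(2)] mult_left_mono) auto
        then have "norm \<omega> * norm s \<le> norm \<omega> * (4 * (1 + K) * norm t)" by (simp add: algebra_simps)
        then have "norm s \<le> 4 * (1 + K) * norm t" using \<omega>1 by (subst (asm) mult_le_cancel_left_pos) auto
        then show ?thesis using t by (simp add: norm_divide divide_le_eq)
      qed
      have K20: "K2 \<ge> 0" using K0 by (simp add: K2_def)
      have \<tau>K: "\<tau> > K2" using elim(2) by (simp add: \<tau>_def)
      have xa: "x \<le> a" using x by simp
      have GA: "norm (A.phi z x * sA z a / A.phi z a) \<le> 1 / (\<tau> - K2)"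
        using compA by (intro A.green_function_small[OF z Im\<omega>(3,1) \<sigma> \<tau>K _ x(1) xa x(3) K20 sA(1-3)[of z] sA0 cA(1-3)[of z]]) auto
      have GB: "norm (B.phi z x * sB z a / B.phi z a) \<le> 1 / (\<tau> - K2)"
        using compB by (intro B.green_function_small[OF z Im\<omega>(3,1) \<sigma> \<tau>K _ x(1) xa x(3) K20 sB(1-3)[of z] sB0 cB(1-3)[of z]]) auto
      have Imz0: "Im z \<noteq> 0" using \<sigma> elim(3) by (auto simp: z_def)
      have nz: "A.phi z a \<noteq> 0" "B.phi z a \<noteq> 0"
        using A.phi_nonreal(1)[OF Imz0, of a] B.phi_nonreal(1)[OF Imz0, of a] x by auto
      have WA: "A.phi' z a * sA z a - A.phi z a * sA' z a = - A.phi z x"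
      by (rule eq_neg_iff_add_eq_0[THEN iffD2])
        (use wronskian_increment[OF A.phi_solves[OF x(1) xa x(3), of z] sA(1)[of z]] sA(2,3) in simp)
      have WB: "B.phi' z a * sB z a - B.phi z a * sB' z a = - B.phi z x"
      by (rule eq_neg_iff_add_eq_0[THEN iffD2])
        (use wronskian_increment[OF B.phi_solves[OF x(1) xa x(3), of z] sB(1)[of z]] sB(2,3) in simp)
      \<comment> \<open>the hypothesis; it cancels the terms of \<open>E\<close> that are not small\<close>
      have m: "A.phi' z a / A.phi z a = B.phi' z a / B.phi z a"
        using wr0[of z] nz by (simp add: wronskian_def field_simps)
      have eA: "sA' z a = A.phi z x / A.phi z a + A.phi' z a / A.phi z a * sA z a" using WA nz by (simp add: field_simps)
      have eB: "sB' z a = B.phi z x / B.phi z a + A.phi' z a / A.phi z a * sB z a" unfolding m using WB nz by (simp add: field_simps)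
      have "E z = A.phi z x / A.phi z a * sB z a - sA z a * (B.phi z x / B.phi z a)"
        unfolding E_def eA eB by (simp add: algebra_simps)
      also have "\<dots> = (sB z a / sA z a) * (A.phi z x * sA z a / A.phi z a) - (sA z a / sB z a) * (B.phi z x * sB z a / B.phi z a)"
        using sA0 sB0 by simp
      also have "norm \<dots> \<le> 4 * (1 + K) * (1 / (\<tau> - K2)) + 4 * (1 + K) * (1 / (\<tau> - K2))"
      proof (intro norm_triangle_le_diff add_mono)
        show "norm (sB z a / sA z a * (A.phi z x * sA z a / A.phi z a)) \<le> 4 * (1 + K) * (1 / (\<tau> - K2))"
          unfolding norm_mult[of "sB z a / sA z a"] using K0
          by (intro mult_mono[OF ratio[OF conjunct1[OF compA] conjunct1[OF conjunct2[OF compB]]] GA]) auto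
        show "norm (sA z a / sB z a * (B.phi z x * sB z a / B.phi z a)) \<le> 4 * (1 + K) * (1 / (\<tau> - K2))"
          unfolding norm_mult[of "sA z a / sB z a"] using K0
          by (intro mult_mono[OF ratio[OF conjunct1[OF compB] conjunct1[OF conjunct2[OF compA]]] GB]) auto
      qed
      finally show ?case by (simp add: z_def \<tau>_def)
    qed
    show "((\<lambda>y. 8 * (1 + K) / (sqrt (y / 2) - K2)) \<longlongrightarrow> 0) at_top" by real_asymp
  qed
  have "E z = 0" by (rule entire_order_half_vanishing_on_axis[OF Ehol growth lim])
  then show ?thesis by (simp add: E_def)
qed

end

context radial_pair
begin

text \<open>
  Reduction of order: \<open>(s/\<phi>)' = \<phi>(x)/\<phi>\<^sup>2\<close>, because the Wronskian of \<open>s\<close> and \<open>\<phi>\<close> is constant.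
\<close>
lemma phi_ratio_integral:
  assumes x: "0 < x" "x < a" "a \<le> 1" and nz: "\<And>t. 0 < t \<Longrightarrow> t \<le> a \<Longrightarrow> \<phi> t \<noteq> 0"
    and \<phi>: "solves V x a \<phi> \<phi>'" and s: "solves V x a s s'" "s x = 0" "s' x = 1"
  shows "s a / \<phi> a = \<phi> x * integral {x..a} (\<lambda>t. 1 / (\<phi> t)\<^sup>2)"
proof -
  have nz': "\<phi> t \<noteq> 0" if "t \<in> {x..a}" for t using nz[of t] that x by auto
  have W: "s' t * \<phi> t - s t * \<phi>' t = \<phi> x" if t: "t \<in> {x..a}" for t
  proof -
    have "solves V x t s s'" "solves V x t \<phi> \<phi>'" using t by (auto intro: solves_subinterval[OF s(1)] solves_subinterval[OF \<phi>])
    from wronskian_increment[OF this] show ?thesis using s by simp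
  qed
  have "((\<lambda>t. \<phi> x * (1 / (\<phi> t)\<^sup>2)) has_integral (s a / \<phi> a - s x / \<phi> x)) {x..a}"
  proof (rule fundamental_theorem_of_calculus)
    fix t assume t: "t \<in> {x..a}"
    have ds: "(s has_derivative (\<lambda>h. h *\<^sub>R s' t)) (at t within {x..a})"
      and dp: "(\<phi> has_derivative (\<lambda>h. h *\<^sub>R \<phi>' t)) (at t within {x..a})"
      using solves_has_vector_derivative[OF s(1) t] solves_has_vector_derivative[OF \<phi> t]
      unfolding has_vector_derivative_def by auto
    have eq: "h *\<^sub>R (\<phi> x * (1 / (\<phi> t)\<^sup>2)) = (h *\<^sub>R s' t * \<phi> t - s t * (h *\<^sub>R \<phi>' t)) / (\<phi> t * \<phi> t)" for h
      unfolding W[OF t, symmetric]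
      using nz'[OF t] by (simp add: power2_eq_square scaleR_conv_of_real field_simps)
    show "((\<lambda>t. s t / \<phi> t) has_vector_derivative \<phi> x * (1 / (\<phi> t)\<^sup>2)) (at t within {x..a})"
      unfolding has_vector_derivative_def eq by (rule has_derivative_divide'[OF ds dp nz'[OF t]])
  qed (use x in simp)
  from integral_unique[OF this]
  have "\<phi> x * integral {x..a} (\<lambda>t. 1 / (\<phi> t)\<^sup>2) = s a / \<phi> a - s x / \<phi> x"
    by (simp only: Henstock_Kurzweil_Integration.integral_mult_right)
  then show ?thesis using s by simp
qed

text \<open>
  At the nonreal point \<open>z = \<i>\<close>, where \<open>\<phi>\<close> has no zeros, \<open>dirichlet_wronskian_zero\<close> and \<open>phi_ratio_integral\<close> give
  \<open>\<phi>(a)\<^sup>2 \<integral>\<^sub>x\<^sup>a \<phi>\<^bsup>-2\<^esup>\<close> the same value for both potentials, for every \<open>x\<close>. Differentiation in \<open>x\<close> shows that the two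
  functions \<open>\<phi>\<close> are proportional. So their Wronskian vanishes on \<open>(0,a)\<close>, and its derivative is the difference of
  the potentials times a function without zeros.
\<close>
lemma borg_marchenko:
  assumes a: "0 < a" "a \<le> 1" and wr0: "\<And>z. wronskian z a = 0"
  shows "AE x in lebesgue. x \<in> {0<..<a} \<longrightarrow> q x = qh x"
proof -
  define f where "f = A.phi \<i>"
  define f' where "f' = A.phi' \<i>"
  define g where "g = B.phi \<i>"
  define g' where "g' = B.phi' \<i>"
  have fnz: "f t \<noteq> 0" and gnz: "g t \<noteq> 0" if "0 < t" "t \<le> 1" for t
    using A.phi_nonreal(1)[of \<i> t] B.phi_nonreal(1)[of \<i> t] that by (auto simp: f_def g_def)
  have fs: "solves (\<lambda>t. A.pot t - \<i>) c d f f'" and gs: "solves (\<lambda>t. B.pot t - \<i>) c d g g'"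
    if "0 < c" "c \<le> d" "d \<le> 1" for c d
    using A.phi_solves[OF that] B.phi_solves[OF that] by (auto simp: f_def f'_def g_def g'_def)
  have fc: "continuous_on {c..d} f" and gc: "continuous_on {c..d} g" if "0 < c" "d \<le> 1" for c d
    using that by (auto simp: f_def g_def intro!: continuous_on_subset[OF A.phi_cont] continuous_on_subset[OF B.phi_cont])
  define k where "k t = (f a)\<^sup>2 * (1 / (f t)\<^sup>2) - (g a)\<^sup>2 * (1 / (g t)\<^sup>2)" for t
  have kc: "continuous_on {c..d} k" if "0 < c" "d \<le> 1" for c d
    unfolding k_def[abs_def] using that fnz gnz by (intro continuous_intros fc gc) auto
  have k_int: "integral {x..a} k = 0" if x: "0 < x" "x < a" for x
  proof -
    have PA: "A.pot absolutely_integrable_on {x..a}" and PB: "B.pot absolutely_integrable_on {x..a}"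
      using A.pot B.pot x a by auto
    have xa: "x \<le> a" "a \<le> x + 1" using x a by auto
    obtain sA sA' where sA: "\<And>z. solves (\<lambda>t. A.pot t - z) x a (sA z) (sA' z)" "\<And>z. sA z x = 0" "\<And>z. sA' z x = 1"
      "(\<lambda>z. sA z a) holomorphic_on UNIV" "(\<lambda>z. sA' z a) holomorphic_on UNIV"
    proof (rule initial_value_problem[OF x(1) xa PA, of 0 1])
      fix s s' assume s: "\<And>z. solves (\<lambda>t. A.pot t - z) x a (s z) (s' z)" "\<And>z. s z x = 0" "\<And>z. s' z x = 1"
        "\<And>y. y \<in> {x..a} \<Longrightarrow> (\<lambda>z. s z y) holomorphic_on UNIV"
        "\<And>y. y \<in> {x..a} \<Longrightarrow> (\<lambda>z. s' z y) holomorphic_on UNIV"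
      show thesis by (rule that[OF s(1-3) s(4)[of a] s(5)[of a]]) (use xa in auto)
    qed
    obtain sB sB' where sB: "\<And>z. solves (\<lambda>t. B.pot t - z) x a (sB z) (sB' z)" "\<And>z. sB z x = 0" "\<And>z. sB' z x = 1"
      "(\<lambda>z. sB z a) holomorphic_on UNIV" "(\<lambda>z. sB' z a) holomorphic_on UNIV"
    proof (rule initial_value_problem[OF x(1) xa PB, of 0 1])
      fix s s' assume s: "\<And>z. solves (\<lambda>t. B.pot t - z) x a (s z) (s' z)" "\<And>z. s z x = 0" "\<And>z. s' z x = 1"
        "\<And>y. y \<in> {x..a} \<Longrightarrow> (\<lambda>z. s z y) holomorphic_on UNIV"
        "\<And>y. y \<in> {x..a} \<Longrightarrow> (\<lambda>z. s' z y) holomorphic_on UNIV"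
      show thesis by (rule that[OF s(1-3) s(4)[of a] s(5)[of a]]) (use xa in auto)
    qed
    have E0: "sA' \<i> a * sB \<i> a - sA \<i> a * sB' \<i> a = 0"
      by (rule dirichlet_wronskian_zero[OF x a(2) wr0 sA sB])
    have IA: "sA \<i> a / f a = f x * integral {x..a} (\<lambda>t. 1 / (f t)\<^sup>2)"
      using x a fnz by (intro phi_ratio_integral[OF x a(2) _ fs sA(1-3)]) auto
    have IB: "sB \<i> a / g a = g x * integral {x..a} (\<lambda>t. 1 / (g t)\<^sup>2)"
      using x a gnz by (intro phi_ratio_integral[OF x a(2) _ gs sB(1-3)]) auto
    have nz: "f a \<noteq> 0" "g a \<noteq> 0" "f x \<noteq> 0" "g x \<noteq> 0" using fnz gnz x a by auto
    have WA: "f' a * sA \<i> a - f a * sA' \<i> a = - f x"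
      by (rule eq_neg_iff_add_eq_0[THEN iffD2])
        (use wronskian_increment[OF fs[OF x(1) xa(1) a(2)] sA(1)] sA(2,3) in simp)
    have WB: "g' a * sB \<i> a - g a * sB' \<i> a = - g x"
      by (rule eq_neg_iff_add_eq_0[THEN iffD2])
        (use wronskian_increment[OF gs[OF x(1) xa(1) a(2)] sB(1)] sB(2,3) in simp)
    have m: "f' a * g a = f a * g' a" using wr0[of \<i>] by (simp add: wronskian_def f_def f'_def g_def g'_def)
    have fx: "f x = f a * sA' \<i> a - f' a * sA \<i> a" and gx: "g x = g a * sB' \<i> a - g' a * sB \<i> a"
      using WA WB by (metis minus_diff_eq minus_minus)+
    have "f x * g a * sB \<i> a - g x * f a * sA \<i> a
      = (f a * sA' \<i> a - f' a * sA \<i> a) * g a * sB \<i> a - (g a * sB' \<i> a - g' a * sB \<i> a) * f a * sA \<i> a"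
      unfolding fx gx by (simp add: algebra_simps)
    also have "\<dots> = f a * g a * (sA' \<i> a * sB \<i> a - sA \<i> a * sB' \<i> a) - (f' a * g a - f a * g' a) * sA \<i> a * sB \<i> a"
      by (simp add: algebra_simps)
    also have "\<dots> = 0" using E0 m by simp
    finally have e1: "f x * g a * sB \<i> a = g x * f a * sA \<i> a" by simp
    have sAe: "sA \<i> a = f a * (f x * integral {x..a} (\<lambda>t. 1 / (f t)\<^sup>2))" using IA nz by (simp add: field_simps)
    have sBe: "sB \<i> a = g a * (g x * integral {x..a} (\<lambda>t. 1 / (g t)\<^sup>2))" using IB nz by (simp add: field_simps)
    have "(f x * g x) * ((g a)\<^sup>2 * integral {x..a} (\<lambda>t. 1 / (g t)\<^sup>2)) = (f x * g x) * ((f a)\<^sup>2 * integral {x..a} (\<lambda>t. 1 / (f t)\<^sup>2))"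
      using e1 unfolding sAe sBe by (simp add: power2_eq_square algebra_simps)
    then have "(g a)\<^sup>2 * integral {x..a} (\<lambda>t. 1 / (g t)\<^sup>2) = (f a)\<^sup>2 * integral {x..a} (\<lambda>t. 1 / (f t)\<^sup>2)"
      using nz by simp
    moreover have "integral {x..a} k = (f a)\<^sup>2 * integral {x..a} (\<lambda>t. 1 / (f t)\<^sup>2) - (g a)\<^sup>2 * integral {x..a} (\<lambda>t. 1 / (g t)\<^sup>2)"
    proof -
      have i1: "(\<lambda>t. (f a)\<^sup>2 * (1 / (f t)\<^sup>2)) integrable_on {x..a}"
        using x a fnz by (intro integrable_continuous_real continuous_intros fc) auto
      have i2: "(\<lambda>t. (g a)\<^sup>2 * (1 / (g t)\<^sup>2)) integrable_on {x..a}"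
        using x a gnz by (intro integrable_continuous_real continuous_intros gc) auto
      show ?thesis unfolding k_def
        using Henstock_Kurzweil_Integration.integral_diff[OF i1 i2] by (simp only: Henstock_Kurzweil_Integration.integral_mult_right)
    qed
    ultimately show ?thesis by simp
  qed
  have k0: "k t = 0" if t: "0 < t" "t < a" for t
  proof -
    define c where "c = t / 2"
    have c: "0 < c" "c < t" using t by (auto simp: c_def)
    have zero: "integral {c..y} k = 0" if y: "y \<in> {c<..<a}" for y
    proof -
      have "k integrable_on {c..a}" using c a by (intro integrable_continuous_real kc) auto
      then have "integral {c..y} k + integral {y..a} k = integral {c..a} k"
        using y by (intro Henstock_Kurzweil_Integration.integral_combine) auto
      then show ?thesis using k_int[of y] k_int[of c] y c t by simp
    qed
    have "((\<lambda>y. integral {c..y} k) has_vector_derivative k t) (at t within {c..a})"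
      using c t a by (intro integral_has_vector_derivative kc) auto
    then have d1: "((\<lambda>y. integral {c..y} k) has_vector_derivative k t) (at t)"
      using c t by (simp add: at_within_Icc_at)
    have "((\<lambda>y. 0) has_vector_derivative k t) (at t)"
      by (rule has_vector_derivative_transform_within_open[OF d1, of "{c<..<a}"]) (use zero c t in auto)
    then show ?thesis using vector_derivative_unique_at has_vector_derivative_const by blast
  qed
  define C where "C = (g a)\<^sup>2 / (f a)\<^sup>2"
  have gC: "g t * g t = C * (f t * f t)" if t: "0 < t" "t < a" for t
  proof -
    have "(f a)\<^sup>2 * (1 / (f t)\<^sup>2) = (g a)\<^sup>2 * (1 / (g t)\<^sup>2)" using k0[OF t] by (simp add: k_def)
    then show ?thesis using fnz[of t] gnz[of t] fnz[of a] t a by (simp add: C_def field_simps power2_eq_square)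
  qed
  have W0: "wronskian \<i> t = 0" if t: "0 < t" "t < a" for t
  proof -
    have ti: "t \<in> {t/2..1}" and at: "at t within {t/2..1} = at t" using t a by (auto simp: at_within_Icc_at)
    have df: "(f has_vector_derivative f' t) (at t)"
      using solves_has_vector_derivative[OF fs ti] t a unfolding at by simp
    have dg: "(g has_vector_derivative g' t) (at t)"
      using solves_has_vector_derivative[OF gs ti] t a unfolding at by simp
    have d1: "((\<lambda>t. g t * g t) has_vector_derivative (g t * g' t + g' t * g t)) (at t)"
      by (rule has_vector_derivative_mult[OF dg dg])
    have "((\<lambda>t. C * (f t * f t)) has_vector_derivative C * (f t * f' t + f' t * f t)) (at t)"
      by (intro has_vector_derivative_mult_right has_vector_derivative_mult df)
    then have d2: "((\<lambda>t. g t * g t) has_vector_derivative C * (f t * f' t + f' t * f t)) (at t)"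
      by (rule has_vector_derivative_transform_within_open[of _ _ _ "{0<..<a}"]) (use t gC in auto)
    have "g t * g' t + g' t * g t = C * (f t * f' t + f' t * f t)"
      using vector_derivative_unique_at[OF d1 d2] .
    then have "2 * (g t * g' t) = 2 * (C * (f t * f' t))" by (simp add: algebra_simps)
    then have "(g t * g' t) * f t = C * (f t * f' t) * f t" by simp
    also have "\<dots> = (g t * g t) * f' t" unfolding gC[OF t] by (simp add: algebra_simps)
    finally have "g t * (g' t * f t) = g t * (g t * f' t)" by (simp add: algebra_simps)
    then have "g' t * f t = g t * f' t" using gnz[of t] t a by simp
    then show ?thesis by (simp add: wronskian_def f_def f'_def g_def g'_def algebra_simps)
  qed
  have "AE x in lebesgue. x \<in> {0<..<a} \<longrightarrow> h x * (A.phi \<i> x * B.phi \<i> x) = 0"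
  proof (rule AE_zero_if_interval_integrals_zero)
    fix s t assume st: "0 < s" "s \<le> t" "t < a"
    let ?H = "\<lambda>x. h x * (A.phi \<i> x * B.phi \<i> x)"
    have i: "?H integrable_on {c..d}" if "0 \<le> c" "d \<le> 1" for c d
      using that by (intro set_lebesgue_integral_eq_integral(1) absolutely_integrable_on_subinterval[OF hphi_integrable]) auto
    have "integral {0..s} ?H + integral {s..t} ?H = integral {0..t} ?H"
      using st a by (intro Henstock_Kurzweil_Integration.integral_combine i) auto
    then show "?H integrable_on {s..t} \<and> integral {s..t} ?H = 0"
      using wronskian_eq_integral[of s \<i>] wronskian_eq_integral[of t \<i>] W0[of s] W0[of t] st a i[of s t] by auto
  qed
  then show ?thesis
  proof eventually_elim
    case (elim x)
    show ?case
    proof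
      assume x: "x \<in> {0<..<a}"
      then have "h x = 0" using elim fnz[of x] gnz[of x] a by (auto simp: f_def g_def)
      then show "q x = qh x" by (simp add: h_def)
    qed
  qed
qed

section \<open>Common eigenvalues as zeros of the Wronskian\<close>

text \<open>Both regular solutions are multiples of the same data at \<open>1\<close>.\<close>
lemma common_eigenvalue_zero:
  assumes "z \<in> sl_spectrum l q \<beta>" "z \<in> sl_spectrum l qh \<beta>"
  shows "wronskian z 1 = 0"
proof -
  obtain k where k: "A.phi z 1 = k * A.bc0 \<beta>" "A.phi' z 1 = k * A.bc1 \<beta>" using A.eigenvalue_phi[OF assms(1)] by metis
  obtain kh where kh: "B.phi z 1 = kh * A.bc0 \<beta>" "B.phi' z 1 = kh * A.bc1 \<beta>"
    using B.eigenvalue_phi[OF assms(2)] unfolding A.bc0_def B.bc0_def A.bc1_def B.bc1_def by metis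
  show ?thesis by (simp add: wronskian_def k kh algebra_simps)
qed

text \<open>
  Let \<open>(b\<^sub>0, b\<^sub>1)\<close> be the data of \<open>\<psi>\<close> at \<open>1\<close>, so that \<open>\<phi> = k \<psi>\<close> there. Green's identity evaluates \<open>b\<^sub>1 \<phi>(\<mu>) - b\<^sub>0 \<phi>'(\<mu>)\<close> as
  \<open>(\<mu> - z)/k\<close> times \<open>\<integral> \<phi>(z,\<cdot>) \<phi>(\<mu>,\<cdot>)\<close>, which tends to \<open>k\<^sup>2 \<zeta>\<close> as \<open>\<mu> \<rightarrow> z\<close>. The difference quotients of \<open>b\<^sub>0 F\<close> and \<open>b\<^sub>1 F\<close> are
  combinations of two such expressions, whose limits cancel when the two norming constants \<open>\<zeta>\<close> agree. One of
  \<open>b\<^sub>0\<close> and \<open>b\<^sub>1\<close> is nonzero.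
\<close>
lemma equal_norming_constants_double_zero:
  assumes z: "z \<in> \<real>" "z \<in> sl_spectrum l q \<beta>" "z \<in> sl_spectrum l qh \<beta>"
    and norming: "norming_const l q \<beta> z = norming_const l qh \<beta> z"
  shows "deriv (\<lambda>z. wronskian z 1) z = 0"
proof -
  define b0 where "b0 = A.bc0 \<beta>"
  define b1 where "b1 = A.bc1 \<beta>"
  obtain k where k: "k \<noteq> 0" "A.phi z 1 = k * b0" "A.phi' z 1 = k * b1"
     "integral {0..1} (\<lambda>x. (norm (A.phi z x))\<^sup>2) = (norm k)\<^sup>2 * norming_const l q \<beta> z"
    using A.eigenvalue_phi[OF z(2)] unfolding b0_def b1_def by metis
  obtain kh where kh: "kh \<noteq> 0" "B.phi z 1 = kh * b0" "B.phi' z 1 = kh * b1"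
     "integral {0..1} (\<lambda>x. (norm (B.phi z x))\<^sup>2) = (norm kh)\<^sup>2 * norming_const l qh \<beta> z"
    using B.eigenvalue_phi[OF z(3)] unfolding b0_def b1_def A.bc0_def B.bc0_def A.bc1_def B.bc1_def by metis
  have b: "b0 = 1 \<or> b1 = -1" by (simp add: b0_def b1_def A.bc0_def A.bc1_def)
  have breal: "cnj b0 = b0" "cnj b1 = b1" by (simp_all add: b0_def b1_def A.bc0_def A.bc1_def)
  \<comment> \<open>the modulus in the norming constants becomes a square because everything is real at a real \<open>z\<close>\<close>
  have kreal: "cnj k = k"
    using b A.phi_real[OF z(1), of 1] k(2,3) breal by (auto simp del: complex_cnj_cancel_iff)
  have khreal: "cnj kh = kh"
    using b B.phi_real[OF z(1), of 1] kh(2,3) breal by (auto simp del: complex_cnj_cancel_iff)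
  define \<zeta> where "\<zeta> = norming_const l q \<beta> z"
  define I where "I \<mu> = integral {0..1} (\<lambda>t. A.phi z t * A.phi \<mu> t)" for \<mu>
  define Ih where "Ih \<mu> = integral {0..1} (\<lambda>t. B.phi z t * B.phi \<mu> t)" for \<mu>
  have real_square: "integral {0..1} (\<lambda>t. f t * f t) = of_real (integral {0..1} (\<lambda>x. (norm (f x))\<^sup>2))"
    if f: "\<And>t. 0 < t \<Longrightarrow> t \<le> 1 \<Longrightarrow> cnj (f t) = f t" "continuous_on {0..1} f" for f :: "real \<Rightarrow> complex"
  proof -
    have i: "(\<lambda>x. (norm (f x))\<^sup>2) integrable_on {0..1}"
      by (intro integrable_continuous_real continuous_intros f)
    have "integral {0..1} (\<lambda>t. f t * f t) = integral {0..1} (\<lambda>t. complex_of_real ((norm (f t))\<^sup>2))"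
    proof (rule integral_spike[of "{0}"])
      show "complex_of_real ((norm (f t))\<^sup>2) = f t * f t" if "t \<in> {0..1} - {0}" for t
        using f(1)[of t] that complex_norm_square[of "f t"] by simp
    qed simp
    then show ?thesis using integral_linear[OF i bounded_linear_of_real[where 'a = complex]] by (simp add: o_def)
  qed
  have Iz: "I z = k * k * of_real \<zeta>"
    using real_square[of "A.phi z"] A.phi_real(1)[OF z(1)] A.phi_cont k(4) complex_norm_square[of k] kreal
    by (simp add: I_def \<zeta>_def)
  have Ihz: "Ih z = kh * kh * of_real \<zeta>"
    using real_square[of "B.phi z"] B.phi_real(1)[OF z(1)] B.phi_cont kh(4) complex_norm_square[of kh] khreal norming
    by (simp add: Ih_def \<zeta>_def)
  have gA: "b1 * A.phi \<mu> 1 - b0 * A.phi' \<mu> 1 = (\<mu> - z) * (I \<mu> / k)" for \<mu>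
    using A.phi_green[of z \<mu>] k by (simp add: I_def field_simps)
  have gB: "b1 * B.phi \<mu> 1 - b0 * B.phi' \<mu> 1 = (\<mu> - z) * (Ih \<mu> / kh)" for \<mu>
    using B.phi_green[of z \<mu>] kh by (simp add: Ih_def field_simps)
  have r0: "b0 * wronskian \<mu> 1 = (\<mu> - z) * (A.phi \<mu> 1 * (Ih \<mu> / kh) - B.phi \<mu> 1 * (I \<mu> / k))" for \<mu>
  proof -
    have "b0 * wronskian \<mu> 1 = A.phi \<mu> 1 * (b1 * B.phi \<mu> 1 - b0 * B.phi' \<mu> 1) - B.phi \<mu> 1 * (b1 * A.phi \<mu> 1 - b0 * A.phi' \<mu> 1)"
      by (simp add: wronskian_def algebra_simps)
    then show ?thesis unfolding gA gB by (simp add: algebra_simps)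
  qed
  have r1: "b1 * wronskian \<mu> 1 = (\<mu> - z) * (A.phi' \<mu> 1 * (Ih \<mu> / kh) - B.phi' \<mu> 1 * (I \<mu> / k))" for \<mu>
  proof -
    have "b1 * wronskian \<mu> 1 = A.phi' \<mu> 1 * (b1 * B.phi \<mu> 1 - b0 * B.phi' \<mu> 1) - B.phi' \<mu> 1 * (b1 * A.phi \<mu> 1 - b0 * A.phi' \<mu> 1)"
      by (simp add: wronskian_def algebra_simps)
    then show ?thesis unfolding gA gB by (simp add: algebra_simps)
  qed
  have Ilim: "(I \<longlongrightarrow> I z) (at z)" "(Ih \<longlongrightarrow> Ih z) (at z)"
    unfolding I_def Ih_def by (rule A.phi_product_integral_continuous B.phi_product_integral_continuous)+
  have hol_lim: "(f \<longlongrightarrow> f z) (at z)" if "f holomorphic_on UNIV" for f :: "complex \<Rightarrow> complex"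
    using holomorphic_on_imp_continuous_on[OF that] by (simp add: continuous_on_def)
  have "((\<lambda>\<mu>. wronskian \<mu> 1 / (\<mu> - z)) \<longlongrightarrow> 0) (at z)"
  proof (cases "b0 = 1")
    case True
    have "((\<lambda>\<mu>. A.phi \<mu> 1 * (Ih \<mu> / kh) - B.phi \<mu> 1 * (I \<mu> / k)) \<longlongrightarrow> A.phi z 1 * (Ih z / kh) - B.phi z 1 * (I z / k)) (at z)"
      by (intro tendsto_intros Ilim k kh hol_lim[OF A.phi_hol] hol_lim[OF B.phi_hol]) auto
    also have "A.phi z 1 * (Ih z / kh) - B.phi z 1 * (I z / k) = 0" using k(1) kh(1) by (simp add: k(2) kh(2) Iz Ihz)
    finally show ?thesis
      by (rule Lim_transform_eventually) (use r0 True in \<open>simp add: eventually_at_filter\<close>)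
  next
    case False
    then have b1: "b1 = -1" using b by simp
    have "((\<lambda>\<mu>. - (A.phi' \<mu> 1 * (Ih \<mu> / kh) - B.phi' \<mu> 1 * (I \<mu> / k))) \<longlongrightarrow> - (A.phi' z 1 * (Ih z / kh) - B.phi' z 1 * (I z / k))) (at z)"
      by (intro tendsto_intros Ilim k kh hol_lim[OF A.phi'_hol] hol_lim[OF B.phi'_hol]) auto
    also have "- (A.phi' z 1 * (Ih z / kh) - B.phi' z 1 * (I z / k)) = 0" using k(1) kh(1) by (simp add: k(3) kh(3) Iz Ihz)
    finally have lim: "((\<lambda>\<mu>. - (A.phi' \<mu> 1 * (Ih \<mu> / kh) - B.phi' \<mu> 1 * (I \<mu> / k))) \<longlongrightarrow> 0) (at z)" .
    show ?thesis
    proof (rule Lim_transform_eventually[OF lim])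
      have "- (A.phi' \<mu> 1 * (Ih \<mu> / kh) - B.phi' \<mu> 1 * (I \<mu> / k)) = wronskian \<mu> 1 / (\<mu> - z)" if "\<mu> \<noteq> z" for \<mu>
      proof -
        have "wronskian \<mu> 1 = (\<mu> - z) * (- (A.phi' \<mu> 1 * (Ih \<mu> / kh) - B.phi' \<mu> 1 * (I \<mu> / k)))"
          using r1[of \<mu>] unfolding b1 by (simp add: algebra_simps)
        then show ?thesis using that by simp
      qed
      then show "\<forall>\<^sub>F \<mu> in at z. - (A.phi' \<mu> 1 * (Ih \<mu> / kh) - B.phi' \<mu> 1 * (I \<mu> / k)) = wronskian \<mu> 1 / (\<mu> - z)"
        by (simp add: eventually_at_filter)
    qed
  qed
  moreover have "wronskian z 1 = 0" by (rule common_eigenvalue_zero[OF z(2,3)])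
  ultimately have "((\<lambda>z. wronskian z 1) has_field_derivative 0) (at z)"
    by (simp add: has_field_derivative_iff)
  then show ?thesis by (rule DERIV_imp_deriv)
qed

lemma wronskian_vanishes_to_order:
  assumes "z \<in> \<real>" "z \<in> sl_spectrum l q \<beta>" "z \<in> sl_spectrum l qh \<beta>"
    and "D \<Longrightarrow> norming_const l q \<beta> z = norming_const l qh \<beta> z"
  shows "vanishes_to_order (\<lambda>z. wronskian z 1) z (if D then 2 else 1)"
proof (cases D)
  case True
  then show ?thesis
    using vanishes_to_order_2[OF wronskian_hol common_eigenvalue_zero[OF assms(2,3)] equal_norming_constants_double_zero[OF assms(1-3)]]
      assms(4) by simp
next
  case False
  then show ?thesis
    using vanishes_to_order_1[OF wronskian_hol common_eigenvalue_zero[OF assms(2,3)]]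
    unfolding vanishes_to_order_def by (metis power_one_right zero_less_one order_refl)
qed

end

section \<open>Weak derivatives and the smoothness hypothesis\<close>

text \<open>
  Continuous approximations of the indicator function of \<open>[x,y]\<close>, which is not itself the derivative of an admissible
  test function.
\<close>
definition plateau :: "nat \<Rightarrow> real \<Rightarrow> real \<Rightarrow> real \<Rightarrow> real" where
  "plateau n x y \<tau> = max 0 (1 - real n * max 0 (max (x - \<tau>) (\<tau> - y)))"

lemma plateau_continuous: "continuous_on S (plateau n x y)"
  unfolding plateau_def[abs_def] by (intro continuous_intros)

lemma plateau_bounds: "0 \<le> plateau n x y \<tau>" "plateau n x y \<tau> \<le> 1"
  by (auto simp: plateau_def)

lemma plateau_eq_0:
  assumes "n > 0" "\<tau> < x - 1 / n \<or> \<tau> > y + 1 / n"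
  shows "plateau n x y \<tau> = 0"
proof -
  have "1 / n \<le> max 0 (max (x - \<tau>) (\<tau> - y))" using assms(2) by (auto simp: le_max_iff_disj)
  then have "1 \<le> n * max 0 (max (x - \<tau>) (\<tau> - y))" using assms by (simp add: field_simps)
  then show ?thesis by (simp add: plateau_def)
qed

lemma plateau_eq_1: "x \<le> \<tau> \<Longrightarrow> \<tau> \<le> y \<Longrightarrow> plateau n x y \<tau> = 1"
  by (simp add: plateau_def max_def)

lemma plateau_tendsto: "(\<lambda>n. plateau n x y \<tau>) \<longlonglongrightarrow> indicator {x..y} \<tau>"
proof (cases "\<tau> \<in> {x..y}")
  case True
  then show ?thesis by (simp add: plateau_eq_1)
next
  case False
  define d where "d = max (x - \<tau>) (\<tau> - y)"
  have d: "d > 0" using False by (auto simp: d_def)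
  obtain N :: nat where N: "1 / d < N" using reals_Archimedean2 by blast
  have "plateau n x y \<tau> = 0" if "n \<ge> N" for n
  proof -
    have "1 / d \<le> n" using N that by (meson less_imp_le of_nat_mono order_trans)
    then have "1 \<le> n * d" using d by (simp add: field_simps)
    then show ?thesis using d by (simp add: plateau_def d_def[symmetric])
  qed
  then have "\<forall>\<^sub>F n in sequentially. plateau n x y \<tau> = 0" by (auto simp: eventually_sequentially)
  then show ?thesis using False by (simp add: tendsto_eventually)
qed

text \<open>
  A continuous function \<open>w\<close> is the derivative of a test function iff its mean is zero. Integration by parts moves
  the weak derivative \<open>v\<close> of \<open>u\<close> to its primitive.
\<close>
lemma weak_derivative_orthogonal:
  assumes wd: "weak_derivative_on s t u v" and v: "v absolutely_integrable_on {b..t}" and st: "s < b" "b < c" "c \<le> d" "d < t"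
    and w: "continuous_on UNIV w" "\<And>x. x \<notin> {c..d} \<Longrightarrow> w x = 0" "integral {c..d} w = 0"
  shows "integral {c..d} (\<lambda>x. (u x + integral {x..t} v) * w x) = 0"
    and "u absolutely_integrable_on {c..d}"
proof -
  define c' where "c' = (b + c) / 2"
  have c': "b < c'" "c' < c" using st by (auto simp: c'_def)
  define \<phi> where "\<phi> x = integral {c'..x} w" for x
  have wc: "continuous_on S w" for S using w(1) continuous_on_subset by blast
  have \<phi>0: "\<phi> x = 0" if "x \<notin> {c..d}" for x
  proof (cases "x < c")
    case True
    then have "\<phi> x = integral {c'..x} (\<lambda>_. 0)"
      unfolding \<phi>_def by (intro Henstock_Kurzweil_Integration.integral_cong w(2)) auto
    then show ?thesis by simp
  next
    case False
    then have x: "x > d" using that by auto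
    have "(w has_integral 0) {c..d}"
      using w(3) integrable_integral[OF integrable_continuous_real[OF wc[of "{c..d}"]]] by simp
    then have "(w has_integral 0) {c'..x}"
      by (rule has_integral_on_superset) (use w(2) c' x in auto)
    then show ?thesis unfolding \<phi>_def by (rule integral_unique)
  qed
  have d\<phi>: "(\<phi> has_real_derivative w x) (at x)" for x
  proof (cases "x < c")
    case True
    have "((\<lambda>_. 0) has_real_derivative 0) (at x)" by simp
    then have "(\<phi> has_real_derivative 0) (at x)"
      by (rule has_field_derivative_transform_within_open[of _ _ _ "{..<c}"]) (use True \<phi>0 in auto)
    then show ?thesis using w(2)[of x] True by simp
  next
    case False
    then have x: "x \<in> {c'..x + 1}" "c' < x" using c' by auto
    have "(\<phi> has_real_derivative w x) (at x within {c'..x + 1})"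
      unfolding \<phi>_def by (rule integral_has_real_derivative[OF wc x(1)])
    then show ?thesis using x by (simp add: at_within_Icc_at)
  qed
  have ui: "u absolutely_integrable_on {c..d}" and vi: "v absolutely_integrable_on {c..d}"
    using wd st unfolding weak_derivative_on_def by auto
  then show "u absolutely_integrable_on {c..d}" by simp
  have "integral {s<..<t} (\<lambda>x. u x * w x) = - integral {s<..<t} (\<lambda>x. v x * \<phi> x)"
  proof -
    have "\<exists>c d. s < c \<and> d < t \<and> (\<forall>x. x \<notin> {c..d} \<longrightarrow> \<phi> x = 0)" using st \<phi>0 by (intro exI[of _ c] exI[of _ d]) auto
    then show ?thesis using wd d\<phi> w(1) unfolding weak_derivative_on_def by blast
  qed
  moreover have restrict: "integral {s<..<t} f = integral {c..d} f" if "f integrable_on {c..d}" "\<And>x. x \<notin> {c..d} \<Longrightarrow> f x = 0" for f :: "real \<Rightarrow> real"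
    by (rule integral_unique, rule has_integral_on_superset[OF integrable_integral[OF that(1)] that(2)]) (use st in auto)
  have \<phi>c: "continuous_on S \<phi>" for S
    using d\<phi> by (intro continuous_at_imp_continuous_on) (auto intro: DERIV_isCont)
  have i1: "(\<lambda>x. u x * w x) integrable_on {c..d}" and i2: "(\<lambda>x. v x * \<phi> x) integrable_on {c..d}"
    by (intro set_lebesgue_integral_eq_integral(1) absolutely_integrable_mult_continuous ui vi wc \<phi>c)+
  ultimately have weak: "integral {c..d} (\<lambda>x. u x * w x) = - integral {c..d} (\<lambda>x. v x * \<phi> x)"
    using restrict[OF i1] restrict[OF i2] w(2) \<phi>0 by simp
  define V where "V x = - integral {x..t} v" for x
  have vbt: "v integrable_on {b..t}" using v set_lebesgue_integral_eq_integral(1) by blast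
  have Vrep: "V x = V c + integral {c..x} v" if "x \<in> {c..d}" for x
  proof -
    have "v integrable_on {c..t}" using integrable_subinterval_real[OF vbt] st by auto
    then have "integral {c..x} v + integral {x..t} v = integral {c..t} v"
      using that st by (intro Henstock_Kurzweil_Integration.integral_combine) auto
    then show ?thesis by (simp add: V_def)
  qed
  have \<phi>rep: "\<phi> x = \<phi> c + integral {c..x} w" if "x \<in> {c..d}" for x
  proof -
    have "(w has_integral (\<phi> x - \<phi> c)) {c..x}"
      using that by (intro fundamental_theorem_of_calculus)
        (auto intro!: has_field_derivative_at_within[OF d\<phi>] simp flip: has_real_derivative_iff_has_vector_derivative)
    then show ?thesis by (simp add: integral_unique)
  qed
  have wi: "w absolutely_integrable_on {c..d}" by (intro absolutely_integrable_continuous_real wc)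
  note parts = integral_by_parts_L1[OF st(3) vi wi Vrep \<phi>rep]
  have "\<phi> c = 0"
  proof -
    have "\<phi> c = integral {c'..c} (\<lambda>_. 0)"
      unfolding \<phi>_def
    proof (rule integral_spike[of "{c}"])
      show "(0::real) = w x" if "x \<in> {c'..c} - {c}" for x using w(2)[of x] that by auto
    qed simp
    then show ?thesis by simp
  qed
  moreover have "\<phi> d = 0" using \<phi>rep[of d] \<open>\<phi> c = 0\<close> w(3) st by simp
  ultimately have p: "integral {c..d} (\<lambda>x. v x * \<phi> x + V x * w x) = 0" using parts(1) by simp
  have Vc: "continuous_on {c..d} V" unfolding V_def
    by (intro continuous_intros continuous_on_subset[OF indefinite_integral_continuous_1'[OF vbt]]) (use st in auto)
  have i3: "(\<lambda>x. V x * w x) integrable_on {c..d}" by (intro integrable_continuous_real continuous_intros Vc wc)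
  have "integral {c..d} (\<lambda>x. (u x + integral {x..t} v) * w x) = integral {c..d} (\<lambda>x. u x * w x - V x * w x)"
    by (simp add: V_def algebra_simps)
  also have "\<dots> = integral {c..d} (\<lambda>x. u x * w x) - integral {c..d} (\<lambda>x. V x * w x)"
    by (rule Henstock_Kurzweil_Integration.integral_diff[OF i1 i3])
  also have "\<dots> = - (integral {c..d} (\<lambda>x. v x * \<phi> x) + integral {c..d} (\<lambda>x. V x * w x))" using weak by simp
  also have "\<dots> = 0" using p Henstock_Kurzweil_Integration.integral_add[OF i2 i3] by simp
  finally show "integral {c..d} (\<lambda>x. (u x + integral {x..t} v) * w x) = 0" .
qed

lemma plateau_integral_tendsto:
  fixes G :: "real \<Rightarrow> real"
  assumes G: "G absolutely_integrable_on {c..d}" and xy: "c \<le> x" "x \<le> y" "y \<le> d"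
  shows "(\<lambda>n. integral {c..d} (\<lambda>\<tau>. G \<tau> * plateau n x y \<tau>)) \<longlonglongrightarrow> integral {x..y} G"
proof -
  have "(\<lambda>n. integral {c..d} (\<lambda>\<tau>. G \<tau> * plateau n x y \<tau>)) \<longlonglongrightarrow> integral {c..d} (\<lambda>\<tau>. G \<tau> * indicator {x..y} \<tau>)"
  proof (rule dominated_convergence(2))
    show "(\<lambda>\<tau>. G \<tau> * plateau n x y \<tau>) integrable_on {c..d}" for n
      by (intro set_lebesgue_integral_eq_integral(1) absolutely_integrable_mult_continuous G plateau_continuous)
    show "(\<lambda>\<tau>. norm (G \<tau>)) integrable_on {c..d}"
      using norm_absolutely_integrable[OF G] set_lebesgue_integral_eq_integral(1) by blast
    show "norm (G \<tau> * plateau n x y \<tau>) \<le> norm (G \<tau>)" for n \<tau>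
      using plateau_bounds[of n x y \<tau>] mult_left_mono[of "plateau n x y \<tau>" 1 "\<bar>G \<tau>\<bar>"] by (simp add: abs_mult)
  qed (intro tendsto_intros plateau_tendsto)
  also have "integral {c..d} (\<lambda>\<tau>. G \<tau> * indicator {x..y} \<tau>) = integral {x..y} G"
  proof -
    have "G integrable_on {x..y}"
      by (intro set_lebesgue_integral_eq_integral(1) absolutely_integrable_on_subinterval[OF G]) (use xy in auto)
    then have "((\<lambda>\<tau>. G \<tau> * indicator {x..y} \<tau>) has_integral integral {x..y} G) {x..y}"
      by (subst has_integral_cong[of _ _ G]) auto
    then show ?thesis
      by (intro integral_unique) (rule has_integral_on_superset, use xy in auto)
  qed
  finally show ?thesis .
qed

text \<open>
  The lemma of du Bois-Reymond. With \<open>w = w\<^sub>1 \<integral> w\<^sub>2 - w\<^sub>2 \<integral> w\<^sub>1\<close>, which has the mean zero, the preceding lemma shows that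
  \<open>\<integral> G w\<^sub>1\<close> is proportional to \<open>\<integral> w\<^sub>1\<close> for \<open>G = u + \<integral>\<^sub>x\<^sup>t v\<close>. For plateau functions \<open>w\<^sub>1\<close> this says in the limit that the
  integrals of \<open>G\<close> over intervals are those of a constant, and the end value of \<open>u\<close> makes the constant \<open>0\<close>.
\<close>
lemma weak_derivative_primitive:
  assumes wd: "weak_derivative_on s t u v" and v: "v absolutely_integrable_on {b..t}" and st: "s < b" "b < t"
    and ev: "has_end_value s t u 0"
  shows "AE x in lebesgue. x \<in> {b<..<t} \<longrightarrow> u x = - integral {x..t} v"
proof -
  define G where "G x = u x + integral {x..t} v" for x
  have vbt: "v integrable_on {b..t}" using v set_lebesgue_integral_eq_integral(1) by blast
  have G: "G absolutely_integrable_on {c..d}" if "b < c" "d < t" for c d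
  proof (cases "c \<le> d")
    case True
    have "u absolutely_integrable_on {c..d}" using wd st that unfolding weak_derivative_on_def by auto
    moreover have "continuous_on {c..d} (\<lambda>x. integral {x..t} v)"
      by (rule continuous_on_subset[OF indefinite_integral_continuous_1'[OF vbt]]) (use that in auto)
    ultimately show ?thesis
      unfolding G_def using set_integral_add(1)[OF _ absolutely_integrable_continuous_real] by blast
  qed simp
  have proportional: "integral {x..y} G * (y' - x') = integral {x'..y'} G * (y - x)"
    if xy: "b < x" "x \<le> y" "y < t" "b < x'" "x' \<le> y'" "y' < t" for x y x' y'
  proof -
    define c where "c = (b + min x x') / 2"
    define d where "d = (t + max y y') / 2"
    have cd: "b < c" "c < x" "c < x'" "y < d" "y' < d" "d < t" "c \<le> d" using xy by (auto simp: c_def d_def min_def max_def)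
    define r where "r = min (min (x - c) (x' - c)) (min (d - y) (d - y'))"
    have r: "r > 0" using cd by (simp add: r_def)
    obtain N where N: "inverse (real (Suc N)) < r" using reals_Archimedean[OF r] by blast
    define w1 where "w1 n = plateau n x y" for n
    define w2 where "w2 n = plateau n x' y'" for n
    have wc: "continuous_on S (w1 n)" "continuous_on S (w2 n)" for S n by (auto simp: w1_def w2_def plateau_continuous)
    define J1 where "J1 n = integral {c..d} (w1 n)" for n
    define J2 where "J2 n = integral {c..d} (w2 n)" for n
    have eq: "integral {c..d} (\<lambda>\<tau>. G \<tau> * w1 n \<tau>) * J2 n = integral {c..d} (\<lambda>\<tau>. G \<tau> * w2 n \<tau>) * J1 n" if "n > N" for n
    proof -
      have n: "n > 0" "1 / n < r"
      proof -
        show "n > 0" using that by simp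
        have "1 / real n \<le> inverse (real (Suc N))" using that by (simp add: inverse_eq_divide frac_le)
        then show "1 / n < r" using N by simp
      qed
      define w where "w \<tau> = w1 n \<tau> * J2 n - w2 n \<tau> * J1 n" for \<tau>
      have w0: "w \<tau> = 0" if "\<tau> \<notin> {c..d}" for \<tau>
      proof -
        have "w1 n \<tau> = 0" unfolding w1_def using that n by (intro plateau_eq_0) (auto simp: r_def)
        moreover have "w2 n \<tau> = 0" unfolding w2_def using that n by (intro plateau_eq_0) (auto simp: r_def)
        ultimately show ?thesis by (simp add: w_def)
      qed
      have i: "w1 n integrable_on {c..d}" "w2 n integrable_on {c..d}" by (intro integrable_continuous_real wc)+
      have "integral {c..d} w = J1 n * J2 n - J2 n * J1 n"
        unfolding w_def J1_def J2_def using i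
        by (subst Henstock_Kurzweil_Integration.integral_diff) (auto intro: integrable_on_mult_left)
      then have "integral {c..d} w = 0" by simp
      moreover have "continuous_on UNIV w" unfolding w_def by (intro continuous_intros wc)
      ultimately have "integral {c..d} (\<lambda>\<tau>. G \<tau> * w \<tau>) = 0"
        unfolding G_def by (intro weak_derivative_orthogonal[OF wd v st(1) cd(1,7,6)] w0)
      moreover have "integral {c..d} (\<lambda>\<tau>. G \<tau> * w \<tau>)
          = integral {c..d} (\<lambda>\<tau>. G \<tau> * w1 n \<tau> * J2 n - G \<tau> * w2 n \<tau> * J1 n)"
        by (simp add: w_def algebra_simps)
      moreover have "\<dots> = integral {c..d} (\<lambda>\<tau>. G \<tau> * w1 n \<tau>) * J2 n - integral {c..d} (\<lambda>\<tau>. G \<tau> * w2 n \<tau>) * J1 n"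
      proof -
        have "(\<lambda>\<tau>. G \<tau> * w1 n \<tau>) integrable_on {c..d}" "(\<lambda>\<tau>. G \<tau> * w2 n \<tau>) integrable_on {c..d}"
          by (intro set_lebesgue_integral_eq_integral(1) absolutely_integrable_mult_continuous G cd wc)+
        then show ?thesis
          by (subst Henstock_Kurzweil_Integration.integral_diff) (auto intro: integrable_on_mult_left)
      qed
      ultimately show ?thesis by simp
    qed
    have one: "(\<lambda>x::real. 1 :: real) absolutely_integrable_on {c..d}"
      by (intro absolutely_integrable_continuous_real continuous_intros)
    have l1: "(\<lambda>n. integral {c..d} (\<lambda>\<tau>. G \<tau> * w1 n \<tau>) * J2 n) \<longlonglongrightarrow> integral {x..y} G * integral {x'..y'} (\<lambda>_. 1)"
      unfolding J2_def w1_def w2_def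
      using plateau_integral_tendsto[OF G[OF cd(1,6)], of x y] plateau_integral_tendsto[OF one, of x' y'] xy cd
      by (intro tendsto_mult) auto
    have l2: "(\<lambda>n. integral {c..d} (\<lambda>\<tau>. G \<tau> * w2 n \<tau>) * J1 n) \<longlonglongrightarrow> integral {x'..y'} G * integral {x..y} (\<lambda>_. 1)"
      unfolding J1_def w1_def w2_def
      using plateau_integral_tendsto[OF G[OF cd(1,6)], of x' y'] plateau_integral_tendsto[OF one, of x y] xy cd
      by (intro tendsto_mult) auto
    have "\<forall>\<^sub>F n in sequentially. integral {c..d} (\<lambda>\<tau>. G \<tau> * w1 n \<tau>) * J2 n = integral {c..d} (\<lambda>\<tau>. G \<tau> * w2 n \<tau>) * J1 n"
      using eq by (auto simp: eventually_sequentially intro!: exI[of _ "Suc N"])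
    from Lim_transform_eventually[OF l1 this]
    have "integral {x..y} G * integral {x'..y'} (\<lambda>_. 1) = integral {x'..y'} G * integral {x..y} (\<lambda>_. 1)"
      using l2 by (rule LIMSEQ_unique)
    then show ?thesis using xy by simp
  qed
  define x0 where "x0 = b + (t - b) / 3"
  define y0 where "y0 = b + 2 * (t - b) / 3"
  have xy0: "b < x0" "x0 < y0" "y0 < t" using st by (auto simp: x0_def y0_def field_simps)
  define \<kappa> where "\<kappa> = integral {x0..y0} G / (y0 - x0)"
  have G\<kappa>: "integral {x..y} G = \<kappa> * (y - x)" if "b < x" "x \<le> y" "y < t" for x y
    using proportional[OF that, of x0 y0] xy0 by (simp add: \<kappa>_def field_simps)
  have "AE x in lebesgue. x \<in> {b<..<t} \<longrightarrow> G x - \<kappa> = 0"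
  proof (rule AE_zero_if_interval_integrals_zero)
    fix x y assume xy: "b < x" "x \<le> y" "y < t"
    have "G integrable_on {x..y}" using G[OF xy(1,3)] set_lebesgue_integral_eq_integral(1) by blast
    then show "(\<lambda>x. G x - \<kappa>) integrable_on {x..y} \<and> integral {x..y} (\<lambda>x. G x - \<kappa>) = 0"
      using G\<kappa>[OF xy] xy
        Henstock_Kurzweil_Integration.integral_diff[of G "{x..y}" "\<lambda>_. \<kappa>"]
        integrable_diff[of G "{x..y}" "\<lambda>_. \<kappa>"] by (simp add: integrable_const_ivl)
  qed
  moreover obtain r where r: "continuous_on {s<..t} r" "AE x in lebesgue. x \<in> {s<..<t} \<longrightarrow> u x = r x" "r t = 0"
    using ev unfolding has_end_value_def by blast
  \<comment> \<open>the continuous representative of \<open>u\<close> differs from the primitive of \<open>v\<close> by \<open>\<kappa>\<close>, and both vanish at \<open>t\<close>\<close>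
  ultimately have ae: "AE x in lebesgue. x \<in> {b<..<t} \<longrightarrow> r x + integral {x..t} v = \<kappa>"
    using st by (auto simp: G_def elim!: eventually_elim2)
  have rc: "continuous_on {b..t} (\<lambda>x. r x + integral {x..t} v)"
    using st by (intro continuous_intros indefinite_integral_continuous_1' vbt continuous_on_subset[OF r(1)]) auto
  have "\<kappa> = 0"
  proof (rule ccontr)
    assume "\<kappa> \<noteq> 0"
    have "((\<lambda>x. r x + integral {x..t} v) \<longlongrightarrow> r t + integral {t..t} v) (at t within {b..t})"
      using rc[unfolded continuous_on_def, rule_format, of t] st by simp
    then have "((\<lambda>x. r x + integral {x..t} v) \<longlongrightarrow> 0) (at_left t)"
      using st r(3) by (simp add: at_within_Icc_at_left)
    then have "\<forall>\<^sub>F x in at_left t. dist (r x + integral {x..t} v) 0 < \<bar>\<kappa>\<bar>"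
      using \<open>\<kappa> \<noteq> 0\<close> by (intro tendstoD) auto
    then obtain e where e: "e < t" "\<And>x. e < x \<Longrightarrow> x < t \<Longrightarrow> \<bar>r x + integral {x..t} v\<bar> < \<bar>\<kappa>\<bar>"
      unfolding eventually_at_left_field by (auto simp: dist_real_def)
    define e' where "e' = max e b"
    have e': "e' < t" using e st by (simp add: e'_def)
    have "AE x in lebesgue. \<not> (x \<in> {e'<..<t})"
      using ae by eventually_elim (use e(2) in \<open>force simp: e'_def\<close>)
    then have "{e'<..<t} \<in> null_sets lebesgue"
      by (subst (asm) AE_iff_null_sets[symmetric]) auto
    then have "emeasure lebesgue {e'<..<t} = 0" by blast
    then show False using e' by simp
  qed
  then show ?thesis using \<open>AE x in lebesgue. x \<in> {b<..<t} \<longrightarrow> G x - \<kappa> = 0\<close>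
    by (auto simp: G_def eq_neg_iff_add_eq_0 elim!: eventually_mono)
qed

lemma Lp_on_absolutely_integrable:
  assumes u: "Lp_on p {s<..<t} u" and p: "p \<ge> 1" and st: "s < b" "b \<le> t"
  shows "u absolutely_integrable_on {b..t}" "(\<lambda>x. \<bar>u x\<bar> powr p) integrable_on {b..t}"
proof -
  have m: "set_borel_measurable lebesgue {s<..<t} u" and i: "set_integrable lebesgue {s<..<t} (\<lambda>x. \<bar>u x\<bar> powr p)"
    using u unfolding Lp_on_def by auto
  have one: "set_integrable lebesgue {s<..<t} (\<lambda>x. 1 :: real)"
    by (rule set_integrable_subset[of _ "{s..t}"])
      (auto intro: absolutely_integrable_continuous_real continuous_intros)
  have ui: "set_integrable lebesgue {s<..<t} u"
  proof (rule set_integrable_bound[OF set_integral_add(1)[OF one i] m])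
    have "\<bar>y\<bar> \<le> 1 + \<bar>y\<bar> powr p" for y :: real
    proof (cases "\<bar>y\<bar> \<le> 1")
      case False
      then have "\<bar>y\<bar> powr 1 \<le> \<bar>y\<bar> powr p" using p by (intro powr_mono) auto
      then show ?thesis using False by simp
    qed (simp add: add_increasing2)
    then show "AE x in lebesgue. x \<in> {s<..<t} \<longrightarrow> norm (u x) \<le> norm (1 + \<bar>u x\<bar> powr p)"
      by (auto simp: abs_of_nonneg)
  qed
  have close: "f absolutely_integrable_on {b..t}" if f: "set_integrable lebesgue {s<..<t} f" for f :: "real \<Rightarrow> real"
  proof -
    have "f absolutely_integrable_on {b..<t}"
      by (rule set_integrable_subset[OF f]) (use st in auto)
    moreover have "f absolutely_integrable_on {b..<t} \<longleftrightarrow> f absolutely_integrable_on {b..t}"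
      by (rule absolutely_integrable_spike_set_eq) (auto intro: negligible_subset[of "{t}"])
    ultimately show ?thesis by simp
  qed
  show "u absolutely_integrable_on {b..t}" by (rule close[OF ui])
  show "(\<lambda>x. \<bar>u x\<bar> powr p) integrable_on {b..t}" using close[OF i] set_lebesgue_integral_eq_integral(1) by blast
qed

text \<open>
  The derivative of order \<open>k\<close> lies in \<open>L\<^sup>p\<close> and contributes the power \<open>1/p'\<close>; then each of the \<open>k\<close> integrations from \<open>t\<close>
  adds \<open>1\<close>.
\<close>
lemma decays_sobolev:
  assumes D: "sobolev_derivs k p s t D" and ev: "\<And>i. i < k \<Longrightarrow> has_end_value s t (D i) 0"
    and p: "p \<ge> 1" and r: "1 / p + ri = 1" and st: "s < b" "b < t"
  shows "decays (real k + ri) (exp_weighted b t (D 0))"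
proof -
  have Lp: "Lp_on p {s<..<t} (D i)" if "i \<le> k" for i using D that unfolding sobolev_derivs_def by blast
  have wd: "weak_derivative_on s t (D i) (D (Suc i))" if "i < k" for i using D that unfolding sobolev_derivs_def by blast
  note int = Lp_on_absolutely_integrable[OF Lp p st(1) less_imp_le[OF st(2)]]
  have base: "decays ri (exp_weighted b t (D k))"
  proof (cases "p = 1")
    case True
    then show ?thesis using decays_L1[OF int(1)[of k] st(2)] r by simp
  next
    case False
    then have "p > 1" using p by simp
    moreover have "ri \<noteq> 0" using r \<open>p > 1\<close> by auto
    ultimately show ?thesis using decays_Lp[OF int(1)[of k] st(2), of p "1 / ri"] int(2)[of k] r by simp
  qed
  have "j \<le> k \<Longrightarrow> decays (real j + ri) (exp_weighted b t (D (k - j)))" for j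
  proof (induction j)
    case 0
    then show ?case using base by simp
  next
    case (Suc j)
    define i where "i = k - Suc j"
    have i: "i < k" "Suc i = k - j" using Suc.prems by (auto simp: i_def)
    have v: "D (Suc i) absolutely_integrable_on {b..t}" using i by (intro int(1)) simp
    have "decays (real j + ri) (exp_weighted b t (D (Suc i)))" using Suc i by simp
    with less_imp_le[OF st(2)] v weak_derivative_primitive[OF wd[OF i(1)] v st ev[OF i(1)]]
    have "decays (real j + ri + 1) (exp_weighted b t (D i))" by (rule decays_primitive)
    then show ?case by (simp add: i_def algebra_simps)
  qed
  from this[of k] show ?thesis by simp
qed

text \<open>
  The same with one power more at the start, since the derivative of order \<open>k\<close> is continuous and vanishes at \<open>t\<close>.
\<close>
lemma decays_Ck:
  assumes D: "Ck_derivs k s t D" and ev: "\<And>i. i \<le> k \<Longrightarrow> D i t = 0" and st: "s < b" "b < t"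
  shows "decays (real k + 1) (exp_weighted b t (D 0))"
proof -
  have sub: "{b..t} \<subseteq> {s<..t}" using st by auto
  have Dc: "continuous_on {b..t} (D i)" if "i \<le> k" for i
    using D that continuous_on_subset[OF _ sub] unfolding Ck_derivs_def by blast
  have dD: "(D i has_real_derivative D (Suc i) x) (at x within {b..t})" if "i < k" "x \<in> {b..t}" for i x
    using D that sub DERIV_subset[OF _ sub] unfolding Ck_derivs_def by blast
  have "j \<le> k \<Longrightarrow> decays (real j + 1) (exp_weighted b t (D (k - j)))" for j
  proof (induction j)
    case 0
    then show ?case using decays_continuous_vanishing[OF Dc[of k] st(2)] ev by simp
  next
    case (Suc j)
    define i where "i = k - Suc j"
    have i: "i < k" "Suc i = k - j" using Suc.prems by (auto simp: i_def)
    have "D i x = - integral {x..t} (D (Suc i))" if x: "x \<in> {b<..<t}" for x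
    proof -
      have "(D (Suc i) has_integral (D i t - D i x)) {x..t}"
        using x by (intro fundamental_theorem_of_calculus)
          (auto intro!: DERIV_subset[OF dD[OF i(1)]] simp flip: has_real_derivative_iff_has_vector_derivative)
      from integral_unique[OF this] show ?thesis using ev[of i] i by simp
    qed
    then have u: "AE x in lebesgue. x \<in> {b<..<t} \<longrightarrow> D i x = - integral {x..t} (D (Suc i))" by simp
    have v: "D (Suc i) absolutely_integrable_on {b..t}"
      using i by (intro absolutely_integrable_continuous_real Dc) simp
    have "decays (real j + 1) (exp_weighted b t (D (Suc i)))" using Suc i by simp
    with less_imp_le[OF st(2)] v u have "decays (real j + 1 + 1) (exp_weighted b t (D i))" by (rule decays_primitive)
    then show ?case by (simp add: i_def algebra_simps)
  qed
  from this[of k] show ?thesis by simp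
qed

lemma exp_weighted_cong_AE:
  assumes "AE x in lebesgue. x \<in> {b<..<a} \<longrightarrow> u x = v x"
  shows "exp_weighted b a u = exp_weighted b a v"
proof
  fix \<tau>
  obtain N where N: "negligible N" "{x. \<not> (x \<in> {b<..<a} \<longrightarrow> u x = v x)} \<subseteq> N"
    using assms unfolding eventually_ae_filter negligible_iff_null_sets by auto
  show "exp_weighted b a u \<tau> = exp_weighted b a v \<tau>"
    unfolding exp_weighted_def
  proof (rule integral_spike)
    show "negligible (N \<union> {a, b})" using N by simp
    fix x assume "x \<in> {b..a} - (N \<union> {a, b})"
    then have "x \<in> {b<..<a}" "x \<notin> N" by auto
    then have "u x = v x" using N(2) by blast
    then show "\<bar>v x\<bar> * exp (- (2 * \<tau> * (a - x))) = \<bar>u x\<bar> * exp (- (2 * \<tau> * (a - x)))" by simp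
  qed
qed

section \<open>Counting the zeros\<close>

lemma zero_order_le:
  assumes F: "\<And>z. F z = z ^ d * F1 z" and F1: "F1 holomorphic_on UNIV" "F1 0 \<noteq> 0" and zero: "vanishes_to_order F 0 m"
  shows "m \<le> d"
proof (rule ccontr)
  assume "\<not> m \<le> d"
  then have md: "m = d + (m - d)" "m - d > 0" by auto
  obtain g where g: "g holomorphic_on UNIV" "\<And>z. F z = (z - 0) ^ m * g z"
    using zero unfolding vanishes_to_order_def by blast
  have eq: "F1 z = z ^ (m - d) * g z" if "z \<noteq> 0" for z
  proof -
    have "z ^ d * F1 z = z ^ d * (z ^ (m - d) * g z)"
      using F[of z] g(2)[of z] power_add[of z d "m - d"] md(1) by (metis diff_zero mult.assoc)
    then show ?thesis using that by simp
  qed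
  have "isCont F1 0" "isCont (\<lambda>z. z ^ (m - d) * g z) 0"
    using holomorphic_on_imp_continuous_on[OF F1(1)] holomorphic_on_imp_continuous_on[OF g(1)]
    by (auto intro!: continuous_intros simp: continuous_on_eq_continuous_at)
  then have l1: "(F1 \<longlongrightarrow> F1 0) (at 0)" and l2: "((\<lambda>z. z ^ (m - d) * g z) \<longlongrightarrow> 0 ^ (m - d) * g 0) (at 0)"
    by (auto simp: isCont_def)
  have "(F1 \<longlongrightarrow> 0 ^ (m - d) * g 0) (at 0)"
    by (rule Lim_transform_eventually[OF l2]) (use eq in \<open>simp add: eventually_at_filter\<close>)
  then have "F1 0 = 0 ^ (m - d) * g 0" using l1 tendsto_unique trivial_limit_at by blast
  then show False using F1(2) md(2) by (simp add: power_0_left)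
qed

text \<open>
  Jensen's inequality for \<open>F\<close>, with two auxiliary factors that have the value \<open>1\<close> at \<open>0\<close>. On the circle \<open>\<bar>z\<bar> = R\<^sup>2\<close> the factor
  \<open>(1 - z / \<rho>')\<^sup>\<sigma>\<close> is at most a multiple of \<open>((1 + \<tau>) / R)\<^sup>\<sigma>\<close>, where \<open>\<tau> = \<bar>Im (sqrt z)\<bar>\<close>, and thus turns the decay in \<open>\<tau>\<close>
  into decay in \<open>R\<close>. The little \<open>o\<close> provides an additional gain \<open>exp (- M)\<close>, but only where \<open>\<tau>\<close> is large, for instance in
  the left half-plane. The factor \<open>exp (M (z\<^sup>2/8 - z/2))\<close>, with \<open>z\<close> scaled to the unit circle, spreads it over the whole
  circle, where \<open>exp (- M/8)\<close> of it remains. The real part of its exponent is \<open>M (c\<^sup>2/4 - c/2 - 1/8)\<close> with \<open>c = cos \<theta>\<close>,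
  which is at most \<open>- M/8\<close> for \<open>c \<ge> 0\<close> and at most \<open>5 M/8\<close> for \<open>c < 0\<close>.
\<close>
lemma zero_counting_bound:
  fixes F :: "complex \<Rightarrow> complex" and \<Lambda> :: "real set" and m :: "real \<Rightarrow> nat"
  assumes F: "F holomorphic_on UNIV" "F z0 \<noteq> 0" and "\<sigma> \<ge> 0" "a > 0" "C > 0"
    and bound: "\<And>\<omega>. norm \<omega> \<ge> 1 \<Longrightarrow> norm (F (\<omega>\<^sup>2)) \<le> C * norm \<omega> powr - s * exp (2 * a * \<bar>Im \<omega>\<bar>) * J \<bar>Im \<omega>\<bar>"
    and J1: "\<And>\<tau>. \<tau> \<ge> 0 \<Longrightarrow> J \<tau> \<le> (1 + \<tau>) powr - \<sigma>"
    and J2: "\<And>M. \<exists>T. \<forall>\<tau>\<ge>T. J \<tau> \<le> exp (- M) * (1 + \<tau>) powr - \<sigma>"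
    and zeros: "\<And>x. x \<in> \<Lambda> \<Longrightarrow> vanishes_to_order F (of_real x) (m x)" and m: "\<And>x. m x \<ge> 1"
  shows "finite {x\<in>\<Lambda>. \<bar>x\<bar> \<le> r}"
    and "\<exists>R0. \<forall>R\<ge>R0. (\<Sum>x\<in>{x\<in>\<Lambda>. \<bar>x\<bar> \<le> R\<^sup>2}. real (m x) * ln (R\<^sup>2 / max 1 \<bar>x\<bar>)) \<le> 4 * a * R / pi - (s + \<sigma>) * ln R + B"
proof -
  have F0: "F (of_real x) = 0" if x: "x \<in> \<Lambda>" for x
  proof -
    obtain g :: "complex \<Rightarrow> complex" where "F (of_real x) = (of_real x - of_real x) ^ m x * g (of_real x)"
      using zeros[OF x] unfolding vanishes_to_order_def by blast
    then show ?thesis using m[of x] by (simp add: power_0_left)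
  qed
  have fin: "finite {x\<in>\<Lambda>. \<bar>x\<bar> \<le> r}" for r
  proof -
    have "finite {z \<in> cball 0 r. F z = 0}"
    proof (cases "F constant_on UNIV")
      case True
      then have "\<And>z. F z \<noteq> 0" using F(2) unfolding constant_on_def by fastforce
      then show ?thesis by simp
    next
      case False
      show ?thesis by (rule holomorphic_compact_finite_zeros[OF F(1) open_UNIV connected_UNIV _ _ False]) auto
    qed
    moreover have "complex_of_real ` {x\<in>\<Lambda>. \<bar>x\<bar> \<le> r} \<subseteq> {z \<in> cball 0 r. F z = 0}" using F0 by auto
    ultimately have "finite (complex_of_real ` {x\<in>\<Lambda>. \<bar>x\<bar> \<le> r})" using finite_subset by blast
    then show ?thesis by (rule finite_imageD) (auto simp: inj_on_def)
  qed
  then show "finite {x\<in>\<Lambda>. \<bar>x\<bar> \<le> r}" .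
  \<comment> \<open>a zero at \<open>0\<close> is split off, because Jensen's inequality evaluates the remaining factor at \<open>0\<close>\<close>
  obtain d F1 where F1: "F1 holomorphic_on UNIV" "F1 0 \<noteq> 0" "\<And>z. F z = z ^ d * F1 z"
    using order_at_0[OF F] by metis
  define B1 where "B1 = ln C + \<sigma> * ln 2 - ln (norm (F1 0))"
  \<comment> \<open>\<open>M/8\<close> is the gain that brings the constant \<open>B1\<close> down to \<open>B\<close>\<close>
  define M where "M = 8 * max 0 (B1 - B)"
  have M0: "M \<ge> 0" by (simp add: M_def)
  obtain T where T: "\<And>\<tau>. \<tau> \<ge> T \<Longrightarrow> J \<tau> \<le> exp (- M) * (1 + \<tau>) powr - \<sigma>" using J2[of M] by blast
  have main: "(\<Sum>x\<in>{x\<in>\<Lambda>. \<bar>x\<bar> \<le> R\<^sup>2}. real (m x) * ln (R\<^sup>2 / max 1 \<bar>x\<bar>)) \<le> 4 * a * R / pi - (s + \<sigma>) * ln R + B"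
    if R: "R \<ge> max 1 (2 * T)" for R
  proof -
    have R1: "R \<ge> 1" "R > 0" "R \<ge> 2 * T" using R by auto
    define \<rho> where "\<rho> = R\<^sup>2"
    have \<rho>1: "\<rho> \<ge> 1" "\<rho> > 0" using R1 by (auto simp: \<rho>_def)
    \<comment> \<open>near \<open>z = \<rho>\<close>, that is for bounded \<open>\<tau>\<close>, the factor \<open>1 - z/\<rho>'\<close> is of size \<open>1/R\<close>, as it should be\<close>
    define \<rho>' where "\<rho>' = \<rho> * (1 + 1 / R)"
    have \<rho>': "\<rho> < \<rho>'" "\<rho>' > 0" using \<rho>1 R1 by (auto simp: \<rho>'_def intro!: mult_pos_pos add_pos_pos)
    define N where "N = {x\<in>\<Lambda>. \<bar>x\<bar> \<le> \<rho> \<and> x \<noteq> 0}"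
    have finN: "finite N" unfolding N_def by (rule finite_subset[OF _ fin[of \<rho>]]) blast
    have "vanishes_to_order F1 w (m (Re w))" if "w \<in> complex_of_real ` N" for w
    proof -
      have "w \<noteq> 0" "vanishes_to_order F w (m (Re w))" using that zeros by (auto simp: N_def)
      then show ?thesis
        by (intro vanishes_to_order_cofactor[OF F1(1), where f = F and w' = 0 and n = d]) (auto simp: F1(3))
    qed
    then obtain G where G: "G holomorphic_on UNIV" "\<And>z. F1 z = G z * (\<Prod>w\<in>complex_of_real ` N. (z - w) ^ m (Re w))"
      using factor_out_zeros[OF finite_imageI[OF finN] F1(1)] by metis
    have F1G: "F1 z = G z * (\<Prod>x\<in>N. (z - of_real x) ^ m x)" for z
      unfolding G(2) by (subst prod.reindex) (auto simp: inj_on_def)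
    define g where "g z = G z * exp (of_real \<sigma> * Ln (1 - z / of_real \<rho>'))
       * exp (of_real M * ((z / of_real \<rho>)\<^sup>2 / 8 - z / of_real \<rho> / 2))" for z
    have "1 - z / of_real \<rho>' \<notin> \<real>\<^sub>\<le>\<^sub>0" if "z \<in> ball 0 \<rho>'" for z :: complex
    proof -
      have "norm (z / of_real \<rho>') < 1" using that \<rho>' by (simp add: norm_divide)
      then have "Re (z / of_real \<rho>') < 1" using complex_Re_le_cmod order_le_less_trans by blast
      then show ?thesis by (auto simp: complex_nonpos_Reals_iff)
    qed
    then have ghol: "g holomorphic_on ball 0 \<rho>'"
      unfolding g_def using \<rho>1 \<rho>' by (intro holomorphic_intros holomorphic_on_subset[OF G(1)]) auto
    define B0 where "B0 = ln C + \<sigma> * ln 2 - (s + \<sigma>) * ln R - M / 8"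
    define A where "A = insert 0 (complex_of_real ` N)"
    define mA where "mA w = (if w = 0 then d else m (Re w))" for w
    have prodA: "(\<Prod>w\<in>A. f w (mA w)) = f 0 d * (\<Prod>x\<in>N. f (of_real x) (m x))" for f :: "complex \<Rightarrow> nat \<Rightarrow> 'b::comm_monoid_mult"
    proof -
      have "0 \<notin> complex_of_real ` N" by (auto simp: N_def)
      then have "(\<Prod>w\<in>A. f w (mA w)) = f 0 (mA 0) * (\<Prod>w\<in>complex_of_real ` N. f w (mA w))"
        unfolding A_def using finN by (intro prod.insert) auto
      also have "(\<Prod>w\<in>complex_of_real ` N. f w (mA w)) = (\<Prod>x\<in>N. f (of_real x) (mA (of_real x)))"
        by (subst prod.reindex) (auto simp: inj_on_def)
      also have "\<dots> = (\<Prod>x\<in>N. f (of_real x) (m x))" by (intro prod.cong) (auto simp: mA_def N_def)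
      finally show ?thesis by (simp add: mA_def)
    qed
    have circle: "norm (g (of_real \<rho> * cis \<theta>) * (\<Prod>w\<in>A. (of_real \<rho> * cis \<theta> - w) ^ mA w)) \<le> exp (B0 + (2 * a * R) * \<bar>sin (\<theta> / 2)\<bar>)" for \<theta>
    proof -
      define z where "z = of_real \<rho> * cis \<theta>"
      define \<omega> where "\<omega> = of_real R * cis (\<theta> / 2)"
      define \<tau> where "\<tau> = R * \<bar>sin (\<theta> / 2)\<bar>"
      have \<tau>0: "\<tau> \<ge> 0" using R1 by (simp add: \<tau>_def)
      have z\<omega>: "\<omega>\<^sup>2 = z" by (simp add: \<omega>_def z_def \<rho>_def power_mult_distrib Complex.DeMoivre)
      have n\<omega>: "norm \<omega> = R" using R1 by (simp add: \<omega>_def norm_mult)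
      have Im\<omega>: "\<bar>Im \<omega>\<bar> = \<tau>" using R1 by (simp add: \<omega>_def \<tau>_def abs_mult)
      have Fz: "norm (F z) \<le> C * R powr - s * exp (2 * a * \<tau>) * J \<tau>"
        using bound[of \<omega>] R1 unfolding z\<omega> n\<omega> Im\<omega> by simp
      have "g z * (\<Prod>w\<in>A. (z - w) ^ mA w) = F z * exp (of_real \<sigma> * Ln (1 - z / of_real \<rho>'))
           * exp (of_real M * ((z / of_real \<rho>)\<^sup>2 / 8 - z / of_real \<rho> / 2))"
        unfolding prodA[of "\<lambda>w n. (z - w) ^ n"] F1(3) F1G g_def by (simp add: algebra_simps)
      then have n: "norm (g z * (\<Prod>w\<in>A. (z - w) ^ mA w)) = norm (F z) * norm (exp (of_real \<sigma> * Ln (1 - z / of_real \<rho>')))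
           * norm (exp (of_real M * ((z / of_real \<rho>)\<^sup>2 / 8 - z / of_real \<rho> / 2)))"
        by (simp add: norm_mult)
      have z\<rho>: "z / of_real \<rho> = cis \<theta>" using \<rho>1 by (simp add: z_def)
      define c where "c = cos \<theta>"
      have c2: "c = 1 - 2 * (sin (\<theta> / 2))\<^sup>2" using cos_double_sin[of "\<theta> / 2"] by (simp add: c_def)
      have e1: "norm (exp (of_real M * ((z / of_real \<rho>)\<^sup>2 / 8 - z / of_real \<rho> / 2))) = exp (M * ((c\<^sup>2 - 2 * c) / 4 - 1 / 8))"
      proof -
        have "Re ((cis \<theta>)\<^sup>2) = 2 * c\<^sup>2 - 1"
          by (simp add: Complex.DeMoivre c_def cos_double_cos)
        then have "Re (of_real M * ((cis \<theta>)\<^sup>2 / 8 - cis \<theta> / 2)) = M * ((2 * c\<^sup>2 - 1) / 8 - c / 2)"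
          by (simp add: c_def)
        also have "\<dots> = M * ((c\<^sup>2 - 2 * c) / 4 - 1 / 8)" by (simp add: field_simps)
        finally show ?thesis unfolding z\<rho> norm_exp_eq_Re by simp
      qed
      have e2: "norm (exp (of_real \<sigma> * Ln (1 - z / of_real \<rho>'))) \<le> (2 / R * (1 + \<tau>)) powr \<sigma>"
      proof -
        define r where "r = \<rho> / \<rho>'"
        have "r = 1 / (1 + 1 / R)" using \<rho>1 by (simp add: r_def \<rho>'_def)
        then have r: "r = R / (R + 1)" using R1 by (simp add: field_simps)
        have r01: "0 < r" "r \<le> 1" "1 - r \<le> 1 / R" using R1 by (auto simp: r field_simps)
        have zr: "z / of_real \<rho>' = of_real r * cis \<theta>" by (simp add: z_def r_def)
        have nz: "1 - of_real r * cis \<theta> \<noteq> 0"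
        proof
          assume "1 - of_real r * cis \<theta> = 0"
          then have "norm (of_real r * cis \<theta>) = norm (1 :: complex)" by simp
          then have "r = 1" using r01 by (simp add: norm_mult)
          then show False using R1 by (simp add: r field_simps)
        qed
        have "(norm (1 - cis \<theta>))\<^sup>2 = (2 * \<bar>sin (\<theta> / 2)\<bar>)\<^sup>2"
        proof -
          have "(norm (1 - cis \<theta>))\<^sup>2 = (1 - cos \<theta>)\<^sup>2 + (sin \<theta>)\<^sup>2" by (simp add: cmod_power2)
          also have "\<dots> = 2 - 2 * cos \<theta>" using sin_cos_squared_add[of \<theta>] by (simp add: power2_eq_square algebra_simps)
          also have "\<dots> = 4 * (sin (\<theta> / 2))\<^sup>2" using c2 by (simp add: c_def)
          finally show ?thesis by (simp add: power_mult_distrib)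
        qed
        then have nc: "norm (1 - cis \<theta>) = 2 * \<bar>sin (\<theta> / 2)\<bar>" by (rule power2_eq_imp_eq) auto
        have "1 - of_real r * cis \<theta> = of_real (1 - r) + of_real r * (1 - cis \<theta>)" by (simp add: algebra_simps)
        also have "norm \<dots> \<le> (1 - r) + r * (2 * \<bar>sin (\<theta> / 2)\<bar>)"
          using r01 nc by (intro norm_triangle_le add_mono) (auto simp: norm_mult simp flip: of_real_diff)
        also have "\<dots> \<le> 1 / R + 1 * (2 * \<bar>sin (\<theta> / 2)\<bar>)" using r01 by (intro add_mono mult_right_mono) auto
        also have "\<dots> \<le> 2 / R * (1 + \<tau>)" using R1 by (simp add: \<tau>_def field_simps)
        finally have le: "norm (1 - of_real r * cis \<theta>) \<le> 2 / R * (1 + \<tau>)" .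
        have "norm (exp (of_real \<sigma> * Ln (1 - z / of_real \<rho>'))) = norm (1 - of_real r * cis \<theta>) powr \<sigma>"
          unfolding zr norm_exp_eq_Re using nz by (simp add: powr_def)
        also have "\<dots> \<le> (2 / R * (1 + \<tau>)) powr \<sigma>" using le \<open>\<sigma> \<ge> 0\<close> by (intro powr_mono2) auto
        finally show ?thesis .
      qed
      have j: "J \<tau> * (1 + \<tau>) powr \<sigma> * exp (M * ((c\<^sup>2 - 2 * c) / 4 - 1 / 8)) \<le> exp (- M / 8)"
      proof (cases "c \<ge> 0")
        case True
        have c1: "c \<le> 1" by (simp add: c_def)
        have "c\<^sup>2 - 2 * c = c * (c - 2)" by (simp add: power2_eq_square algebra_simps)
        also have "\<dots> \<le> 0" using True c1 by (intro mult_nonneg_nonpos) auto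
        finally have "M * ((c\<^sup>2 - 2 * c) / 4 - 1 / 8) \<le> M * (- 1 / 8)" using M0 by (intro mult_left_mono) auto
        then have x: "exp (M * ((c\<^sup>2 - 2 * c) / 4 - 1 / 8)) \<le> exp (- M / 8)" by simp
        have "J \<tau> * (1 + \<tau>) powr \<sigma> \<le> (1 + \<tau>) powr - \<sigma> * (1 + \<tau>) powr \<sigma>"
          using J1[OF \<tau>0] by (intro mult_right_mono) auto
        also have "\<dots> = 1" using \<tau>0 by (simp add: powr_minus)
        finally have y: "J \<tau> * (1 + \<tau>) powr \<sigma> \<le> 1" .
        have "J \<tau> * (1 + \<tau>) powr \<sigma> * exp (M * ((c\<^sup>2 - 2 * c) / 4 - 1 / 8)) \<le> 1 * exp (M * ((c\<^sup>2 - 2 * c) / 4 - 1 / 8))"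
          using y by (intro mult_right_mono) auto
        also have "\<dots> \<le> exp (- M / 8)" using x by simp
        finally show ?thesis .
      next
        case False
        have c1: "c \<ge> -1" by (simp add: c_def)
        have "(1 / 2)\<^sup>2 \<le> (sin (\<theta> / 2))\<^sup>2" using False c2 by (simp add: power2_eq_square)
        then have "1 / 2 \<le> \<bar>sin (\<theta> / 2)\<bar>" by (metis abs_le_square_iff abs_of_nonneg divide_nonneg_nonneg zero_le_numeral zero_le_one)
        then have "R * (1 / 2) \<le> \<tau>" unfolding \<tau>_def using R1 by (intro mult_left_mono) auto
        then have "\<tau> \<ge> T" using R1 by simp
        have "c\<^sup>2 \<le> 1" using c1 False by (intro square_le_1) auto
        then have "(c\<^sup>2 - 2 * c) / 4 - 1 / 8 \<le> 5 / 8" using c1 by simp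
        then have "M * ((c\<^sup>2 - 2 * c) / 4 - 1 / 8) \<le> M * (5 / 8)" using M0 by (rule mult_left_mono)
        then have x: "exp (M * ((c\<^sup>2 - 2 * c) / 4 - 1 / 8)) \<le> exp (M * (5 / 8))" by simp
        have "J \<tau> * (1 + \<tau>) powr \<sigma> \<le> exp (- M) * (1 + \<tau>) powr - \<sigma> * (1 + \<tau>) powr \<sigma>"
          using T[OF \<open>\<tau> \<ge> T\<close>] by (intro mult_right_mono) auto
        also have "\<dots> = exp (- M)" using \<tau>0 by (simp add: powr_minus)
        finally have y: "J \<tau> * (1 + \<tau>) powr \<sigma> \<le> exp (- M)" .
        have "J \<tau> * (1 + \<tau>) powr \<sigma> * exp (M * ((c\<^sup>2 - 2 * c) / 4 - 1 / 8)) \<le> exp (- M) * exp (M * (5 / 8))"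
          using x y by (intro mult_mono) auto
        also have "\<dots> \<le> exp (- M / 8)" unfolding exp_add[symmetric] using M0 by simp
        finally show ?thesis .
      qed
      have CR: "C * R powr - s * (2 / R) powr \<sigma> = exp (ln C + \<sigma> * ln 2 - (s + \<sigma>) * ln R)"
        using \<open>C > 0\<close> R1 by (simp add: powr_def exp_add exp_diff exp_minus ln_div field_simps exp_of_real)
      have "norm (g z * (\<Prod>w\<in>A. (z - w) ^ mA w))
        \<le> (C * R powr - s * exp (2 * a * \<tau>) * J \<tau>) * (2 / R * (1 + \<tau>)) powr \<sigma> * exp (M * ((c\<^sup>2 - 2 * c) / 4 - 1 / 8))"
        unfolding n e1 using Fz by (intro mult_right_mono mult_mono e2 Fz) (auto intro: order_trans[OF norm_ge_zero])
      also have "\<dots> = (C * R powr - s * (2 / R) powr \<sigma> * exp (2 * a * \<tau>)) * (J \<tau> * (1 + \<tau>) powr \<sigma> * exp (M * ((c\<^sup>2 - 2 * c) / 4 - 1 / 8)))"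
        using R1 \<tau>0 by (subst powr_mult) (auto simp: mult_ac)
      also have "\<dots> \<le> (C * R powr - s * (2 / R) powr \<sigma> * exp (2 * a * \<tau>)) * exp (- M / 8)"
        using \<open>C > 0\<close> by (intro mult_left_mono j) auto
      also have "\<dots> = exp (B0 + (2 * a * R) * \<bar>sin (\<theta> / 2)\<bar>)"
        unfolding CR exp_add[symmetric] by (simp add: B0_def \<tau>_def)
      finally show ?thesis by (simp add: z_def)
    qed
    have jen: "norm (g 0) * (\<Prod>w\<in>A. \<rho> ^ mA w) \<le> exp (B0 + 2 * (2 * a * R) / pi)"
      using \<open>a > 0\<close> R1 by (intro jensen_inequality[OF ghol \<rho>1(2) \<rho>'(1) _ circle]) auto
    have "g 0 = G 0" by (simp add: g_def)
    have absF1: "norm (F1 0) = norm (G 0) * (\<Prod>x\<in>N. \<bar>x\<bar> ^ m x)"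
      unfolding F1G[of 0] by (simp add: norm_mult norm_power flip: prod_norm)
    have pN: "(\<Prod>x\<in>N. \<bar>x\<bar> ^ m x) > 0" by (intro prod_pos) (auto simp: N_def)
    have G0: "norm (G 0) > 0" using absF1 F1(2) pN by (metis mult_eq_0_iff norm_eq_zero zero_less_norm_iff)
    have "ln (norm (G 0) * (\<rho> ^ d * (\<Prod>x\<in>N. \<rho> ^ m x))) \<le> B0 + 2 * (2 * a * R) / pi"
    proof -
      have "norm (G 0) * (\<rho> ^ d * (\<Prod>x\<in>N. \<rho> ^ m x)) \<le> exp (B0 + 2 * (2 * a * R) / pi)"
        using jen unfolding prodA[of "\<lambda>w n. \<rho> ^ n"] \<open>g 0 = G 0\<close> .
      moreover have "norm (G 0) * (\<rho> ^ d * (\<Prod>x\<in>N. \<rho> ^ m x)) > 0"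
        using G0 \<rho>1 by (intro mult_pos_pos prod_pos) auto
      ultimately show ?thesis using ln_le_cancel_iff[of _ "exp (B0 + 2 * (2 * a * R) / pi)"] by simp
    qed
    moreover have "ln (norm (G 0) * (\<rho> ^ d * (\<Prod>x\<in>N. \<rho> ^ m x)))
       = ln (norm (G 0)) + real d * ln \<rho> + (\<Sum>x\<in>N. real (m x) * ln \<rho>)"
      using G0 \<rho>1 finN by (simp add: ln_mult ln_prod ln_realpow prod_pos)
    moreover have "ln (norm (F1 0)) = ln (norm (G 0)) + (\<Sum>x\<in>N. real (m x) * ln \<bar>x\<bar>)"
    proof -
      have "ln (\<Prod>x\<in>N. \<bar>x\<bar> ^ m x) = (\<Sum>x\<in>N. ln (\<bar>x\<bar> ^ m x))"
        using finN by (intro ln_prod) (auto simp: N_def)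
      also have "\<dots> = (\<Sum>x\<in>N. real (m x) * ln \<bar>x\<bar>)" by (intro sum.cong) (auto simp: N_def ln_realpow)
      finally show ?thesis unfolding absF1 using G0 pN by (simp add: ln_mult)
    qed
    ultimately have jen2: "ln (norm (F1 0)) + real d * ln \<rho> + (\<Sum>x\<in>N. real (m x) * ln \<rho> - real (m x) * ln \<bar>x\<bar>) \<le> B0 + 4 * a * R / pi"
      by (simp add: sum_subtractf)
    have termwise: "real (m x) * ln (\<rho> / max 1 \<bar>x\<bar>) \<le> real (m x) * ln \<rho> - real (m x) * ln \<bar>x\<bar>" if "x \<in> N" for x
    proof -
      have x: "\<bar>x\<bar> > 0" using that by (simp add: N_def)
      have "ln \<bar>x\<bar> \<le> ln (max 1 \<bar>x\<bar>)" using x by (subst ln_le_cancel_iff) auto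
      then have "ln (\<rho> / max 1 \<bar>x\<bar>) \<le> ln \<rho> - ln \<bar>x\<bar>" using \<rho>1 ln_divide_pos[of \<rho> "max 1 \<bar>x\<bar>"] by simp
      then have "real (m x) * ln (\<rho> / max 1 \<bar>x\<bar>) \<le> real (m x) * (ln \<rho> - ln \<bar>x\<bar>)" by (intro mult_left_mono) auto
      then show ?thesis by (simp add: right_diff_distrib)
    qed
    have ln\<rho>: "ln \<rho> \<ge> 0" using \<rho>1 by simp
    have "(\<Sum>x\<in>{x\<in>\<Lambda>. \<bar>x\<bar> \<le> \<rho>}. real (m x) * ln (\<rho> / max 1 \<bar>x\<bar>)) \<le> real d * ln \<rho> + (\<Sum>x\<in>N. real (m x) * ln (\<rho> / max 1 \<bar>x\<bar>))"
    proof (cases "0 \<in> \<Lambda>")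
      case True
      have "{x\<in>\<Lambda>. \<bar>x\<bar> \<le> \<rho>} = insert 0 N" "0 \<notin> N" using True \<rho>1 by (auto simp: N_def)
      moreover have "m 0 \<le> d" using zero_order_le[OF F1(3,1,2)] zeros[OF True] by simp
      then have "real (m 0) * ln \<rho> \<le> real d * ln \<rho>" using ln\<rho> by (intro mult_right_mono) auto
      ultimately show ?thesis using finN by simp
    next
      case False
      then have "{x\<in>\<Lambda>. \<bar>x\<bar> \<le> \<rho>} = N" by (auto simp: N_def)
      then show ?thesis using ln\<rho> by simp
    qed
    also have "(\<Sum>x\<in>N. real (m x) * ln (\<rho> / max 1 \<bar>x\<bar>)) \<le> (\<Sum>x\<in>N. real (m x) * ln \<rho> - real (m x) * ln \<bar>x\<bar>)"
      by (intro sum_mono termwise)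
    finally have "(\<Sum>x\<in>{x\<in>\<Lambda>. \<bar>x\<bar> \<le> \<rho>}. real (m x) * ln (\<rho> / max 1 \<bar>x\<bar>)) \<le> B0 + 4 * a * R / pi - ln (norm (F1 0))"
      using jen2 by linarith
    also have "\<dots> \<le> 4 * a * R / pi - (s + \<sigma>) * ln R + B"
      by (simp add: B0_def M_def B1_def)
    finally show ?thesis by (simp add: \<rho>_def)
  qed
  then show "\<exists>R0. \<forall>R\<ge>R0. (\<Sum>x\<in>{x\<in>\<Lambda>. \<bar>x\<bar> \<le> R\<^sup>2}. real (m x) * ln (R\<^sup>2 / max 1 \<bar>x\<bar>)) \<le> 4 * a * R / pi - (s + \<sigma>) * ln R + B"
    by blast
qed

text \<open>
  The maximum accounts for the points with \<open>\<bar>x\<bar> < 1\<close>, which are counted from the lower limit \<open>t = 1\<close> on.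
\<close>
lemma nn_integral_inverse_from:
  assumes "R \<ge> 1"
  shows "(\<integral>\<^sup>+t\<in>{1..R}. (if \<bar>x\<bar> \<le> t\<^sup>2 then 1 / ennreal t else 0) \<partial>lborel)
     = (if \<bar>x\<bar> \<le> R\<^sup>2 then ennreal (ln (R\<^sup>2 / max 1 \<bar>x\<bar>) / 2) else 0)"
proof -
  define c where "c = sqrt (max 1 \<bar>x\<bar>)"
  have c1: "c \<ge> 1" by (simp add: c_def)
  have c: "\<bar>x\<bar> \<le> t\<^sup>2 \<longleftrightarrow> c \<le> t" if "t \<ge> 1" for t
  proof -
    have "c \<le> t \<longleftrightarrow> max 1 \<bar>x\<bar> \<le> t\<^sup>2" unfolding c_def using that sqrt_le_D real_le_lsqrt by fastforce
    also have "\<dots> \<longleftrightarrow> \<bar>x\<bar> \<le> t\<^sup>2" using that by simp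
    finally show ?thesis by simp
  qed
  have eq: "(\<integral>\<^sup>+t\<in>{1..R}. (if \<bar>x\<bar> \<le> t\<^sup>2 then 1 / ennreal t else 0) \<partial>lborel) = (\<integral>\<^sup>+t. ennreal (1 / t) * indicator {c..R} t \<partial>lborel)"
  proof (rule nn_integral_cong)
    fix t :: real
    show "(if \<bar>x\<bar> \<le> t\<^sup>2 then 1 / ennreal t else 0) * indicator {1..R} t = ennreal (1 / t) * indicator {c..R} t"
    proof (cases "t \<ge> 1")
      case True
      then have "1 / ennreal t = ennreal (1 / t)" by (metis divide_ennreal ennreal_1 less_le_trans zero_le_one zero_less_one)
      then show ?thesis using c[OF True] True by (auto simp: indicator_def)
    next
      case False
      then show ?thesis using c1 by (auto simp: indicator_def)
    qed
  qed
  show ?thesis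
  proof (cases "\<bar>x\<bar> \<le> R\<^sup>2")
    case True
    then have "c \<le> R" using c[OF assms] by simp
    have "(\<integral>\<^sup>+t. ennreal (1 / t) * indicator {c..R} t \<partial>lborel) = ennreal (ln R - ln c)"
      by (rule nn_integral_FTC_Icc) (use c1 \<open>c \<le> R\<close> in \<open>auto intro!: derivative_eq_intros simp: divide_inverse\<close>)
    also have "ln R - ln c = ln (R\<^sup>2 / max 1 \<bar>x\<bar>) / 2"
      using assms by (simp add: c_def ln_sqrt ln_div ln_realpow)
    finally show ?thesis using eq True by simp
  next
    case False
    then have "\<not> c \<le> R" using c[OF assms] by simp
    then show ?thesis using eq False by simp
  qed
qed

text \<open>
  A point \<open>x\<close> contributes to \<open>\<integral> m(t)/t dt\<close> from \<open>t = sqrt \<bar>x\<bar>\<close> on. The factor \<open>2\<close> in \<open>m\<close> cancels the \<open>1/2\<close> of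
  \<open>ln (R / sqrt \<bar>x\<bar>) = ln (R\<^sup>2/\<bar>x\<bar>)/2\<close>, so that the integral is exactly the sum in Jensen's inequality.
\<close>
lemma nn_integral_mcount:
  assumes fin: "finite {x\<in>\<Lambda>. \<bar>x\<bar> \<le> R\<^sup>2}" and "S \<subseteq> \<Lambda>" and R: "R \<ge> 1"
  shows "(\<integral>\<^sup>+t\<in>{1..R}. mcount \<Lambda> S t / ennreal t \<partial>lborel)
     = ennreal (\<Sum>x\<in>{x\<in>\<Lambda>. \<bar>x\<bar> \<le> R\<^sup>2}. real (if x \<in> S then 2 else 1) * ln (R\<^sup>2 / max 1 \<bar>x\<bar>))"
proof -
  define N where "N = {x\<in>\<Lambda>. \<bar>x\<bar> \<le> R\<^sup>2}"
  define mu where "mu x = (if x \<in> S then 4 else 2 :: ennreal)" for x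
  have cnt: "ncount A (t\<^sup>2) = (\<Sum>x\<in>N. if x \<in> A \<and> \<bar>x\<bar> \<le> t\<^sup>2 then 1 else 0)" if A: "A \<subseteq> \<Lambda>" and t: "t \<in> {1..R}" for A t
  proof -
    have t2: "t\<^sup>2 \<le> R\<^sup>2" using t by (intro power_mono) auto
    have "{x\<in>A. \<bar>x\<bar> \<le> t\<^sup>2} = {x\<in>N. x \<in> A \<and> \<bar>x\<bar> \<le> t\<^sup>2}" using A t2 by (auto simp: N_def)
    moreover have "finite {x\<in>N. x \<in> A \<and> \<bar>x\<bar> \<le> t\<^sup>2}" using fin unfolding N_def by (rule rev_finite_subset) auto
    ultimately have "ncount A (t\<^sup>2) = of_nat (card {x\<in>N. x \<in> A \<and> \<bar>x\<bar> \<le> t\<^sup>2})"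
      unfolding ncount_def by (simp add: emeasure_count_space)
    also have "\<dots> = (\<Sum>x\<in>N. if x \<in> A \<and> \<bar>x\<bar> \<le> t\<^sup>2 then 1 else 0)"
      using fin by (simp add: N_def sum.If_cases Int_def)
    finally show ?thesis .
  qed
  have "(\<integral>\<^sup>+t\<in>{1..R}. mcount \<Lambda> S t / ennreal t \<partial>lborel)
     = (\<integral>\<^sup>+t. (\<Sum>x\<in>N. mu x * ((if \<bar>x\<bar> \<le> t\<^sup>2 then 1 / ennreal t else 0) * indicator {1..R} t)) \<partial>lborel)"
  proof (rule nn_integral_cong)
    fix t :: real
    show "mcount \<Lambda> S t / ennreal t * indicator {1..R} t
       = (\<Sum>x\<in>N. mu x * ((if \<bar>x\<bar> \<le> t\<^sup>2 then 1 / ennreal t else 0) * indicator {1..R} t))"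
    proof (cases "t \<in> {1..R}")
      case True
      have "mcount \<Lambda> S t = (\<Sum>x\<in>N. 2 * (if x \<in> \<Lambda> \<and> \<bar>x\<bar> \<le> t\<^sup>2 then 1 else 0) + 2 * (if x \<in> S \<and> \<bar>x\<bar> \<le> t\<^sup>2 then 1 else 0))"
        unfolding mcount_def cnt[OF order_refl True] cnt[OF assms(2) True] by (simp add: sum.distrib sum_distrib_left)
      also have "\<dots> = (\<Sum>x\<in>N. mu x * (if \<bar>x\<bar> \<le> t\<^sup>2 then 1 else 0))"
        by (intro sum.cong) (auto simp: mu_def N_def)
      finally have "mcount \<Lambda> S t / ennreal t = (\<Sum>x\<in>N. mu x * (if \<bar>x\<bar> \<le> t\<^sup>2 then 1 else 0)) * (1 / ennreal t)"
        by (simp add: ennreal_times_divide)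
      also have "\<dots> = (\<Sum>x\<in>N. mu x * (if \<bar>x\<bar> \<le> t\<^sup>2 then 1 / ennreal t else 0))"
        unfolding sum_distrib_right by (intro sum.cong) (auto simp: mult.assoc)
      finally show ?thesis using True by simp
    next
      case False
      then show ?thesis by simp
    qed
  qed
  also have "\<dots> = (\<Sum>x\<in>N. mu x * (\<integral>\<^sup>+t\<in>{1..R}. (if \<bar>x\<bar> \<le> t\<^sup>2 then 1 / ennreal t else 0) \<partial>lborel))"
    by (subst nn_integral_sum) (auto simp: nn_integral_cmult)
  also have "\<dots> = (\<Sum>x\<in>N. ennreal (real (if x \<in> S then 2 else 1) * ln (R\<^sup>2 / max 1 \<bar>x\<bar>)))"
  proof (rule sum.cong)
    fix x assume x: "x \<in> N"
    have "max 1 \<bar>x\<bar> \<le> R\<^sup>2" using x R by (simp add: N_def)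
    then have pos: "ln (R\<^sup>2 / max 1 \<bar>x\<bar>) \<ge> 0" by (intro ln_ge_zero) (simp add: field_simps)
    have "mu x = ennreal (if x \<in> S then 4 else 2)" by (simp add: mu_def)
    then show "mu x * (\<integral>\<^sup>+t\<in>{1..R}. (if \<bar>x\<bar> \<le> t\<^sup>2 then 1 / ennreal t else 0) \<partial>lborel)
        = ennreal (real (if x \<in> S then 2 else 1) * ln (R\<^sup>2 / max 1 \<bar>x\<bar>))"
      unfolding nn_integral_inverse_from[OF R] using x pos by (simp add: N_def ennreal_mult[symmetric])
  qed simp
  also have "\<dots> = ennreal (\<Sum>x\<in>N. real (if x \<in> S then 2 else 1) * ln (R\<^sup>2 / max 1 \<bar>x\<bar>))"
  proof (rule sum_ennreal)
    fix x assume x: "x \<in> N"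
    have "max 1 \<bar>x\<bar> \<le> R\<^sup>2" using x R by (simp add: N_def)
    then have "ln (R\<^sup>2 / max 1 \<bar>x\<bar>) \<ge> 0" by (intro ln_ge_zero) (simp add: field_simps)
    then show "real (if x \<in> S then 2 else 1) * ln (R\<^sup>2 / max 1 \<bar>x\<bar>) \<ge> 0" by simp
  qed
  finally show ?thesis unfolding N_def .
qed

text \<open>
  \<open>\<tau>\<close> is replaced by \<open>1 + \<tau>\<close> so that the estimate covers all \<open>\<tau> \<ge> 0\<close>; the constant \<open>C\<close> is common to both bounds, and the
  gain is written as \<open>exp (- M)\<close>.
\<close>
lemma decays_bounds:
  assumes v: "v absolutely_integrable_on {0..a}" and "a \<ge> 0" "\<sigma> \<ge> 0" and dec: "decays \<sigma> (exp_weighted 0 a v)"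
  obtains C where "C > 0" "\<And>\<tau>. \<tau> \<ge> 0 \<Longrightarrow> exp_weighted 0 a v \<tau> \<le> C * (1 + \<tau>) powr - \<sigma>"
    "\<And>M. \<exists>T. \<forall>\<tau>\<ge>T. exp_weighted 0 a v \<tau> \<le> C * exp (- M) * (1 + \<tau>) powr - \<sigma>"
proof -
  have large: "\<exists>T\<ge>1. \<forall>\<tau>\<ge>T. exp_weighted 0 a v \<tau> \<le> \<epsilon> * (1 + \<tau>) powr - \<sigma>" if \<epsilon>: "\<epsilon> > 0" for \<epsilon>
  proof -
    have "\<forall>\<^sub>F \<tau> in at_top. exp_weighted 0 a v \<tau> \<le> (\<epsilon> / 2 powr \<sigma>) * \<tau> powr - \<sigma>"
      using dec[unfolded decays_def, rule_format, of "\<epsilon> / 2 powr \<sigma>"] \<epsilon> by simp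
    then obtain T where T: "\<And>\<tau>. \<tau> \<ge> T \<Longrightarrow> exp_weighted 0 a v \<tau> \<le> (\<epsilon> / 2 powr \<sigma>) * \<tau> powr - \<sigma>"
      unfolding eventually_at_top_linorder by blast
    have "exp_weighted 0 a v \<tau> \<le> \<epsilon> * (1 + \<tau>) powr - \<sigma>" if \<tau>: "\<tau> \<ge> max 1 T" for \<tau>
    proof -
      have "(1 + \<tau>) powr \<sigma> \<le> (2 * \<tau>) powr \<sigma>" using \<tau> \<open>\<sigma> \<ge> 0\<close> by (intro powr_mono2) auto
      then have "(1 + \<tau>) powr \<sigma> \<le> 2 powr \<sigma> * \<tau> powr \<sigma>" using \<tau> by (simp add: powr_mult)
      then have "1 / (2 powr \<sigma> * \<tau> powr \<sigma>) \<le> 1 / (1 + \<tau>) powr \<sigma>" using \<tau> by (intro divide_left_mono) auto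
      then have "\<epsilon> * (1 / (2 powr \<sigma> * \<tau> powr \<sigma>)) \<le> \<epsilon> * (1 / (1 + \<tau>) powr \<sigma>)" using \<epsilon> by (intro mult_left_mono) auto
      moreover have "exp_weighted 0 a v \<tau> \<le> (\<epsilon> / 2 powr \<sigma>) * \<tau> powr - \<sigma>" using T \<tau> by simp
      ultimately show ?thesis by (simp add: powr_minus_divide)
    qed
    then show ?thesis by (intro exI[of _ "max 1 T"]) auto
  qed
  obtain T1 where T1: "T1 \<ge> 1" "\<And>\<tau>. \<tau> \<ge> T1 \<Longrightarrow> exp_weighted 0 a v \<tau> \<le> 1 * (1 + \<tau>) powr - \<sigma>" using large[of 1] by auto
  define I where "I = integral {0..a} (\<lambda>x. \<bar>v x\<bar>)"
  have av: "(\<lambda>t. \<bar>v t\<bar>) integrable_on {0..a}"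
    using norm_absolutely_integrable[OF v] set_lebesgue_integral_eq_integral(1) by fastforce
  have I0: "I \<ge> 0" unfolding I_def by (intro Henstock_Kurzweil_Integration.integral_nonneg av) auto
  define C where "C = 1 + I * (1 + T1) powr \<sigma>"
  have C: "C \<ge> 1" using I0 by (simp add: C_def)
  show thesis
  proof (rule that[of C])
    show "C > 0" using C by simp
    fix \<tau> :: real assume \<tau>: "\<tau> \<ge> 0"
    show "exp_weighted 0 a v \<tau> \<le> C * (1 + \<tau>) powr - \<sigma>"
    proof (cases "\<tau> \<ge> T1")
      case True
      have "1 * (1 + \<tau>) powr - \<sigma> \<le> C * (1 + \<tau>) powr - \<sigma>" using C by (intro mult_right_mono) auto
      then show ?thesis using T1(2)[OF True] by linarith
    next
      case False
      have "exp_weighted 0 a v \<tau> \<le> I"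
        unfolding exp_weighted_def I_def
      proof (rule integral_le)
        show "(\<lambda>x. \<bar>v x\<bar> * exp (- (2 * \<tau> * (a - x)))) integrable_on {0..a}"
          using exp_weighted_integrable[OF v] set_lebesgue_integral_eq_integral(1) by blast
        fix x assume "x \<in> {0..a}"
        then have "exp (- (2 * \<tau> * (a - x))) \<le> 1" using \<tau> by simp
        from mult_left_mono[OF this, of "\<bar>v x\<bar>"] show "\<bar>v x\<bar> * exp (- (2 * \<tau> * (a - x))) \<le> \<bar>v x\<bar>" by simp
      qed (rule av)
      also have "I = I * (1 + \<tau>) powr \<sigma> * (1 + \<tau>) powr - \<sigma>" using \<tau> by (simp add: powr_minus)
      also have "\<dots> \<le> I * (1 + T1) powr \<sigma> * (1 + \<tau>) powr - \<sigma>"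
        using False \<tau> I0 \<open>\<sigma> \<ge> 0\<close> by (intro mult_right_mono mult_left_mono powr_mono2) auto
      also have "\<dots> \<le> C * (1 + \<tau>) powr - \<sigma>" by (intro mult_right_mono) (auto simp: C_def)
      finally show ?thesis .
    qed
  next
    fix M
    obtain T where T: "\<And>\<tau>. \<tau> \<ge> T \<Longrightarrow> exp_weighted 0 a v \<tau> \<le> exp (- M) * (1 + \<tau>) powr - \<sigma>" using large[of "exp (- M)"] by auto
    have "exp (- M) * (1 + \<tau>) powr - \<sigma> \<le> C * exp (- M) * (1 + \<tau>) powr - \<sigma>" for \<tau>
      using C by (intro mult_right_mono) auto
    then show "\<exists>T. \<forall>\<tau>\<ge>T. exp_weighted 0 a v \<tau> \<le> C * exp (- M) * (1 + \<tau>) powr - \<sigma>" using T order_trans by blast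
  qed
qed

section \<open>The uniqueness theorem\<close>

context radial_pair
begin

lemma wronskian_end:
  assumes a: "0 < a" "a \<le> 1" and ae: "AE x in lebesgue. x \<in> {a<..<1} \<longrightarrow> qh x = q x"
  shows "wronskian z 1 = wronskian z a"
proof -
  let ?H = "\<lambda>t. h t * (A.phi z t * B.phi z t)"
  obtain N where N: "negligible N" "{x. \<not> (x \<in> {a<..<1} \<longrightarrow> qh x = q x)} \<subseteq> N"
    using ae unfolding eventually_ae_filter negligible_iff_null_sets by auto
  have "integral {a..1} ?H = integral {a..1} (\<lambda>_. 0)"
  proof (rule integral_spike)
    show "negligible (N \<union> {a, 1})" using N by simp
    fix x assume "x \<in> {a..1} - (N \<union> {a, 1})"
    then have "x \<in> {a<..<1}" "x \<notin> N" by auto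
    then have "qh x = q x" using N(2) by blast
    then show "0 = ?H x" by (simp add: h_def)
  qed
  moreover have "integral {0..a} ?H + integral {a..1} ?H = integral {0..1} ?H"
    using a by (intro Henstock_Kurzweil_Integration.integral_combine set_lebesgue_integral_eq_integral(1)[OF hphi_integrable]) auto
  ultimately show ?thesis using wronskian_eq_integral[of a z] wronskian_eq_integral[of 1 z] a by simp
qed

lemma wronskian_bound:
  assumes a: "0 < a" "a \<le> 1"
  obtains C where "C > 0"
    "\<And>\<omega>. norm \<omega> \<ge> 1 \<Longrightarrow> norm (wronskian (\<omega>\<^sup>2) a)
        \<le> C * norm \<omega> powr - (2 * l + 2) * exp (2 * a * \<bar>Im \<omega>\<bar>) * exp_weighted 0 a (\<lambda>x. q x - qh x) \<bar>Im \<omega>\<bar>"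
proof -
  obtain CA where CA: "CA > 0" "\<And>\<omega> x. norm \<omega> \<ge> 1 \<Longrightarrow> 0 < x \<Longrightarrow> x \<le> 1 \<Longrightarrow>
        norm (A.phi (\<omega>\<^sup>2) x) \<le> CA * norm \<omega> powr - (l + 1) * exp (\<bar>Im \<omega>\<bar> * x)"
    using A.phi_bound by metis
  obtain CB where CB: "CB > 0" "\<And>\<omega> x. norm \<omega> \<ge> 1 \<Longrightarrow> 0 < x \<Longrightarrow> x \<le> 1 \<Longrightarrow>
        norm (B.phi (\<omega>\<^sup>2) x) \<le> CB * norm \<omega> powr - (l + 1) * exp (\<bar>Im \<omega>\<bar> * x)"
    using B.phi_bound by metis
  have v: "(\<lambda>x. q x - qh x) absolutely_integrable_on {0..a}"
    using a by (intro set_integral_diff(1) A.q_sub B.q_sub) auto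
  show thesis
  proof (rule that[of "CA * CB"])
    show "CA * CB > 0" using CA CB by simp
    fix \<omega> :: complex assume \<omega>: "norm \<omega> \<ge> 1"
    define \<tau> where "\<tau> = \<bar>Im \<omega>\<bar>"
    define K where "K = CA * CB * norm \<omega> powr - (2 * l + 2) * exp (2 * a * \<tau>)"
    have "norm (wronskian (\<omega>\<^sup>2) a) = norm (integral {0..a} (\<lambda>t. h t * (A.phi (\<omega>\<^sup>2) t * B.phi (\<omega>\<^sup>2) t)))"
      using wronskian_eq_integral[of a] a by simp
    also have "\<dots> \<le> integral {0..a} (\<lambda>t. K * (\<bar>q t - qh t\<bar> * exp (- (2 * \<tau> * (a - t)))))"
    proof (rule Henstock_Kurzweil_Integration.integral_norm_bound_integral)
      show "(\<lambda>t. h t * (A.phi (\<omega>\<^sup>2) t * B.phi (\<omega>\<^sup>2) t)) integrable_on {0..a}"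
        using a by (intro set_lebesgue_integral_eq_integral(1) absolutely_integrable_on_subinterval[OF hphi_integrable]) auto
      show "(\<lambda>t. K * (\<bar>q t - qh t\<bar> * exp (- (2 * \<tau> * (a - t))))) integrable_on {0..a}"
        by (intro integrable_on_mult_right set_lebesgue_integral_eq_integral(1)[OF exp_weighted_integrable[OF v]])
      fix t assume t: "t \<in> {0..a}"
      show "norm (h t * (A.phi (\<omega>\<^sup>2) t * B.phi (\<omega>\<^sup>2) t)) \<le> K * (\<bar>q t - qh t\<bar> * exp (- (2 * \<tau> * (a - t))))"
      proof (cases "t = 0")
        case True
        have "A.phi (\<omega>\<^sup>2) 0 = 0" using A.l by (simp add: A.phi_def)
        then show ?thesis using True CA CB by (simp add: K_def)
      next
        case False
        then have t0: "0 < t" "t \<le> 1" using t a by auto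
        have "norm (A.phi (\<omega>\<^sup>2) t * B.phi (\<omega>\<^sup>2) t)
          \<le> (CA * norm \<omega> powr - (l + 1) * exp (\<tau> * t)) * (CB * norm \<omega> powr - (l + 1) * exp (\<tau> * t))"
          unfolding norm_mult \<tau>_def using CA(1) by (intro mult_mono CA(2) CB(2) \<omega> t0) auto
        also have "\<dots> = CA * CB * (norm \<omega> powr - (l + 1) * norm \<omega> powr - (l + 1)) * (exp (\<tau> * t) * exp (\<tau> * t))"
          by (simp only: mult_ac)
        also have "norm \<omega> powr - (l + 1) * norm \<omega> powr - (l + 1) = norm \<omega> powr - (2 * l + 2)"
          unfolding powr_add[symmetric] by simp
        also have "exp (\<tau> * t) * exp (\<tau> * t) = exp (2 * a * \<tau>) * exp (- (2 * \<tau> * (a - t)))"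
          unfolding exp_add[symmetric] by (simp add: algebra_simps)
        finally have "norm (A.phi (\<omega>\<^sup>2) t * B.phi (\<omega>\<^sup>2) t) \<le> K * exp (- (2 * \<tau> * (a - t)))" by (simp add: K_def mult.assoc)
        then have "\<bar>q t - qh t\<bar> * norm (A.phi (\<omega>\<^sup>2) t * B.phi (\<omega>\<^sup>2) t) \<le> \<bar>q t - qh t\<bar> * (K * exp (- (2 * \<tau> * (a - t))))"
          by (intro mult_left_mono) auto
        then show ?thesis unfolding norm_mult[of "h t"] by (simp add: h_def mult_ac flip: of_real_diff)
      qed
    qed
    also have "\<dots> = K * exp_weighted 0 a (\<lambda>x. q x - qh x) \<tau>" by (simp add: exp_weighted_def)
    finally show "norm (wronskian (\<omega>\<^sup>2) a) \<le> CA * CB * norm \<omega> powr - (2 * l + 2) * exp (2 * a * \<bar>Im \<omega>\<bar>) * exp_weighted 0 a (\<lambda>x. q x - qh x) \<bar>Im \<omega>\<bar>"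
      by (simp add: K_def \<tau>_def)
  qed
qed

end

lemma absolutely_integrable_Ioo_imp_Icc:
  fixes f :: "real \<Rightarrow> real"
  assumes "f absolutely_integrable_on {c<..<d}"
  shows "f absolutely_integrable_on {c..d}"
proof -
  have "f absolutely_integrable_on {c<..<d} \<longleftrightarrow> f absolutely_integrable_on {c..d}"
    by (rule absolutely_integrable_spike_set_eq)
      (rule negligible_subset[of "{c, d}"]; auto)+
  with assms show ?thesis by blast
qed

text \<open>
  In the extended nonnegative reals \<open>1/p\<close> is \<open>0\<close> for \<open>p = \<infinity>\<close> and \<open>1/p'\<close> is \<open>0\<close> for \<open>p = 1\<close>, so the equation covers the end
  point cases.
\<close>
lemma conjugate_exponent_real:
  assumes "1 \<le> p" "1 / p + 1 / p' = (1 :: ennreal)"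
  shows "p < \<infinity> \<Longrightarrow> 1 \<le> enn2real p \<and> 1 / enn2real p + enn2real (1 / p') = 1"
    and "p = \<infinity> \<Longrightarrow> enn2real (1 / p') = 1"
proof -
  show "p = \<infinity> \<Longrightarrow> enn2real (1 / p') = 1" using assms by simp
  assume "p < \<infinity>"
  then obtain r where r: "p = ennreal r" "r \<ge> 0" by (cases p) auto
  have r1: "r \<ge> 1" using assms(1) r by (simp add: ennreal_le_iff flip: ennreal_1)
  have p1: "1 / p = ennreal (1 / r)" using r r1 divide_ennreal[of 1 r] by simp
  have "1 / p' \<le> 1" using assms(2) by (metis add_increasing le_add_same_cancel2 zero_le le_iff_add add.commute)
  then have "1 / p' < \<infinity>" by (rule order_le_less_trans) simp
  then obtain y where y: "1 / p' = ennreal y" "y \<ge> 0" by (cases "1 / p'") auto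
  have "ennreal (1 / r + y) = ennreal 1" using assms(2) p1 y r1 by (simp add: ennreal_plus)
  then have "1 / r + y = 1" using r1 y by (subst (asm) ennreal_inj) auto
  then show "1 \<le> enn2real p \<and> 1 / enn2real p + enn2real (1 / p') = 1" using r r1 y by simp
qed

theorem theorem1p3:
  fixes l a :: real and q qh :: "real \<Rightarrow> real"
    and \<beta> :: "nat \<Rightarrow> ereal" and lam :: "nat \<Rightarrow> real" and \<Lambda> S :: "real set"
    and k :: nat and p p' :: ennreal
  assumes "l \<ge> - 1 / 2"
    and "q absolutely_integrable_on {0<..<1}"
    and "qh absolutely_integrable_on {0<..<1}"
    and "0 < a" and "a \<le> 1"
    and "AE x in lebesgue. x \<in> {a<..<1} \<longrightarrow> qh x = q x"
    and "\<And>n. \<beta> n \<noteq> -\<infinity>"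
    and "\<And>n. complex_of_real (lam n) \<in> sl_spectrum l q (\<beta> n) \<inter> sl_spectrum l qh (\<beta> n)"
    and "inj lam"
    and "\<not> filterlim lam at_bot sequentially"
    and "\<Lambda> = range lam"
    and "S \<subseteq> \<Lambda>"
    and "\<And>n. lam n \<in> S \<Longrightarrow>
           norming_const l q (\<beta> n) (lam n) = norming_const l qh (\<beta> n) (lam n)"
    and "1 \<le> p" and "1 / p + 1 / p' = 1"
    and "\<exists>\<delta>>0. \<delta> \<le> a \<and>
           (p < \<infinity> \<longrightarrow> (\<exists>D. D 0 = (\<lambda>x. q x - qh x) \<and>
              sobolev_derivs k (enn2real p) (a - \<delta>) a D \<and>
              (\<forall>i<k. has_end_value (a - \<delta>) a (D i) 0))) \<and>
           (p = \<infinity> \<longrightarrow> (\<exists>D. (AE x in lebesgue. x \<in> {a - \<delta><..<a} \<longrightarrow> q x - qh x = D 0 x) \<and>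
              Ck_derivs k (a - \<delta>) a D \<and>
              (\<forall>i\<le>k. D i a = 0)))"
    and "\<exists>R :: nat \<Rightarrow> real. filterlim R at_top sequentially \<and>
           limsup (\<lambda>i. enn2ereal (\<integral>\<^sup>+t\<in>{1..R i}. mcount \<Lambda> S t / ennreal t \<partial>lborel)
                       - ereal (4 * a * R i / pi)
                       + ereal ((real k + 2 * l + 2 + enn2real (1 / p')) * ln (R i))) > -\<infinity>"
  shows "AE x in lebesgue. x \<in> {0<..<a} \<longrightarrow> q x = qh x"
proof -
  interpret radial_pair l q qh
    by unfold_locales (use assms(1-3) in \<open>auto intro: absolutely_integrable_Ioo_imp_Icc\<close>)
  note a = assms(4,5)
  define v where "v = (\<lambda>x. q x - qh x)"
  define \<sigma> where "\<sigma> = real k + enn2real (1 / p')"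
  have \<sigma>0: "\<sigma> \<ge> 0" by (simp add: \<sigma>_def)
  have v: "v absolutely_integrable_on {0..a}"
    unfolding v_def using a by (intro set_integral_diff(1) A.q_sub B.q_sub) auto
  obtain \<delta> where \<delta>: "\<delta> > 0" "\<delta> \<le> a"
    and fin_p: "p < \<infinity> \<Longrightarrow> \<exists>D. D 0 = v \<and> sobolev_derivs k (enn2real p) (a - \<delta>) a D \<and> (\<forall>i<k. has_end_value (a - \<delta>) a (D i) 0)"
    and inf_p: "p = \<infinity> \<Longrightarrow> \<exists>D. (AE x in lebesgue. x \<in> {a - \<delta><..<a} \<longrightarrow> v x = D 0 x) \<and> Ck_derivs k (a - \<delta>) a D \<and> (\<forall>i\<le>k. D i a = 0)"
    using assms(16) unfolding v_def by blast
  \<comment> \<open>strictly inside, since for \<open>p = \<infinity>\<close> nothing is known at the left end point \<open>a - \<delta>\<close>\<close>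
  define b where "b = a - \<delta> / 2"
  have b: "a - \<delta> < b" "b < a" "0 \<le> b" using \<delta> by (auto simp: b_def)
  have "decays \<sigma> (exp_weighted b a v)"
  proof (cases "p = \<infinity>")
    case True
    then obtain D where D: "AE x in lebesgue. x \<in> {a - \<delta><..<a} \<longrightarrow> v x = D 0 x" "Ck_derivs k (a - \<delta>) a D" "\<And>i. i \<le> k \<Longrightarrow> D i a = 0"
      using inf_p by blast
    have "AE x in lebesgue. x \<in> {b<..<a} \<longrightarrow> v x = D 0 x" using D(1) by eventually_elim (use b in auto)
    then have "exp_weighted b a v = exp_weighted b a (D 0)" by (rule exp_weighted_cong_AE)
    then show ?thesis using decays_Ck[OF D(2,3) b(1,2)] conjugate_exponent_real(2)[OF assms(14,15) True]
      by (simp add: \<sigma>_def)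
  next
    case False
    then have "p < \<infinity>" by (simp add: less_top)
    then obtain D where D: "D 0 = v" "sobolev_derivs k (enn2real p) (a - \<delta>) a D" "\<And>i. i < k \<Longrightarrow> has_end_value (a - \<delta>) a (D i) 0"
      using fin_p by blast
    have e: "1 \<le> enn2real p" "1 / enn2real p + enn2real (1 / p') = 1"
      using conjugate_exponent_real(1)[OF assms(14,15) \<open>p < \<infinity>\<close>] by auto
    show ?thesis using decays_sobolev[OF D(2,3) e b(1,2)] by (simp add: \<sigma>_def D(1))
  qed
  then have dec: "decays \<sigma> (exp_weighted 0 a v)" by (rule decays_localize[OF v b(3,2)])
  show ?thesis
  proof (cases "\<forall>z. wronskian z 1 = 0")
    case True
    then have "wronskian z a = 0" for z using wronskian_end[OF a assms(6), of z] by simp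
    then show ?thesis by (rule borg_marchenko[OF a])
  next
    case False
    then obtain z0 where z0: "wronskian z0 1 \<noteq> 0" by blast
    obtain CW where CW: "CW > 0" "\<And>\<omega>. norm \<omega> \<ge> 1 \<Longrightarrow> norm (wronskian (\<omega>\<^sup>2) a)
        \<le> CW * norm \<omega> powr - (2 * l + 2) * exp (2 * a * \<bar>Im \<omega>\<bar>) * exp_weighted 0 a v \<bar>Im \<omega>\<bar>"
      using wronskian_bound[OF a] unfolding v_def by metis
    obtain CJ where CJ: "CJ > 0" "\<And>\<tau>. \<tau> \<ge> 0 \<Longrightarrow> exp_weighted 0 a v \<tau> \<le> CJ * (1 + \<tau>) powr - \<sigma>"
      "\<And>M. \<exists>T. \<forall>\<tau>\<ge>T. exp_weighted 0 a v \<tau> \<le> CJ * exp (- M) * (1 + \<tau>) powr - \<sigma>"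
      using decays_bounds[OF v less_imp_le[OF a(1)] \<sigma>0 dec] by blast
    define J where "J \<tau> = exp_weighted 0 a v \<tau> / CJ" for \<tau>
    define m where "m x = (if x \<in> S then 2 else 1 :: nat)" for x
    have bound: "norm (wronskian (\<omega>\<^sup>2) 1) \<le> (CW * CJ) * norm \<omega> powr - (2 * l + 2) * exp (2 * a * \<bar>Im \<omega>\<bar>) * J \<bar>Im \<omega>\<bar>"
      if "norm \<omega> \<ge> 1" for \<omega>
      using CW(2)[OF that] CJ(1) wronskian_end[OF a assms(6)] by (simp add: J_def)
    have J1: "J \<tau> \<le> (1 + \<tau>) powr - \<sigma>" if "\<tau> \<ge> 0" for \<tau>
      using CJ(2)[OF that] CJ(1) by (simp add: J_def divide_le_eq mult.commute)
    have J2: "\<exists>T. \<forall>\<tau>\<ge>T. J \<tau> \<le> exp (- M) * (1 + \<tau>) powr - \<sigma>" for M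
      using CJ(3)[of M] CJ(1) by (simp add: J_def divide_le_eq mult_ac)
    have zeros: "vanishes_to_order (\<lambda>z. wronskian z 1) (of_real x) (m x)" if x: "x \<in> \<Lambda>" for x
    proof -
      obtain n where n: "x = lam n" using x assms(11) by blast
      show ?thesis unfolding m_def n
        using assms(8)[of n] assms(13)[of n] by (intro wronskian_vanishes_to_order[where \<beta> = "\<beta> n"]) auto
    qed
    have CWJ: "CW * CJ > 0" using CW CJ by simp
    have m1: "m x \<ge> 1" for x by (simp add: m_def)
    have hol: "(\<lambda>z. wronskian z 1) holomorphic_on UNIV" by (rule wronskian_hol) auto
    note count = zero_counting_bound[OF hol z0 \<sigma>0 a(1) CWJ bound J1 J2 zeros m1]
    obtain R where R: "filterlim R at_top sequentially"
      and limsup: "limsup (\<lambda>i. enn2ereal (\<integral>\<^sup>+t\<in>{1..R i}. mcount \<Lambda> S t / ennreal t \<partial>lborel)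
                       - ereal (4 * a * R i / pi)
                       + ereal ((real k + 2 * l + 2 + enn2real (1 / p')) * ln (R i))) > -\<infinity>"
      using assms(17) by blast
    \<comment> \<open>the bound by Jensen's inequality holds for this \<open>B\<close> as well\<close>
    obtain B where B: "ereal B < limsup (\<lambda>i. enn2ereal (\<integral>\<^sup>+t\<in>{1..R i}. mcount \<Lambda> S t / ennreal t \<partial>lborel)
                       - ereal (4 * a * R i / pi)
                       + ereal ((real k + 2 * l + 2 + enn2real (1 / p')) * ln (R i)))"
      using ereal_dense2[OF limsup] by auto
    obtain R0 where R0: "\<And>R. R \<ge> R0 \<Longrightarrow> (\<Sum>x\<in>{x\<in>\<Lambda>. \<bar>x\<bar> \<le> R\<^sup>2}. real (m x) * ln (R\<^sup>2 / max 1 \<bar>x\<bar>)) \<le> 4 * a * R / pi - (2 * l + 2 + \<sigma>) * ln R + B"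
      using count(2)[where B = B] by blast
    have "\<forall>\<^sub>F i in sequentially. R i \<ge> max 1 R0" using R unfolding filterlim_at_top by blast
    then have "\<forall>\<^sub>F i in sequentially. enn2ereal (\<integral>\<^sup>+t\<in>{1..R i}. mcount \<Lambda> S t / ennreal t \<partial>lborel)
                       - ereal (4 * a * R i / pi)
                       + ereal ((real k + 2 * l + 2 + enn2real (1 / p')) * ln (R i)) \<le> ereal B"
    proof eventually_elim
      case (elim i)
      define X where "X = (\<Sum>x\<in>{x\<in>\<Lambda>. \<bar>x\<bar> \<le> (R i)\<^sup>2}. real (m x) * ln ((R i)\<^sup>2 / max 1 \<bar>x\<bar>))"
      have Ri: "R i \<ge> 1" "R i \<ge> R0" using elim by auto
      have X0: "X \<ge> 0"
        unfolding X_def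
      proof (intro sum_nonneg mult_nonneg_nonneg)
        fix x assume "x \<in> {x\<in>\<Lambda>. \<bar>x\<bar> \<le> (R i)\<^sup>2}"
        then have "max 1 \<bar>x\<bar> \<le> (R i)\<^sup>2" using Ri by simp
        then show "ln ((R i)\<^sup>2 / max 1 \<bar>x\<bar>) \<ge> 0" by (intro ln_ge_zero) (simp add: field_simps)
      qed auto
      have "(\<integral>\<^sup>+t\<in>{1..R i}. mcount \<Lambda> S t / ennreal t \<partial>lborel) = ennreal X"
        unfolding X_def m_def by (rule nn_integral_mcount[OF count(1) assms(12) Ri(1)])
      then have "enn2ereal (\<integral>\<^sup>+t\<in>{1..R i}. mcount \<Lambda> S t / ennreal t \<partial>lborel) = ereal X" using X0 by simp
      moreover have "X \<le> 4 * a * R i / pi - (2 * l + 2 + \<sigma>) * ln (R i) + B" unfolding X_def by (rule R0[OF Ri(2)])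
      ultimately show ?case by (simp add: \<sigma>_def algebra_simps)
    qed
    then have "limsup (\<lambda>i. enn2ereal (\<integral>\<^sup>+t\<in>{1..R i}. mcount \<Lambda> S t / ennreal t \<partial>lborel)
                       - ereal (4 * a * R i / pi)
                       + ereal ((real k + 2 * l + 2 + enn2real (1 / p')) * ln (R i))) \<le> ereal B"
      by (rule Limsup_bounded)
    with B show ?thesis by simp
  qed
qed

end
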